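(* Let $\eta$ be a standard axiomatization of $\mathrm{HA}$. For all strictly positive quantified modal formulas $\varphi,\psi$: $\varphi\vdash_{\mathrm{QRC}_1}\psi$ if and only if for every infinitary realization $\cdot^\circ$ we have $\mathrm{HA}\vdash\forall\theta\,\forall\mathbf{y},\mathbf{z}\,(\Box_{\psi^{\circ\eta}}\theta\rightarrow\Box_{\varphi^{\circ\eta}}\theta)$, where $\mathbf{y},\mathbf{z}$ are the free variables other than $u$. That is, $\mathrm{QRL}(\mathrm{HA})=\mathrm{QRC}_1$.
   Context: Fix a signature of relation symbols and individual constants (no function symbols or equality); terms are variables $x_i$ or constants $c_i$. Strictly positive formulas: $\varphi ::= \top \mid S(\mathbf{t}) \mid (\varphi\wedge\varphi) \mid \forall x\,\varphi \mid \Diamond\varphi$. $\mathrm{QRC}_1$ derives sequents $\varphi\vdash\psi$ by: (i) $\varphi\vdash\top$, $\varphi\vdash\varphi$; (ii) $\varphi\wedge\psi\vdash\varphi$, $\varphi\wedge\psi\vdash\psi$; (iii) from $\varphi\vdash\psi$ and $\varphi\vdash\chi$ infer $\varphi\vdash\psi\wedge\chi$; (iv) from $\varphi\vdash\psi$ and $\psi\vdash\chi$ infer $\varphi\vdash\chi$; (v) from $\varphi\vdash\psi$ infer $\Diamond\varphi\vdash\Diamond\psi$; (vi) $\Diamond\Diamond\varphi\vdash\Diamond\varphi$; (vii) from $\varphi\vdash\psi$ infer $\varphi\vdash\forall x\psi$ if $x$ not free in $\varphi$; (viii) from $\varphi[x\leftarrow t]\vdash\psi$ infer $\forall x\varphi\vdash\psi$,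 $t$ free for $x$ in $\varphi$; (ix) from $\varphi\vdash\psi$ infer $\varphi[x\leftarrow t]\vdash\psi[x\leftarrow t]$, $t$ free for $x$ in $\varphi,\psi$; (x) from $\varphi[x\leftarrow c]\vdash\psi[x\leftarrow c]$ infer $\varphi\vdash\psi$, $c$ a constant not in $\varphi,\psi$. An infinitary realization $\cdot^\circ$ assigns to each atomic $S(\mathbf{t})$ with $S$ $n$-ary a $\Sigma_1$ arithmetical formula $S(\mathbf{t})^\circ$ with an extra free variable $u$, where modal variables $x_k$ become $y_k$ and constants $c_k$ become $z_k$; such a formula is read as axiomatizing a family of theories parametrized by $\mathbf{y},\mathbf{z}$ (axioms are the sentences whose Gödel numbers $u$ satisfy it). For such $\alpha$, $\Box_\alpha$ denotes formalized provability in the theory axiomatized by $\alpha$ and $\Diamond_\alpha\chi:=\neg\Box_\alpha\neg\chi$. For a $\Sigma_1$ base axiomatization $\tau(u)$: $\top^{\circ\tau}:=\tau(u)$; $S(\mathbf{t})^{\circ\tau}:=S(\mathbf{t})^\circ\vee\tau(u)$; $(\psi\wedge\delta)^{\circ\tau}:=\psi^{\circ\tau}\vee\delta^{\circ\tau}$; $(\Diamond\psi)^{\circ\tau}:=\tau(u)\vee(u=\ulcorner\Diamond_{\psi^{\circ\tau}}\top\urcorner)$; $(\forall x_i\psi)^{\circ\tau}:=\exists y_i\,\psi^{\circ\tau}$. $\theta$ ranges over Gödel numbers of sentences. *)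

theory Defs
  imports Main
begin

section \<open>The calculus QRC1\<close>

text \<open>Modal variables and constants are indexed by natural numbers, since the arithmetical
  side turns \<open>x\<^sub>k\<close> into \<open>y\<^sub>k\<close> and \<open>c\<^sub>k\<close> into \<open>z\<^sub>k\<close>.\<close>

datatype mtm = MVar nat | MCon nat

datatype 'r qfm =
    QTop
  | QAtom 'r "mtm list"
  | QAnd "'r qfm" "'r qfm"
  | QAll nat "'r qfm"
  | QDia "'r qfm"

record 'r signature =
  rel_syms :: "'r set"
  rel_arity :: "'r \<Rightarrow> nat"
  con_syms :: "nat set"

primrec wf_mtm :: "'r signature \<Rightarrow> mtm \<Rightarrow> bool" where
  "wf_mtm \<Sigma> (MVar k) \<longleftrightarrow> True"
| "wf_mtm \<Sigma> (MCon k) \<longleftrightarrow> k \<in> con_syms \<Sigma>"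

primrec wf_qfm :: "'r signature \<Rightarrow> 'r qfm \<Rightarrow> bool" where
  "wf_qfm \<Sigma> QTop \<longleftrightarrow> True"
| "wf_qfm \<Sigma> (QAtom S ts) \<longleftrightarrow>
     S \<in> rel_syms \<Sigma> \<and> length ts = rel_arity \<Sigma> S \<and> (\<forall>t\<in>set ts. wf_mtm \<Sigma> t)"
| "wf_qfm \<Sigma> (QAnd \<phi> \<psi>) \<longleftrightarrow> wf_qfm \<Sigma> \<phi> \<and> wf_qfm \<Sigma> \<psi>"
| "wf_qfm \<Sigma> (QAll x \<phi>) \<longleftrightarrow> wf_qfm \<Sigma> \<phi>"
| "wf_qfm \<Sigma> (QDia \<phi>) \<longleftrightarrow> wf_qfm \<Sigma> \<phi>"

primrec qfv :: "'r qfm \<Rightarrow> nat set" where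
  "qfv QTop = {}"
| "qfv (QAtom S ts) = {k. MVar k \<in> set ts}"
| "qfv (QAnd \<phi> \<psi>) = qfv \<phi> \<union> qfv \<psi>"
| "qfv (QAll x \<phi>) = qfv \<phi> - {x}"
| "qfv (QDia \<phi>) = qfv \<phi>"

primrec qcons :: "'r qfm \<Rightarrow> nat set" where
  "qcons QTop = {}"
| "qcons (QAtom S ts) = {k. MCon k \<in> set ts}"
| "qcons (QAnd \<phi> \<psi>) = qcons \<phi> \<union> qcons \<psi>"
| "qcons (QAll x \<phi>) = qcons \<phi>"
| "qcons (QDia \<phi>) = qcons \<phi>"

primrec qsubst :: "nat \<Rightarrow> mtm \<Rightarrow> 'r qfm \<Rightarrow> 'r qfm" where
  "qsubst x t QTop = QTop"
| "qsubst x t (QAtom S ts) = QAtom S (map (\<lambda>s. if s = MVar x then t else s) ts)"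
| "qsubst x t (QAnd \<phi> \<psi>) = QAnd (qsubst x t \<phi>) (qsubst x t \<psi>)"
| "qsubst x t (QAll y \<phi>) = QAll y (if y = x then \<phi> else qsubst x t \<phi>)"
| "qsubst x t (QDia \<phi>) = QDia (qsubst x t \<phi>)"

primrec free_for :: "mtm \<Rightarrow> nat \<Rightarrow> 'r qfm \<Rightarrow> bool" where
  "free_for t x QTop \<longleftrightarrow> True"
| "free_for t x (QAtom S ts) \<longleftrightarrow> True"
| "free_for t x (QAnd \<phi> \<psi>) \<longleftrightarrow> free_for t x \<phi> \<and> free_for t x \<psi>"
| "free_for t x (QAll y \<phi>) \<longleftrightarrow> x \<notin> qfv (QAll y \<phi>) \<or> (t \<noteq> MVar y \<and> free_for t x \<phi>)"
| "free_for t x (QDia \<phi>) \<longleftrightarrow> free_for t x \<phi>"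

inductive qrc1 :: "'r signature \<Rightarrow> 'r qfm \<Rightarrow> 'r qfm \<Rightarrow> bool" for \<Sigma> :: "'r signature" where
  qrc1_top: "wf_qfm \<Sigma> \<phi> \<Longrightarrow> qrc1 \<Sigma> \<phi> QTop"
| qrc1_refl: "wf_qfm \<Sigma> \<phi> \<Longrightarrow> qrc1 \<Sigma> \<phi> \<phi>"
| qrc1_conjE1: "wf_qfm \<Sigma> \<phi> \<Longrightarrow> wf_qfm \<Sigma> \<psi> \<Longrightarrow> qrc1 \<Sigma> (QAnd \<phi> \<psi>) \<phi>"
| qrc1_conjE2: "wf_qfm \<Sigma> \<phi> \<Longrightarrow> wf_qfm \<Sigma> \<psi> \<Longrightarrow> qrc1 \<Sigma> (QAnd \<phi> \<psi>) \<psi>"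
| qrc1_conjI: "qrc1 \<Sigma> \<phi> \<psi> \<Longrightarrow> qrc1 \<Sigma> \<phi> \<chi> \<Longrightarrow> qrc1 \<Sigma> \<phi> (QAnd \<psi> \<chi>)"
| qrc1_cut: "qrc1 \<Sigma> \<phi> \<psi> \<Longrightarrow> qrc1 \<Sigma> \<psi> \<chi> \<Longrightarrow> qrc1 \<Sigma> \<phi> \<chi>"
| qrc1_nec: "qrc1 \<Sigma> \<phi> \<psi> \<Longrightarrow> qrc1 \<Sigma> (QDia \<phi>) (QDia \<psi>)"
| qrc1_trans: "wf_qfm \<Sigma> \<phi> \<Longrightarrow> qrc1 \<Sigma> (QDia (QDia \<phi>)) (QDia \<phi>)"
| qrc1_allR: "qrc1 \<Sigma> \<phi> \<psi> \<Longrightarrow> x \<notin> qfv \<phi> \<Longrightarrow> qrc1 \<Sigma> \<phi> (QAll x \<psi>)"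
| qrc1_allL: "wf_qfm \<Sigma> \<phi> \<Longrightarrow> wf_mtm \<Sigma> t \<Longrightarrow> free_for t x \<phi> \<Longrightarrow> qrc1 \<Sigma> (qsubst x t \<phi>) \<psi> \<Longrightarrow>
    qrc1 \<Sigma> (QAll x \<phi>) \<psi>"
| qrc1_inst: "qrc1 \<Sigma> \<phi> \<psi> \<Longrightarrow> wf_mtm \<Sigma> t \<Longrightarrow> free_for t x \<phi> \<Longrightarrow> free_for t x \<psi> \<Longrightarrow>
    qrc1 \<Sigma> (qsubst x t \<phi>) (qsubst x t \<psi>)"
| qrc1_gen_con: "wf_qfm \<Sigma> \<phi> \<Longrightarrow> wf_qfm \<Sigma> \<psi> \<Longrightarrow> c \<in> con_syms \<Sigma> \<Longrightarrow> c \<notin> qcons \<phi> \<Longrightarrow> c \<notin> qcons \<psi> \<Longrightarrow>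
    qrc1 \<Sigma> (qsubst x (MCon c) \<phi>) (qsubst x (MCon c) \<psi>) \<Longrightarrow> qrc1 \<Sigma> \<phi> \<psi>"

section \<open>The language of arithmetic\<close>

text \<open>Bound variables are de Bruijn indices.  Free variables are nevertheless used by name:
  \<open>exv n\<close> and \<open>allv n\<close> below bind the free variable \<open>V n\<close> and leave the names of all other
  free variables unchanged.\<close>

datatype tm = V nat | Zero | Succ tm | Plus tm tm | Times tm tm

datatype fm =
    Eq tm tm  (infix "\<approx>" 50)
  | Less tm tm  (infix "\<prec>" 50)
  | Fls
  | And fm fm  (infixr "\<^bold>\<and>" 35)
  | Or fm fm  (infixr "\<^bold>\<or>" 30)
  | Imp fm fm  (infixr "\<^bold>\<rightarrow>" 25)
  | All fm
  | Ex fm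

abbreviation Neg :: "fm \<Rightarrow> fm"  ("\<^bold>\<not> _" [40] 40) where
  "\<^bold>\<not> A \<equiv> A \<^bold>\<rightarrow> Fls"

abbreviation Tru :: fm where
  "Tru \<equiv> Fls \<^bold>\<rightarrow> Fls"

abbreviation Iff :: "fm \<Rightarrow> fm \<Rightarrow> fm"  (infix "\<^bold>\<leftrightarrow>" 24) where
  "A \<^bold>\<leftrightarrow> B \<equiv> (A \<^bold>\<rightarrow> B) \<^bold>\<and> (B \<^bold>\<rightarrow> A)"

primrec tfv :: "tm \<Rightarrow> nat set" where
  "tfv (V i) = {i}"
| "tfv Zero = {}"
| "tfv (Succ t) = tfv t"
| "tfv (Plus s t) = tfv s \<union> tfv t"
| "tfv (Times s t) = tfv s \<union> tfv t"

primrec fv :: "fm \<Rightarrow> nat set" where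
  "fv (s \<approx> t) = tfv s \<union> tfv t"
| "fv (s \<prec> t) = tfv s \<union> tfv t"
| "fv Fls = {}"
| "fv (A \<^bold>\<and> B) = fv A \<union> fv B"
| "fv (A \<^bold>\<or> B) = fv A \<union> fv B"
| "fv (A \<^bold>\<rightarrow> B) = fv A \<union> fv B"
| "fv (All A) = {i. Suc i \<in> fv A}"
| "fv (Ex A) = {i. Suc i \<in> fv A}"

primrec tsubst :: "(nat \<Rightarrow> tm) \<Rightarrow> tm \<Rightarrow> tm" where
  "tsubst f (V i) = f i"
| "tsubst f Zero = Zero"
| "tsubst f (Succ t) = Succ (tsubst f t)"
| "tsubst f (Plus s t) = Plus (tsubst f s) (tsubst f t)"
| "tsubst f (Times s t) = Times (tsubst f s) (tsubst f t)"

definition tlift :: "tm \<Rightarrow> tm" where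
  "tlift = tsubst (\<lambda>i. V (Suc i))"

definition up :: "(nat \<Rightarrow> tm) \<Rightarrow> nat \<Rightarrow> tm" where
  "up f = case_nat (V 0) (\<lambda>i. tlift (f i))"

text \<open>Simultaneous capture-avoiding substitution for the free variables.\<close>

primrec subst :: "(nat \<Rightarrow> tm) \<Rightarrow> fm \<Rightarrow> fm" where
  "subst f (s \<approx> t) = (tsubst f s \<approx> tsubst f t)"
| "subst f (s \<prec> t) = (tsubst f s \<prec> tsubst f t)"
| "subst f Fls = Fls"
| "subst f (A \<^bold>\<and> B) = (subst f A \<^bold>\<and> subst f B)"
| "subst f (A \<^bold>\<or> B) = (subst f A \<^bold>\<or> subst f B)"
| "subst f (A \<^bold>\<rightarrow> B) = (subst f A \<^bold>\<rightarrow> subst f B)"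
| "subst f (All A) = All (subst (up f) A)"
| "subst f (Ex A) = Ex (subst (up f) A)"

definition lift :: "fm \<Rightarrow> fm" where
  "lift = subst (\<lambda>i. V (Suc i))"

text \<open>The body of a quantifier, instantiated with \<open>t\<close>.\<close>

definition inst :: "tm \<Rightarrow> fm \<Rightarrow> fm" where
  "inst t = subst (case_nat t V)"

text \<open>The free variables \<open>0, \<dots>, length ts - 1\<close> are replaced by the terms \<open>ts\<close>.\<close>

definition app :: "fm \<Rightarrow> tm list \<Rightarrow> fm" where
  "app A ts = subst (\<lambda>i. if i < length ts then ts ! i else V i) A"

definition exv :: "nat \<Rightarrow> fm \<Rightarrow> fm" where
  "exv n A = Ex (subst (\<lambda>i. if i = n then V 0 else V (Suc i)) A)"

definition allv :: "nat \<Rightarrow> fm \<Rightarrow> fm" where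
  "allv n A = All (subst (\<lambda>i. if i = n then V 0 else V (Suc i)) A)"

abbreviation exs :: "nat list \<Rightarrow> fm \<Rightarrow> fm" where
  "exs ns A \<equiv> foldr exv ns A"

abbreviation alls :: "nat list \<Rightarrow> fm \<Rightarrow> fm" where
  "alls ns A \<equiv> foldr allv ns A"

text \<open>Bounded quantifiers; \<open>V n\<close> must not occur in \<open>t\<close>.\<close>

abbreviation exb :: "nat \<Rightarrow> tm \<Rightarrow> fm \<Rightarrow> fm" where
  "exb n t A \<equiv> exv n (V n \<prec> t \<^bold>\<and> A)"

abbreviation allb :: "nat \<Rightarrow> tm \<Rightarrow> fm \<Rightarrow> fm" where
  "allb n t A \<equiv> allv n (V n \<prec> t \<^bold>\<rightarrow> A)"

inductive delta0 :: "fm \<Rightarrow> bool" where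
  "delta0 (s \<approx> t)"
| "delta0 (s \<prec> t)"
| "delta0 Fls"
| "delta0 A \<Longrightarrow> delta0 B \<Longrightarrow> delta0 (A \<^bold>\<and> B)"
| "delta0 A \<Longrightarrow> delta0 B \<Longrightarrow> delta0 (A \<^bold>\<or> B)"
| "delta0 A \<Longrightarrow> delta0 B \<Longrightarrow> delta0 (A \<^bold>\<rightarrow> B)"
| "delta0 A \<Longrightarrow> delta0 (All (V 0 \<prec> tlift t \<^bold>\<rightarrow> A))"
| "delta0 A \<Longrightarrow> delta0 (Ex (V 0 \<prec> tlift t \<^bold>\<and> A))"

text \<open>The class of \<open>\<Sigma>\<^sub>1\<close> formulas closed under conjunction, disjunction and bounded universal
  quantification, so that \<open>\<phi>\<^sup>\<circ>\<^sup>\<tau>\<close> and \<open>\<box>\<^sub>\<alpha>\<close> below belong to it as they stand.  By collection,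
  HA proves each member equivalent to a \<open>\<Delta>\<^sub>0\<close> formula prefixed by existential quantifiers.\<close>

inductive sigma1 :: "fm \<Rightarrow> bool" where
  "delta0 A \<Longrightarrow> sigma1 A"
| "sigma1 A \<Longrightarrow> sigma1 B \<Longrightarrow> sigma1 (A \<^bold>\<and> B)"
| "sigma1 A \<Longrightarrow> sigma1 B \<Longrightarrow> sigma1 (A \<^bold>\<or> B)"
| "sigma1 A \<Longrightarrow> sigma1 (All (V 0 \<prec> tlift t \<^bold>\<rightarrow> A))"
| "sigma1 A \<Longrightarrow> sigma1 (Ex A)"

section \<open>Intuitionistic logic and Heyting arithmetic\<close>

inductive logical_axiom :: "fm \<Rightarrow> bool" where
  ax_K: "logical_axiom (A \<^bold>\<rightarrow> B \<^bold>\<rightarrow> A)"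
| ax_S: "logical_axiom ((A \<^bold>\<rightarrow> B \<^bold>\<rightarrow> C) \<^bold>\<rightarrow> (A \<^bold>\<rightarrow> B) \<^bold>\<rightarrow> A \<^bold>\<rightarrow> C)"
| ax_andE1: "logical_axiom (A \<^bold>\<and> B \<^bold>\<rightarrow> A)"
| ax_andE2: "logical_axiom (A \<^bold>\<and> B \<^bold>\<rightarrow> B)"
| ax_andI: "logical_axiom (A \<^bold>\<rightarrow> B \<^bold>\<rightarrow> A \<^bold>\<and> B)"
| ax_orI1: "logical_axiom (A \<^bold>\<rightarrow> A \<^bold>\<or> B)"
| ax_orI2: "logical_axiom (B \<^bold>\<rightarrow> A \<^bold>\<or> B)"
| ax_orE: "logical_axiom ((A \<^bold>\<rightarrow> C) \<^bold>\<rightarrow> (B \<^bold>\<rightarrow> C) \<^bold>\<rightarrow> A \<^bold>\<or> B \<^bold>\<rightarrow> C)"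
| ax_flsE: "logical_axiom (Fls \<^bold>\<rightarrow> A)"
| ax_allE: "logical_axiom (All A \<^bold>\<rightarrow> inst t A)"
| ax_exI: "logical_axiom (inst t A \<^bold>\<rightarrow> Ex A)"
| ax_allI: "logical_axiom (All (lift B \<^bold>\<rightarrow> A) \<^bold>\<rightarrow> B \<^bold>\<rightarrow> All A)"
| ax_exE: "logical_axiom (All (A \<^bold>\<rightarrow> lift B) \<^bold>\<rightarrow> Ex A \<^bold>\<rightarrow> B)"
| ax_eq_refl: "logical_axiom (t \<approx> t)"
| ax_eq_subst: "logical_axiom (s \<approx> t \<^bold>\<rightarrow> inst s A \<^bold>\<rightarrow> inst t A)"

inductive provable :: "fm set \<Rightarrow> fm \<Rightarrow> bool"  (infix "\<turnstile>" 20) for T :: "fm set" where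
  provable_logic: "logical_axiom A \<Longrightarrow> T \<turnstile> A"
| provable_axiom: "A \<in> T \<Longrightarrow> T \<turnstile> A"
| provable_mp: "T \<turnstile> A \<^bold>\<rightarrow> B \<Longrightarrow> T \<turnstile> A \<Longrightarrow> T \<turnstile> B"
| provable_gen: "T \<turnstile> A \<Longrightarrow> T \<turnstile> All A"

definition basic_axioms :: "fm list" where
  "basic_axioms =
    [\<^bold>\<not> (Succ (V 0) \<approx> Zero),
     Succ (V 0) \<approx> Succ (V 1) \<^bold>\<rightarrow> V 0 \<approx> V 1,
     Plus (V 0) Zero \<approx> V 0,
     Plus (V 0) (Succ (V 1)) \<approx> Succ (Plus (V 0) (V 1)),
     Times (V 0) Zero \<approx> Zero,
     Times (V 0) (Succ (V 1)) \<approx> Plus (Times (V 0) (V 1)) (V 0),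
     V 0 \<prec> V 1 \<^bold>\<leftrightarrow> exv 2 (Plus (V 0) (Succ (V 2)) \<approx> V 1)]"

definition induction_axiom :: "fm \<Rightarrow> fm" where
  "induction_axiom A =
    (inst Zero A \<^bold>\<rightarrow> All (A \<^bold>\<rightarrow> subst (V(0 := Succ (V 0))) A) \<^bold>\<rightarrow> All A)"

inductive_set HA_generalizations :: "fm set" where
  "A \<in> set basic_axioms \<Longrightarrow> A \<in> HA_generalizations"
| "induction_axiom A \<in> HA_generalizations"
| "A \<in> HA_generalizations \<Longrightarrow> All A \<in> HA_generalizations"

text \<open>The axioms are sentences: the universal closures of the basic axioms and of induction.\<close>

definition HA :: "fm set" where
  "HA = {A \<in> HA_generalizations. fv A = {}}"

section \<open>Goedel numbers\<close>

text \<open>The pairing \<open>(x + y)\<^sup>2 + x\<close> is injective and, unlike Cantor's, given by a term.\<close>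

definition pair :: "nat \<Rightarrow> nat \<Rightarrow> nat" where
  "pair x y = (x + y) * (x + y) + x"

primrec tgn :: "tm \<Rightarrow> nat" where
  "tgn (V i) = pair 0 i"
| "tgn Zero = pair 1 0"
| "tgn (Succ t) = pair 2 (tgn t)"
| "tgn (Plus s t) = pair 3 (pair (tgn s) (tgn t))"
| "tgn (Times s t) = pair 4 (pair (tgn s) (tgn t))"

primrec gn :: "fm \<Rightarrow> nat" where
  "gn (s \<approx> t) = pair 5 (pair (tgn s) (tgn t))"
| "gn (s \<prec> t) = pair 6 (pair (tgn s) (tgn t))"
| "gn Fls = pair 7 0"
| "gn (A \<^bold>\<and> B) = pair 8 (pair (gn A) (gn B))"
| "gn (A \<^bold>\<or> B) = pair 9 (pair (gn A) (gn B))"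
| "gn (A \<^bold>\<rightarrow> B) = pair 10 (pair (gn A) (gn B))"
| "gn (All A) = pair 11 (gn A)"
| "gn (Ex A) = pair 12 (gn A)"

section \<open>Arithmetization of syntax\<close>

primrec num :: "nat \<Rightarrow> tm" where
  "num 0 = Zero"
| "num (Suc n) = Succ (num n)"

definition tpair :: "tm \<Rightarrow> tm \<Rightarrow> tm"  ("\<langle>_,/ _\<rangle>") where
  "\<langle>s, t\<rangle> = Plus (Times (Plus s t) (Plus s t)) s"

abbreviation "cVar i \<equiv> \<langle>num 0, i\<rangle>"
abbreviation "cZero \<equiv> \<langle>num 1, num 0\<rangle>"
abbreviation "cSucc t \<equiv> \<langle>num 2, t\<rangle>"
abbreviation "cPlus s t \<equiv> \<langle>num 3, \<langle>s, t\<rangle>\<rangle>"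
abbreviation "cTimes s t \<equiv> \<langle>num 4, \<langle>s, t\<rangle>\<rangle>"
abbreviation "cEq s t \<equiv> \<langle>num 5, \<langle>s, t\<rangle>\<rangle>"
abbreviation "cLess s t \<equiv> \<langle>num 6, \<langle>s, t\<rangle>\<rangle>"
abbreviation "cFls \<equiv> \<langle>num 7, num 0\<rangle>"
abbreviation "cAnd a b \<equiv> \<langle>num 8, \<langle>a, b\<rangle>\<rangle>"
abbreviation "cOr a b \<equiv> \<langle>num 9, \<langle>a, b\<rangle>\<rangle>"
abbreviation "cImp a b \<equiv> \<langle>num 10, \<langle>a, b\<rangle>\<rangle>"
abbreviation "cAll a \<equiv> \<langle>num 11, a\<rangle>"
abbreviation "cEx a \<equiv> \<langle>num 12, a\<rangle>"

text \<open>All arithmetized notions are written as formulas with parameters \<open>V 0, V 1, \<dots>\<close>, to be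
  filled in by \<^const>\<open>app\<close>.

  \<open>beta\<close>: \<open>V 3\<close> is entry number \<open>V 2\<close> of the sequence coded by \<open>V 0, V 1\<close>, that is, the
  remainder of \<open>V 0\<close> modulo \<open>1 + (1 + V 2) * V 1\<close>.\<close>

definition beta :: fm where
  "beta =
    (let m = Succ (Times (Succ (V 2)) (V 1))
     in V 3 \<prec> m \<^bold>\<and> exb 4 (Succ (V 0)) (V 0 \<approx> Plus (Times (V 4) m) (V 3)))"

text \<open>\<open>V 3\<close> is one of the first \<open>V 2\<close> entries of the sequence coded by \<open>V 0, V 1\<close>.\<close>

definition occurs :: fm where
  "occurs = exb 4 (V 2) (app beta [V 0, V 1, V 4, V 3])"

text \<open>Inductive definitions.  The rules are given by a formula in which \<open>V 0\<close> is the number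
  being generated and \<open>earlier t\<close> says that \<open>t\<close> has been generated before; its variables
  \<open>V 1, V 2, V 3\<close> are reserved for that purpose.  \<open>generated R\<close> says that \<open>V 0\<close> is an entry of a
  finite sequence each of whose entries follows from previous ones by \<open>R\<close>.  \<open>V 4\<close> and \<open>V 5\<close> are
  bound by \<open>generated\<close>; parameters of \<open>R\<close> must come after them.\<close>

abbreviation earlier :: "tm \<Rightarrow> fm" where
  "earlier t \<equiv> app occurs [V 1, V 2, V 3, t]"

definition generated :: "fm \<Rightarrow> fm" where
  "generated R =
    exs [1, 2, 3] (app occurs [V 1, V 2, V 3, V 0] \<^bold>\<and>
      allb 4 (V 3) (exv 5 (app beta [V 1, V 2, V 4, V 5] \<^bold>\<and> app R [V 5, V 1, V 2, V 4])))"

text \<open>\<open>is_term_below d t\<close>: \<open>t\<close> codes a term all of whose variables are less than \<open>d\<close>.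
  Similarly for formulas and free variables.\<close>

definition term_rules :: fm where
  "term_rules = exs [4, 5, 6, 7] (V 0 \<approx> \<langle>V 4, V 5\<rangle> \<^bold>\<and>
     ((V 5 \<approx> cVar (V 6) \<^bold>\<and> V 6 \<prec> V 4) \<^bold>\<or>
      V 5 \<approx> cZero \<^bold>\<or>
      (V 5 \<approx> cSucc (V 6) \<^bold>\<and> earlier \<langle>V 4, V 6\<rangle>) \<^bold>\<or>
      ((V 5 \<approx> cPlus (V 6) (V 7) \<^bold>\<or> V 5 \<approx> cTimes (V 6) (V 7)) \<^bold>\<and>
        earlier \<langle>V 4, V 6\<rangle> \<^bold>\<and> earlier \<langle>V 4, V 7\<rangle>)))"

definition is_term_below :: "tm \<Rightarrow> tm \<Rightarrow> fm" where
  "is_term_below d t = app (generated term_rules) [\<langle>d, t\<rangle>]"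

definition formula_rules :: fm where
  "formula_rules = exs [4, 5, 6, 7] (V 0 \<approx> \<langle>V 4, V 5\<rangle> \<^bold>\<and>
     (((V 5 \<approx> cEq (V 6) (V 7) \<^bold>\<or> V 5 \<approx> cLess (V 6) (V 7)) \<^bold>\<and>
        is_term_below (V 4) (V 6) \<^bold>\<and> is_term_below (V 4) (V 7)) \<^bold>\<or>
      V 5 \<approx> cFls \<^bold>\<or>
      ((V 5 \<approx> cAnd (V 6) (V 7) \<^bold>\<or> V 5 \<approx> cOr (V 6) (V 7) \<^bold>\<or> V 5 \<approx> cImp (V 6) (V 7)) \<^bold>\<and>
        earlier \<langle>V 4, V 6\<rangle> \<^bold>\<and> earlier \<langle>V 4, V 7\<rangle>) \<^bold>\<or>
      ((V 5 \<approx> cAll (V 6) \<^bold>\<or> V 5 \<approx> cEx (V 6)) \<^bold>\<and> earlier \<langle>Succ (V 4), V 6\<rangle>)))"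

definition is_formula_below :: "tm \<Rightarrow> tm \<Rightarrow> fm" where
  "is_formula_below d a = app (generated formula_rules) [\<langle>d, a\<rangle>]"

definition is_term :: "tm \<Rightarrow> fm" where
  "is_term t = app (exv 1 (is_term_below (V 1) (V 0))) [t]"

definition is_formula :: "tm \<Rightarrow> fm" where
  "is_formula a = app (exv 1 (is_formula_below (V 1) (V 0))) [a]"

definition is_sentence :: "tm \<Rightarrow> fm" where
  "is_sentence a = is_formula_below (num 0) a"

text \<open>Operations that act on variables only, as quadruples \<open>\<langle>d, \<langle>p, \<langle>a, b\<rangle>\<rangle>\<rangle>\<close>: under \<open>d\<close>
  quantifiers and with parameter \<open>p\<close>, the operation takes \<open>a\<close> to \<open>b\<close>.  The formula \<open>W\<close>
  describes its value \<open>V 3\<close> at the variable with index \<open>V 2\<close>, for \<open>d = V 0\<close> and \<open>p = V 1\<close>;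
  \<open>T\<close> is its action on terms; \<open>U\<close> says how the parameter changes from \<open>V 0\<close> to \<open>V 1\<close> under a
  further quantifier.\<close>

definition term_operation :: "fm \<Rightarrow> fm" where
  "term_operation W = generated (exs [4, 5, 6, 7, 8, 9, 10, 11]
     (V 0 \<approx> \<langle>V 4, \<langle>V 5, \<langle>V 6, V 7\<rangle>\<rangle>\<rangle> \<^bold>\<and>
     ((V 6 \<approx> cVar (V 8) \<^bold>\<and> app W [V 4, V 5, V 8, V 7]) \<^bold>\<or>
      (V 6 \<approx> cZero \<^bold>\<and> V 7 \<approx> cZero) \<^bold>\<or>
      (V 6 \<approx> cSucc (V 8) \<^bold>\<and> V 7 \<approx> cSucc (V 9) \<^bold>\<and> earlier \<langle>V 4, \<langle>V 5, \<langle>V 8, V 9\<rangle>\<rangle>\<rangle>) \<^bold>\<or>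
      (((V 6 \<approx> cPlus (V 8) (V 10) \<^bold>\<and> V 7 \<approx> cPlus (V 9) (V 11)) \<^bold>\<or>
        (V 6 \<approx> cTimes (V 8) (V 10) \<^bold>\<and> V 7 \<approx> cTimes (V 9) (V 11))) \<^bold>\<and>
        earlier \<langle>V 4, \<langle>V 5, \<langle>V 8, V 9\<rangle>\<rangle>\<rangle> \<^bold>\<and> earlier \<langle>V 4, \<langle>V 5, \<langle>V 10, V 11\<rangle>\<rangle>\<rangle>))))"

definition formula_operation :: "fm \<Rightarrow> fm \<Rightarrow> fm" where
  "formula_operation T U = generated (exs [4, 5, 6, 7, 8, 9, 10, 11]
     (V 0 \<approx> \<langle>V 4, \<langle>V 5, \<langle>V 6, V 7\<rangle>\<rangle>\<rangle> \<^bold>\<and>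
     ((((V 6 \<approx> cEq (V 8) (V 10) \<^bold>\<and> V 7 \<approx> cEq (V 9) (V 11)) \<^bold>\<or>
        (V 6 \<approx> cLess (V 8) (V 10) \<^bold>\<and> V 7 \<approx> cLess (V 9) (V 11))) \<^bold>\<and>
        app T [\<langle>V 4, \<langle>V 5, \<langle>V 8, V 9\<rangle>\<rangle>\<rangle>] \<^bold>\<and> app T [\<langle>V 4, \<langle>V 5, \<langle>V 10, V 11\<rangle>\<rangle>\<rangle>]) \<^bold>\<or>
      (V 6 \<approx> cFls \<^bold>\<and> V 7 \<approx> cFls) \<^bold>\<or>
      (((V 6 \<approx> cAnd (V 8) (V 10) \<^bold>\<and> V 7 \<approx> cAnd (V 9) (V 11)) \<^bold>\<or>
        (V 6 \<approx> cOr (V 8) (V 10) \<^bold>\<and> V 7 \<approx> cOr (V 9) (V 11)) \<^bold>\<or>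
        (V 6 \<approx> cImp (V 8) (V 10) \<^bold>\<and> V 7 \<approx> cImp (V 9) (V 11))) \<^bold>\<and>
        earlier \<langle>V 4, \<langle>V 5, \<langle>V 8, V 9\<rangle>\<rangle>\<rangle> \<^bold>\<and> earlier \<langle>V 4, \<langle>V 5, \<langle>V 10, V 11\<rangle>\<rangle>\<rangle>) \<^bold>\<or>
      (((V 6 \<approx> cAll (V 8) \<^bold>\<and> V 7 \<approx> cAll (V 9)) \<^bold>\<or> (V 6 \<approx> cEx (V 8) \<^bold>\<and> V 7 \<approx> cEx (V 9))) \<^bold>\<and>
        app U [V 5, V 10] \<^bold>\<and> earlier \<langle>Succ (V 4), \<langle>V 10, \<langle>V 8, V 9\<rangle>\<rangle>\<rangle>))))"

text \<open>Lifting increments the indices from \<open>d\<close> on; its parameter is idle (\<open>0\<close>).\<close>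

definition lift_var :: fm where
  "lift_var = ((V 2 \<prec> V 0 \<^bold>\<and> V 3 \<approx> cVar (V 2)) \<^bold>\<or> (V 0 \<prec> Succ (V 2) \<^bold>\<and> V 3 \<approx> cVar (Succ (V 2))))"

definition is_lift_term :: "tm \<Rightarrow> tm \<Rightarrow> tm \<Rightarrow> fm" where
  "is_lift_term d s t = app (term_operation lift_var) [\<langle>d, \<langle>num 0, \<langle>s, t\<rangle>\<rangle>\<rangle>]"

definition is_lift :: "tm \<Rightarrow> tm \<Rightarrow> tm \<Rightarrow> fm" where
  "is_lift d a b =
    app (formula_operation (term_operation lift_var) (V 1 \<approx> V 0)) [\<langle>d, \<langle>num 0, \<langle>a, b\<rangle>\<rangle>\<rangle>]"

text \<open>Instantiation puts the term \<open>p\<close> for the index \<open>d\<close> and decrements the indices above \<open>d\<close>.\<close>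

definition inst_var :: fm where
  "inst_var = ((V 2 \<prec> V 0 \<^bold>\<and> V 3 \<approx> cVar (V 2)) \<^bold>\<or> (V 2 \<approx> V 0 \<^bold>\<and> V 3 \<approx> V 1) \<^bold>\<or>
     (V 0 \<prec> V 2 \<^bold>\<and> exv 4 (V 2 \<approx> Succ (V 4) \<^bold>\<and> V 3 \<approx> cVar (V 4))))"

definition is_inst :: "tm \<Rightarrow> tm \<Rightarrow> tm \<Rightarrow> fm" where
  "is_inst p a b =
    app (formula_operation (term_operation inst_var) (is_lift_term (num 0) (V 0) (V 1)))
      [\<langle>num 0, \<langle>p, \<langle>a, b\<rangle>\<rangle>\<rangle>]"

text \<open>\<open>c\<close> is the Goedel number of the numeral of \<open>n\<close>.\<close>

definition is_numeral :: "tm \<Rightarrow> tm \<Rightarrow> fm" where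
  "is_numeral n c = app (generated (exs [4, 5]
     (V 0 \<approx> \<langle>num 0, cZero\<rangle> \<^bold>\<or> (V 0 \<approx> \<langle>Succ (V 4), cSucc (V 5)\<rangle> \<^bold>\<and> earlier \<langle>V 4, V 5\<rangle>))))
     [\<langle>n, c\<rangle>]"

definition is_logical_axiom :: fm where
  "is_logical_axiom =
    (exs [1, 2, 3] (is_formula (V 1) \<^bold>\<and> is_formula (V 2) \<^bold>\<and> is_formula (V 3) \<^bold>\<and>
       (let a = V 1; b = V 2; c = V 3 in
        V 0 \<approx> cImp a (cImp b a) \<^bold>\<or>
        V 0 \<approx> cImp (cImp a (cImp b c)) (cImp (cImp a b) (cImp a c)) \<^bold>\<or>
        V 0 \<approx> cImp (cAnd a b) a \<^bold>\<or>
        V 0 \<approx> cImp (cAnd a b) b \<^bold>\<or>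
        V 0 \<approx> cImp a (cImp b (cAnd a b)) \<^bold>\<or>
        V 0 \<approx> cImp a (cOr a b) \<^bold>\<or>
        V 0 \<approx> cImp b (cOr a b) \<^bold>\<or>
        V 0 \<approx> cImp (cImp a c) (cImp (cImp b c) (cImp (cOr a b) c)) \<^bold>\<or>
        V 0 \<approx> cImp cFls a)) \<^bold>\<or>
     exs [1, 2, 3, 4, 5] (is_formula (V 1) \<^bold>\<and> is_formula (V 2) \<^bold>\<and> is_term (V 3) \<^bold>\<and> is_term (V 4) \<^bold>\<and>
       (let a = V 1; b = V 2; s = V 3; t = V 4; b' = V 5 in
        exv 6 (is_inst t a (V 6) \<^bold>\<and> (V 0 \<approx> cImp (cAll a) (V 6) \<^bold>\<or> V 0 \<approx> cImp (V 6) (cEx a))) \<^bold>\<or>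
        (is_lift (num 0) b b' \<^bold>\<and>
          (V 0 \<approx> cImp (cAll (cImp b' a)) (cImp b (cAll a)) \<^bold>\<or>
           V 0 \<approx> cImp (cAll (cImp a b')) (cImp (cEx a) b))) \<^bold>\<or>
        V 0 \<approx> cEq t t \<^bold>\<or>
        exs [6, 7] (is_inst s a (V 6) \<^bold>\<and> is_inst t a (V 7) \<^bold>\<and>
          V 0 \<approx> cImp (cEq s t) (cImp (V 6) (V 7))))))"

text \<open>\<open>A[x \<leftarrow> S x]\<close> in the induction axiom is obtained by lifting \<open>A\<close> above \<open>x = V 0\<close> and
  instantiating \<open>x\<close> with \<open>S x\<close>.\<close>

definition is_induction_axiom :: fm where
  "is_induction_axiom = exs [1, 2, 3, 4]
     (is_formula (V 1) \<^bold>\<and> is_inst cZero (V 1) (V 2) \<^bold>\<and>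
      is_lift (num 1) (V 1) (V 3) \<^bold>\<and> is_inst (cSucc (cVar (num 0))) (V 3) (V 4) \<^bold>\<and>
      V 0 \<approx> cImp (V 2) (cImp (cAll (cImp (V 1) (V 4))) (cAll (V 1))))"

definition is_HA_axiom :: fm where
  "is_HA_axiom = (is_sentence (V 0) \<^bold>\<and>
     generated (foldr (\<lambda>A B. V 0 \<approx> num (gn A) \<^bold>\<or> B) basic_axioms is_induction_axiom \<^bold>\<or>
       exv 4 (V 0 \<approx> cAll (V 4) \<^bold>\<and> earlier (V 4))))"

text \<open>\<open>box \<alpha>\<close> is \<open>\<box>\<^sub>\<alpha>\<close>, with the same free variables as \<open>\<alpha>\<close> except that \<open>V 0\<close>, which in \<open>\<alpha>\<close>
  is the Goedel number \<open>u\<close> of an axiom, is now that of the theorem.  The other free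
  variables of \<open>\<alpha>\<close> are renamed apart from the working variables and back.\<close>

definition box :: "fm \<Rightarrow> fm" where
  "box \<alpha> = subst (\<lambda>i. V (i - 10)) (generated
     (is_logical_axiom \<^bold>\<or>
      (is_sentence (V 0) \<^bold>\<and> subst (\<lambda>i. if i = 0 then V 0 else V (i + 10)) \<alpha>) \<^bold>\<or>
      exv 4 (earlier (cImp (V 4) (V 0)) \<^bold>\<and> earlier (V 4)) \<^bold>\<or>
      exv 4 (V 0 \<approx> cAll (V 4) \<^bold>\<and> earlier (V 4))))"

definition dia :: "fm \<Rightarrow> fm \<Rightarrow> fm" where
  "dia \<alpha> \<chi> = (\<^bold>\<not> subst (V(0 := num (gn (\<^bold>\<not> \<chi>)))) (box \<alpha>))"

text \<open>A standard axiomatization of HA need not be literally \<^const>\<open>is_HA_axiom\<close>, but HA must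
  recognise that it defines the same axioms.\<close>

definition standard_axiomatization_HA :: "fm \<Rightarrow> bool" where
  "standard_axiomatization_HA \<eta> \<longleftrightarrow>
    sigma1 \<eta> \<and> fv \<eta> \<subseteq> {0} \<and> (HA \<turnstile> allv 0 (\<eta> \<^bold>\<leftrightarrow> is_HA_axiom))"

text \<open>Goedel numbers with dots: \<open>u = \<ulcorner>D(v\<^sub>1, \<dots>, v\<^sub>m)\<urcorner>\<close>, where the numerals of the values of the
  free variables \<open>v\<^sub>j\<close> of \<open>D\<close> are put for these variables, so that \<open>u\<close> is the number of a
  sentence.  Below \<open>d\<close> quantifiers, \<open>dotted_tm\<close> and \<open>dotted_fm\<close> are the code of the
  argument as a term in which \<open>V (N + j)\<close> stands for the code of the numeral of \<open>V j\<close>.\<close>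

primrec dotted_tm :: "nat \<Rightarrow> nat \<Rightarrow> tm \<Rightarrow> tm" where
  "dotted_tm N d (V i) = (if i < d then cVar (num i) else V (N + (i - d)))"
| "dotted_tm N d Zero = cZero"
| "dotted_tm N d (Succ t) = cSucc (dotted_tm N d t)"
| "dotted_tm N d (Plus s t) = cPlus (dotted_tm N d s) (dotted_tm N d t)"
| "dotted_tm N d (Times s t) = cTimes (dotted_tm N d s) (dotted_tm N d t)"

primrec dotted_fm :: "nat \<Rightarrow> nat \<Rightarrow> fm \<Rightarrow> tm" where
  "dotted_fm N d (s \<approx> t) = cEq (dotted_tm N d s) (dotted_tm N d t)"
| "dotted_fm N d (s \<prec> t) = cLess (dotted_tm N d s) (dotted_tm N d t)"
| "dotted_fm N d Fls = cFls"
| "dotted_fm N d (A \<^bold>\<and> B) = cAnd (dotted_fm N d A) (dotted_fm N d B)"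
| "dotted_fm N d (A \<^bold>\<or> B) = cOr (dotted_fm N d A) (dotted_fm N d B)"
| "dotted_fm N d (A \<^bold>\<rightarrow> B) = cImp (dotted_fm N d A) (dotted_fm N d B)"
| "dotted_fm N d (All A) = cAll (dotted_fm N (Suc d) A)"
| "dotted_fm N d (Ex A) = cEx (dotted_fm N (Suc d) A)"

definition u_is_code_of :: "fm \<Rightarrow> fm" where
  "u_is_code_of D =
    (let N = Suc (Max (insert 0 (fv D)))
     in foldr (\<lambda>j A. exv (N + j) (is_numeral (V j) (V (N + j)) \<^bold>\<and> A))
          (sorted_list_of_set (fv D)) (V 0 \<approx> dotted_fm N 0 D))"

section \<open>Infinitary realizations\<close>

text \<open>The variables \<open>u\<close>, \<open>y\<^sub>k\<close> and \<open>z\<^sub>k\<close>.\<close>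

abbreviation (input) "uvar \<equiv> 0 :: nat"
abbreviation (input) "yvar k \<equiv> 2 * k + 1 :: nat"
abbreviation (input) "zvar k \<equiv> 2 * k + 2 :: nat"

primrec realize_mtm :: "mtm \<Rightarrow> tm" where
  "realize_mtm (MVar k) = V (yvar k)"
| "realize_mtm (MCon k) = V (zvar k)"

text \<open>\<open>S(t)\<^sup>\<circ>\<close> depends on \<open>t\<close> by substitution only: it is obtained from one \<open>\<Sigma>\<^sub>1\<close> formula for
  \<open>S\<close>, with \<open>u\<close> and \<open>n\<close> further free variables, by putting the variables belonging to \<open>t\<close>.\<close>

definition infinitary_realization :: "'r signature \<Rightarrow> ('r \<Rightarrow> mtm list \<Rightarrow> fm) \<Rightarrow> bool" where
  "infinitary_realization \<Sigma> R \<longleftrightarrow>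
    (\<forall>S\<in>rel_syms \<Sigma>. \<exists>\<sigma>. sigma1 \<sigma> \<and> fv \<sigma> \<subseteq> {0..rel_arity \<Sigma> S} \<and>
       (\<forall>ts. length ts = rel_arity \<Sigma> S \<longrightarrow> R S ts = app \<sigma> (V uvar # map realize_mtm ts)))"

primrec realize :: "('r \<Rightarrow> mtm list \<Rightarrow> fm) \<Rightarrow> fm \<Rightarrow> 'r qfm \<Rightarrow> fm" where
  "realize R \<tau> QTop = \<tau>"
| "realize R \<tau> (QAtom S ts) = (R S ts \<^bold>\<or> \<tau>)"
| "realize R \<tau> (QAnd \<psi> \<delta>) = (realize R \<tau> \<psi> \<^bold>\<or> realize R \<tau> \<delta>)"
| "realize R \<tau> (QAll i \<psi>) = exv (yvar i) (realize R \<tau> \<psi>)"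
| "realize R \<tau> (QDia \<psi>) = (\<tau> \<^bold>\<or> u_is_code_of (dia (realize R \<tau> \<psi>) Tru))"

text \<open>\<open>\<forall>\<theta> \<forall>y,z (\<box>\<^sub>\<beta> \<theta> \<rightarrow> \<box>\<^sub>\<alpha> \<theta>)\<close> for Goedel numbers \<open>\<theta>\<close> of sentences.\<close>

definition theory_inclusion :: "fm \<Rightarrow> fm \<Rightarrow> fm" where
  "theory_inclusion \<beta> \<alpha> =
    (let \<chi> = (is_sentence (V 0) \<^bold>\<rightarrow> box \<beta> \<^bold>\<rightarrow> box \<alpha>)
     in allv 0 (alls (sorted_list_of_set (fv \<chi> - {0})) \<chi>))"

end

theory Submission
  imports Defs "HOL-Library.Countable_Set"
begin

text \<open>
  An implication between \<open>\<Sigma>\<^sub>1\<close> formulas is provable in HA as soon as it holds in all classical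
  models of arithmetic: a Henkin construction with Friedman's translation built in turns an
  unprovable implication into a model refuting it.  Theories, consistency statements and
  provability can therefore be treated semantically, model by model.

  Soundness of QRC1 is an induction on derivations; for \<open>\<Diamond>\<close> one uses that the inconsistency of a
  \<open>\<Sigma>\<^sub>1\<close> family of theories is \<open>\<Sigma>\<^sub>1\<close>, and for \<open>\<Diamond>\<Diamond>\<phi> \<turnstile> \<Diamond>\<phi>\<close> provable \<open>\<Sigma>\<^sub>1\<close>-completeness.

  For completeness, an underivable sequent fails in a finite transitive irreflexive Kripke model
  with a constant domain, whose worlds are instances of subformulas of the antecedent.
  A root \<open>0\<close> is added to it, and Solovay's construction is carried out without the deduction
  theorem and without excluded middle: a sentence \<open>solovay w\<close> says that the Solovay path, which
  moves to a successor \<open>v\<close> when HA together with the limit sentence of \<open>v\<close> is first seen to be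
  inconsistent, visits \<open>w\<close>; it is \<open>\<Sigma>\<^sub>1\<close>.  The limit sentence of \<open>w\<close> says that the path visits \<open>w\<close>
  and no successor of \<open>w\<close>.  An atom \<open>S(d)\<close> is realized by the axiom that refutes all limit
  sentences of worlds other than the root that do not force \<open>S(d)\<close>.  By induction on \<open>\<chi>\<close>, the
  theory of \<open>\<chi>\<close> refutes the limit sentence of every world not forcing \<open>\<chi>\<close>, and is contained in
  HA plus the limit sentence of any world forcing \<open>\<chi>\<close>.  An inclusion of the two theories at a world
  forcing \<open>\<phi>\<close> but not \<open>\<psi>\<close> would make HA plus the limit sentence of that world inconsistent, which
  reflection in the standard model excludes.
\<close>

section \<open>Substitution\<close>

text \<open>All models used for conservativity have carrier \<open>nat\<close>: HOL cannot quantify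
  over carrier types inside a premise, and the refuting model, made of terms, is countably infinite.
  In it truth agrees with membership without any translation for Sigma_1 formulas, because induction
  decides the bounded ones; for other formulas it need not. Hence each implication wanted in HA is
  first brought into Sigma_1 form, and consistency statements are compared contrapositively.

  The quantifier is realized by a union over all elements of an arithmetical model, nonstandard ones
  included, whereas a Kripke domain is finite; this is what \<open>cut\<close> bridges. The axioms
  then contain numerals of arbitrary elements, so the uniform implications carry a bounded formula
  \<open>cond\<close> that remembers only the cuts.

  A trigger is inconsistency of HA with one more axiom, not provability of a negation, so that
  theories can be compared through their axioms alone. The missing case distinction, whether the
  path stops at a world, is avoided by deriving only negations, from the top of the frame
  downwards.\<close>

lemma tsubst_cong: "(\<And>i. i \<in> tfv t \<Longrightarrow> f i = g i) \<Longrightarrow> tsubst f t = tsubst g t"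
  by (induction t) auto

lemma up_0 [simp]: "up f 0 = V 0"
  and up_Suc [simp]: "up f (Suc i) = tlift (f i)"
  by (simp_all add: up_def)

lemma subst_cong: "(\<And>i. i \<in> fv A \<Longrightarrow> f i = g i) \<Longrightarrow> subst f A = subst g A"
proof (induction A arbitrary: f g)
  case (All A)
  have "up f i = up g i" if "i \<in> fv A" for i
    using that All.prems by (cases i) auto
  then have "subst (up f) A = subst (up g) A" by (rule All.IH)
  then show ?case by simp
next
  case (Ex A)
  have "up f i = up g i" if "i \<in> fv A" for i
    using that Ex.prems by (cases i) auto
  then have "subst (up f) A = subst (up g) A" by (rule Ex.IH)
  then show ?case by simp
next
  case (Eq s t)
  have "tsubst f s = tsubst g s" "tsubst f t = tsubst g t"
    using Eq.prems by (intro tsubst_cong; simp)+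
  then show ?case by simp
next
  case (Less s t)
  have "tsubst f s = tsubst g s" "tsubst f t = tsubst g t"
    using Less.prems by (intro tsubst_cong; simp)+
  then show ?case by simp
next
  case (And A B)
  have "subst f A = subst g A" "subst f B = subst g B"
    using And.prems by (intro And.IH; simp)+
  then show ?case by simp
next
  case (Or A B)
  have "subst f A = subst g A" "subst f B = subst g B"
    using Or.prems by (intro Or.IH; simp)+
  then show ?case by simp
next
  case (Imp A B)
  have "subst f A = subst g A" "subst f B = subst g B"
    using Imp.prems by (intro Imp.IH; simp)+
  then show ?case by simp
qed simp

lemma tsubst_tsubst: "tsubst f (tsubst g t) = tsubst (\<lambda>i. tsubst f (g i)) t"
  by (induction t) auto

lemma tlift_V [simp]: "tlift (V i) = V (Suc i)"
  and tlift_Zero [simp]: "tlift Zero = Zero"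
  and tlift_Succ [simp]: "tlift (Succ t) = Succ (tlift t)"
  and tlift_Plus [simp]: "tlift (Plus s t) = Plus (tlift s) (tlift t)"
  and tlift_Times [simp]: "tlift (Times s t) = Times (tlift s) (tlift t)"
  by (simp_all add: tlift_def)

lemma tsubst_tlift: "tsubst f (tlift t) = tsubst (\<lambda>i. f (Suc i)) t"
  by (simp add: tlift_def tsubst_tsubst)

lemma tsubst_up_tlift [simp]: "tsubst (up f) (tlift t) = tlift (tsubst f t)"
proof -
  have "tsubst (up f) (tlift t) = tsubst (\<lambda>i. tlift (f i)) t" by (simp add: tsubst_tlift)
  then show ?thesis by (simp add: tlift_def tsubst_tsubst)
qed

lemma up_comp: "(\<lambda>i. tsubst (up f) (up g i)) = up (\<lambda>i. tsubst f (g i))"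
proof
  fix i show "tsubst (up f) (up g i) = up (\<lambda>i. tsubst f (g i)) i" by (cases i) auto
qed

lemma subst_subst: "subst f (subst g A) = subst (\<lambda>i. tsubst f (g i)) A"
  by (induction A arbitrary: f g) (auto simp: tsubst_tsubst up_comp)

lemma tsubst_V [simp]: "tsubst V t = t"
  by (induction t) auto

lemma up_V [simp]: "up V = V"
proof
  fix i show "up V i = V i" by (cases i) auto
qed

lemma subst_V [simp]: "subst V A = A"
  by (induction A) auto

lemma subst_closed: "fv A = {} \<Longrightarrow> subst f A = A"
  using subst_cong[of A f V] by simp

lemma tfv_tsubst: "tfv (tsubst f t) = (\<Union>i\<in>tfv t. tfv (f i))"
  by (induction t) auto

lemma fv_up: "{i. Suc i \<in> (\<Union>j\<in>X. tfv (up f j))} = (\<Union>j\<in>{i. Suc i \<in> X}. tfv (f j))"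
proof -
  have "Suc i \<in> tfv (up f j) \<longleftrightarrow> (\<exists>k. j = Suc k \<and> i \<in> tfv (f k))" for i j
    by (cases j) (auto simp: tlift_def tfv_tsubst)
  then show ?thesis by auto
qed

lemma fv_subst: "fv (subst f A) = (\<Union>i\<in>fv A. tfv (f i))"
proof (induction A arbitrary: f)
  case (All A) then show ?case using fv_up[of f "fv A"] by simp
next
  case (Ex A) then show ?case using fv_up[of f "fv A"] by simp
qed (auto simp: tfv_tsubst)

lemma inst_subst_up: "inst t (subst (up f) A) = subst (case_nat t f) A"
proof -
  have "(\<lambda>i. tsubst (case_nat t V) (up f i)) = case_nat t f"
    by (auto simp: fun_eq_iff tsubst_tlift split: nat.split)
  then show ?thesis by (simp add: inst_def subst_subst)
qed

lemma subst_inst: "subst f (inst t A) = inst (tsubst f t) (subst (up f) A)"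
proof -
  have "(\<lambda>i. tsubst f (case_nat t V i)) = case_nat (tsubst f t) f"
    by (auto simp: fun_eq_iff split: nat.split)
  then show ?thesis by (simp add: inst_subst_up, simp add: inst_def subst_subst)
qed

lemma subst_lift: "subst f (lift A) = subst (\<lambda>i. f (Suc i)) A"
  by (simp add: lift_def subst_subst)

lemma subst_up_lift [simp]: "subst (up f) (lift A) = lift (subst f A)"
  by (simp add: lift_def subst_subst, simp add: tlift_def)

lemma inst_lift [simp]: "inst t (lift A) = A"
  by (simp add: inst_def subst_lift)

lemma inst_simps [simp]:
  "inst t (A \<^bold>\<rightarrow> C) = (inst t A \<^bold>\<rightarrow> inst t C)"
  "inst t (A \<^bold>\<and> C) = (inst t A \<^bold>\<and> inst t C)"
  "inst t (A \<^bold>\<or> C) = (inst t A \<^bold>\<or> inst t C)"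
  "inst t Fls = Fls"
  by (simp_all add: inst_def)

lemma lift_simps [simp]:
  "lift (A \<^bold>\<rightarrow> C) = (lift A \<^bold>\<rightarrow> lift C)"
  "lift (A \<^bold>\<and> C) = (lift A \<^bold>\<and> lift C)"
  "lift (A \<^bold>\<or> C) = (lift A \<^bold>\<or> lift C)"
  "lift Fls = Fls"
  by (simp_all add: lift_def)

lemma finite_tfv [simp]: "finite (tfv t)"
  by (induction t) auto

lemma finite_fv [simp]: "finite (fv A)"
proof (induction A)
  case (All A)
  then show ?case using finite_vimageI[of "fv A" Suc] by (simp add: vimage_def)
next
  case (Ex A)
  then show ?case using finite_vimageI[of "fv A" Suc] by (simp add: vimage_def)
qed auto

lemma fv_All_funpow: "fv ((All ^^ n) A) = {i. i + n \<in> fv A}"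
  by (induction n) auto

text \<open>Only finitely many indices are free, and each \<open>All\<close> lowers them by one.
  Facts about the sentences in \<open>HA\<close> reach open formulas through this closure.\<close>

lemma closing_exists: "\<exists>n. fv ((All ^^ n) A) = {}"
proof -
  obtain n where "\<forall>i\<in>fv A. i < n"
    using finite_fv[of A] by (meson finite_nat_set_iff_bounded)
  then show ?thesis by (intro exI[of _ n]) (fastforce simp: fv_All_funpow)
qed

lemma HA_generalizations_funpow: "A \<in> HA_generalizations \<Longrightarrow> (All ^^ n) A \<in> HA_generalizations"
  by (induction n) (auto intro: HA_generalizations.intros)

section \<open>Structures\<close>

record 'm struct =
  m_zero :: 'm
  m_suc :: "'m \<Rightarrow> 'm"
  m_add :: "'m \<Rightarrow> 'm \<Rightarrow> 'm"
  m_mul :: "'m \<Rightarrow> 'm \<Rightarrow> 'm"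
  m_less :: "'m \<Rightarrow> 'm \<Rightarrow> bool"

primrec eval :: "'m struct \<Rightarrow> (nat \<Rightarrow> 'm) \<Rightarrow> tm \<Rightarrow> 'm" where
  "eval M e (V i) = e i"
| "eval M e Zero = m_zero M"
| "eval M e (Succ t) = m_suc M (eval M e t)"
| "eval M e (Plus s t) = m_add M (eval M e s) (eval M e t)"
| "eval M e (Times s t) = m_mul M (eval M e s) (eval M e t)"

primrec sat :: "'m struct \<Rightarrow> (nat \<Rightarrow> 'm) \<Rightarrow> fm \<Rightarrow> bool" where
  "sat M e (s \<approx> t) \<longleftrightarrow> eval M e s = eval M e t"
| "sat M e (s \<prec> t) \<longleftrightarrow> m_less M (eval M e s) (eval M e t)"
| "sat M e Fls \<longleftrightarrow> False"
| "sat M e (A \<^bold>\<and> B) \<longleftrightarrow> sat M e A \<and> sat M e B"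
| "sat M e (A \<^bold>\<or> B) \<longleftrightarrow> sat M e A \<or> sat M e B"
| "sat M e (A \<^bold>\<rightarrow> B) \<longleftrightarrow> (sat M e A \<longrightarrow> sat M e B)"
| "sat M e (All A) \<longleftrightarrow> (\<forall>x. sat M (case_nat x e) A)"
| "sat M e (Ex A) \<longleftrightarrow> (\<exists>x. sat M (case_nat x e) A)"

lemma eval_cong: "(\<And>i. i \<in> tfv t \<Longrightarrow> e i = e' i) \<Longrightarrow> eval M e t = eval M e' t"
  by (induction t) auto

lemma sat_cong: "(\<And>i. i \<in> fv A \<Longrightarrow> e i = e' i) \<Longrightarrow> sat M e A = sat M e' A"
proof (induction A arbitrary: e e')
  case (All A)
  have "sat M (case_nat x e) A = sat M (case_nat x e') A" for x
    by (rule All.IH) (use All.prems in \<open>auto split: nat.split\<close>)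
  then show ?case by auto
next
  case (Ex A)
  have "sat M (case_nat x e) A = sat M (case_nat x e') A" for x
    by (rule Ex.IH) (use Ex.prems in \<open>auto split: nat.split\<close>)
  then show ?case by auto
next
  case (Eq s t)
  have "eval M e s = eval M e' s" "eval M e t = eval M e' t"
    using Eq.prems by (intro eval_cong; simp)+
  then show ?case by simp
next
  case (Less s t)
  have "eval M e s = eval M e' s" "eval M e t = eval M e' t"
    using Less.prems by (intro eval_cong; simp)+
  then show ?case by simp
next
  case (And A B)
  have "sat M e A = sat M e' A" "sat M e B = sat M e' B"
    using And.prems by (intro And.IH; simp)+
  then show ?case by simp
next
  case (Or A B)
  have "sat M e A = sat M e' A" "sat M e B = sat M e' B"
    using Or.prems by (intro Or.IH; simp)+
  then show ?case by simp
next
  case (Imp A B)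
  have "sat M e A = sat M e' A" "sat M e B = sat M e' B"
    using Imp.prems by (intro Imp.IH; simp)+
  then show ?case by simp
qed auto

lemma eval_tsubst: "eval M e (tsubst f t) = eval M (\<lambda>i. eval M e (f i)) t"
  by (induction t) auto

lemma eval_tlift [simp]: "eval M (case_nat x e) (tlift t) = eval M e t"
  by (simp add: tlift_def eval_tsubst)

lemma eval_up: "(\<lambda>i. eval M (case_nat x e) (up f i)) = case_nat x (\<lambda>i. eval M e (f i))"
  by (auto simp: fun_eq_iff split: nat.split)

lemma sat_subst: "sat M e (subst f A) = sat M (\<lambda>i. eval M e (f i)) A"
  by (induction A arbitrary: e f) (auto simp: eval_tsubst eval_up)

lemma sat_lift [simp]: "sat M (case_nat x e) (lift A) = sat M e A"
  by (simp add: lift_def sat_subst)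

lemma sat_inst: "sat M e (inst t A) = sat M (case_nat (eval M e t) e) A"
proof -
  have "(\<lambda>i. eval M e (case_nat t V i)) = case_nat (eval M e t) e"
    by (auto simp: fun_eq_iff split: nat.split)
  then show ?thesis by (simp add: inst_def sat_subst)
qed

lemma sat_app: "sat M e (app A ts) = sat M (\<lambda>i. if i < length ts then eval M e (ts ! i) else e i) A"
  by (simp add: app_def sat_subst if_distrib cong: if_cong)

lemma eval_exv: "(\<lambda>i. eval M (case_nat x e) (if i = n then V 0 else V (Suc i))) = e(n := x)"
  by (auto simp: fun_eq_iff)

lemma sat_exv [simp]: "sat M e (exv n A) \<longleftrightarrow> (\<exists>x. sat M (e(n := x)) A)"
  by (simp add: exv_def sat_subst eval_exv)

lemma sat_allv [simp]: "sat M e (allv n A) \<longleftrightarrow> (\<forall>x. sat M (e(n := x)) A)"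
  by (simp add: allv_def sat_subst eval_exv)

definition pa :: "'m struct \<Rightarrow> bool" where
  "pa M \<longleftrightarrow> (\<forall>A\<in>HA. \<forall>e. sat M e A)"

text \<open>\<open>pa\<close> speaks of sentences only. An open axiom is recovered by stripping the
  quantifiers of its closure, using each time that an environment is \<open>case_nat\<close> of its
  head and its tail.\<close>

lemma sat_HA_generalizations:
  assumes "pa M" "A \<in> HA_generalizations"
  shows "sat M e A"
proof -
  obtain n where n: "fv ((All ^^ n) A) = {}" using closing_exists by blast
  have "\<forall>e. sat M e ((All ^^ n) A)"
    using assms n HA_generalizations_funpow unfolding pa_def HA_def by blast
  then have "\<forall>e. sat M e A"
  proof (induction n)
    case (Suc n)
    have "sat M e ((All ^^ n) A)" for e
    proof -
      have "case_nat (e 0) (\<lambda>i. e (Suc i)) = e" by (auto simp: fun_eq_iff split: nat.split)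
      then show ?thesis using Suc.prems by (metis comp_apply funpow.simps(2) sat.simps(7))
    qed
    then show ?case using Suc.IH by blast
  qed simp
  then show ?thesis by blast
qed

lemma paI:
  assumes "\<And>A e. A \<in> set basic_axioms \<Longrightarrow> sat M e A"
    and "\<And>A e. sat M e (induction_axiom A)"
  shows "pa M"
proof -
  have "A \<in> HA_generalizations \<Longrightarrow> sat M e A" for A e
    by (induction arbitrary: e rule: HA_generalizations.induct) (auto simp: assms)
  then show ?thesis by (auto simp: pa_def HA_def)
qed

lemma sat_logical_axiom: "logical_axiom A \<Longrightarrow> sat M e A"
  by (induction rule: logical_axiom.induct) (auto simp: sat_inst)

lemma soundness: "T \<turnstile> A \<Longrightarrow> (\<And>A e. A \<in> T \<Longrightarrow> sat M e A) \<Longrightarrow> sat M e A"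
  by (induction arbitrary: e rule: provable.induct) (auto simp: sat_logical_axiom)

lemma HA_sound: "HA \<turnstile> A \<Longrightarrow> pa M \<Longrightarrow> sat M e A"
  using soundness unfolding pa_def by blast

section \<open>Derivability from open assumptions\<close>

lemma provable_funpow: "T \<turnstile> A \<Longrightarrow> T \<turnstile> (All ^^ n) A"
  by (induction n) (auto intro: provable_gen)

lemma provable_inst: "T \<turnstile> All A \<Longrightarrow> T \<turnstile> inst t A"
  by (meson ax_allE provable_logic provable_mp)

text \<open>The quantifiers of a closure are instantiated one at a time: induction applies the tail
  of \<open>f\<close> to \<open>All A\<close>, and \<open>inst\<close> then supplies
  \<open>f 0\<close>. This makes the theorems closed under simultaneous substitution.\<close>

lemma provable_subst_closed: "T \<turnstile> (All ^^ n) A \<Longrightarrow> fv ((All ^^ n) A) = {} \<Longrightarrow> T \<turnstile> subst f A"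
proof (induction n arbitrary: f A)
  case (Suc n)
  have "T \<turnstile> subst (\<lambda>i. f (Suc i)) (All A)"
    using Suc.IH[of "All A"] Suc.prems by (simp only: funpow_Suc_right comp_apply)
  moreover have "case_nat (f 0) (\<lambda>i. f (Suc i)) = f"
    by (auto simp: fun_eq_iff split: nat.split)
  ultimately show ?case using provable_inst[of T _ "f 0"] by (fastforce simp: inst_subst_up)
qed (simp add: subst_closed)

lemma provable_subst: "T \<turnstile> A \<Longrightarrow> T \<turnstile> subst f A"
  using closing_exists provable_funpow provable_subst_closed by blast

lemma HA_generalizations_provable: "A \<in> HA_generalizations \<Longrightarrow> HA \<turnstile> A"
proof -
  assume "A \<in> HA_generalizations"
  moreover obtain n where n: "fv ((All ^^ n) A) = {}" using closing_exists by blast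
  ultimately have "HA \<turnstile> (All ^^ n) A"
    by (auto intro: provable_axiom simp: HA_def HA_generalizations_funpow)
  then show ?thesis using n provable_subst_closed[of HA n A V] by simp
qed

text \<open>The generalization rule of \<open>provable\<close> also acts on members of the axiom set
  with free variables, which blocks the deduction theorem. Here hypotheses are kept apart and
  generalization is confined to theorems of HA, so \<open>derives_impI\<close> is a plain
  induction.\<close>

inductive derives :: "fm set \<Rightarrow> fm \<Rightarrow> bool" for \<Gamma> :: "fm set" where
  derives_hyp: "A \<in> \<Gamma> \<Longrightarrow> derives \<Gamma> A"
| derives_thm: "HA \<turnstile> A \<Longrightarrow> derives \<Gamma> A"
| derives_mp: "derives \<Gamma> (A \<^bold>\<rightarrow> C) \<Longrightarrow> derives \<Gamma> A \<Longrightarrow> derives \<Gamma> C"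

lemma derives_ax: "logical_axiom A \<Longrightarrow> derives \<Gamma> A"
  by (simp add: derives_thm provable_logic)

lemma derives_mono: "derives \<Gamma> A \<Longrightarrow> \<Gamma> \<subseteq> \<Delta> \<Longrightarrow> derives \<Delta> A"
  by (induction rule: derives.induct) (auto intro: derives.intros)

lemma derives_empty: "derives {} A \<Longrightarrow> HA \<turnstile> A"
  by (induction rule: derives.induct) (auto intro: provable_mp)

lemma derives_refl: "derives \<Gamma> (A \<^bold>\<rightarrow> A)"
  using derives_mp[OF derives_mp[OF derives_ax[OF ax_S] derives_ax[OF ax_K]] derives_ax[OF ax_K]] .

lemma derives_impI: "derives (insert A \<Gamma>) C \<Longrightarrow> derives \<Gamma> (A \<^bold>\<rightarrow> C)"
proof (induction rule: derives.induct)
  case (derives_hyp C)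
  then show ?case
    using derives_refl derives_mp[OF derives_ax[OF ax_K] derives.derives_hyp] by blast
next
  case (derives_thm C)
  then show ?case using derives_mp[OF derives_ax[OF ax_K] derives.derives_thm] by blast
next
  case (derives_mp C D)
  then show ?case using derives.derives_mp derives_ax[OF ax_S] by blast
qed

lemma derives_finite: "derives \<Gamma> A \<Longrightarrow> \<exists>\<Delta>\<subseteq>\<Gamma>. finite \<Delta> \<and> derives \<Delta> A"
proof (induction rule: derives.induct)
  case (derives_hyp A)
  then show ?case by (intro exI[of _ "{A}"]) (auto intro: derives.intros)
next
  case (derives_thm A)
  then show ?case by (intro exI[of _ "{}"]) (auto intro: derives.intros)
next
  case (derives_mp A C)
  then obtain \<Delta> \<Delta>' where "\<Delta> \<subseteq> \<Gamma>" "finite \<Delta>" "derives \<Delta> (A \<^bold>\<rightarrow> C)" "\<Delta>' \<subseteq> \<Gamma>" "finite \<Delta>'" "derives \<Delta>' A"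
    by blast
  then show ?case
    by (intro exI[of _ "\<Delta> \<union> \<Delta>'"]) (auto intro: derives.derives_mp derives_mono)
qed

lemma derives_subst: "derives \<Gamma> A \<Longrightarrow> derives (subst f ` \<Gamma>) (subst f A)"
  by (induction rule: derives.induct) (auto intro: derives.intros provable_subst)

text \<open>The hypotheses are moved into the formula one by one and taken out again with
  \<open>ax_allI\<close>, which is why finiteness is assumed; once none is left,
  \<open>provable_gen\<close> applies.\<close>

lemma derives_allI:
  assumes "finite \<Gamma>" "derives (lift ` \<Gamma>) A"
  shows "derives \<Gamma> (All A)"
  using assms
proof (induction \<Gamma> arbitrary: A rule: finite_induct)
  case empty
  then show ?case by (simp add: derives_empty derives_thm provable_gen)
next
  case (insert C \<Gamma>)
  then have "derives \<Gamma> (All (lift C \<^bold>\<rightarrow> A))" using derives_impI by auto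
  then have "derives (insert C \<Gamma>) (C \<^bold>\<rightarrow> All A)"
    using derives_mp[OF derives_ax[OF ax_allI]] derives_mono by blast
  then show ?case using derives_mp derives_hyp by blast
qed

lemma derives_all_fresh:
  assumes "finite \<Gamma>" "derives \<Gamma> (inst (V x) A)" "\<forall>C\<in>\<Gamma>. x \<notin> fv C" "x \<notin> fv (All A)"
  shows "derives \<Gamma> (All A)"
proof (rule derives_allI)
  \<comment> \<open>The eigenvariable becomes the index of the new quantifier and everything else is
    lifted; on hypotheses without \<open>x\<close> this is just \<open>lift\<close>.\<close>
  let ?f = "\<lambda>i. if i = x then V 0 else V (Suc i)"
  have "subst ?f C = lift C" if "C \<in> \<Gamma>" for C
    unfolding lift_def by (rule subst_cong) (use that assms(3) in auto)
  then have "subst ?f ` \<Gamma> = lift ` \<Gamma>" by auto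
  moreover have "subst ?f (inst (V x) A) = subst V A"
    unfolding inst_def subst_subst by (rule subst_cong) (use assms(4) in \<open>auto split: nat.split\<close>)
  ultimately show "derives (lift ` \<Gamma>) A"
    using derives_subst[OF assms(2), of ?f] by simp
qed (fact assms)

lemma derives_andI: "derives \<Gamma> A \<Longrightarrow> derives \<Gamma> C \<Longrightarrow> derives \<Gamma> (A \<^bold>\<and> C)"
  by (meson ax_andI derives_ax derives_mp)

lemma derives_conjunct1: "derives \<Gamma> (A \<^bold>\<and> C) \<Longrightarrow> derives \<Gamma> A"
  by (meson ax_andE1 derives_ax derives_mp)

lemma derives_conjunct2: "derives \<Gamma> (A \<^bold>\<and> C) \<Longrightarrow> derives \<Gamma> C"
  by (meson ax_andE2 derives_ax derives_mp)

lemma derives_orE: "derives \<Gamma> (A \<^bold>\<or> C) \<Longrightarrow> derives (insert A \<Gamma>) D \<Longrightarrow> derives (insert C \<Gamma>) D \<Longrightarrow> derives \<Gamma> D"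
  by (meson ax_orE derives_ax derives_impI derives_mp)

lemma derives_FlsE: "derives \<Gamma> Fls \<Longrightarrow> derives \<Gamma> A"
  by (meson ax_flsE derives_ax derives_mp)

lemma derives_inst: "derives \<Gamma> (All A) \<Longrightarrow> derives \<Gamma> (inst t A)"
  by (meson ax_allE derives_ax derives_mp)

lemma derives_dni: "derives \<Gamma> (A \<^bold>\<rightarrow> (A \<^bold>\<rightarrow> B) \<^bold>\<rightarrow> B)"
  by (intro derives_impI) (rule derives_mp[of _ A]; simp add: derives_hyp)

text \<open>Negation relative to \<open>B\<close> is stable: three collapse to one. Formulas that
  are themselves such negations therefore behave classically in the construction below.\<close>

lemma derives_dn3: "derives \<Gamma> ((((A \<^bold>\<rightarrow> B) \<^bold>\<rightarrow> B) \<^bold>\<rightarrow> B) \<^bold>\<rightarrow> A \<^bold>\<rightarrow> B)"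
proof (intro derives_impI)
  let ?\<Gamma> = "insert A (insert (((A \<^bold>\<rightarrow> B) \<^bold>\<rightarrow> B) \<^bold>\<rightarrow> B) \<Gamma>)"
  have "derives ?\<Gamma> ((A \<^bold>\<rightarrow> B) \<^bold>\<rightarrow> B)"
    using derives_mp[OF derives_dni] derives_hyp by blast
  then show "derives ?\<Gamma> B" by (meson derives_hyp derives_mp insertCI)
qed

lemma All_mono: "HA \<turnstile> A \<^bold>\<rightarrow> C \<Longrightarrow> HA \<turnstile> All A \<^bold>\<rightarrow> All C"
proof -
  assume "HA \<turnstile> A \<^bold>\<rightarrow> C"
  moreover have "derives {lift (All A)} (inst (V 0) (subst (up (\<lambda>i. V (Suc i))) A))"
    by (rule derives_inst) (simp add: derives_hyp lift_def)
  moreover have "inst (V 0) (subst (up (\<lambda>i. V (Suc i))) A) = A"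
    unfolding inst_subst_up using subst_cong[of A "case_nat (V 0) (\<lambda>i. V (Suc i))" V]
    by (auto split: nat.split)
  ultimately have "derives {lift (All A)} C" by (metis derives_mp derives_thm)
  then have "derives {All A} (All C)" by (intro derives_allI) auto
  then show ?thesis using derives_empty derives_impI by blast
qed

section \<open>Saturated sets\<close>

instance tm :: countable by countable_datatype
instance fm :: countable by countable_datatype

text \<open>Friedman's A-translation built into a Henkin construction: \<open>B\<close> plays the role of falsity.\<close>

locale saturated =
  fixes B :: fm and \<Gamma> :: "fm set"
  assumes derives_mem: "derives \<Gamma> C \<Longrightarrow> C \<in> \<Gamma>"
    and not_mem: "B \<notin> \<Gamma>"
    and maximal: "C \<notin> \<Gamma> \<Longrightarrow> (C \<^bold>\<rightarrow> B) \<in> \<Gamma>"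
    and all_mem: "(\<And>s. inst s E \<in> \<Gamma>) \<Longrightarrow> All ((E \<^bold>\<rightarrow> lift B) \<^bold>\<rightarrow> lift B) \<in> \<Gamma>"

text \<open>Consistency means that \<open>B\<close> is not derivable. A universal formula that has
  to be rejected leaves behind a refuted instance as Henkin witness, whenever one can be added
  consistently; witnesses are variables, so no new constants are needed.\<close>

definition extend :: "fm \<Rightarrow> fm \<Rightarrow> fm set \<Rightarrow> fm set" where
  "extend B F \<Gamma> =
    (if \<not> derives (insert F \<Gamma>) B then insert F \<Gamma>
     else if \<exists>G x. F = All G \<and> \<not> derives (insert (inst (V x) G \<^bold>\<rightarrow> B) \<Gamma>) B
     then insert (SOME C. \<exists>G x. C = (inst (V x) G \<^bold>\<rightarrow> B) \<and> F = All G \<and> \<not> derives (insert C \<Gamma>) B) \<Gamma>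
     else \<Gamma>)"

lemma extend_cases:
  obtains "\<not> derives (insert F \<Gamma>) B" "extend B F \<Gamma> = insert F \<Gamma>"
  | G x where "derives (insert F \<Gamma>) B" "F = All G" "extend B F \<Gamma> = insert (inst (V x) G \<^bold>\<rightarrow> B) \<Gamma>"
      "\<not> derives (insert (inst (V x) G \<^bold>\<rightarrow> B) \<Gamma>) B"
  | "derives (insert F \<Gamma>) B" "extend B F \<Gamma> = \<Gamma>"
      "\<nexists>G x. F = All G \<and> \<not> derives (insert (inst (V x) G \<^bold>\<rightarrow> B) \<Gamma>) B"
proof (cases "derives (insert F \<Gamma>) B \<and> (\<exists>G x. F = All G \<and> \<not> derives (insert (inst (V x) G \<^bold>\<rightarrow> B) \<Gamma>) B)")
  case True
  let ?P = "\<lambda>C. \<exists>G x. C = (inst (V x) G \<^bold>\<rightarrow> B) \<and> F = All G \<and> \<not> derives (insert C \<Gamma>) B"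
  have "?P (SOME C. ?P C)" by (rule someI_ex) (use True in blast)
  moreover have "extend B F \<Gamma> = insert (SOME C. ?P C) \<Gamma>" using True by (simp add: extend_def)
  ultimately show ?thesis using that(2) True by metis
next
  case False
  show ?thesis
  proof (cases "derives (insert F \<Gamma>) B")
    case True
    with False have "\<nexists>G x. F = All G \<and> \<not> derives (insert (inst (V x) G \<^bold>\<rightarrow> B) \<Gamma>) B" by blast
    moreover from this True have "extend B F \<Gamma> = \<Gamma>" by (auto simp: extend_def)
    ultimately show ?thesis using True that(3) by blast
  next
    case False
    then show ?thesis using that(1) by (simp add: extend_def)
  qed
qed

primrec chain :: "fm \<Rightarrow> fm \<Rightarrow> nat \<Rightarrow> fm set" where
  "chain A B 0 = {A}"
| "chain A B (Suc n) = extend B (from_nat n) (chain A B n)"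

lemma saturated_exists:
  assumes "\<not> (HA \<turnstile> A \<^bold>\<rightarrow> B)"
  obtains \<Gamma> where "saturated B \<Gamma>" "A \<in> \<Gamma>"
proof
  define \<Gamma> where "\<Gamma> = (\<Union>n. chain A B n)"
  show "A \<in> \<Gamma>" unfolding \<Gamma>_def by (rule UN_I[of 0]) auto
  have cons: "\<not> derives (chain A B n) B" for n
  proof (induction n)
    case 0
    then show ?case using assms derives_empty derives_impI by auto
  next
    case (Suc n)
    then show ?case by (cases rule: extend_cases[of "from_nat n" "chain A B n" B]) auto
  qed
  have fin: "finite (chain A B n)" for n
  proof (induction n)
    case (Suc n)
    then show ?case by (cases rule: extend_cases[of "from_nat n" "chain A B n" B]) auto
  qed simp
  have "chain A B n \<subseteq> chain A B (Suc n)" for n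
    by (cases rule: extend_cases[of "from_nat n" "chain A B n" B]) auto
  then have mono: "chain A B m \<subseteq> chain A B n" if "m \<le> n" for m n
    using that lift_Suc_mono_le by blast
  have finite_sub: "\<exists>n. \<Delta> \<subseteq> chain A B n" if "finite \<Delta>" "\<Delta> \<subseteq> \<Gamma>" for \<Delta>
    using that
  proof (induction rule: finite_induct)
    case (insert C \<Delta>)
    then obtain m n where "\<Delta> \<subseteq> chain A B n" "C \<in> chain A B m" unfolding \<Gamma>_def by blast
    then have "insert C \<Delta> \<subseteq> chain A B (max m n)"
      using mono[of m "max m n"] mono[of n "max m n"] by auto
    then show ?case ..
  qed simp
  have not_B: "\<not> derives \<Gamma> B"
    using derives_finite finite_sub cons derives_mono by metis
  have stage: "\<exists>n. from_nat n = C" for C :: fm by (metis from_nat_to_nat)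
  have maximal: "derives \<Gamma> (C \<^bold>\<rightarrow> B)" if "C \<notin> \<Gamma>" for C
  proof -
    obtain n where n: "from_nat n = C" using stage by blast
    have "derives (insert C (chain A B n)) B"
    proof (rule ccontr)
      assume "\<not> ?thesis"
      then have "C \<in> chain A B (Suc n)" using n by (simp add: extend_def)
      then show False using that \<Gamma>_def by blast
    qed
    then show ?thesis using derives_impI derives_mono[of _ _ \<Gamma>] unfolding \<Gamma>_def by blast
  qed
  have mem: "C \<in> \<Gamma>" if "derives \<Gamma> C" for C
    using maximal[of C] that not_B derives_mp by blast
  show "saturated B \<Gamma>"
  proof
    fix E assume E: "\<And>s. inst s E \<in> \<Gamma>"
    let ?G = "(E \<^bold>\<rightarrow> lift B) \<^bold>\<rightarrow> lift B"
    show "All ?G \<in> \<Gamma>"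
    proof (rule ccontr)
      assume nin: "All ?G \<notin> \<Gamma>"
      obtain n where n: "from_nat n = All ?G" using stage by blast
      let ?C = "chain A B n"
      have "finite (\<Union> (fv ` ?C) \<union> fv (All ?G))" using fin finite_fv by blast
      then obtain x where x: "x \<notin> \<Union> (fv ` ?C) \<union> fv (All ?G)"
        using ex_new_if_finite infinite_UNIV_nat by blast
      \<comment> \<open>A fresh \<open>x\<close> always works. \<open>?G\<close> is a negation
        relative to \<open>B\<close>, so if refuting its instance at \<open>x\<close> were
        inconsistent, the instance itself would be derivable, then \<open>All ?G\<close>, and with
        it \<open>B\<close> at this stage.\<close>
      have "\<not> derives (insert (inst (V x) ?G \<^bold>\<rightarrow> B) ?C) B" if "derives (insert (All ?G) ?C) B"
      proof
        assume "derives (insert (inst (V x) ?G \<^bold>\<rightarrow> B) ?C) B"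
        then have "derives ?C ((inst (V x) ?G \<^bold>\<rightarrow> B) \<^bold>\<rightarrow> B)" by (rule derives_impI)
        then have "derives ?C (inst (V x) ?G)" using derives_dn3 derives_mp by fastforce
        then have "derives ?C (All ?G)" using x fin by (intro derives_all_fresh) auto
        then show False using that derives_impI derives_mp cons by blast
      qed
      then obtain y where "(inst (V y) ?G \<^bold>\<rightarrow> B) \<in> chain A B (Suc n)"
      proof (cases rule: extend_cases[of "All ?G" "?C" B])
        case 1
        then have "All ?G \<in> chain A B (Suc n)" using n by simp
        then show thesis using nin \<Gamma>_def by blast
      qed (use n that in auto)
      then have y: "(inst (V y) ?G \<^bold>\<rightarrow> B) \<in> \<Gamma>" unfolding \<Gamma>_def by blast
      have "derives \<Gamma> (inst (V y) ?G)"
        using derives_mp[OF derives_dni derives_hyp[OF E[of "V y"]]] by simp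
      then show False using y not_B derives_hyp derives_mp by blast
    qed
  qed (use mem maximal not_B derives_hyp in blast)+
qed

context saturated
begin

lemma thm_mem: "HA \<turnstile> C \<Longrightarrow> C \<in> \<Gamma>"
  by (simp add: derives_mem derives_thm)

lemma mp_mem: "(C \<^bold>\<rightarrow> D) \<in> \<Gamma> \<Longrightarrow> C \<in> \<Gamma> \<Longrightarrow> D \<in> \<Gamma>"
  by (meson derives_hyp derives_mem derives_mp)

lemma thm_mp: "HA \<turnstile> C \<^bold>\<rightarrow> D \<Longrightarrow> C \<in> \<Gamma> \<Longrightarrow> D \<in> \<Gamma>"
  using mp_mem thm_mem by blast

lemma ax_mem: "logical_axiom C \<Longrightarrow> C \<in> \<Gamma>"
  by (simp add: provable_logic thm_mem)

lemma Fls_mem [simp]: "Fls \<notin> \<Gamma>"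
  using ax_flsE ax_mem mp_mem not_mem by blast

lemma And_mem [simp]: "(C \<^bold>\<and> D) \<in> \<Gamma> \<longleftrightarrow> C \<in> \<Gamma> \<and> D \<in> \<Gamma>"
  by (meson ax_andE1 ax_andE2 ax_andI ax_mem mp_mem)

lemma Or_mem [simp]: "(C \<^bold>\<or> D) \<in> \<Gamma> \<longleftrightarrow> C \<in> \<Gamma> \<or> D \<in> \<Gamma>"
  by (meson ax_orE ax_orI1 ax_orI2 ax_mem maximal mp_mem not_mem)

lemma dn_mem [simp]: "((C \<^bold>\<rightarrow> B) \<^bold>\<rightarrow> B) \<in> \<Gamma> \<longleftrightarrow> C \<in> \<Gamma>"
  by (meson derives_dni derives_mem maximal mp_mem not_mem)

text \<open>If \<open>C\<close> is absent, maximality only provides the implication from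
  \<open>C\<close> to \<open>B\<close>, not the one to \<open>D\<close>. Negating the consequent
  twice relative to \<open>B\<close> is what gives implication its classical truth table.\<close>

lemma imp_dn_mem: "(C \<^bold>\<rightarrow> (D \<^bold>\<rightarrow> B) \<^bold>\<rightarrow> B) \<in> \<Gamma> \<longleftrightarrow> (C \<in> \<Gamma> \<longrightarrow> D \<in> \<Gamma>)"
proof
  assume *: "C \<in> \<Gamma> \<longrightarrow> D \<in> \<Gamma>"
  show "(C \<^bold>\<rightarrow> (D \<^bold>\<rightarrow> B) \<^bold>\<rightarrow> B) \<in> \<Gamma>"
  proof (cases "D \<in> \<Gamma>")
    case True
    then show ?thesis by (meson ax_K ax_mem dn_mem mp_mem)
  next
    case False
    then have "(C \<^bold>\<rightarrow> B) \<in> \<Gamma>" using * maximal by blast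
    then have "derives (insert C \<Gamma>) B" by (meson derives_hyp derives_mp insertCI)
    then have "derives (insert C \<Gamma>) ((D \<^bold>\<rightarrow> B) \<^bold>\<rightarrow> B)" by (meson ax_K derives_ax derives_mp)
    then show ?thesis using derives_impI derives_mem by blast
  qed
qed (use mp_mem dn_mem in blast)

text \<open>The construction adds no existential witnesses; they come from \<open>all_mem\<close>.
  If no instance is a member, all are refuted relative to \<open>B\<close>, so the universal
  refutation is a member up to a triple negation, which collapses.\<close>

lemma Ex_mem: "Ex C \<in> \<Gamma> \<longleftrightarrow> (\<exists>s. inst s C \<in> \<Gamma>)"
proof
  show "\<exists>s. inst s C \<in> \<Gamma>" if "Ex C \<in> \<Gamma>"
  proof (rule ccontr)
    assume "\<nexists>s. inst s C \<in> \<Gamma>"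
    then have "All (((C \<^bold>\<rightarrow> lift B) \<^bold>\<rightarrow> lift B) \<^bold>\<rightarrow> lift B) \<in> \<Gamma>"
      using maximal all_mem[of "C \<^bold>\<rightarrow> lift B"] by simp
    then have "All (C \<^bold>\<rightarrow> lift B) \<in> \<Gamma>"
      using All_mono derives_dn3 derives_empty thm_mp by blast
    then show False using that by (meson ax_exE ax_mem mp_mem not_mem)
  qed
qed (meson ax_exI ax_mem mp_mem)

lemma All_inst_mem: "All C \<in> \<Gamma> \<Longrightarrow> inst s C \<in> \<Gamma>"
  by (meson ax_allE ax_mem mp_mem)

text \<open>By maximality, every formula may be replaced by its double negation relative to \<open>B\<close>.\<close>

lemma induct_mem:
  assumes zero: "inst Zero C \<in> \<Gamma>" and step: "\<And>s. inst s C \<in> \<Gamma> \<Longrightarrow> inst (Succ s) C \<in> \<Gamma>"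
  shows "inst s C \<in> \<Gamma>"
proof -
  let ?E = "(C \<^bold>\<rightarrow> lift B) \<^bold>\<rightarrow> lift B"
  let ?f = "V(0 := Succ (V 0))"
  have f: "inst s (subst ?f D) = inst (Succ s) D" for s D
    unfolding inst_def subst_subst by (rule subst_cong) (auto split: nat.split)
  have lB: "subst ?f (lift B) = lift B"
    unfolding subst_lift by (simp add: lift_def)
  have "All (((?E \<^bold>\<rightarrow> subst ?f ?E) \<^bold>\<rightarrow> lift B) \<^bold>\<rightarrow> lift B) \<in> \<Gamma>"
    using step by (intro all_mem) (simp add: f lB imp_dn_mem)
  moreover have "derives {} ((((?E \<^bold>\<rightarrow> subst ?f ?E) \<^bold>\<rightarrow> lift B) \<^bold>\<rightarrow> lift B) \<^bold>\<rightarrow> ?E \<^bold>\<rightarrow> subst ?f ?E)"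
  proof -
    let ?D = "subst ?f C \<^bold>\<rightarrow> lift B"
    have "derives {} ((((?E \<^bold>\<rightarrow> ?D \<^bold>\<rightarrow> lift B) \<^bold>\<rightarrow> lift B) \<^bold>\<rightarrow> lift B) \<^bold>\<rightarrow> ?E \<^bold>\<rightarrow> ?D \<^bold>\<rightarrow> lift B)"
    proof (intro derives_impI)
      let ?F = "?E \<^bold>\<rightarrow> ?D \<^bold>\<rightarrow> lift B"
      let ?\<Delta> = "insert ?D (insert ?E (insert ((?F \<^bold>\<rightarrow> lift B) \<^bold>\<rightarrow> lift B) {}))"
      have "derives (insert ?F ?\<Delta>) (?D \<^bold>\<rightarrow> lift B)"
        by (rule derives_mp[of _ ?E]) (simp_all add: derives_hyp)
      then have "derives (insert ?F ?\<Delta>) (lift B)"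
        by (rule derives_mp) (simp add: derives_hyp)
      then have "derives ?\<Delta> (?F \<^bold>\<rightarrow> lift B)" by (rule derives_impI)
      moreover have "derives ?\<Delta> ((?F \<^bold>\<rightarrow> lift B) \<^bold>\<rightarrow> lift B)" by (simp add: derives_hyp)
      ultimately show "derives ?\<Delta> (lift B)" by (rule derives_mp[rotated])
    qed
    then show ?thesis using lB by simp
  qed
  ultimately have "All (?E \<^bold>\<rightarrow> subst ?f ?E) \<in> \<Gamma>"
    using All_mono derives_empty thm_mp by blast
  moreover have "induction_axiom ?E \<in> \<Gamma>"
    by (intro thm_mem HA_generalizations_provable HA_generalizations.intros)
  moreover have "inst Zero ?E \<in> \<Gamma>" using zero by simp
  ultimately have "All ?E \<in> \<Gamma>"
    unfolding induction_axiom_def by (rule_tac mp_mem, rule_tac mp_mem)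
  from All_inst_mem[OF this, of s] show ?thesis by simp
qed

end

text \<open>Membership of \<open>trans B C\<close> in a saturated set amounts to truth of \<open>C\<close> in the term model.\<close>

primrec trans :: "fm \<Rightarrow> fm \<Rightarrow> fm" where
  "trans B (s \<approx> t) = (s \<approx> t)"
| "trans B (s \<prec> t) = (s \<prec> t)"
| "trans B Fls = Fls"
| "trans B (C \<^bold>\<and> D) = (trans B C \<^bold>\<and> trans B D)"
| "trans B (C \<^bold>\<or> D) = (trans B C \<^bold>\<or> trans B D)"
| "trans B (C \<^bold>\<rightarrow> D) = (trans B C \<^bold>\<rightarrow> (trans B D \<^bold>\<rightarrow> B) \<^bold>\<rightarrow> B)"
| "trans B (All C) = All ((trans (lift B) C \<^bold>\<rightarrow> lift B) \<^bold>\<rightarrow> lift B)"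
| "trans B (Ex C) = Ex (trans (lift B) C)"

lemma subst_trans: "subst f (trans B C) = trans (subst f B) (subst f C)"
  by (induction C arbitrary: f B) simp_all

lemma inst_trans: "inst t (trans (lift B) C) = trans B (inst t C)"
  using subst_trans[of "case_nat t V" "lift B" C] inst_lift[of t B] by (simp add: inst_def)

context saturated
begin

lemma eq_refl_mem: "(t \<approx> t) \<in> \<Gamma>"
  by (simp add: ax_eq_refl ax_mem)

lemma eq_subst_mem: "(s \<approx> t) \<in> \<Gamma> \<Longrightarrow> inst s C \<in> \<Gamma> \<Longrightarrow> inst t C \<in> \<Gamma>"
  by (meson ax_eq_subst ax_mem mp_mem)

lemma inst_V_tlift: "tsubst (case_nat s V) (tlift t) = t"
  by (simp add: tsubst_tlift)

lemma eq_sym_mem: "(s \<approx> t) \<in> \<Gamma> \<Longrightarrow> (t \<approx> s) \<in> \<Gamma>"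
  using eq_subst_mem[of s t "V 0 \<approx> tlift s"] eq_refl_mem by (simp add: inst_def inst_V_tlift)

lemma eq_trans_mem: "(s \<approx> t) \<in> \<Gamma> \<Longrightarrow> (t \<approx> u) \<in> \<Gamma> \<Longrightarrow> (s \<approx> u) \<in> \<Gamma>"
  using eq_subst_mem[of t u "tlift s \<approx> V 0"] by (simp add: inst_def inst_V_tlift)

lemma eq_cong1_mem:
  assumes "(s \<approx> t) \<in> \<Gamma>"
  shows "(Succ s \<approx> Succ t) \<in> \<Gamma>" "(Plus s u \<approx> Plus t u) \<in> \<Gamma>" "(Plus u s \<approx> Plus u t) \<in> \<Gamma>"
    "(Times s u \<approx> Times t u) \<in> \<Gamma>" "(Times u s \<approx> Times u t) \<in> \<Gamma>"
    "(s \<prec> u) \<in> \<Gamma> \<Longrightarrow> (t \<prec> u) \<in> \<Gamma>" "(u \<prec> s) \<in> \<Gamma> \<Longrightarrow> (u \<prec> t) \<in> \<Gamma>"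
  using eq_subst_mem[OF assms, of "tlift (Succ s) \<approx> Succ (V 0)"]
    eq_subst_mem[OF assms, of "tlift (Plus s u) \<approx> Plus (V 0) (tlift u)"]
    eq_subst_mem[OF assms, of "tlift (Plus u s) \<approx> Plus (tlift u) (V 0)"]
    eq_subst_mem[OF assms, of "tlift (Times s u) \<approx> Times (V 0) (tlift u)"]
    eq_subst_mem[OF assms, of "tlift (Times u s) \<approx> Times (tlift u) (V 0)"]
    eq_subst_mem[OF assms, of "V 0 \<prec> tlift u"] eq_subst_mem[OF assms, of "tlift u \<prec> V 0"]
  by (simp_all add: inst_def inst_V_tlift eq_refl_mem)

lemma basic_mem: "A \<in> set basic_axioms \<Longrightarrow> subst f A \<in> \<Gamma>"
  by (simp add: HA_generalizations.intros(1) HA_generalizations_provable provable_subst thm_mem)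

lemma Succ_not_Zero_mem: "(Succ s \<approx> Zero) \<notin> \<Gamma>"
  using basic_mem[of "\<^bold>\<not> (Succ (V 0) \<approx> Zero)" "\<lambda>i. s"]
    mp_mem[of "Succ s \<approx> Zero" Fls] Fls_mem by (auto simp: basic_axioms_def)

lemma Succ_inject_mem: "(Succ s \<approx> Succ t) \<in> \<Gamma> \<Longrightarrow> (s \<approx> t) \<in> \<Gamma>"
  using basic_mem[of "Succ (V 0) \<approx> Succ (V 1) \<^bold>\<rightarrow> V 0 \<approx> V 1" "case_nat s (\<lambda>i. t)"] mp_mem
  by (auto simp: basic_axioms_def)

lemma Less_mem: "(s \<prec> t) \<in> \<Gamma> \<longleftrightarrow> (\<exists>u. (Plus s (Succ u) \<approx> t) \<in> \<Gamma>)"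
proof -
  have "subst (case_nat s (\<lambda>i. t)) (V 0 \<prec> V 1 \<^bold>\<leftrightarrow> exv 2 (Plus (V 0) (Succ (V 2)) \<approx> V 1)) \<in> \<Gamma>"
    by (rule basic_mem) (simp add: basic_axioms_def)
  then have "(s \<prec> t) \<in> \<Gamma> \<longleftrightarrow> Ex (Plus (tlift s) (Succ (V 0)) \<approx> tlift t) \<in> \<Gamma>"
    using mp_mem by (auto simp: exv_def)
  then show ?thesis by (simp add: Ex_mem inst_def inst_V_tlift)
qed

end

text \<open>Distinct numerals are never identified, so the quotient of the terms is countably
  infinite and can be renamed to \<open>nat\<close>. The fixed carrier is what allows later premises
  to range over all models.\<close>

lemma (in saturated) term_map:
  obtains h :: "tm \<Rightarrow> nat" where "surj h" "\<And>s t. h s = h t \<longleftrightarrow> (s \<approx> t) \<in> \<Gamma>"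
proof -
  define q where "q t = {s. (s \<approx> t) \<in> \<Gamma>}" for t
  have q: "q s = q t \<longleftrightarrow> (s \<approx> t) \<in> \<Gamma>" for s t
    using eq_refl_mem eq_sym_mem eq_trans_mem unfolding q_def by blast
  have "(num m \<approx> num n) \<in> \<Gamma> \<Longrightarrow> m = n" for m n
  proof (induction m arbitrary: n)
    case 0
    then show ?case by (cases n) (use Succ_not_Zero_mem eq_sym_mem in auto)
  next
    case (Suc m)
    then show ?case by (cases n) (use Succ_not_Zero_mem Succ_inject_mem in auto)
  qed
  then have "inj (\<lambda>n. q (num n))" by (auto simp: inj_def q)
  then have "infinite (range q)"
    using finite_subset[of "range (\<lambda>n. q (num n))" "range q"] range_inj_infinite by blast
  moreover have "countable (range q)" by simp
  ultimately obtain b :: "tm set \<Rightarrow> nat" where b: "bij_betw b (range q) UNIV"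
    using countableE_infinite by blast
  show thesis
  proof
    show "surj (b \<circ> q)" using b by (simp add: bij_betw_def image_comp)
    show "(b \<circ> q) s = (b \<circ> q) t \<longleftrightarrow> (s \<approx> t) \<in> \<Gamma>" for s t
      using inj_on_eq_iff[of b "range q" "q s" "q t", OF _ rangeI rangeI] b q by (simp add: bij_betw_def)
  qed
qed

locale term_model = saturated +
  fixes h :: "tm \<Rightarrow> nat"
  assumes surj: "surj h" and h_eq: "\<And>s t. h s = h t \<longleftrightarrow> (s \<approx> t) \<in> \<Gamma>"
begin

abbreviation "r \<equiv> inv h"

lemma h_r [simp]: "h (r x) = x"
  by (simp add: surj surj_f_inv_f)

lemma r_h: "(r (h s) \<approx> s) \<in> \<Gamma>"
  by (simp flip: h_eq)

definition M :: "nat struct" where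
  "M = \<lparr>m_zero = h Zero, m_suc = (\<lambda>x. h (Succ (r x))), m_add = (\<lambda>x y. h (Plus (r x) (r y))),
    m_mul = (\<lambda>x y. h (Times (r x) (r y))), m_less = (\<lambda>x y. (r x \<prec> r y) \<in> \<Gamma>)\<rparr>"

lemma less: "(r (h s) \<prec> r (h t)) \<in> \<Gamma> \<longleftrightarrow> (s \<prec> t) \<in> \<Gamma>"
  by (meson eq_cong1_mem(6,7) r_h eq_sym_mem)

lemma M_h [simp]: "m_zero M = h Zero" "m_suc M (h s) = h (Succ s)"
  "m_add M (h s) (h t) = h (Plus s t)" "m_mul M (h s) (h t) = h (Times s t)"
  "m_less M (h s) (h t) \<longleftrightarrow> (s \<prec> t) \<in> \<Gamma>"
  using r_h less eq_sym_mem[OF r_h]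
  by (auto simp: M_def h_eq intro: eq_cong1_mem eq_trans_mem[OF eq_cong1_mem(2) eq_cong1_mem(3)]
      eq_trans_mem[OF eq_cong1_mem(4) eq_cong1_mem(5)])

lemma eval_M: "eval M (\<lambda>i. h (f i)) t = h (tsubst f t)"
  by (induction t) auto

lemma ex_h: "(\<exists>x. P x) \<longleftrightarrow> (\<exists>s. P (h s))" and all_h: "(\<forall>x. P x) \<longleftrightarrow> (\<forall>s. P (h s))"
  by (metis h_r)+

lemma sat_trans: "sat M (\<lambda>i. h (f i)) C \<longleftrightarrow> trans B (subst f C) \<in> \<Gamma>"
proof (induction C arbitrary: f)
  case (All C)
  have "(\<forall>s. inst s (trans (lift B) (subst (up f) C)) \<in> \<Gamma>)
    \<longleftrightarrow> All ((trans (lift B) (subst (up f) C) \<^bold>\<rightarrow> lift B) \<^bold>\<rightarrow> lift B) \<in> \<Gamma>"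
    using all_mem All_inst_mem by fastforce
  moreover have "case_nat (h s) (\<lambda>i. h (f i)) = (\<lambda>i. h (case_nat s f i))" for s
    by (auto simp: fun_eq_iff split: nat.split)
  ultimately show ?case
    by (simp add: all_h[of "\<lambda>x. sat M (case_nat x _) _"] All.IH inst_trans inst_subst_up)
next
  case (Ex C)
  have "case_nat (h s) (\<lambda>i. h (f i)) = (\<lambda>i. h (case_nat s f i))" for s
    by (auto simp: fun_eq_iff split: nat.split)
  then show ?case
    by (simp add: ex_h[of "\<lambda>x. sat M (case_nat x _) _"] Ex.IH inst_trans inst_subst_up Ex_mem)
qed (auto simp: eval_M h_eq imp_dn_mem)

lemma env_h: "e = (\<lambda>i. h (r (e i)))"
  by simp

text \<open>The basic axioms are equations or are checked on the operations directly. Induction for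
  \<open>A\<close> in the model is induction inside \<Gamma> for the translation of
  \<open>A\<close>, which \<open>induct_mem\<close> provides.\<close>

lemma M_pa: "pa M"
proof (rule paI)
  fix A and e :: "nat \<Rightarrow> nat" assume A: "A \<in> set basic_axioms"
  let ?f = "\<lambda>i. r (e i)"
  have pos: "sat M e C \<longleftrightarrow> subst ?f C \<in> \<Gamma>" if "\<exists>s t. C = (s \<approx> t)" for C
    using that sat_trans[of ?f C] env_h[of e] by auto
  have less: "m_less M x y \<longleftrightarrow> (\<exists>z. m_add M x (m_suc M z) = y)" for x y
  proof -
    have "m_less M (h (r x)) (h (r y)) \<longleftrightarrow> (\<exists>s. m_add M (h (r x)) (m_suc M (h s)) = h (r y))"
      unfolding M_h h_eq by (rule Less_mem)
    then show ?thesis using ex_h[of "\<lambda>z. m_add M x (m_suc M z) = y"] by simp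
  qed
  have suc: "m_suc M x \<noteq> m_zero M" "m_suc M x = m_suc M y \<Longrightarrow> x = y" for x y
    using Succ_not_Zero_mem[of "r x"] Succ_inject_mem[of "r x" "r y"] M_h(2)[of "r x"] M_h(2)[of "r y"]
      h_eq h_r M_h(1) by metis+
  show "sat M e A"
  proof (cases "\<exists>s t. A = (s \<approx> t)")
    case True
    then show ?thesis using pos basic_mem[OF A] by blast
  next
    case False
    then show ?thesis using A suc less by (auto simp: basic_axioms_def)
  qed
next
  fix A and e :: "nat \<Rightarrow> nat"
  let ?f = "\<lambda>i. r (e i)"
  let ?C = "trans (lift B) (subst (up ?f) A)"
  have mem: "sat M (case_nat (h s) e) A \<longleftrightarrow> inst s ?C \<in> \<Gamma>" for s
  proof -
    have "case_nat (h s) e = (\<lambda>i. h (case_nat s ?f i))" by (auto simp: fun_eq_iff split: nat.split)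
    then show ?thesis by (simp add: sat_trans inst_trans inst_subst_up)
  qed
  have up: "(\<lambda>i. eval M (case_nat x e) ((V(0 := Succ (V 0))) i)) = case_nat (m_suc M x) e" for x
    by (auto simp: fun_eq_iff split: nat.split)
  have "sat M (case_nat x e) A" if "sat M (case_nat (m_zero M) e) A"
    "\<forall>x. sat M (case_nat x e) A \<longrightarrow> sat M (case_nat (m_suc M x) e) A" for x
  proof -
    have "inst (r x) ?C \<in> \<Gamma>"
    proof (rule induct_mem)
      show "inst Zero ?C \<in> \<Gamma>" using that(1) mem[of Zero] by simp
      show "inst (Succ s) ?C \<in> \<Gamma>" if "inst s ?C \<in> \<Gamma>" for s
        using that \<open>\<forall>x. _\<close> mem M_h(2) by metis
    qed
    then show ?thesis using mem[of "r x"] by simp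
  qed
  then show "sat M e (induction_axiom A)"
    unfolding induction_axiom_def sat.simps sat_inst sat_subst up eval.simps by blast
qed

text \<open>Truth is compared with membership of the formula itself instead of its translation. Only
  for such formulas does a fact about the model say something about derivability in HA.\<close>

definition faithful :: "fm \<Rightarrow> bool" where
  "faithful C \<longleftrightarrow> (\<forall>f. sat M (\<lambda>i. h (f i)) C \<longleftrightarrow> subst f C \<in> \<Gamma>)"

lemma faithful_intros:
  "faithful (s \<approx> t)" "faithful (s \<prec> t)" "faithful Fls"
  "faithful C \<Longrightarrow> faithful D \<Longrightarrow> faithful (C \<^bold>\<and> D)"
  "faithful C \<Longrightarrow> faithful D \<Longrightarrow> faithful (C \<^bold>\<or> D)"
  by (auto simp: faithful_def eval_M h_eq)

lemma faithful_Ex: "faithful C \<Longrightarrow> faithful (Ex C)"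
proof -
  have "case_nat (h s) (\<lambda>i. h (f i)) = (\<lambda>i. h (case_nat s f i))" for s f
    by (auto simp: fun_eq_iff split: nat.split)
  then show "faithful C \<Longrightarrow> faithful (Ex C)"
    by (simp add: faithful_def ex_h[of "\<lambda>x. sat M (case_nat x _) _"] inst_subst_up Ex_mem)
qed

end

lemma term_model_exists:
  assumes "\<not> (HA \<turnstile> A \<^bold>\<rightarrow> B)"
  obtains \<Gamma> h where "term_model B \<Gamma> h" "A \<in> \<Gamma>"
proof -
  obtain \<Gamma> where \<Gamma>: "saturated B \<Gamma>" "A \<in> \<Gamma>" using saturated_exists assms by blast
  obtain h :: "tm \<Rightarrow> nat" where "surj h" "\<And>s t. h s = h t \<longleftrightarrow> (s \<approx> t) \<in> \<Gamma>"
    using saturated.term_map[OF \<Gamma>(1)] by blast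
  then show thesis using that[of \<Gamma> h] \<Gamma> by (simp add: term_model_def term_model_axioms_def)
qed

text \<open>An unprovable implication yields \<Gamma> with \<open>A\<close> as a member and
  \<open>B\<close> not. Faithfulness of both turns the term model, with every variable denoting
  itself, into a countermodel.\<close>

lemma conservative_faithful:
  assumes "\<And>\<Gamma> h. term_model B \<Gamma> h \<Longrightarrow> term_model.faithful \<Gamma> h A \<and> term_model.faithful \<Gamma> h B"
    and "\<And>(M :: nat struct) e. pa M \<Longrightarrow> sat M e A \<Longrightarrow> sat M e B"
  shows "HA \<turnstile> A \<^bold>\<rightarrow> B"
proof (rule ccontr)
  assume "\<not> ?thesis"
  then obtain \<Gamma> h where *: "term_model B \<Gamma> h" "A \<in> \<Gamma>" using term_model_exists by blast
  interpret term_model B \<Gamma> h by (fact *)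
  show False
    using assms(1)[OF *(1)] assms(2)[OF M_pa, of "\<lambda>i. h (V i)"] *(2) not_mem
    by (auto simp: faithful_def)
qed

text \<open>A first class for which faithfulness needs no decidability. It gives the order facts in
  HA from which the decidability of bounded formulas is then obtained.\<close>

inductive positive :: "fm \<Rightarrow> bool" where
  "positive (s \<approx> t)"
| "positive (s \<prec> t)"
| "positive Fls"
| "positive A \<Longrightarrow> positive B \<Longrightarrow> positive (A \<^bold>\<and> B)"
| "positive A \<Longrightarrow> positive B \<Longrightarrow> positive (A \<^bold>\<or> B)"
| "positive A \<Longrightarrow> positive (Ex A)"

lemma conservative_positive:
  assumes "positive A" "positive B" "\<And>(M :: nat struct) e. pa M \<Longrightarrow> sat M e A \<Longrightarrow> sat M e B"
  shows "HA \<turnstile> A \<^bold>\<rightarrow> B"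
proof (rule conservative_faithful)
  fix \<Gamma> h assume "term_model B \<Gamma> h"
  then interpret term_model B \<Gamma> h .
  have "positive C \<Longrightarrow> faithful C" for C
    by (induction rule: positive.induct) (auto intro: faithful_intros faithful_Ex)
  then show "faithful A \<and> faithful B" using assms by blast
qed (fact assms)

section \<open>Definable relations\<close>

text \<open>Definability with parameters: \<open>g\<close> tells for each free variable of the defining formula whether
  it is an argument or a parameter.\<close>

abbreviation env :: "(nat \<Rightarrow> nat + 'm) \<Rightarrow> (nat \<Rightarrow> 'm) \<Rightarrow> nat \<Rightarrow> 'm" where
  "env g e i \<equiv> case_sum e id (g i)"

definition dfn :: "'m struct \<Rightarrow> ((nat \<Rightarrow> 'm) \<Rightarrow> bool) \<Rightarrow> bool" where
  "dfn M P \<longleftrightarrow> (\<exists>A g. \<forall>e. P e = sat M (env g e) A)"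

definition dft :: "'m struct \<Rightarrow> ((nat \<Rightarrow> 'm) \<Rightarrow> 'm) \<Rightarrow> bool" where
  "dft M t \<longleftrightarrow> (\<exists>s g. \<forall>e. t e = eval M (env g e) s)"

text \<open>Two defining formulas bring their own argument and parameter lists; moving one to the
  even and the other to the odd variables keeps them apart.\<close>

lemma env_merge:
  obtains h where "\<And>e. (\<lambda>i. env h e (2 * i)) = env g e" "\<And>e. (\<lambda>i. env h e (2 * i + 1)) = env g' e"
proof
  let ?h = "\<lambda>i. if even i then g (i div 2) else g' (i div 2)"
  show "(\<lambda>i. env ?h e (2 * i)) = env g e" "(\<lambda>i. env ?h e (2 * i + 1)) = env g' e" for e
    by auto
qed

lemma dft_const: "dft M (\<lambda>e. c)"
  unfolding dft_def by (intro exI[of _ "V 0"] exI[of _ "\<lambda>_. Inr c"]) simp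

lemma dft_var: "dft M (\<lambda>e. e i)"
  unfolding dft_def by (intro exI[of _ "V 0"] exI[of _ "\<lambda>_. Inl i"]) simp

lemma dft_suc: "dft M s \<Longrightarrow> dft M (\<lambda>e. m_suc M (s e))"
  unfolding dft_def by (metis eval.simps(3))

lemma dft_merge:
  assumes "dft M s" "dft M t"
  obtains s' t' h where "\<And>e. s e = eval M (env h e) s'" "\<And>e. t e = eval M (env h e) t'"
proof -
  obtain s' g t' g' where *: "\<And>e. s e = eval M (env g e) s'" "\<And>e. t e = eval M (env g' e) t'"
    using assms unfolding dft_def by blast
  obtain h where h: "\<And>e. (\<lambda>i. env h e (2 * i)) = env g e" "\<And>e. (\<lambda>i. env h e (2 * i + 1)) = env g' e"
    using env_merge[of g g'] by metis
  show thesis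
    by (rule that[of h "tsubst (\<lambda>i. V (2 * i)) s'" "tsubst (\<lambda>i. V (2 * i + 1)) t'"])
      (simp_all only: * eval_tsubst eval.simps h)
qed

lemma dft_add: "dft M s \<Longrightarrow> dft M t \<Longrightarrow> dft M (\<lambda>e. m_add M (s e) (t e))"
  by (erule (1) dft_merge) (unfold dft_def, metis eval.simps(4))

lemma dft_mul: "dft M s \<Longrightarrow> dft M t \<Longrightarrow> dft M (\<lambda>e. m_mul M (s e) (t e))"
  by (erule (1) dft_merge) (unfold dft_def, metis eval.simps(5))

lemma dft_shift: "dft M t \<Longrightarrow> dft M (\<lambda>e. t (\<lambda>i. e (Suc i)))"
proof -
  assume "dft M t"
  then obtain s g where *: "\<And>e. t e = eval M (env g e) s" unfolding dft_def by blast
  have "(env g (\<lambda>i. e (Suc i))) = env (\<lambda>i. map_sum Suc id (g i)) e" for e :: "nat \<Rightarrow> 'a"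
  proof
    fix i show "env g (\<lambda>i. e (Suc i)) i = env (\<lambda>i. map_sum Suc id (g i)) e i" by (cases "g i") auto
  qed
  then show ?thesis unfolding dft_def * by metis
qed

lemma dfn_eq: "dft M s \<Longrightarrow> dft M t \<Longrightarrow> dfn M (\<lambda>e. s e = t e)"
  by (erule (1) dft_merge) (unfold dfn_def, metis sat.simps(1))

lemma dfn_less: "dft M s \<Longrightarrow> dft M t \<Longrightarrow> dfn M (\<lambda>e. m_less M (s e) (t e))"
  by (erule (1) dft_merge) (unfold dfn_def, metis sat.simps(2))

lemma dfn_merge:
  assumes "dfn M P" "dfn M Q"
  obtains A B h where "\<And>e. P e = sat M (env h e) A" "\<And>e. Q e = sat M (env h e) B"
proof -
  obtain A g B g' where *: "\<And>e. P e = sat M (env g e) A" "\<And>e. Q e = sat M (env g' e) B"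
    using assms unfolding dfn_def by blast
  obtain h where h: "\<And>e. (\<lambda>i. env h e (2 * i)) = env g e" "\<And>e. (\<lambda>i. env h e (2 * i + 1)) = env g' e"
    using env_merge[of g g'] by metis
  show thesis
    by (rule that[of h "subst (\<lambda>i. V (2 * i)) A" "subst (\<lambda>i. V (2 * i + 1)) B"])
      (simp_all only: * sat_subst eval.simps h)
qed

lemma dfn_conj: "dfn M P \<Longrightarrow> dfn M Q \<Longrightarrow> dfn M (\<lambda>e. P e \<and> Q e)"
  by (erule (1) dfn_merge) (unfold dfn_def, metis sat.simps(4))

lemma dfn_disj: "dfn M P \<Longrightarrow> dfn M Q \<Longrightarrow> dfn M (\<lambda>e. P e \<or> Q e)"
  by (erule (1) dfn_merge) (unfold dfn_def, metis sat.simps(5))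

lemma dfn_imp: "dfn M P \<Longrightarrow> dfn M Q \<Longrightarrow> dfn M (\<lambda>e. P e \<longrightarrow> Q e)"
  by (erule (1) dfn_merge) (unfold dfn_def, metis sat.simps(6))

lemma dfn_const: "dfn M (\<lambda>e. b)"
  unfolding dfn_def by (cases b) (auto intro: exI[of _ Fls] exI[of _ Tru])

lemma dfn_not: "dfn M P \<Longrightarrow> dfn M (\<lambda>e. \<not> P e)"
  using dfn_imp[of M P "\<lambda>_. False", OF _ dfn_const] by simp

lemma dfn_quantifier:
  assumes "dfn M (\<lambda>e. P (e 0) (\<lambda>i. e (Suc i)))"
  obtains A h where "\<And>x e. P x e = sat M (case_nat x (env h e)) A"
proof -
  obtain A g where *: "\<And>e. P (e 0) (\<lambda>i. e (Suc i)) = sat M (env g e) A"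
    using assms unfolding dfn_def by blast
  \<comment> \<open>All variables denoting argument 0 become the bound variable. The others are
    shifted past it, and \<open>?h\<close> lowers their argument numbers by one.\<close>
  let ?f = "\<lambda>i. if g i = Inl 0 then V 0 else V (Suc i)"
  let ?h = "\<lambda>i. map_sum (\<lambda>j. j - 1) id (g i)"
  have "env g (case_nat x e) i = eval M (case_nat x (env ?h e)) (?f i)" for x e i
    by (cases "g i") (auto split: nat.split)
  then have "env g (case_nat x e) = (\<lambda>i. eval M (case_nat x (env ?h e)) (?f i))" for x e by blast
  then have "P x e = sat M (case_nat x (env ?h e)) (subst ?f A)" for x e
    using *[of "case_nat x e"] by (simp add: sat_subst)
  then show thesis by (rule that)
qed

lemma dfn_ex: "dfn M (\<lambda>e. P (e 0) (\<lambda>i. e (Suc i))) \<Longrightarrow> dfn M (\<lambda>e. \<exists>x. P x e)"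
  by (erule dfn_quantifier) (unfold dfn_def, metis sat.simps(8))

lemma dfn_all: "dfn M (\<lambda>e. P (e 0) (\<lambda>i. e (Suc i))) \<Longrightarrow> dfn M (\<lambda>e. \<forall>x. P x e)"
  by (erule dfn_quantifier) (unfold dfn_def, metis sat.simps(7))

lemmas dfn_intros = dfn_const dfn_conj dfn_disj dfn_imp dfn_not dfn_ex dfn_all dfn_eq dfn_less
  dft_const dft_var dft_suc dft_add dft_mul

lemma dft_eval: "(\<And>i. i \<in> tfv t \<Longrightarrow> dft M (\<lambda>e. g e i)) \<Longrightarrow> dft M (\<lambda>e. eval M (g e) t)"
  by (induction t) (auto intro: dfn_intros)

lemma dfn_sat: "(\<And>i. i \<in> fv A \<Longrightarrow> dft M (\<lambda>e. g e i)) \<Longrightarrow> dfn M (\<lambda>e. sat M (g e) A)"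
proof (induction A arbitrary: g)
  case (All A)
  have "dft M (\<lambda>e. case_nat (e 0) (g (\<lambda>i. e (Suc i))) i)" if "i \<in> fv A" for i
    using that All.prems dft_shift[of M "\<lambda>e. g e (i - 1)"] by (cases i) (auto intro: dft_var)
  then have "dfn M (\<lambda>e. sat M (case_nat (e 0) (g (\<lambda>i. e (Suc i)))) A)" by (rule All.IH)
  then show ?case by (simp add: dfn_all)
next
  case (Ex A)
  have "dft M (\<lambda>e. case_nat (e 0) (g (\<lambda>i. e (Suc i))) i)" if "i \<in> fv A" for i
    using that Ex.prems dft_shift[of M "\<lambda>e. g e (i - 1)"] by (cases i) (auto intro: dft_var)
  then have "dfn M (\<lambda>e. sat M (case_nat (e 0) (g (\<lambda>i. e (Suc i)))) A)" by (rule Ex.IH)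
  then show ?case by (simp add: dfn_ex)
next
  case (Eq s t)
  then show ?case by (auto intro!: dfn_eq dft_eval)
next
  case (Less s t)
  then show ?case by (auto intro!: dfn_less dft_eval)
qed (auto intro!: dfn_conj dfn_disj dfn_imp dfn_const)

section \<open>Arithmetic in a model\<close>

locale pa_model =
  fixes M :: "'m struct"
  assumes pa: "pa M"
begin

abbreviation "zr \<equiv> m_zero M"
abbreviation "sc \<equiv> m_suc M"
abbreviation add (infixl "\<oplus>" 65) where "x \<oplus> y \<equiv> m_add M x y"
abbreviation mul (infixl "\<otimes>" 70) where "x \<otimes> y \<equiv> m_mul M x y"
abbreviation lt (infix "\<sqsubset>" 50) where "x \<sqsubset> y \<equiv> m_less M x y"
abbreviation le (infix "\<sqsubseteq>" 50) where "x \<sqsubseteq> y \<equiv> \<exists>z. x \<oplus> z = y"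

lemma basic: "A \<in> set basic_axioms \<Longrightarrow> sat M e A"
  using HA_generalizations.intros(1) pa sat_HA_generalizations by blast

lemma suc_ne [simp]: "sc x \<noteq> zr" "zr \<noteq> sc x"
  using basic[of "\<^bold>\<not> (Succ (V 0) \<approx> Zero)" "\<lambda>i. x"] by (auto simp: basic_axioms_def)

lemma suc_inj [simp]: "sc x = sc y \<longleftrightarrow> x = y"
  using basic[of "Succ (V 0) \<approx> Succ (V 1) \<^bold>\<rightarrow> V 0 \<approx> V 1" "case_nat x (\<lambda>i. y)"]
  by (auto simp: basic_axioms_def)

lemma add_0 [simp]: "x \<oplus> zr = x"
  using basic[of "Plus (V 0) Zero \<approx> V 0" "\<lambda>i. x"] by (auto simp: basic_axioms_def)

lemma add_suc [simp]: "x \<oplus> sc y = sc (x \<oplus> y)"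
  using basic[of "Plus (V 0) (Succ (V 1)) \<approx> Succ (Plus (V 0) (V 1))" "case_nat x (\<lambda>i. y)"]
  by (auto simp: basic_axioms_def)

lemma mul_0 [simp]: "x \<otimes> zr = zr"
  using basic[of "Times (V 0) Zero \<approx> Zero" "\<lambda>i. x"] by (auto simp: basic_axioms_def)

lemma mul_suc [simp]: "x \<otimes> sc y = x \<otimes> y \<oplus> x"
  using basic[of "Times (V 0) (Succ (V 1)) \<approx> Plus (Times (V 0) (V 1)) (V 0)" "case_nat x (\<lambda>i. y)"]
  by (auto simp: basic_axioms_def)

lemma less_iff: "x \<sqsubset> y \<longleftrightarrow> (\<exists>z. x \<oplus> sc z = y)"
proof -
  have "sat M (case_nat x (\<lambda>i. y)) (V 0 \<prec> V 1 \<^bold>\<leftrightarrow> exv 2 (Plus (V 0) (Succ (V 2)) \<approx> V 1))"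
    by (rule basic) (simp add: basic_axioms_def)
  then show ?thesis by auto
qed

lemma pa_induct [case_names definable zero suc]:
  assumes "dfn M (\<lambda>e. P (e 0))" "P zr" "\<And>x. P x \<Longrightarrow> P (sc x)"
  shows "P x"
proof -
  obtain A g where *: "\<And>e. P (e 0) = sat M (env g e) A" using assms(1) unfolding dfn_def by blast
  \<comment> \<open>The value of \<open>P (e 0)\<close> does not depend on the other arguments, so
    every argument variable may be read as the induction variable; what remains are
    parameters.\<close>
  let ?f = "\<lambda>i. if isl (g i) then V 0 else V (Suc i)"
  let ?e = "\<lambda>i. projr (g i)"
  have "env g (\<lambda>_. x) i = eval M (case_nat x ?e) (?f i)" for x i
    by (cases "g i") (auto split: nat.split)
  then have "env g (\<lambda>_. x) = (\<lambda>i. eval M (case_nat x ?e) (?f i))" for x by blast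
  then have P: "P x = sat M (case_nat x ?e) (subst ?f A)" for x
    using *[of "\<lambda>_. x"] by (simp add: sat_subst)
  have up: "(\<lambda>i. eval M (case_nat x e) ((V(0 := Succ (V 0))) i)) = case_nat (sc x) e" for x e
    by (auto simp: fun_eq_iff split: nat.split)
  have "sat M ?e (induction_axiom (subst ?f A))"
    using pa sat_HA_generalizations HA_generalizations.intros(2) by blast
  then show ?thesis
    unfolding induction_axiom_def sat.simps sat_inst sat_subst[of _ _ "V(0 := Succ (V 0))"] up eval.simps P[symmetric]
    using assms(2,3) by blast
qed

lemma add_assoc: "(x \<oplus> y) \<oplus> z = x \<oplus> (y \<oplus> z)"
  by (induction z rule: pa_induct) (intro dfn_intros, simp_all)

lemma zero_add [simp]: "zr \<oplus> x = x"
  by (induction x rule: pa_induct) (intro dfn_intros, simp_all)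

lemma suc_add [simp]: "sc x \<oplus> y = sc (x \<oplus> y)"
  by (induction y rule: pa_induct) (intro dfn_intros, simp_all)

lemma add_comm: "x \<oplus> y = y \<oplus> x"
  by (induction y rule: pa_induct) (intro dfn_intros, simp_all)

lemma add_left_comm: "x \<oplus> (y \<oplus> z) = y \<oplus> (x \<oplus> z)"
  by (metis add_assoc add_comm)

lemma distrib: "x \<otimes> (y \<oplus> z) = x \<otimes> y \<oplus> x \<otimes> z"
  by (induction z rule: pa_induct) (intro dfn_intros, simp_all add: add_assoc)

lemma zero_mul [simp]: "zr \<otimes> x = zr"
  by (induction x rule: pa_induct) (intro dfn_intros, simp_all)

lemma suc_mul [simp]: "sc x \<otimes> y = x \<otimes> y \<oplus> y"
  by (induction y rule: pa_induct) (intro dfn_intros, simp_all add: add_assoc add_comm[of x])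

lemma mul_comm: "x \<otimes> y = y \<otimes> x"
  by (induction y rule: pa_induct) (intro dfn_intros, simp_all)

lemma distrib_right: "(y \<oplus> z) \<otimes> x = y \<otimes> x \<oplus> z \<otimes> x"
  by (metis mul_comm distrib)

lemma mul_assoc: "(x \<otimes> y) \<otimes> z = x \<otimes> (y \<otimes> z)"
  by (induction z rule: pa_induct) (intro dfn_intros, simp_all add: distrib)

lemma mul_left_comm: "x \<otimes> (y \<otimes> z) = y \<otimes> (x \<otimes> z)"
  by (metis mul_assoc mul_comm)

lemmas alg = add_assoc add_comm add_left_comm distrib distrib_right mul_assoc mul_comm mul_left_comm

lemma add_cancel [simp]: "x \<oplus> z = y \<oplus> z \<longleftrightarrow> x = y" "z \<oplus> x = z \<oplus> y \<longleftrightarrow> x = y"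
proof -
  have "x \<oplus> z = y \<oplus> z \<longrightarrow> x = y" for z
    by (induction z rule: pa_induct) (intro dfn_intros, simp_all)
  then show "x \<oplus> z = y \<oplus> z \<longleftrightarrow> x = y" by blast
  then show "z \<oplus> x = z \<oplus> y \<longleftrightarrow> x = y" by (simp add: add_comm)
qed

lemma suc_cases: obtains "x = zr" | y where "x = sc y"
proof -
  have "x = zr \<or> (\<exists>y. x = sc y)"
    by (induction x rule: pa_induct) (intro dfn_intros, simp_all)
  then show thesis using that by blast
qed

lemma add_eq_zero [simp]: "x \<oplus> y = zr \<longleftrightarrow> x = zr \<and> y = zr"
  by (cases y rule: suc_cases) auto

lemma add_eq_self [simp]: "x \<oplus> y = x \<longleftrightarrow> y = zr" "x = x \<oplus> y \<longleftrightarrow> y = zr"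
  using add_cancel(2)[of x y zr] by (auto simp del: add_cancel)

lemma le_total: "x \<sqsubseteq> y \<or> y \<sqsubseteq> x"
proof (induction y rule: pa_induct)
  case (suc y)
  then show ?case
  proof
    assume "x \<sqsubseteq> y"
    then show ?thesis by (metis add_suc)
  next
    assume "y \<sqsubseteq> x"
    then obtain z where "y \<oplus> z = x" ..
    then show ?thesis by (cases z rule: suc_cases) (metis add_0 add_suc, metis add_suc suc_add)
  qed
qed (intro dfn_intros, auto)

lemma less_le: "x \<sqsubset> y \<longleftrightarrow> x \<sqsubseteq> y \<and> x \<noteq> y"
proof
  show "x \<sqsubset> y" if "x \<sqsubseteq> y \<and> x \<noteq> y"
  proof -
    from that obtain z where "x \<oplus> z = y" "x \<noteq> y" by blast
    then show ?thesis by (cases z rule: suc_cases) (auto simp: less_iff)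
  qed
next
  assume "x \<sqsubset> y"
  then obtain z where "x \<oplus> sc z = y" by (auto simp: less_iff)
  then show "x \<sqsubseteq> y \<and> x \<noteq> y" by (metis add_eq_self(2) suc_ne(1))
qed

lemma le_antisym: "x \<sqsubseteq> y \<Longrightarrow> y \<sqsubseteq> x \<Longrightarrow> x = y"
  by (auto simp: add_assoc)

lemma ord_order_refl: "x \<sqsubseteq> x"
  using add_0 by blast

lemma ord_less_irrefl: "\<not> x \<sqsubset> x"
  by (simp add: less_le)

lemma ord_less_asym: "x \<sqsubset> y \<Longrightarrow> \<not> y \<sqsubset> x"
  unfolding less_le using le_antisym by blast

lemma ord_not_less: "\<not> x \<sqsubset> y \<longleftrightarrow> y \<sqsubseteq> x"
proof
  show "\<not> x \<sqsubset> y \<Longrightarrow> y \<sqsubseteq> x" unfolding less_le using le_total ord_order_refl by metis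
  show "y \<sqsubseteq> x \<Longrightarrow> \<not> x \<sqsubset> y" unfolding less_le using le_antisym by blast
qed

lemma ord_neqE: "x \<noteq> y \<Longrightarrow> (x \<sqsubset> y \<Longrightarrow> R) \<Longrightarrow> (y \<sqsubset> x \<Longrightarrow> R) \<Longrightarrow> R"
  unfolding less_le using le_total by metis

lemma ord_less_le_trans: "x \<sqsubset> y \<Longrightarrow> y \<sqsubseteq> z \<Longrightarrow> x \<sqsubset> z"
  by (auto simp: less_iff add_assoc)

lemma ord_le_less_trans: "x \<sqsubseteq> y \<Longrightarrow> y \<sqsubset> z \<Longrightarrow> x \<sqsubset> z"
  unfolding less_iff by (metis add_assoc add_suc)

lemma ord_less_trans: "x \<sqsubset> y \<Longrightarrow> y \<sqsubset> z \<Longrightarrow> x \<sqsubset> z"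
  using ord_less_le_trans less_le by metis

lemma less_suc: "x \<sqsubset> sc y \<longleftrightarrow> x \<sqsubset> y \<or> x = y"
  unfolding less_iff
proof
  assume "\<exists>z. x \<oplus> sc z = sc y"
  then obtain z where "x \<oplus> z = y" by auto
  then show "(\<exists>z. x \<oplus> sc z = y) \<or> x = y" by (cases z rule: suc_cases) auto
qed (auto intro: exI[of _ "sc _"] exI[of _ zr])

lemma not_less_zero [simp]: "\<not> x \<sqsubset> zr"
  by (simp add: less_iff)

lemma zero_less [simp]: "zr \<sqsubset> x \<longleftrightarrow> x \<noteq> zr"
  by (auto simp: less_le)

lemma less_suc_le: "x \<sqsubset> sc y \<longleftrightarrow> x \<sqsubseteq> y"
  unfolding less_iff by simp

lemma less_add_suc [simp]: "x \<sqsubset> sc (x \<oplus> y)" "y \<sqsubset> sc (x \<oplus> y)" "x \<sqsubset> sc x"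
  unfolding less_suc_le using add_comm add_0 by metis+

lemma pa_less_induct [case_names definable less]:
  assumes "dfn M (\<lambda>e. P (e 0))" "\<And>x. (\<And>y. y \<sqsubset> x \<Longrightarrow> P y) \<Longrightarrow> P x"
  shows "P x"
proof -
  have "\<forall>y. y \<sqsubset> x \<longrightarrow> P y"
  proof (induction x rule: pa_induct)
    case definable
    have "dfn M (\<lambda>e. P (e (0::nat)))" by fact
    then have "dfn M (\<lambda>e. P ((\<lambda>_. e 0) (0::nat)))" by simp
    then show ?case by (intro dfn_intros) simp_all
  next
    case (suc x)
    then show ?case using assms(2) by (auto simp: less_suc)
  qed simp
  then show ?thesis using assms(2) by blast
qed

lemma pa_least:
  assumes "dfn M (\<lambda>e. P (e 0))" "P x"
  obtains y where "P y" "\<And>z. z \<sqsubset> y \<Longrightarrow> \<not> P z"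
proof (rule ccontr)
  assume "\<not> thesis"
  then have "\<not> P x" for x
    using pa_less_induct[of "\<lambda>x. \<not> P x"] dfn_not[OF assms(1)] that by blast
  then show False using assms(2) by blast
qed

lemma mul_eq_zero [simp]: "x \<otimes> y = zr \<longleftrightarrow> x = zr \<or> y = zr"
  by (cases x rule: suc_cases; cases y rule: suc_cases) auto

lemma less_add_mono: "x \<sqsubset> y \<Longrightarrow> x \<oplus> z \<sqsubset> y \<oplus> z"
  unfolding less_iff by (metis add_assoc add_comm)

lemma division: "m \<noteq> zr \<Longrightarrow> \<exists>q r. a = q \<otimes> m \<oplus> r \<and> r \<sqsubset> m"
proof (induction a rule: pa_induct)
  case zero
  then show ?case by (intro exI[of _ zr]) simp
next
  case (suc a)
  then obtain q r where qr: "a = q \<otimes> m \<oplus> r" "r \<sqsubset> m" by blast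
  show ?case
  proof (cases "sc r = m")
    case True
    have "sc a = sc q \<otimes> m \<oplus> zr" unfolding qr(1) using True by auto
    then show ?thesis using suc(2) zero_less by blast
  next
    case False
    have "sc r \<sqsubset> m" using qr(2) False by (metis less_iff less_le suc_add add_suc)
    moreover have "sc a = q \<otimes> m \<oplus> sc r" using qr by simp
    ultimately show ?thesis by blast
  qed
qed (intro dfn_intros)

lemma division_unique:
  assumes "q \<otimes> m \<oplus> r = q' \<otimes> m \<oplus> r'" "r \<sqsubset> m" "r' \<sqsubset> m"
  shows "r = r'"
proof -
  have *: "q \<otimes> m \<oplus> r \<noteq> q' \<otimes> m \<oplus> r'" if lt: "q \<sqsubset> q'" "r \<sqsubset> m" for q q' r r'
  proof -
    obtain w where w: "q \<oplus> sc w = q'" using lt(1) unfolding less_iff by blast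
    obtain z where z: "r \<oplus> sc z = m" using lt(2) unfolding less_iff by blast
    have "(q \<otimes> m \<oplus> r) \<oplus> sc (z \<oplus> w \<otimes> m \<oplus> r') = q \<otimes> m \<oplus> (w \<otimes> m \<oplus> (r \<oplus> sc z)) \<oplus> r'"
      by (simp add: add_assoc add_left_comm)
    also have "\<dots> = q' \<otimes> m \<oplus> r'" unfolding w[symmetric] z by (simp add: distrib_right add_assoc)
    finally have "q' \<otimes> m \<oplus> r' = (q \<otimes> m \<oplus> r) \<oplus> sc (z \<oplus> w \<otimes> m \<oplus> r')" ..
    then show ?thesis using add_eq_self(2) suc_ne(1) by metis
  qed
  have "\<not> q \<sqsubset> q'" "\<not> q' \<sqsubset> q" using *[of q q' r r'] *[of q' q r' r] assms by metis+
  then have "q = q'" using ord_neqE by blast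
  then show ?thesis using assms by simp
qed

subsection \<open>Pairing\<close>

definition mp :: "'m \<Rightarrow> 'm \<Rightarrow> 'm" where
  "mp x y = (x \<oplus> y) \<otimes> (x \<oplus> y) \<oplus> x"

lemma eval_tpair [simp]: "eval M e \<langle>s, t\<rangle> = mp (eval M e s) (eval M e t)"
  by (simp add: tpair_def mp_def)

text \<open>With \<open>s\<close> the sum of the components, the value lies between the square of
  \<open>s\<close> and the next square. It therefore determines \<open>s\<close>, and then
  \<open>x\<close> as the remainder.\<close>

lemma mp_inject [simp]: "mp x y = mp x' y' \<longleftrightarrow> x = x' \<and> y = y'"
proof
  assume eq: "mp x y = mp x' y'"
  have *: "mp x y \<noteq> mp x' y'" if lt: "x \<oplus> y \<sqsubset> x' \<oplus> y'" for x y x' y'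
  proof -
    obtain w where w: "(x \<oplus> y) \<oplus> sc w = x' \<oplus> y'" using lt unfolding less_iff by blast
    let ?s = "x \<oplus> y"
    let ?z = "?s \<otimes> w \<oplus> (y \<oplus> (sc w \<otimes> ?s \<oplus> sc w \<otimes> sc w \<oplus> x'))"
    have "(s \<oplus> v) \<otimes> (s \<oplus> v) \<oplus> x' = s \<otimes> s \<oplus> (s \<otimes> v \<oplus> (v \<otimes> s \<oplus> v \<otimes> v \<oplus> x'))" for s v
      by (simp only: alg)
    then have "mp x' y' = ?s \<otimes> ?s \<oplus> (?s \<otimes> w \<oplus> ?s \<oplus> (sc w \<otimes> ?s \<oplus> sc w \<otimes> sc w \<oplus> x'))"
      unfolding mp_def w[symmetric] by (simp only: mul_suc)
    also have "\<dots> = mp x y \<oplus> ?z" unfolding mp_def by (simp only: add_assoc add_comm add_left_comm)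
    finally have z: "mp x' y' = mp x y \<oplus> ?z" .
    have "?z \<noteq> zr" using suc_ne(1)[of w] by (metis add_eq_zero mul_eq_zero)
    then show ?thesis unfolding z by (simp only: add_eq_self not_False_eq_True)
  qed
  have "\<not> x \<oplus> y \<sqsubset> x' \<oplus> y'" "\<not> x' \<oplus> y' \<sqsubset> x \<oplus> y" using * eq by metis+
  then have "x \<oplus> y = x' \<oplus> y'" using ord_neqE by blast
  moreover from this have "x = x'" using eq by (simp add: mp_def)
  ultimately show "x = x' \<and> y = y'" by simp
qed simp

lemma dft_mp: "dft M s \<Longrightarrow> dft M t \<Longrightarrow> dft M (\<lambda>e. mp (s e) (t e))"
  unfolding mp_def by (intro dfn_intros)

subsection \<open>Standard elements\<close>

primrec on :: "nat \<Rightarrow> 'm" where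
  "on 0 = zr"
| "on (Suc n) = sc (on n)"

lemma eval_num [simp]: "eval M e (num n) = on n"
  by (induction n) auto

lemma on_add: "on (m + n) = on m \<oplus> on n"
  by (induction n) auto

lemma on_mul: "on (m * n) = on m \<otimes> on n"
  by (induction n) (auto simp: on_add add_comm)

lemma on_inject [simp]: "on m = on n \<longleftrightarrow> m = n"
proof (induction m arbitrary: n)
  case 0
  then show ?case by (cases n) auto
next
  case (Suc m)
  then show ?case by (cases n) auto
qed

lemma on_less [simp]: "on m \<sqsubset> on n \<longleftrightarrow> m < n"
proof -
  have "on m \<sqsubset> on n" if "m < n" for m n
    using that by (auto simp: less_iff on_add dest!: less_imp_Suc_add)
  then show ?thesis by (metis linorder_neqE_nat ord_less_asym ord_less_irrefl)
qed

lemma less_on: "x \<sqsubset> on n \<Longrightarrow> \<exists>m<n. x = on m"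
  by (induction n) (auto simp: less_suc less_Suc_eq)

lemma on_pair [simp]: "on (pair x y) = mp (on x) (on y)"
  by (simp add: pair_def mp_def on_add on_mul)

subsection \<open>Goedel's beta function\<close>

definition Mod :: "'m \<Rightarrow> 'm \<Rightarrow> 'm" where
  "Mod b i = sc (sc i \<otimes> b)"

definition Beta :: "'m \<Rightarrow> 'm \<Rightarrow> 'm \<Rightarrow> 'm \<Rightarrow> bool" where
  "Beta a b i v \<longleftrightarrow> v \<sqsubset> Mod b i \<and> (\<exists>q. a = q \<otimes> Mod b i \<oplus> v)"

lemma Beta_unique: "Beta a b i v \<Longrightarrow> Beta a b i w \<Longrightarrow> v = w"
  unfolding Beta_def using division_unique by metis

lemma Beta_total: "\<exists>v. Beta a b i v"
  unfolding Beta_def using division[of "Mod b i" a] by (metis Mod_def suc_ne(1))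

lemma sat_beta [simp]: "sat M e beta \<longleftrightarrow> Beta (e 0) (e 1) (e 2) (e 3)"
proof -
  have "q \<sqsubset> sc a" if "a = q \<otimes> sc c \<oplus> v" for q a c v
    using that unfolding less_suc_le by (metis add_assoc add_comm mul_suc)
  moreover have "sat M e beta \<longleftrightarrow> e 3 \<sqsubset> sc (sc (e 2) \<otimes> e 1) \<and>
      (\<exists>q. q \<sqsubset> sc (e 0) \<and> e 0 = q \<otimes> sc (sc (e 2) \<otimes> e 1) \<oplus> e 3)"
    by (simp add: beta_def Let_def del: mul_suc suc_mul add_suc suc_add)
  ultimately show ?thesis unfolding Beta_def Mod_def by blast
qed

lemma dfn_Beta:
  "dft M a \<Longrightarrow> dft M b \<Longrightarrow> dft M i \<Longrightarrow> dft M v \<Longrightarrow> dfn M (\<lambda>e. Beta (a e) (b e) (i e) (v e))"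
  unfolding Beta_def Mod_def by (intro dfn_intros dft_shift)

text \<open>The moduli \<open>1 + (k + 1) b\<close> and \<open>1 + (j + 1) b\<close> with \<open>j = k + d\<close> and \<open>b = d q\<close> are coprime:
  \<open>w = (1 + K b) q J\<^sup>2\<close> satisfies \<open>w + 1 = (1 + J b) (q J K + 1)\<close>, so \<open>w\<^sup>2\<close> is \<open>1\<close> modulo \<open>1 + J b\<close>.\<close>

lemma Mod_inverse:
  assumes b: "b = d \<otimes> q" "b \<noteq> zr" and j: "j = k \<oplus> d"
  shows "\<exists>x y. Mod b k \<otimes> x = sc zr \<oplus> Mod b j \<otimes> y"
proof -
  have identity: "sc (sc (K \<otimes> (d \<otimes> q)) \<otimes> (q \<otimes> J \<otimes> J)) = sc (J \<otimes> (d \<otimes> q)) \<otimes> sc (q \<otimes> J \<otimes> K)"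
    if "J = K \<oplus> d" for J K
    unfolding that by (simp add: alg)
  let ?J = "sc j" let ?K = "sc k"
  let ?u = "q \<otimes> ?J \<otimes> ?J" let ?s = "sc (q \<otimes> ?J \<otimes> ?K)"
  let ?w = "Mod b k \<otimes> ?u"
  have w: "sc ?w = Mod b j \<otimes> ?s"
    using identity[of ?J ?K] j by (simp only: Mod_def b(1) suc_add)
  have "?w \<noteq> zr" using b by (auto simp: Mod_def simp del: mul_suc suc_mul)
  then obtain v where v: "?w = sc v" by (metis suc_cases)
  have "?w \<otimes> ?w \<oplus> sc ?w = sc (?w \<otimes> sc ?w)" by (simp only: mul_suc add_suc)
  also have "\<dots> = sc (v \<otimes> sc ?w) \<oplus> sc ?w" by (subst v) (simp only: suc_mul suc_add)
  finally have "?w \<otimes> ?w = sc (v \<otimes> sc ?w)" by (simp only: add_cancel)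
  then have "Mod b k \<otimes> (?u \<otimes> ?w) = sc zr \<oplus> Mod b j \<otimes> (?s \<otimes> v)"
    unfolding w by (simp only: suc_add zero_add mul_assoc mul_comm[of v])
  then show ?thesis by blast
qed

text \<open>Stands in for the factorial, whose definition would already require coded
  sequences.\<close>

lemma common_multiple: "\<exists>c. c \<noteq> zr \<and> (\<forall>d. d \<noteq> zr \<longrightarrow> d \<sqsubseteq> n \<longrightarrow> (\<exists>q. c = d \<otimes> q))"
proof (induction n rule: pa_induct)
  case zero
  then show ?case by (intro exI[of _ "sc zr"]) auto
next
  case (suc n)
  then obtain c where c: "c \<noteq> zr" "\<And>d. d \<noteq> zr \<Longrightarrow> d \<sqsubseteq> n \<Longrightarrow> \<exists>q. c = d \<otimes> q" by blast
  have "\<exists>q. c \<otimes> sc n = d \<otimes> q" if "d \<noteq> zr" "d \<sqsubseteq> sc n" for d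
  proof (cases "d = sc n")
    case True
    then show ?thesis using mul_comm by blast
  next
    case False
    then have "d \<sqsubseteq> n" using that by (metis less_le less_suc_le)
    then show ?thesis using c(2) that mul_assoc by metis
  qed
  then show ?case using c(1) by (intro exI[of _ "c \<otimes> sc n"]) (auto simp del: mul_suc)
qed (intro dfn_intros)

text \<open>Chinese remaindering without a product function: along with the code \<open>a\<close>
  the induction carries some common multiple \<open>c\<close> of the moduli treated so far that is
  invertible modulo each remaining one.\<close>

lemma beta_comprehension:
  assumes dfn: "dfn M (\<lambda>e. F (e 0) (e 1))" and F: "\<And>i. i \<sqsubset> n \<Longrightarrow> \<exists>!v. F i v"
  shows "\<exists>a b. \<forall>i v. i \<sqsubset> n \<longrightarrow> Beta a b i v = F i v"
proof -
  have dfn': "dfn M (\<lambda>e. F (s e) (t e))" if "dft M s" "dft M t" for s t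
  proof -
    obtain A g where A: "\<And>e. F (e 0) (e 1) = sat M (env g e) A" using dfn unfolding dfn_def by blast
    have "F (s e) (t e) = sat M (env g (\<lambda>i. if i = 0 then s e else t e)) A" for e
      using A[of "\<lambda>i. if i = 0 then s e else t e"] by simp
    moreover have "dft M (\<lambda>e. env g (\<lambda>i. if i = 0 then s e else t e) i)" for i
    proof (cases "g i")
      case (Inl a)
      then show ?thesis using that by (cases "a = 0") auto
    qed (auto intro: dft_const)
    ultimately show ?thesis using dfn_sat[of A M "\<lambda>e. env g (\<lambda>i. if i = 0 then s e else t e)"] by simp
  qed
  have "\<exists>K. \<forall>i v. i \<sqsubset> k \<longrightarrow> F i v \<longrightarrow> v \<sqsubseteq> K" if "k \<sqsubseteq> n" for k
    using that
  proof (induction k rule: pa_induct)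
    case definable
    then show ?case by (intro dfn_intros dfn')
  next
    case (suc k)
    then have "k \<sqsubset> n" by (metis less_iff add_suc suc_add)
    then have "k \<sqsubseteq> n" by (metis less_le)
    then obtain K where K: "\<And>i v. i \<sqsubset> k \<Longrightarrow> F i v \<Longrightarrow> v \<sqsubseteq> K" using suc.IH by blast
    obtain w where w: "\<And>v. F k v \<Longrightarrow> v = w" using F[OF \<open>k \<sqsubset> n\<close>] by blast
    have "v \<sqsubseteq> K \<oplus> w" if "i \<sqsubset> sc k" "F i v" for i v
    proof (cases "i \<sqsubset> k")
      case True
      then show ?thesis using K that(2) add_assoc by metis
    next
      case False
      then show ?thesis using w that add_comm by (metis less_suc)
    qed
    then show ?case by blast
  qed simp
  then obtain K where K: "\<And>i v. i \<sqsubset> n \<Longrightarrow> F i v \<Longrightarrow> v \<sqsubseteq> K" by (metis add_0)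
  obtain c0 where c0: "c0 \<noteq> zr" "\<And>d. d \<noteq> zr \<Longrightarrow> d \<sqsubseteq> n \<Longrightarrow> \<exists>q. c0 = d \<otimes> q"
    using common_multiple by metis
  \<comment> \<open>The factor \<open>c0\<close> makes all differences of positions divide
    \<open>b\<close>, hence the moduli coprime. The factor \<open>sc K\<close> lifts
    \<open>b\<close>, and so every modulus, above all values.\<close>
  define b where "b = c0 \<otimes> sc K"
  have b0: "b \<noteq> zr" using c0(1) by (simp add: b_def del: mul_suc)
  have bd: "\<exists>q. b = d \<otimes> q" if "d \<noteq> zr" "d \<sqsubseteq> n" for d
    using c0(2)[OF that] by (auto simp: b_def mul_assoc simp del: mul_suc)
  have Kb: "K \<sqsubset> b"
  proof -
    obtain c1 where "c0 = sc c1" using c0(1) by (metis suc_cases)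
    then have "b = K \<oplus> sc (c1 \<oplus> c1 \<otimes> K)" by (simp add: b_def alg)
    then show ?thesis using less_iff by blast
  qed
  have bM: "b \<sqsubset> Mod b i" for i
    unfolding Mod_def by (simp add: less_suc_le add_comm[of "i \<otimes> b"])
  have KM: "v \<sqsubset> Mod b i" if "v \<sqsubseteq> K" for i v
    using ord_less_trans[OF ord_le_less_trans[OF that Kb] bM] .
  have "\<exists>a c. (\<forall>i v. i \<sqsubset> k \<longrightarrow> F i v \<longrightarrow> Beta a b i v) \<and> (\<forall>i. i \<sqsubset> k \<longrightarrow> (\<exists>w. c = Mod b i \<otimes> w)) \<and>
      (\<forall>j. k \<sqsubseteq> j \<longrightarrow> j \<sqsubset> n \<longrightarrow> (\<exists>x y. c \<otimes> x = sc zr \<oplus> Mod b j \<otimes> y))" if "k \<sqsubseteq> n" for k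
    using that
  proof (induction k rule: pa_induct)
    case definable
    show ?case unfolding Mod_def by (intro dfn_intros dfn' dfn_Beta)
  next
    case zero
    have "\<exists>x y. sc zr \<otimes> x = sc zr \<oplus> Mod b j \<otimes> y" for j
      by (intro exI[of _ "sc zr"] exI[of _ zr]) simp
    then have "(\<forall>i v. i \<sqsubset> zr \<longrightarrow> F i v \<longrightarrow> Beta zr b i v) \<and> (\<forall>i. i \<sqsubset> zr \<longrightarrow> (\<exists>w. sc zr = Mod b i \<otimes> w)) \<and>
      (\<forall>j. zr \<sqsubseteq> j \<longrightarrow> j \<sqsubset> n \<longrightarrow> (\<exists>x y. sc zr \<otimes> x = sc zr \<oplus> Mod b j \<otimes> y))"
      using not_less_zero by blast
    then show ?case by blast
  next
    case (suc k)
    then have kn: "k \<sqsubset> n" by (metis less_iff add_suc suc_add)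
    then have "k \<sqsubseteq> n" by (metis less_le)
    then obtain a c where a: "\<And>i v. i \<sqsubset> k \<Longrightarrow> F i v \<Longrightarrow> Beta a b i v"
      and c: "\<And>i. i \<sqsubset> k \<Longrightarrow> \<exists>w. c = Mod b i \<otimes> w"
      and inv: "\<And>j. k \<sqsubseteq> j \<Longrightarrow> j \<sqsubset> n \<Longrightarrow> \<exists>x y. c \<otimes> x = sc zr \<oplus> Mod b j \<otimes> y"
      using suc.IH by blast
    obtain v where v: "F k v" "\<And>w. F k w \<Longrightarrow> w = v" using F[OF kn] by blast
    have "k \<sqsubseteq> k" by simp
    then obtain y z where yz: "c \<otimes> y = sc zr \<oplus> Mod b k \<otimes> z" using inv kn by blast
    let ?p = "sc k \<otimes> b"
    \<comment> \<open>Modulo \<open>Mod b k\<close>, which is \<open>sc ?p\<close>, the product of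
      \<open>c\<close> and \<open>y\<close> is 1. Adding \<open>c\<close> times \<open>t\<close>
      therefore adds \<open>v\<close> plus \<open>a\<close> times \<open>?p\<close>, and
      \<open>a\<close> plus \<open>a\<close> times \<open>?p\<close> vanishes, leaving
      \<open>v\<close>.\<close>
    define t where "t = y \<otimes> (v \<oplus> a \<otimes> ?p)"
    define a' where "a' = a \<oplus> c \<otimes> t"
    have "c \<otimes> t = (c \<otimes> y) \<otimes> (v \<oplus> a \<otimes> ?p)" by (simp only: t_def mul_assoc)
    then have "a' = (a \<oplus> z \<otimes> (v \<oplus> a \<otimes> ?p)) \<otimes> Mod b k \<oplus> v"
      unfolding a'_def yz by (simp add: Mod_def alg)
    then have new: "Beta a' b k v"
      using KM K kn v(1) unfolding Beta_def by blast
    have old: "Beta a' b i w" if lt: "i \<sqsubset> k" "F i w" for i w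
    proof -
      obtain u where u: "c = Mod b i \<otimes> u" using c lt by blast
      obtain q where q: "a = q \<otimes> Mod b i \<oplus> w" "w \<sqsubset> Mod b i" using a lt unfolding Beta_def by blast
      have "a' = (q \<oplus> u \<otimes> t) \<otimes> Mod b i \<oplus> w" unfolding a'_def u q(1) by (simp add: alg)
      then show ?thesis using q(2) unfolding Beta_def by blast
    qed
    have "Beta a' b i w" if "i \<sqsubset> sc k" "F i w" for i w
      using that(1) unfolding less_suc using old new v(2) that(2) by blast
    moreover have "\<exists>w. c \<otimes> Mod b k = Mod b i \<otimes> w" if "i \<sqsubset> sc k" for i
    proof (cases "i = k")
      case False
      then have "i \<sqsubset> k" using that unfolding less_suc by blast
      then obtain w where w: "c = Mod b i \<otimes> w" using c by blast
      have "c \<otimes> Mod b k = Mod b i \<otimes> (w \<otimes> Mod b k)" unfolding w by (rule mul_assoc)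
      then show ?thesis by blast
    qed (use mul_comm in blast)
    moreover have "\<exists>x y. (c \<otimes> Mod b k) \<otimes> x = sc zr \<oplus> Mod b j \<otimes> y" if j: "sc k \<sqsubseteq> j" "j \<sqsubset> n" for j
    proof -
      obtain d0 where "sc k \<oplus> d0 = j" using j(1) by blast
      then have d0: "j = k \<oplus> sc d0" by simp
      obtain z' where "j \<oplus> sc z' = n" using j(2) unfolding less_iff by blast
      then have "sc d0 \<oplus> (k \<oplus> sc z') = n" unfolding d0 by (simp only: add_assoc add_left_comm)
      then obtain q where "b = sc d0 \<otimes> q" using bd[OF suc_ne(1)] by blast
      then obtain A C where AC: "Mod b k \<otimes> A = sc zr \<oplus> Mod b j \<otimes> C"
        using Mod_inverse[OF _ b0 d0] by blast
      obtain x y where xy: "c \<otimes> x = sc zr \<oplus> Mod b j \<otimes> y" using inv[of j] j(2) d0 by blast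
      have "(c \<otimes> Mod b k) \<otimes> (x \<otimes> A) = (c \<otimes> x) \<otimes> (Mod b k \<otimes> A)"
        by (simp only: mul_assoc mul_left_comm)
      also have "\<dots> = sc zr \<oplus> Mod b j \<otimes> (y \<oplus> C \<oplus> y \<otimes> Mod b j \<otimes> C)" unfolding AC xy by (simp add: alg)
      finally show ?thesis by blast
    qed
    ultimately show ?case by blast
  qed
  then obtain a where "\<And>i v. i \<sqsubset> n \<Longrightarrow> F i v \<Longrightarrow> Beta a b i v" by (metis add_0)
  then show ?thesis using F Beta_unique by metis
qed

end

section \<open>Conservativity for implications between \<open>\<Sigma>\<^sub>1\<close> formulas\<close>

lemma inst_V0_lift: "inst (V 0) (subst (up (\<lambda>i. V (Suc i))) A) = A"
proof -
  have "case_nat (V 0) (\<lambda>i. V (Suc i)) = V" by (auto simp: fun_eq_iff split: nat.split)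
  then show ?thesis by (simp add: inst_subst_up)
qed

text \<open>Read off from models by \<open>conservative_positive\<close>. The antecedent
  \<open>Zero \<approx> Zero\<close> only gives trichotomy the form of an implication, and
  \<open>t \<approx> s\<close> is oriented for \<open>ax_eq_subst\<close>.\<close>

lemma HA_less_Succ: "HA \<turnstile> s \<prec> Succ t \<^bold>\<rightarrow> (s \<prec> t \<^bold>\<or> t \<approx> s)"
  and HA_not_less_Zero: "HA \<turnstile> s \<prec> Zero \<^bold>\<rightarrow> Fls"
  and HA_trichotomy: "HA \<turnstile> Zero \<approx> Zero \<^bold>\<rightarrow> (s \<approx> t \<^bold>\<or> (s \<prec> t \<^bold>\<or> t \<prec> s))"
  and HA_less_irrefl: "HA \<turnstile> (s \<approx> t \<^bold>\<and> (s \<prec> t \<^bold>\<or> t \<prec> s)) \<^bold>\<rightarrow> Fls"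
  and HA_less_asym: "HA \<turnstile> (s \<prec> t \<^bold>\<and> t \<prec> s) \<^bold>\<rightarrow> Fls"
proof -
  have "sat M e (s \<prec> Succ t) \<Longrightarrow> sat M e (s \<prec> t \<^bold>\<or> t \<approx> s)" "\<not> sat M e (s \<prec> Zero)"
    "sat M e (s \<approx> t \<^bold>\<or> (s \<prec> t \<^bold>\<or> t \<prec> s))" "\<not> sat M e (s \<approx> t \<^bold>\<and> (s \<prec> t \<^bold>\<or> t \<prec> s))"
    "\<not> sat M e (s \<prec> t \<^bold>\<and> t \<prec> s)" if "pa M" for M :: "nat struct" and e
  proof -
    interpret pa_model M by standard (fact that)
    show "sat M e (s \<prec> Succ t) \<Longrightarrow> sat M e (s \<prec> t \<^bold>\<or> t \<approx> s)" "\<not> sat M e (s \<prec> Zero)"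
      by (auto simp: less_suc)
    show "sat M e (s \<approx> t \<^bold>\<or> (s \<prec> t \<^bold>\<or> t \<prec> s))" "\<not> sat M e (s \<approx> t \<^bold>\<and> (s \<prec> t \<^bold>\<or> t \<prec> s))"
      "\<not> sat M e (s \<prec> t \<^bold>\<and> t \<prec> s)"
      using ord_neqE ord_less_irrefl ord_less_asym by auto
  qed
  then show "HA \<turnstile> s \<prec> Succ t \<^bold>\<rightarrow> (s \<prec> t \<^bold>\<or> t \<approx> s)" "HA \<turnstile> s \<prec> Zero \<^bold>\<rightarrow> Fls"
    "HA \<turnstile> Zero \<approx> Zero \<^bold>\<rightarrow> (s \<approx> t \<^bold>\<or> (s \<prec> t \<^bold>\<or> t \<prec> s))"
    "HA \<turnstile> (s \<approx> t \<^bold>\<and> (s \<prec> t \<^bold>\<or> t \<prec> s)) \<^bold>\<rightarrow> Fls" "HA \<turnstile> (s \<prec> t \<^bold>\<and> t \<prec> s) \<^bold>\<rightarrow> Fls"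
    by (intro conservative_positive positive.intros; blast)+
qed

text \<open>\<open>C\<close> is arbitrary, so no conservativity is available yet and the implication
  is derived syntactically.\<close>

lemma HA_ball_Succ:
  "HA \<turnstile> (All (V 0 \<prec> tlift s \<^bold>\<rightarrow> C) \<^bold>\<and> inst s C) \<^bold>\<rightarrow> All (V 0 \<prec> Succ (tlift s) \<^bold>\<rightarrow> C)"
proof -
  let ?X = "All (V 0 \<prec> tlift s \<^bold>\<rightarrow> C) \<^bold>\<and> inst s C"
  let ?\<Delta> = "{V 0 \<prec> Succ (tlift s), lift ?X}"
  have X: "derives \<Delta> (lift (All (V 0 \<prec> tlift s \<^bold>\<rightarrow> C)) \<^bold>\<and> lift (inst s C))" if "?\<Delta> \<subseteq> \<Delta>" for \<Delta>
    using that by (intro derives_hyp) auto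
  have "derives ?\<Delta> (V 0 \<prec> tlift s \<^bold>\<or> tlift s \<approx> V 0)"
    using derives_mp[OF derives_thm[OF HA_less_Succ] derives_hyp] by blast
  moreover have "derives (insert (V 0 \<prec> tlift s) ?\<Delta>) C"
  proof -
    have "derives (insert (V 0 \<prec> tlift s) ?\<Delta>) (lift (All (V 0 \<prec> tlift s \<^bold>\<rightarrow> C)))"
      by (rule derives_conjunct1[OF X]) auto
    then have "derives (insert (V 0 \<prec> tlift s) ?\<Delta>)
        (inst (V 0) (subst (up (\<lambda>i. V (Suc i))) (V 0 \<prec> tlift s \<^bold>\<rightarrow> C)))"
      unfolding lift_def by (metis derives_inst subst.simps(7))
    then have "derives (insert (V 0 \<prec> tlift s) ?\<Delta>) (V 0 \<prec> tlift s \<^bold>\<rightarrow> C)"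
      by (simp only: inst_V0_lift)
    then show ?thesis by (rule derives_mp) (simp add: derives_hyp)
  qed
  moreover have "derives (insert (tlift s \<approx> V 0) ?\<Delta>) C"
  proof -
    let ?C = "subst (up (\<lambda>i. V (Suc i))) C"
    let ?\<Delta>' = "insert (tlift s \<approx> V 0) ?\<Delta>"
    have "inst (tlift s) ?C = lift (inst s C)" by (simp add: lift_def subst_inst tlift_def)
    then have "derives ?\<Delta>' (inst (tlift s) ?C)" using derives_conjunct2[OF X] by auto
    moreover have "derives ?\<Delta>' (tlift s \<approx> V 0 \<^bold>\<rightarrow> inst (tlift s) ?C \<^bold>\<rightarrow> inst (V 0) ?C)"
      by (simp add: derives_ax ax_eq_subst)
    moreover have "derives ?\<Delta>' (tlift s \<approx> V 0)" by (simp add: derives_hyp)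
    ultimately show ?thesis using derives_mp by (metis inst_V0_lift)
  qed
  ultimately have "derives ?\<Delta> C" by (rule derives_orE)
  then have "derives {?X} (All (V 0 \<prec> Succ (tlift s) \<^bold>\<rightarrow> C))"
    by (intro derives_allI derives_impI) auto
  then show ?thesis using derives_empty derives_impI by blast
qed

lemma HA_ball_Zero: "HA \<turnstile> All (V 0 \<prec> Zero \<^bold>\<rightarrow> C)"
proof -
  have "derives {V 0 \<prec> Zero} Fls"
    using derives_mp[OF derives_thm[OF HA_not_less_Zero]] derives_hyp by blast
  then show ?thesis using derives_FlsE derives_impI derives_empty provable_gen by blast
qed

section \<open>Bounded formulas are decided in the term model\<close>

context term_model
begin

interpretation pa_model M by standard (rule M_pa)

lemma less_mem: "(s \<prec> t) \<in> \<Gamma> \<longleftrightarrow> m_less M (h s) (h t)"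
  by simp

lemma neg_mem: "HA \<turnstile> (C \<^bold>\<and> D) \<^bold>\<rightarrow> Fls \<Longrightarrow> D \<in> \<Gamma> \<Longrightarrow> (\<^bold>\<not> C) \<in> \<Gamma>"
  by (meson derives_andI derives_hyp derives_impI derives_mem derives_mp derives_thm insertCI)

text \<open>In general the membership of all instances does not give a universal formula. For a
  bounded one it does: induction inside \<Gamma> on \<open>s\<close> proves that \<open>s\<close>
  exceeds \<open>t\<close> or that the quantifier bounded by \<open>s\<close> holds, the first
  disjunct excusing the stages beyond \<open>t\<close>; then \<open>s\<close> is taken to be
  \<open>t\<close>.\<close>

lemma ball_mem:
  assumes C: "\<And>s. (s \<prec> t) \<in> \<Gamma> \<Longrightarrow> inst s C \<in> \<Gamma>"
  shows "All (V 0 \<prec> tlift t \<^bold>\<rightarrow> C) \<in> \<Gamma>"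
proof -
  let ?G = "tlift t \<prec> V 0 \<^bold>\<or> All (V 0 \<prec> V 1 \<^bold>\<rightarrow> subst (up (\<lambda>i. V (Suc i))) C)"
  have G: "inst s ?G = (t \<prec> s \<^bold>\<or> All (V 0 \<prec> tlift s \<^bold>\<rightarrow> C))" for s
    by (simp add: inst_def inst_V_tlift subst_subst up_comp)
  have "inst t ?G \<in> \<Gamma>"
  proof (rule induct_mem)
    show "inst Zero ?G \<in> \<Gamma>" unfolding G using thm_mem[OF HA_ball_Zero[of C]] by simp
    fix s assume IH: "inst s ?G \<in> \<Gamma>"
    show "inst (Succ s) ?G \<in> \<Gamma>"
    proof (cases "(t \<prec> Succ s) \<in> \<Gamma>")
      case False
      then have nl: "\<not> m_less M (h t) (h s)" "h s \<noteq> h t"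
        unfolding less_mem M_h(2)[symmetric] less_suc by auto
      then have "(s \<prec> t) \<in> \<Gamma>" using ord_neqE less_mem by blast
      moreover have "All (V 0 \<prec> tlift s \<^bold>\<rightarrow> C) \<in> \<Gamma>" using IH nl(1) unfolding G by simp
      ultimately have "All (V 0 \<prec> Succ (tlift s) \<^bold>\<rightarrow> C) \<in> \<Gamma>"
        using C by (intro thm_mp[OF HA_ball_Succ]) simp
      then show ?thesis unfolding G by simp
    qed (simp only: G Or_mem simp_thms)
  qed
  then show ?thesis unfolding G using less_mem[of t t] ord_less_irrefl by simp
qed

text \<open>Needed for antecedents: if \<open>C\<close> is false, its negation to \<open>Fls\<close>
  must be a member to make every implication from \<open>C\<close> a member; maximality alone
  refutes \<open>C\<close> only relative to \<open>B\<close>.\<close>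

definition decided :: "fm \<Rightarrow> bool" where
  "decided C \<longleftrightarrow> (\<forall>f. subst f C \<in> \<Gamma> \<or> (\<^bold>\<not> subst f C) \<in> \<Gamma>)"

lemma trichotomy_mem: "(s \<approx> t) \<in> \<Gamma> \<or> (s \<prec> t) \<in> \<Gamma> \<or> (t \<prec> s) \<in> \<Gamma>"
  using thm_mp[OF HA_trichotomy eq_refl_mem[of Zero], of s t] by simp

lemma decided_atoms: "decided (s \<approx> t)" "decided (s \<prec> t)"
proof -
  have "(\<^bold>\<not> s \<approx> t) \<in> \<Gamma>" if "(s \<approx> t) \<notin> \<Gamma>" for s t
    by (rule neg_mem[OF HA_less_irrefl]) (use trichotomy_mem[of s t] that in simp)
  then show "decided (s \<approx> t)" unfolding decided_def by auto
  have "(\<^bold>\<not> s \<prec> t) \<in> \<Gamma>" if nl: "(s \<prec> t) \<notin> \<Gamma>" for s t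
  proof (cases "(t \<prec> s) \<in> \<Gamma>")
    case True
    then show ?thesis by (rule neg_mem[OF HA_less_asym])
  next
    case False
    then have "(s \<approx> t) \<in> \<Gamma>" using trichotomy_mem nl by blast
    then have "(\<^bold>\<not> (s \<prec> t \<^bold>\<or> t \<prec> s)) \<in> \<Gamma>"
      by (meson HA_less_irrefl derives_andI derives_hyp derives_impI derives_mem derives_mp derives_thm insertCI)
    then show ?thesis
      by (meson ax_orI1 derives_ax derives_hyp derives_impI derives_mem derives_mp insertCI derives_mono subset_insertI)
  qed
  then show "decided (s \<prec> t)" unfolding decided_def by auto
qed

lemma mem_imp: "D \<in> \<Gamma> \<Longrightarrow> (C \<^bold>\<rightarrow> D) \<in> \<Gamma>"
  by (meson ax_K ax_mem mp_mem)

lemma neg_mem_imp: "(\<^bold>\<not> C) \<in> \<Gamma> \<Longrightarrow> (C \<^bold>\<rightarrow> D) \<in> \<Gamma>"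
  by (meson derives_FlsE derives_hyp derives_impI derives_mem derives_mp insertCI)

lemma faithful_Imp: "faithful C \<Longrightarrow> faithful D \<Longrightarrow> decided C \<Longrightarrow> faithful (C \<^bold>\<rightarrow> D)"
  unfolding faithful_def decided_def using mem_imp neg_mem_imp mp_mem by (metis sat.simps(6) subst.simps(6))

lemma decided_Imp:
  assumes "decided C" "decided D"
  shows "decided (C \<^bold>\<rightarrow> D)"
  unfolding decided_def
proof
  fix f
  have "(\<^bold>\<not> (subst f C \<^bold>\<rightarrow> subst f D)) \<in> \<Gamma>" if "subst f C \<in> \<Gamma>" "(\<^bold>\<not> subst f D) \<in> \<Gamma>"
    by (meson that derives_hyp derives_impI derives_mem derives_mp insertCI)
  then show "subst f (C \<^bold>\<rightarrow> D) \<in> \<Gamma> \<or> (\<^bold>\<not> subst f (C \<^bold>\<rightarrow> D)) \<in> \<Gamma>"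
    using assms mem_imp neg_mem_imp unfolding decided_def by (metis subst.simps(6))
qed

lemma decided_And_Or:
  assumes "decided C" "decided D"
  shows "decided (C \<^bold>\<and> D)" "decided (C \<^bold>\<or> D)"
proof -
  have "(\<^bold>\<not> (A \<^bold>\<and> A')) \<in> \<Gamma>" if "(\<^bold>\<not> A) \<in> \<Gamma> \<or> (\<^bold>\<not> A') \<in> \<Gamma>" for A A'
    using that by (meson derives_conjunct1 derives_conjunct2 derives_hyp derives_impI derives_mem derives_mp insertCI)
  then show "decided (C \<^bold>\<and> D)"
    using assms unfolding decided_def by (metis And_mem subst.simps(4))
  have "(\<^bold>\<not> (A \<^bold>\<or> A')) \<in> \<Gamma>" if "(\<^bold>\<not> A) \<in> \<Gamma>" "(\<^bold>\<not> A') \<in> \<Gamma>" for A A'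
    using that by (meson ax_orE ax_mem mp_mem)
  then show "decided (C \<^bold>\<or> D)"
    using assms unfolding decided_def by (metis Or_mem subst.simps(5))
qed

lemma faithful_ball:
  assumes "faithful C"
  shows "faithful (All (V 0 \<prec> tlift t \<^bold>\<rightarrow> C))"
  unfolding faithful_def
proof
  fix f
  have case_f: "case_nat (h s) (\<lambda>i. h (f i)) = (\<lambda>i. h (case_nat s f i))" for s
    by (auto simp: fun_eq_iff split: nat.split)
  have "sat M (\<lambda>i. h (f i)) (All (V 0 \<prec> tlift t \<^bold>\<rightarrow> C)) \<longleftrightarrow>
      (\<forall>s. (s \<prec> tsubst f t) \<in> \<Gamma> \<longrightarrow> inst s (subst (up f) C) \<in> \<Gamma>)"
    unfolding sat.simps all_h eval_tlift eval_M case_f inst_subst_up using assms unfolding faithful_def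
    by (simp add: eval_M)
  also have "\<dots> \<longleftrightarrow> All (V 0 \<prec> tlift (tsubst f t) \<^bold>\<rightarrow> subst (up f) C) \<in> \<Gamma>"
  proof
    assume "All (V 0 \<prec> tlift (tsubst f t) \<^bold>\<rightarrow> subst (up f) C) \<in> \<Gamma>"
    then have "(s \<prec> tsubst f t \<^bold>\<rightarrow> inst s (subst (up f) C)) \<in> \<Gamma>" for s
      using All_inst_mem[of _ s] by (fastforce simp: inst_def inst_V_tlift)
    then show "\<forall>s. (s \<prec> tsubst f t) \<in> \<Gamma> \<longrightarrow> inst s (subst (up f) C) \<in> \<Gamma>" using mp_mem by blast
  qed (use ball_mem in blast)
  finally show "sat M (\<lambda>i. h (f i)) (All (V 0 \<prec> tlift t \<^bold>\<rightarrow> C)) \<longleftrightarrow>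
      subst f (All (V 0 \<prec> tlift t \<^bold>\<rightarrow> C)) \<in> \<Gamma>" by simp
qed

lemma decided_ball:
  assumes "decided C"
  shows "decided (All (V 0 \<prec> tlift t \<^bold>\<rightarrow> C))"
  unfolding decided_def
proof
  fix f
  let ?t = "tsubst f t" let ?C = "subst (up f) C"
  let ?A = "All (V 0 \<prec> tlift ?t \<^bold>\<rightarrow> ?C)"
  have "(\<^bold>\<not> ?A) \<in> \<Gamma>" if "?A \<notin> \<Gamma>"
  proof -
    obtain s where s: "(s \<prec> ?t) \<in> \<Gamma>" "inst s ?C \<notin> \<Gamma>" using ball_mem \<open>?A \<notin> \<Gamma>\<close> by blast
    then have "(\<^bold>\<not> inst s ?C) \<in> \<Gamma>" using assms unfolding decided_def inst_subst_up by blast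
    moreover have "derives (insert ?A \<Gamma>) (s \<prec> ?t \<^bold>\<rightarrow> inst s ?C)"
      using derives_inst[of "insert ?A \<Gamma>" "V 0 \<prec> tlift ?t \<^bold>\<rightarrow> ?C" s]
      by (simp add: derives_hyp inst_def inst_V_tlift)
    ultimately show ?thesis
      using s(1) by (meson derives_hyp derives_impI derives_mem derives_mp insertCI)
  qed
  then show "subst f (All (V 0 \<prec> tlift t \<^bold>\<rightarrow> C)) \<in> \<Gamma> \<or> (\<^bold>\<not> subst f (All (V 0 \<prec> tlift t \<^bold>\<rightarrow> C))) \<in> \<Gamma>"
    by auto
qed

lemma decided_bex:
  assumes "decided C"
  shows "decided (Ex (V 0 \<prec> tlift t \<^bold>\<and> C))"
  unfolding decided_def
proof
  fix f
  let ?t = "tsubst f t" let ?C = "subst (up f) C"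
  let ?A = "Ex (V 0 \<prec> tlift ?t \<^bold>\<and> ?C)"
  have "(\<^bold>\<not> ?A) \<in> \<Gamma>" if "?A \<notin> \<Gamma>"
  proof -
    have "inst s (V 0 \<prec> tlift ?t \<^bold>\<and> ?C) \<notin> \<Gamma>" for s using that Ex_mem by blast
    then have "inst s ?C \<notin> \<Gamma>" if "(s \<prec> ?t) \<in> \<Gamma>" for s
      using that by (simp add: inst_def inst_V_tlift)
    then have "inst s (\<^bold>\<not> ?C) \<in> \<Gamma>" if "(s \<prec> ?t) \<in> \<Gamma>" for s
      using that assms unfolding decided_def by (simp add: inst_subst_up) blast
    then have "All (V 0 \<prec> tlift ?t \<^bold>\<rightarrow> \<^bold>\<not> ?C) \<in> \<Gamma>" by (rule ball_mem)
    moreover have "HA \<turnstile> (V 0 \<prec> tlift ?t \<^bold>\<rightarrow> \<^bold>\<not> ?C) \<^bold>\<rightarrow> (V 0 \<prec> tlift ?t \<^bold>\<and> ?C) \<^bold>\<rightarrow> lift Fls"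
    proof (rule derives_empty, intro derives_impI)
      let ?P = "V 0 \<prec> tlift ?t"
      let ?\<Delta> = "{?P \<^bold>\<and> ?C, ?P \<^bold>\<rightarrow> \<^bold>\<not> ?C}"
      have "derives ?\<Delta> (?P \<^bold>\<and> ?C)" "derives ?\<Delta> (?P \<^bold>\<rightarrow> \<^bold>\<not> ?C)" by (simp_all add: derives_hyp)
      then show "derives ?\<Delta> (lift Fls)"
        by (metis derives_conjunct1 derives_conjunct2 derives_mp lift_simps(4))
    qed
    ultimately have "All ((V 0 \<prec> tlift ?t \<^bold>\<and> ?C) \<^bold>\<rightarrow> lift Fls) \<in> \<Gamma>" using All_mono thm_mp by blast
    then show ?thesis by (meson ax_exE ax_mem mp_mem)
  qed
  then show "subst f (Ex (V 0 \<prec> tlift t \<^bold>\<and> C)) \<in> \<Gamma> \<or> (\<^bold>\<not> subst f (Ex (V 0 \<prec> tlift t \<^bold>\<and> C))) \<in> \<Gamma>"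
    by auto
qed

lemma faithful_delta0: "delta0 C \<Longrightarrow> faithful C \<and> decided C"
proof (induction rule: delta0.induct)
  case 3
  then show ?case
    using mem_imp derives_mem derives_refl by (auto intro: faithful_intros simp: decided_def)
qed (auto intro: faithful_intros decided_atoms decided_And_Or faithful_Imp decided_Imp
    faithful_ball decided_ball faithful_Ex decided_bex)

lemma faithful_sigma1: "sigma1 C \<Longrightarrow> faithful C"
  by (induction rule: sigma1.induct)
    (auto intro: faithful_intros faithful_ball faithful_Ex simp: faithful_delta0)

end

theorem conservative:
  assumes "sigma1 A" "sigma1 B" "\<And>(M :: nat struct) e. pa M \<Longrightarrow> sat M e A \<Longrightarrow> sat M e B"
  shows "HA \<turnstile> A \<^bold>\<rightarrow> B"
  using assms by (intro conservative_faithful) (auto intro: term_model.faithful_sigma1)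

lemma HA_imp_iff: "(HA \<turnstile> A \<^bold>\<rightarrow> B) \<longleftrightarrow> derives {A} B"
  using derives_empty derives_impI derives_mp derives_thm derives_hyp by (metis singletonI)

section \<open>Closure properties of \<open>\<Sigma>\<^sub>1\<close> formulas\<close>

lemma delta0_subst: "delta0 A \<Longrightarrow> delta0 (subst f A)"
  by (induction arbitrary: f rule: delta0.induct) (auto intro: delta0.intros)

lemma sigma1_subst: "sigma1 A \<Longrightarrow> sigma1 (subst f A)"
  by (induction arbitrary: f rule: sigma1.induct) (auto intro: sigma1.intros delta0_subst)

lemma sigma1_atoms: "sigma1 (s \<approx> t)" "sigma1 (s \<prec> t)" "sigma1 Fls" "sigma1 Tru"
  by (auto intro: sigma1.intros delta0.intros)

lemma sigma1_exv: "sigma1 A \<Longrightarrow> sigma1 (exv n A)"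
  unfolding exv_def by (intro sigma1.intros(5) sigma1_subst)

lemma sigma1_app: "sigma1 A \<Longrightarrow> sigma1 (app A ts)"
  unfolding app_def by (rule sigma1_subst)

lemma sigma1_allb: "n \<notin> tfv t \<Longrightarrow> sigma1 A \<Longrightarrow> sigma1 (allb n t A)"
proof -
  let ?f = "\<lambda>i. if i = n then V 0 else V (Suc i)"
  assume "n \<notin> tfv t"
  then have "tsubst ?f t = tlift t" unfolding tlift_def by (intro tsubst_cong) auto
  moreover assume "sigma1 A"
  ultimately show ?thesis unfolding allv_def by (auto intro: sigma1.intros sigma1_subst)
qed

lemma delta0_allb: "n \<notin> tfv t \<Longrightarrow> delta0 A \<Longrightarrow> delta0 (allb n t A)"
  and delta0_exb: "n \<notin> tfv t \<Longrightarrow> delta0 A \<Longrightarrow> delta0 (exb n t A)"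
proof -
  let ?f = "\<lambda>i. if i = n then V 0 else V (Suc i)"
  assume "n \<notin> tfv t"
  then have t: "tsubst ?f t = tlift t" unfolding tlift_def by (intro tsubst_cong) auto
  assume "delta0 A"
  then show "delta0 (allb n t A)" "delta0 (exb n t A)"
    unfolding allv_def exv_def using t by (auto intro: delta0.intros delta0_subst)
qed

lemmas sigma1_intros = sigma1_atoms sigma1.intros(2,3) sigma1_exv sigma1_app

section \<open>Inductive definitions in a model\<close>

declare num.simps [simp del]

lemma dfn_comp:
  assumes "dfn M P" "\<And>i. dft M (\<lambda>e. g e i)"
  shows "dfn M (\<lambda>e. P (g e))"
proof -
  obtain A h where A: "\<And>e. P e = sat M (env h e) A" using assms(1) unfolding dfn_def by blast
  have "dft M (\<lambda>e. env h (g e) i)" for i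
    using assms(2) by (cases "h i") (auto intro: dft_const)
  then show ?thesis unfolding A by (rule dfn_sat)
qed

lemma dfn_comp1: "dfn M (\<lambda>e. P (e 0)) \<Longrightarrow> dft M t \<Longrightarrow> dfn M (\<lambda>e. P (t e))"
  using dfn_comp[of M "\<lambda>e. P (e 0)" "\<lambda>e i. t e"] by simp

definition mono_rule :: "(('m \<Rightarrow> bool) \<Rightarrow> 'm \<Rightarrow> bool) \<Rightarrow> bool" where
  "mono_rule R \<longleftrightarrow> (\<forall>E E' x. (\<forall>y. E y \<longrightarrow> E' y) \<longrightarrow> R E x \<longrightarrow> R E' x)"

lemma mono_ruleD: "mono_rule R \<Longrightarrow> R E x \<Longrightarrow> (\<And>y. E y \<Longrightarrow> E' y) \<Longrightarrow> R E' x"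
  unfolding mono_rule_def by blast

context pa_model
begin

declare on.simps [simp del]

definition Occ :: "'m \<Rightarrow> 'm \<Rightarrow> 'm \<Rightarrow> 'm \<Rightarrow> bool" where
  "Occ a b n x \<longleftrightarrow> (\<exists>i. i \<sqsubset> n \<and> Beta a b i x)"

lemma sat_occurs [simp]: "sat M e occurs \<longleftrightarrow> Occ (e 0) (e 1) (e 2) (e 3)"
  by (simp add: occurs_def Occ_def sat_app)

lemma sat_earlier [simp]: "sat M e (earlier t) \<longleftrightarrow> Occ (e 1) (e 2) (e 3) (eval M e t)"
  by (simp add: sat_app)

lemma Occ_mono: "Occ a b m x \<Longrightarrow> m \<sqsubseteq> n \<Longrightarrow> Occ a b n x"
  unfolding Occ_def using ord_less_le_trans by blast

lemmas sat_earlier_Suc [simp] = sat_earlier[unfolded One_nat_def]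

definition gen :: "(('m \<Rightarrow> bool) \<Rightarrow> 'm \<Rightarrow> bool) \<Rightarrow> 'm \<Rightarrow> bool" where
  "gen R x \<longleftrightarrow> (\<exists>a b n. Occ a b n x \<and> (\<forall>i. i \<sqsubset> n \<longrightarrow> (\<exists>v. Beta a b i v \<and> R (Occ a b i) v)))"

text \<open>The environment in the premise is the one inside \<open>generated\<close>:
  \<open>app\<close> resets the variables 0 to 3, while 4 and 5 still hold the position and the
  entry bound there.\<close>

lemma sat_generated:
  assumes "\<And>v a b i. sat M (e(0 := v, 1 := a, 2 := b, 3 := i, 4 := i, 5 := v)) A \<longleftrightarrow> R (Occ a b i) v"
  shows "sat M e (generated A) \<longleftrightarrow> gen R (e 0)"
proof -
  have "(\<lambda>j. if j < length [V 5, V 1, V 2, V 4] then eval M (e(1 := a, 2 := b, 3 := n, 4 := i, 5 := v)) ([V 5, V 1, V 2, V 4] ! j)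
      else (e(1 := a, 2 := b, 3 := n, 4 := i, 5 := v)) j) = e(0 := v, 1 := a, 2 := b, 3 := i, 4 := i, 5 := v)" for a b n i v
    by (auto simp: fun_eq_iff less_Suc_eq numeral_eq_Suc)
  then have "sat M (e(1 := a, 2 := b, 3 := n, 4 := i, 5 := v)) (app A [V 5, V 1, V 2, V 4]) = R (Occ a b i) v" for a b n i v
    using assms by (simp only: sat_app)
  then show ?thesis by (simp add: generated_def gen_def sat_app)
qed

lemma gen_unfold:
  assumes "gen R x" "mono_rule R"
  shows "R (gen R) x"
proof -
  obtain a b n i where *: "i \<sqsubset> n" "Beta a b i x" "\<And>i. i \<sqsubset> n \<Longrightarrow> \<exists>v. Beta a b i v \<and> R (Occ a b i) v"
    using assms(1) unfolding gen_def Occ_def by blast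
  then have "R (Occ a b i) x" using Beta_unique by blast
  moreover have "gen R y" if "Occ a b i y" for y
    using that * ord_less_trans unfolding gen_def by blast
  ultimately show ?thesis using mono_ruleD[OF assms(2)] by blast
qed

text \<open>Induction along the positions of the coded sequence. The induction principle itself is
  the premise \<open>ind\<close>, because it is supplied by definability in an arbitrary model and
  by full induction in the standard one.\<close>

lemma gen_induct_aux:
  assumes "gen R x" "mono_rule R" "\<And>x. R P x \<Longrightarrow> P x"
    and ind: "\<And>a b n i. (\<And>i. (\<And>j. j \<sqsubset> i \<Longrightarrow> j \<sqsubset> n \<longrightarrow> (\<forall>v. Beta a b j v \<longrightarrow> P v)) \<Longrightarrow> i \<sqsubset> n \<longrightarrow> (\<forall>v. Beta a b i v \<longrightarrow> P v))
      \<Longrightarrow> i \<sqsubset> n \<longrightarrow> (\<forall>v. Beta a b i v \<longrightarrow> P v)"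
  shows "P x"
proof -
  obtain a b n i where *: "i \<sqsubset> n" "Beta a b i x" "\<And>i. i \<sqsubset> n \<Longrightarrow> \<exists>v. Beta a b i v \<and> R (Occ a b i) v"
    using assms(1) unfolding gen_def Occ_def by blast
  have "i \<sqsubset> n \<longrightarrow> (\<forall>v. Beta a b i v \<longrightarrow> P v)" for i
  proof (rule ind, intro allI impI)
    fix i v
    assume IH: "\<And>j. j \<sqsubset> i \<Longrightarrow> j \<sqsubset> n \<longrightarrow> (\<forall>v. Beta a b j v \<longrightarrow> P v)" and i: "i \<sqsubset> n" "Beta a b i v"
    then have "R (Occ a b i) v" using *(3) Beta_unique by blast
    moreover have "P y" if "Occ a b i y" for y
      using that IH i(1) ord_less_trans unfolding Occ_def by blast
    ultimately show "P v" using mono_ruleD[OF assms(2)] assms(3) by blast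
  qed
  then show ?thesis using * by blast
qed

lemma gen_induct:
  assumes "gen R x" "mono_rule R" "\<And>x. R P x \<Longrightarrow> P x" "dfn M (\<lambda>e. P (e 0))"
  shows "P x"
  using assms(1-3)
proof (rule gen_induct_aux)
  fix a b n i
  assume "\<And>i. (\<And>j. j \<sqsubset> i \<Longrightarrow> j \<sqsubset> n \<longrightarrow> (\<forall>v. Beta a b j v \<longrightarrow> P v)) \<Longrightarrow> i \<sqsubset> n \<longrightarrow> (\<forall>v. Beta a b i v \<longrightarrow> P v)"
  moreover have "dfn M (\<lambda>e. e 0 \<sqsubset> n \<longrightarrow> (\<forall>v. Beta a b (e 0) v \<longrightarrow> P v))"
    by (intro dfn_intros dfn_Beta dfn_comp1[OF assms(4)])
  ultimately show "i \<sqsubset> n \<longrightarrow> (\<forall>v. Beta a b i v \<longrightarrow> P v)"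
    using pa_less_induct[of "\<lambda>i. i \<sqsubset> n \<longrightarrow> (\<forall>v. Beta a b i v \<longrightarrow> P v)"] by blast
qed

lemma gen_I0:
  assumes "R (\<lambda>_. False) x" "mono_rule R"
  shows "gen R x"
proof -
  have "dfn M (\<lambda>e. e 1 = x)" by (intro dfn_intros)
  then obtain a b where "\<forall>i v. i \<sqsubset> sc zr \<longrightarrow> Beta a b i v = (v = x)"
    using beta_comprehension[of "\<lambda>i v. v = x" "sc zr"] by blast
  moreover have "zr \<sqsubset> sc zr" by simp
  ultimately have "Occ a b (sc zr) x" "\<forall>i. i \<sqsubset> sc zr \<longrightarrow> Beta a b i x"
    unfolding Occ_def by blast+
  moreover have "R (Occ a b i) x" for i
    using mono_ruleD[OF assms(2,1)] by blast
  ultimately show ?thesis unfolding gen_def by blast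
qed

text \<open>The two derivation sequences are concatenated and \<open>x\<close> is appended.
  Monotonicity of the rules keeps every earlier step valid, since each entry retains its
  predecessors.\<close>

lemma gen_I2:
  assumes "gen R y" "gen R z" "R (\<lambda>t. t = y \<or> t = z) x" and mono: "mono_rule R"
  shows "gen R x"
proof -
  obtain a b n where 1: "Occ a b n y" "\<And>i. i \<sqsubset> n \<Longrightarrow> \<exists>v. Beta a b i v \<and> R (Occ a b i) v"
    using assms(1) unfolding gen_def by blast
  obtain a' b' n' where 2: "Occ a' b' n' z" "\<And>i. i \<sqsubset> n' \<Longrightarrow> \<exists>v. Beta a' b' i v \<and> R (Occ a' b' i) v"
    using assms(2) unfolding gen_def by blast
  \<comment> \<open>Positions below \<open>n\<close> copy the first sequence, the next
    \<open>n'\<close> the second one, and the last position holds \<open>x\<close>.\<close>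
  let ?F = "\<lambda>i v. (i \<sqsubset> n \<and> Beta a b i v) \<or> (\<exists>j. i = n \<oplus> j \<and> j \<sqsubset> n' \<and> Beta a' b' j v) \<or> (i = n \<oplus> n' \<and> v = x)"
  have nl: "\<not> n \<oplus> j \<sqsubset> n" for j
    using ord_not_less by blast
  have cases: "i \<sqsubset> n \<or> (\<exists>j. i = n \<oplus> j \<and> j \<sqsubset> n') \<or> i = n \<oplus> n'" if i: "i \<sqsubset> sc (n \<oplus> n')" for i
  proof (cases "i \<sqsubset> n")
    case False
    then obtain j where j: "n \<oplus> j = i" using ord_not_less by blast
    obtain z where "n \<oplus> j \<oplus> z = n \<oplus> n'" using i unfolding less_suc_le j by blast
    then have "j \<oplus> z = n'" by (simp add: add_assoc)
    then have "j \<sqsubset> n' \<or> j = n'" unfolding less_le by blast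
    then show ?thesis using j by blast
  qed simp
  have "dfn M (\<lambda>e. ?F (e 0) (e 1))" by (intro dfn_intros dfn_Beta)
  moreover have "\<exists>!v. ?F i v" if "i \<sqsubset> sc (n \<oplus> n')" for i
    using cases[OF that]
  proof (elim disjE exE conjE)
    assume i: "i \<sqsubset> n"
    then have "?F i v \<longleftrightarrow> Beta a b i v" for v using nl by auto
    then show ?thesis using Beta_total Beta_unique by metis
  next
    fix j assume i: "i = n \<oplus> j" "j \<sqsubset> n'"
    then have "?F i v \<longleftrightarrow> Beta a' b' j v" for v using nl ord_less_irrefl by auto
    then show ?thesis using Beta_total Beta_unique by metis
  next
    assume i: "i = n \<oplus> n'"
    then have "?F i v \<longleftrightarrow> v = x" for v using nl ord_less_irrefl by auto
    then show ?thesis by metis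
  qed
  ultimately obtain c d where cd: "\<And>i v. i \<sqsubset> sc (n \<oplus> n') \<Longrightarrow> Beta c d i v = ?F i v"
    using beta_comprehension[of ?F "sc (n \<oplus> n')"] by blast
  have lt: "i \<sqsubset> sc (n \<oplus> n')" if "i \<sqsubset> n" for i
    using that ord_less_trans less_add_suc(1) by blast
  have lt': "n \<oplus> j \<sqsubset> n \<oplus> n'" "n \<oplus> j \<sqsubset> sc (n \<oplus> n')" if "j \<sqsubset> n'" for j
    using that less_add_mono[of j n' n] by (simp_all add: add_comm less_suc)
  have old: "Occ c d i t" if occ: "Occ a b i t" and le: "i \<sqsubseteq> n" for i t
  proof -
    obtain j where "j \<sqsubset> i" "Beta a b j t" using occ unfolding Occ_def by blast
    moreover from this have "j \<sqsubset> n" using le ord_less_le_trans by blast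
    ultimately show ?thesis using cd[OF lt] unfolding Occ_def by blast
  qed
  have old': "Occ c d (n \<oplus> i) t" if occ: "Occ a' b' i t" and le: "i \<sqsubseteq> n'" for i t
  proof -
    obtain j where j: "j \<sqsubset> i" "Beta a' b' j t" using occ unfolding Occ_def by blast
    then have "j \<sqsubset> n'" using le ord_less_le_trans by blast
    then have "Beta c d (n \<oplus> j) t" using cd[OF lt'(2)] j(2) by blast
    moreover have "n \<oplus> j \<sqsubset> n \<oplus> i" using less_add_mono[OF j(1), of n] by (simp add: add_comm)
    ultimately show ?thesis unfolding Occ_def by blast
  qed
  have last: "Beta c d (n \<oplus> n') x"
    by (rule iffD2[OF cd[OF less_add_suc(3)]], rule disjI2, rule disjI2) (simp only: simp_thms)
  have "\<exists>v. Beta c d i v \<and> R (Occ c d i) v" if i: "i \<sqsubset> sc (n \<oplus> n')" for i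
    using cases[OF i]
  proof (elim disjE exE conjE)
    assume "i \<sqsubset> n"
    moreover from this obtain v where "Beta a b i v" "R (Occ a b i) v" using 1(2) by blast
    moreover have "i \<sqsubseteq> n" using \<open>i \<sqsubset> n\<close> less_le by blast
    ultimately show ?thesis using cd[OF i] mono_ruleD[OF mono] old by metis
  next
    fix j assume j: "i = n \<oplus> j" "j \<sqsubset> n'"
    then obtain v where v: "Beta a' b' j v" "R (Occ a' b' j) v" using 2(2) by blast
    have "j \<sqsubseteq> n'" using j less_le by blast
    then have "R (Occ c d i) v" using mono_ruleD[OF mono v(2)] old' j(1) by blast
    moreover have "Beta c d i v" using cd[OF i] j v(1) by blast
    ultimately show ?thesis by blast
  next
    assume i': "i = n \<oplus> n'"
    have "n \<sqsubseteq> i" using i' by blast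
    then have "Occ c d i y" by (rule Occ_mono[OF old[OF 1(1) ord_order_refl]])
    moreover have "Occ c d i z" unfolding i' by (rule old'[OF 2(1) ord_order_refl])
    ultimately have *: "t = y \<or> t = z \<longrightarrow> Occ c d i t" for t by blast
    have "R (Occ c d i) x"
      using mono_ruleD[of R "\<lambda>t. t = y \<or> t = z" x "Occ c d i", OF mono assms(3)] * by simp
    moreover have "Beta c d i x"
      by (subst i') (rule last)
    ultimately show ?thesis by blast
  qed
  moreover have "Occ c d (sc (n \<oplus> n')) x"
    unfolding Occ_def using less_add_suc(3) last by blast
  ultimately show ?thesis unfolding gen_def by blast
qed

lemma gen_I1: "gen R y \<Longrightarrow> R (\<lambda>t. t = y) x \<Longrightarrow> mono_rule R \<Longrightarrow> gen R x"
  using gen_I2[of R y y x] by simp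

section \<open>Arithmetized syntax in a model\<close>

abbreviation "kvar i \<equiv> mp (on 0) i"
abbreviation "kzero \<equiv> mp (on (Suc 0)) (on 0)"
abbreviation "ksuc t \<equiv> mp (on 2) t"
abbreviation "kplus s t \<equiv> mp (on 3) (mp s t)"
abbreviation "ktimes s t \<equiv> mp (on 4) (mp s t)"
abbreviation "keq s t \<equiv> mp (on 5) (mp s t)"
abbreviation "kless s t \<equiv> mp (on 6) (mp s t)"
abbreviation "kfls \<equiv> mp (on 7) (on 0)"
abbreviation "kand a b \<equiv> mp (on 8) (mp a b)"
abbreviation "kor a b \<equiv> mp (on 9) (mp a b)"
abbreviation "kimp a b \<equiv> mp (on 10) (mp a b)"
abbreviation "kall a \<equiv> mp (on 11) a"
abbreviation "kex a \<equiv> mp (on 12) a"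
abbreviation "quad d p a b \<equiv> mp d (mp p (mp a b))"

definition rTm :: "('m \<Rightarrow> bool) \<Rightarrow> 'm \<Rightarrow> bool" where
  "rTm E x \<longleftrightarrow> (\<exists>d t i j. x = mp d t \<and>
    ((t = kvar i \<and> i \<sqsubset> d) \<or> t = kzero \<or> (t = ksuc i \<and> E (mp d i)) \<or>
     ((t = kplus i j \<or> t = ktimes i j) \<and> E (mp d i) \<and> E (mp d j))))"

definition Tm :: "'m \<Rightarrow> 'm \<Rightarrow> bool" where
  "Tm d t \<longleftrightarrow> gen rTm (mp d t)"

lemma sat_is_term_below [simp]:
  "sat M e (is_term_below d t) \<longleftrightarrow> Tm (eval M e d) (eval M e t)"
  unfolding is_term_below_def sat_app Tm_def
  by (subst sat_generated[where R = rTm]) (simp_all add: term_rules_def rTm_def)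

definition rFm :: "('m \<Rightarrow> bool) \<Rightarrow> 'm \<Rightarrow> bool" where
  "rFm E x \<longleftrightarrow> (\<exists>d a i j. x = mp d a \<and>
    (((a = keq i j \<or> a = kless i j) \<and> Tm d i \<and> Tm d j) \<or> a = kfls \<or>
     ((a = kand i j \<or> a = kor i j \<or> a = kimp i j) \<and> E (mp d i) \<and> E (mp d j)) \<or>
     ((a = kall i \<or> a = kex i) \<and> E (mp (sc d) i))))"

definition Fm :: "'m \<Rightarrow> 'm \<Rightarrow> bool" where
  "Fm d a \<longleftrightarrow> gen rFm (mp d a)"

lemma sat_is_formula_below [simp]:
  "sat M e (is_formula_below d a) \<longleftrightarrow> Fm (eval M e d) (eval M e a)"
  unfolding is_formula_below_def sat_app Fm_def
  by (subst sat_generated[where R = rFm]) (simp_all add: formula_rules_def rFm_def)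

abbreviation "Term t \<equiv> \<exists>d. Tm d t"
abbreviation "Form a \<equiv> \<exists>d. Fm d a"
abbreviation "Sent a \<equiv> Fm (on 0) a"

lemma sat_is_term [simp]: "sat M e (is_term t) \<longleftrightarrow> Term (eval M e t)"
  by (simp add: is_term_def sat_app)

lemma sat_is_formula [simp]: "sat M e (is_formula a) \<longleftrightarrow> Form (eval M e a)"
  by (simp add: is_formula_def sat_app)

lemma sat_is_sentence [simp]: "sat M e (is_sentence a) \<longleftrightarrow> Sent (eval M e a)"
  by (simp add: is_sentence_def)

definition rTO :: "('m \<Rightarrow> 'm \<Rightarrow> 'm \<Rightarrow> 'm \<Rightarrow> bool) \<Rightarrow> ('m \<Rightarrow> bool) \<Rightarrow> 'm \<Rightarrow> bool" where
  "rTO W E x \<longleftrightarrow> (\<exists>d p a b i j k l. x = quad d p a b \<and>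
    ((a = kvar i \<and> W d p i b) \<or> (a = kzero \<and> b = kzero) \<or>
     (a = ksuc i \<and> b = ksuc j \<and> E (quad d p i j)) \<or>
     (((a = kplus i k \<and> b = kplus j l) \<or> (a = ktimes i k \<and> b = ktimes j l)) \<and>
       E (quad d p i j) \<and> E (quad d p k l))))"

lemma sat_term_operation:
  assumes "\<And>e. sat M e W \<longleftrightarrow> W' (e 0) (e 1) (e 2) (e 3)"
  shows "sat M e (term_operation W) \<longleftrightarrow> gen (rTO W') (e 0)"
  unfolding term_operation_def
  by (rule sat_generated) (simp add: rTO_def sat_app assms)

definition rFO :: "('m \<Rightarrow> bool) \<Rightarrow> ('m \<Rightarrow> 'm \<Rightarrow> bool) \<Rightarrow> ('m \<Rightarrow> bool) \<Rightarrow> 'm \<Rightarrow> bool" where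
  "rFO T U E x \<longleftrightarrow> (\<exists>d p a b i j k l. x = quad d p a b \<and>
    ((((a = keq i k \<and> b = keq j l) \<or> (a = kless i k \<and> b = kless j l)) \<and>
       T (quad d p i j) \<and> T (quad d p k l)) \<or>
     (a = kfls \<and> b = kfls) \<or>
     (((a = kand i k \<and> b = kand j l) \<or> (a = kor i k \<and> b = kor j l) \<or> (a = kimp i k \<and> b = kimp j l)) \<and>
       E (quad d p i j) \<and> E (quad d p k l)) \<or>
     (((a = kall i \<and> b = kall j) \<or> (a = kex i \<and> b = kex j)) \<and> U p k \<and> E (quad (sc d) k i j))))"

lemma sat_formula_operation:
  assumes "\<And>e. sat M e T \<longleftrightarrow> T' (e 0)" "\<And>e. sat M e U \<longleftrightarrow> U' (e 0) (e 1)"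
  shows "sat M e (formula_operation T U) \<longleftrightarrow> gen (rFO T' U') (e 0)"
  unfolding formula_operation_def
  by (rule sat_generated) (simp add: rFO_def sat_app assms)

definition LV :: "'m \<Rightarrow> 'm \<Rightarrow> 'm \<Rightarrow> 'm \<Rightarrow> bool" where
  "LV d p i v \<longleftrightarrow> (i \<sqsubset> d \<and> v = kvar i) \<or> (d \<sqsubset> sc i \<and> v = kvar (sc i))"

definition IV :: "'m \<Rightarrow> 'm \<Rightarrow> 'm \<Rightarrow> 'm \<Rightarrow> bool" where
  "IV d p i v \<longleftrightarrow> (i \<sqsubset> d \<and> v = kvar i) \<or> (i = d \<and> v = p) \<or> (d \<sqsubset> i \<and> (\<exists>j. i = sc j \<and> v = kvar j))"

definition LiftT :: "'m \<Rightarrow> 'm \<Rightarrow> 'm \<Rightarrow> bool" where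
  "LiftT d s t \<longleftrightarrow> gen (rTO LV) (quad d (on 0) s t)"

definition LiftF :: "'m \<Rightarrow> 'm \<Rightarrow> 'm \<Rightarrow> bool" where
  "LiftF d a b \<longleftrightarrow> gen (rFO (gen (rTO LV)) (\<lambda>p p'. p' = p)) (quad d (on 0) a b)"

definition InstT :: "'m \<Rightarrow> 'm \<Rightarrow> 'm \<Rightarrow> 'm \<Rightarrow> bool" where
  "InstT d p s t \<longleftrightarrow> gen (rTO IV) (quad d p s t)"

definition InstF :: "'m \<Rightarrow> 'm \<Rightarrow> 'm \<Rightarrow> 'm \<Rightarrow> bool" where
  "InstF d p a b \<longleftrightarrow> gen (rFO (gen (rTO IV)) (LiftT (on 0))) (quad d p a b)"

lemma sat_lift_var: "sat M e (term_operation lift_var) \<longleftrightarrow> gen (rTO LV) (e 0)"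
  by (rule sat_term_operation) (simp add: lift_var_def LV_def)

lemma sat_inst_var: "sat M e (term_operation inst_var) \<longleftrightarrow> gen (rTO IV) (e 0)"
  by (rule sat_term_operation) (simp add: inst_var_def IV_def)

lemma sat_is_lift_term [simp]:
  "sat M e (is_lift_term d s t) \<longleftrightarrow> LiftT (eval M e d) (eval M e s) (eval M e t)"
  by (simp add: is_lift_term_def sat_app sat_lift_var LiftT_def)

lemma sat_is_lift [simp]:
  "sat M e (is_lift d s t) \<longleftrightarrow> LiftF (eval M e d) (eval M e s) (eval M e t)"
  unfolding is_lift_def sat_app LiftF_def
  by (subst sat_formula_operation[OF sat_lift_var, where U' = "\<lambda>p p'. p' = p"]) simp_all

lemma sat_is_inst [simp]:
  "sat M e (is_inst p a b) \<longleftrightarrow> InstF (on 0) (eval M e p) (eval M e a) (eval M e b)"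
  unfolding is_inst_def sat_app InstF_def
  by (subst sat_formula_operation[OF sat_inst_var, where U' = "LiftT (on 0)"]) simp_all

definition rNum :: "('m \<Rightarrow> bool) \<Rightarrow> 'm \<Rightarrow> bool" where
  "rNum E x \<longleftrightarrow> (\<exists>n c. x = mp (on 0) kzero \<or> (x = mp (sc n) (ksuc c) \<and> E (mp n c)))"

definition IsNum :: "'m \<Rightarrow> 'm \<Rightarrow> bool" where
  "IsNum n c \<longleftrightarrow> gen rNum (mp n c)"

lemma sat_is_numeral [simp]: "sat M e (is_numeral n c) \<longleftrightarrow> IsNum (eval M e n) (eval M e c)"
  unfolding is_numeral_def sat_app IsNum_def
  by (subst sat_generated[where R = rNum]) (simp_all add: rNum_def)

definition LogAx :: "'m \<Rightarrow> bool" where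
  "LogAx x \<longleftrightarrow> (\<exists>a b c. Form a \<and> Form b \<and> Form c \<and>
     (x = kimp a (kimp b a) \<or>
      x = kimp (kimp a (kimp b c)) (kimp (kimp a b) (kimp a c)) \<or>
      x = kimp (kand a b) a \<or>
      x = kimp (kand a b) b \<or>
      x = kimp a (kimp b (kand a b)) \<or>
      x = kimp a (kor a b) \<or>
      x = kimp b (kor a b) \<or>
      x = kimp (kimp a c) (kimp (kimp b c) (kimp (kor a b) c)) \<or>
      x = kimp kfls a)) \<or>
   (\<exists>a b s t b'. Form a \<and> Form b \<and> Term s \<and> Term t \<and>
     ((\<exists>c. InstF (on 0) t a c \<and> (x = kimp (kall a) c \<or> x = kimp c (kex a))) \<or>
      (LiftF (on 0) b b' \<and>
        (x = kimp (kall (kimp b' a)) (kimp b (kall a)) \<or> x = kimp (kall (kimp a b')) (kimp (kex a) b))) \<or>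
      x = keq t t \<or>
      (\<exists>c d. InstF (on 0) s a c \<and> InstF (on 0) t a d \<and> x = kimp (keq s t) (kimp c d))))"

lemma sat_is_logical_axiom [simp]: "sat M e is_logical_axiom \<longleftrightarrow> LogAx (e 0)"
  by (simp add: is_logical_axiom_def LogAx_def Let_def)

definition IndAx :: "'m \<Rightarrow> bool" where
  "IndAx x \<longleftrightarrow> (\<exists>a b c d. Form a \<and> InstF (on 0) kzero a b \<and> LiftF (on (Suc 0)) a c \<and>
     InstF (on 0) (ksuc (kvar (on 0))) c d \<and> x = kimp b (kimp (kall (kimp a d)) (kall a)))"

lemma sat_is_induction_axiom [simp]: "sat M e is_induction_axiom \<longleftrightarrow> IndAx (e 0)"
  by (simp add: is_induction_axiom_def IndAx_def)

definition rHA :: "('m \<Rightarrow> bool) \<Rightarrow> 'm \<Rightarrow> bool" where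
  "rHA E x \<longleftrightarrow> ((\<exists>A\<in>set basic_axioms. x = on (gn A)) \<or> IndAx x) \<or> (\<exists>y. x = kall y \<and> E y)"

definition HAx :: "'m \<Rightarrow> bool" where
  "HAx x \<longleftrightarrow> Sent x \<and> gen rHA x"

lemma sat_is_HA_axiom [simp]: "sat M e is_HA_axiom \<longleftrightarrow> HAx (e 0)"
proof -
  have "sat M e (foldr (\<lambda>A B. V 0 \<approx> num (gn A) \<^bold>\<or> B) As B) \<longleftrightarrow> (\<exists>A\<in>set As. e 0 = on (gn A)) \<or> sat M e B"
    for e As B by (induction As) auto
  then show ?thesis unfolding is_HA_axiom_def HAx_def sat.simps
    by (subst sat_generated[where R = rHA]) (simp_all add: rHA_def)
qed

definition rPr :: "('m \<Rightarrow> bool) \<Rightarrow> ('m \<Rightarrow> bool) \<Rightarrow> 'm \<Rightarrow> bool" where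
  "rPr X E x \<longleftrightarrow> LogAx x \<or> X x \<or> (\<exists>y. E (kimp y x) \<and> E y) \<or> (\<exists>y. x = kall y \<and> E y)"

definition Pr :: "('m \<Rightarrow> bool) \<Rightarrow> 'm \<Rightarrow> bool" where
  "Pr X = gen (rPr X)"

definition Axs :: "fm \<Rightarrow> (nat \<Rightarrow> 'm) \<Rightarrow> 'm \<Rightarrow> bool" where
  "Axs \<alpha> e x \<longleftrightarrow> Sent x \<and> sat M (e(0 := x)) \<alpha>"

lemma sat_box [simp]: "sat M e (box \<alpha>) \<longleftrightarrow> Pr (Axs \<alpha> e) (e 0)"
proof -
  let ?e = "\<lambda>i. e (i - 10)"
  have \<alpha>: "(\<lambda>i. eval M (?e(0 := v, 1 := a, 2 := b, 3 := n, 4 := n, 5 := v)) (if i = 0 then V 0 else V (i + 10))) = e(0 := v)"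
    for v a b n by (auto simp: fun_eq_iff)
  have "sat M ?e (generated
     (is_logical_axiom \<^bold>\<or>
      (is_sentence (V 0) \<^bold>\<and> subst (\<lambda>i. if i = 0 then V 0 else V (i + 10)) \<alpha>) \<^bold>\<or>
      exv 4 (earlier (cImp (V 4) (V 0)) \<^bold>\<and> earlier (V 4)) \<^bold>\<or>
      exv 4 (V 0 \<approx> cAll (V 4) \<^bold>\<and> earlier (V 4)))) = gen (rPr (Axs \<alpha> e)) (?e 0)"
    by (rule sat_generated) (simp only: sat.simps sat_subst \<alpha>, simp add: rPr_def Axs_def)
  then show ?thesis by (simp add: box_def sat_subst Pr_def)
qed

end

section \<open>Formalized provability in a model\<close>

text \<open>Together with \<open>isb\<close>: lifting and instantiation below \<open>d\<close>
  binders, in the form in which the coded operations carry their depth. The term \<open>u\<close> of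
  \<open>isb\<close> is taken to be already lifted to that depth.\<close>

definition lsb :: "nat \<Rightarrow> nat \<Rightarrow> tm" where
  "lsb d i = (if i < d then V i else V (Suc i))"

definition isb :: "nat \<Rightarrow> tm \<Rightarrow> nat \<Rightarrow> tm" where
  "isb d u i = (if i < d then V i else if i = d then u else V (i - 1))"

lemma up_lsb: "up (lsb d) = lsb (Suc d)"
proof
  fix i show "up (lsb d) i = lsb (Suc d) i" by (cases i) (auto simp: lsb_def)
qed

lemma up_isb: "up (isb d u) = isb (Suc d) (tlift u)"
proof
  fix i show "up (isb d u) i = isb (Suc d) (tlift u) i"
    by (cases i) (auto simp: isb_def gr0_conv_Suc)
qed

lemma lsb_0: "lsb 0 = (\<lambda>i. V (Suc i))"
  by (auto simp: lsb_def)

lemma isb_0: "isb 0 u = case_nat u V"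
  by (auto simp: isb_def fun_eq_iff split: nat.split)

lemma tlift_lsb: "tlift u = tsubst (lsb 0) u"
  by (simp add: tlift_def lsb_0)

lemma Succ_subst: "subst (isb 0 (Succ (V 0))) (subst (lsb 1) A) = subst (V(0 := Succ (V 0))) A"
  unfolding subst_subst by (rule subst_cong) (auto simp: isb_def lsb_def)

definition sh :: "nat \<Rightarrow> (nat \<Rightarrow> tm) \<Rightarrow> nat \<Rightarrow> tm" where
  "sh d g i = (if i < d then V i else tsubst (\<lambda>j. V (j + d)) (g (i - d)))"

lemma up_sh: "up (sh d g) = sh (Suc d) g"
proof
  fix i show "up (sh d g) i = sh (Suc d) g i"
    by (cases i) (auto simp: sh_def tlift_def tsubst_tsubst)
qed

lemma sh_0: "sh 0 g = g"
  by (auto simp: sh_def)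

context pa_model
begin

lemma on_0: "on 0 = zr"
  by (simp add: on.simps)

lemma on_Suc: "on (Suc n) = sc (on n)"
  by (simp add: on.simps)

lemma mono_rules: "mono_rule rTm" "mono_rule rFm" "mono_rule (rTO W)" "mono_rule (rFO T U)"
  "mono_rule rNum" "mono_rule rHA" "mono_rule (rPr X)"
  unfolding mono_rule_def rTm_def rFm_def rTO_def rFO_def rNum_def rHA_def rPr_def by blast+

lemma Tm_intros:
  "i \<sqsubset> d \<Longrightarrow> Tm d (kvar i)" "Tm d kzero" "Tm d s \<Longrightarrow> Tm d (ksuc s)"
  "Tm d s \<Longrightarrow> Tm d t \<Longrightarrow> Tm d (kplus s t)" "Tm d s \<Longrightarrow> Tm d t \<Longrightarrow> Tm d (ktimes s t)"
  unfolding Tm_def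
  by ((rule gen_I0 gen_I1 gen_I2, (assumption | rule mono_rules | simp add: rTm_def)+)+)

lemma Fm_intros:
  "Tm d s \<Longrightarrow> Tm d t \<Longrightarrow> Fm d (keq s t)" "Tm d s \<Longrightarrow> Tm d t \<Longrightarrow> Fm d (kless s t)" "Fm d kfls"
  "Fm d a \<Longrightarrow> Fm d b \<Longrightarrow> Fm d (kand a b)" "Fm d a \<Longrightarrow> Fm d b \<Longrightarrow> Fm d (kor a b)"
  "Fm d a \<Longrightarrow> Fm d b \<Longrightarrow> Fm d (kimp a b)" "Fm (sc d) a \<Longrightarrow> Fm d (kall a)" "Fm (sc d) a \<Longrightarrow> Fm d (kex a)"
proof -
  show "Tm d s \<Longrightarrow> Tm d t \<Longrightarrow> Fm d (keq s t)" "Tm d s \<Longrightarrow> Tm d t \<Longrightarrow> Fm d (kless s t)" "Fm d kfls"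
    unfolding Fm_def by (rule gen_I0; simp add: rFm_def mono_rules)+
  show "Fm d a \<Longrightarrow> Fm d b \<Longrightarrow> Fm d (kand a b)" "Fm d a \<Longrightarrow> Fm d b \<Longrightarrow> Fm d (kor a b)"
    "Fm d a \<Longrightarrow> Fm d b \<Longrightarrow> Fm d (kimp a b)"
    unfolding Fm_def by (rule gen_I2, assumption, assumption, simp add: rFm_def, rule mono_rules)+
  show "Fm (sc d) a \<Longrightarrow> Fm d (kall a)" "Fm (sc d) a \<Longrightarrow> Fm d (kex a)"
    unfolding Fm_def by (rule gen_I1, assumption, simp add: rFm_def, rule mono_rules)+
qed

lemma TO_intros:
  "W d p i b \<Longrightarrow> gen (rTO W) (quad d p (kvar i) b)" "gen (rTO W) (quad d p kzero kzero)"
  "gen (rTO W) (quad d p s s') \<Longrightarrow> gen (rTO W) (quad d p (ksuc s) (ksuc s'))"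
  "gen (rTO W) (quad d p s s') \<Longrightarrow> gen (rTO W) (quad d p t t') \<Longrightarrow>
    gen (rTO W) (quad d p (kplus s t) (kplus s' t'))"
  "gen (rTO W) (quad d p s s') \<Longrightarrow> gen (rTO W) (quad d p t t') \<Longrightarrow>
    gen (rTO W) (quad d p (ktimes s t) (ktimes s' t'))"
proof -
  show "W d p i b \<Longrightarrow> gen (rTO W) (quad d p (kvar i) b)" "gen (rTO W) (quad d p kzero kzero)"
    by (rule gen_I0; simp add: rTO_def mono_rules)+
  show "gen (rTO W) (quad d p s s') \<Longrightarrow> gen (rTO W) (quad d p (ksuc s) (ksuc s'))"
    by (rule gen_I1, assumption, simp add: rTO_def, rule mono_rules)
  show "gen (rTO W) (quad d p s s') \<Longrightarrow> gen (rTO W) (quad d p t t') \<Longrightarrow>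
      gen (rTO W) (quad d p (kplus s t) (kplus s' t'))"
    "gen (rTO W) (quad d p s s') \<Longrightarrow> gen (rTO W) (quad d p t t') \<Longrightarrow>
      gen (rTO W) (quad d p (ktimes s t) (ktimes s' t'))"
    by (rule gen_I2, assumption, assumption, simp add: rTO_def, rule mono_rules)+
qed

lemma FO_intros:
  "T (quad d p s s') \<Longrightarrow> T (quad d p t t') \<Longrightarrow> gen (rFO T U) (quad d p (keq s t) (keq s' t'))"
  "T (quad d p s s') \<Longrightarrow> T (quad d p t t') \<Longrightarrow> gen (rFO T U) (quad d p (kless s t) (kless s' t'))"
  "gen (rFO T U) (quad d p kfls kfls)"
  "gen (rFO T U) (quad d p s s') \<Longrightarrow> gen (rFO T U) (quad d p t t') \<Longrightarrow>
    gen (rFO T U) (quad d p (kand s t) (kand s' t'))"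
  "gen (rFO T U) (quad d p s s') \<Longrightarrow> gen (rFO T U) (quad d p t t') \<Longrightarrow>
    gen (rFO T U) (quad d p (kor s t) (kor s' t'))"
  "gen (rFO T U) (quad d p s s') \<Longrightarrow> gen (rFO T U) (quad d p t t') \<Longrightarrow>
    gen (rFO T U) (quad d p (kimp s t) (kimp s' t'))"
  "gen (rFO T U) (quad (sc d) q s s') \<Longrightarrow> U p q \<Longrightarrow> gen (rFO T U) (quad d p (kall s) (kall s'))"
  "gen (rFO T U) (quad (sc d) q s s') \<Longrightarrow> U p q \<Longrightarrow> gen (rFO T U) (quad d p (kex s) (kex s'))"
proof -
  show "T (quad d p s s') \<Longrightarrow> T (quad d p t t') \<Longrightarrow> gen (rFO T U) (quad d p (keq s t) (keq s' t'))"
    "T (quad d p s s') \<Longrightarrow> T (quad d p t t') \<Longrightarrow> gen (rFO T U) (quad d p (kless s t) (kless s' t'))"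
    "gen (rFO T U) (quad d p kfls kfls)"
    by (rule gen_I0; simp add: rFO_def mono_rules)+
  show "gen (rFO T U) (quad d p s s') \<Longrightarrow> gen (rFO T U) (quad d p t t') \<Longrightarrow>
      gen (rFO T U) (quad d p (kand s t) (kand s' t'))"
    "gen (rFO T U) (quad d p s s') \<Longrightarrow> gen (rFO T U) (quad d p t t') \<Longrightarrow>
      gen (rFO T U) (quad d p (kor s t) (kor s' t'))"
    "gen (rFO T U) (quad d p s s') \<Longrightarrow> gen (rFO T U) (quad d p t t') \<Longrightarrow>
      gen (rFO T U) (quad d p (kimp s t) (kimp s' t'))"
    by (rule gen_I2, assumption, assumption, simp add: rFO_def, rule mono_rules)+
  show "gen (rFO T U) (quad (sc d) q s s') \<Longrightarrow> U p q \<Longrightarrow> gen (rFO T U) (quad d p (kall s) (kall s'))"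
    "gen (rFO T U) (quad (sc d) q s s') \<Longrightarrow> U p q \<Longrightarrow> gen (rFO T U) (quad d p (kex s) (kex s'))"
    by (rule gen_I1, assumption, simp add: rFO_def, rule mono_rules)+
qed

lemma Tm_on: "tfv t \<subseteq> {..<d} \<Longrightarrow> Tm (on d) (on (tgn t))"
  by (induction t) (auto intro: Tm_intros)

lemma fv_quantifier: "{i. Suc i \<in> X} \<subseteq> {..<d} \<Longrightarrow> X \<subseteq> {..<Suc d}"
proof
  fix i assume "{i. Suc i \<in> X} \<subseteq> {..<d}" "i \<in> X"
  then show "i \<in> {..<Suc d}" by (cases i) auto
qed

lemma Fm_on: "fv A \<subseteq> {..<d} \<Longrightarrow> Fm (on d) (on (gn A))"
  by (induction A arbitrary: d) (auto intro!: Fm_intros Tm_on simp flip: on_Suc dest!: fv_quantifier)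

lemma bound_exists: "finite X \<Longrightarrow> \<exists>d. X \<subseteq> {..<d::nat}"
  by (meson finite_nat_bounded)

lemma Form_on: "Form (on (gn A))"
  using Fm_on bound_exists[OF finite_fv] by blast

lemma Term_on: "Term (on (tgn t))"
  using Tm_on bound_exists[OF finite_tfv] by blast

lemma LV_on: "LV (on d) p (on i) (on (tgn (lsb d i)))"
  unfolding LV_def lsb_def by (simp flip: on_Suc)

lemma IV_on: "IV (on d) p (on i) (if i < d then kvar (on i) else if i = d then p else kvar (on (i - 1)))"
proof -
  consider "i < d" | "i = d" | j where "i = Suc j" "d \<le> j" by (metis Suc_le_D Suc_le_mono linorder_neqE_nat not_less_eq_eq less_eq_Suc_le)
  then show ?thesis
  proof cases
    case 3
    then have "(if i < d then kvar (on i) else if i = d then p else kvar (on (i - 1))) = kvar (on j)" by simp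
    moreover have "on d \<sqsubset> on i" using 3 by simp
    moreover have "on i = sc (on j)" using 3 on_Suc by simp
    ultimately show ?thesis unfolding IV_def by metis
  qed (simp_all add: IV_def)
qed

lemma LiftT_on: "gen (rTO LV) (quad (on d) p (on (tgn t)) (on (tgn (tsubst (lsb d) t))))"
  by (induction t) (auto intro!: TO_intros LV_on)

lemma LiftF_on: "gen (rFO (gen (rTO LV)) (\<lambda>p p'. p' = p)) (quad (on d) p (on (gn A)) (on (gn (subst (lsb d) A))))"
proof (induction A arbitrary: d)
  case (All A)
  then show ?case using FO_intros(7)[OF All[of "Suc d", unfolded on_Suc]] by (simp add: up_lsb)
next
  case (Ex A)
  then show ?case using FO_intros(8)[OF Ex[of "Suc d", unfolded on_Suc]] by (simp add: up_lsb)
qed (auto intro!: FO_intros LiftT_on)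

lemma InstT_on: "gen (rTO IV) (quad (on d) (on (tgn u)) (on (tgn t)) (on (tgn (tsubst (isb d u) t))))"
proof (induction t)
  case (V i)
  have "IV (on d) (on (tgn u)) (on i) (on (tgn (isb d u i)))"
  proof -
    have "on (tgn (isb d u i)) = (if i < d then kvar (on i) else if i = d then on (tgn u) else kvar (on (i - 1)))"
      by (simp add: isb_def)
    then show ?thesis using IV_on by simp
  qed
  then show ?case by (auto intro: TO_intros)
qed (auto intro!: TO_intros)

lemma InstF_on: "InstF (on d) (on (tgn u)) (on (gn A)) (on (gn (subst (isb d u) A)))"
  unfolding InstF_def
proof (induction A arbitrary: d u)
  case (All A)
  have "LiftT (on 0) (on (tgn u)) (on (tgn (tlift u)))" unfolding LiftT_def tlift_lsb by (rule LiftT_on)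
  then show ?case using FO_intros(7)[OF All[of "Suc d" "tlift u", unfolded on_Suc]] by (simp add: up_isb)
next
  case (Ex A)
  have "LiftT (on 0) (on (tgn u)) (on (tgn (tlift u)))" unfolding LiftT_def tlift_lsb by (rule LiftT_on)
  then show ?case using FO_intros(8)[OF Ex[of "Suc d" "tlift u", unfolded on_Suc]] by (simp add: up_isb)
qed (auto intro!: FO_intros InstT_on)

lemma InstF_on_inst: "InstF (on 0) (on (tgn t)) (on (gn A)) (on (gn (inst t A)))"
  using InstF_on[of 0 t A] by (simp add: inst_def isb_0)

lemma LiftF_on_lift: "LiftF (on 0) (on (gn A)) (on (gn (lift A)))"
  using LiftF_on[of 0 "on 0" A] by (simp add: LiftF_def lift_def lsb_0)

lemma LogAx_propositional:
  assumes "Form a" "Form b" "Form c"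
    "x = kimp a (kimp b a) \<or> x = kimp (kimp a (kimp b c)) (kimp (kimp a b) (kimp a c)) \<or>
     x = kimp (kand a b) a \<or> x = kimp (kand a b) b \<or> x = kimp a (kimp b (kand a b)) \<or>
     x = kimp a (kor a b) \<or> x = kimp b (kor a b) \<or>
     x = kimp (kimp a c) (kimp (kimp b c) (kimp (kor a b) c)) \<or> x = kimp kfls a"
  shows "LogAx x"
  unfolding LogAx_def
  by (rule disjI1, rule exI[of _ a], rule exI[of _ b], rule exI[of _ c]) (intro conjI; fact assms)

lemma LogAx_quantifier:
  assumes "Form a" "Form b" "Term s" "Term t"
    "(\<exists>c. InstF (on 0) t a c \<and> (x = kimp (kall a) c \<or> x = kimp c (kex a))) \<or>
      (LiftF (on 0) b b' \<and>
        (x = kimp (kall (kimp b' a)) (kimp b (kall a)) \<or> x = kimp (kall (kimp a b')) (kimp (kex a) b))) \<or>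
      x = keq t t \<or>
      (\<exists>c d. InstF (on 0) s a c \<and> InstF (on 0) t a d \<and> x = kimp (keq s t) (kimp c d))"
  shows "LogAx x"
  unfolding LogAx_def
  by (rule disjI2, rule exI[of _ a], rule exI[of _ b], rule exI[of _ s], rule exI[of _ t], rule exI[of _ b'])
    (intro conjI; fact assms)

lemma LogAx_on: "logical_axiom A \<Longrightarrow> LogAx (on (gn A))"
proof (induction rule: logical_axiom.induct)
  case (ax_allE A t)
  then show ?case using InstF_on_inst[of t A]
    by (intro LogAx_quantifier[OF Form_on[of A] Form_on[of A] Term_on[of t] Term_on[of t]]) auto
next
  case (ax_exI t A)
  then show ?case using InstF_on_inst[of t A]
    by (intro LogAx_quantifier[OF Form_on[of A] Form_on[of A] Term_on[of t] Term_on[of t]]) auto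
next
  case (ax_allI B A)
  then show ?case using LiftF_on_lift[of B]
    by (intro LogAx_quantifier[OF Form_on[of A] Form_on[of B] Term_on[of Zero] Term_on[of Zero]]) auto
next
  case (ax_exE A B)
  then show ?case using LiftF_on_lift[of B]
    by (intro LogAx_quantifier[OF Form_on[of A] Form_on[of B] Term_on[of Zero] Term_on[of Zero]]) auto
next
  case (ax_eq_refl t)
  then show ?case
    by (intro LogAx_quantifier[OF Form_on[of Fls] Form_on[of Fls] Term_on[of Zero] Term_on[of t]]) auto
next
  case (ax_eq_subst s t A)
  then show ?case using InstF_on_inst[of t A] InstF_on_inst[of s A]
    by (intro LogAx_quantifier[OF Form_on[of A] Form_on[of A] Term_on[of s] Term_on[of t]]) auto
next
  case (ax_K A B)
  show ?case by (rule LogAx_propositional[OF Form_on[of A] Form_on[of B] Form_on[of A]]) simp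
next
  case (ax_S A B C)
  show ?case by (rule LogAx_propositional[OF Form_on[of A] Form_on[of B] Form_on[of C]]) simp
next
  case (ax_andE1 A B)
  show ?case by (rule LogAx_propositional[OF Form_on[of A] Form_on[of B] Form_on[of A]]) simp
next
  case (ax_andE2 A B)
  show ?case by (rule LogAx_propositional[OF Form_on[of A] Form_on[of B] Form_on[of A]]) simp
next
  case (ax_andI A B)
  show ?case by (rule LogAx_propositional[OF Form_on[of A] Form_on[of B] Form_on[of A]]) simp
next
  case (ax_orI1 A B)
  show ?case by (rule LogAx_propositional[OF Form_on[of A] Form_on[of B] Form_on[of A]]) simp
next
  case (ax_orI2 B A)
  show ?case by (rule LogAx_propositional[OF Form_on[of A] Form_on[of B] Form_on[of A]]) simp
next
  case (ax_orE A C B)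
  show ?case by (rule LogAx_propositional[OF Form_on[of A] Form_on[of B] Form_on[of C]]) simp
next
  case (ax_flsE A)
  show ?case by (rule LogAx_propositional[OF Form_on[of A] Form_on[of A] Form_on[of A]]) simp
qed

lemma IndAx_on: "IndAx (on (gn (induction_axiom A)))"
proof -
  have "InstF (on 0) kzero (on (gn A)) (on (gn (inst Zero A)))"
    using InstF_on_inst[of Zero A] by simp
  moreover have "LiftF (on (Suc 0)) (on (gn A)) (on (gn (subst (lsb 1) A)))"
    unfolding LiftF_def using LiftF_on[of 1 "on 0" A] by simp
  moreover have "InstF (on 0) (ksuc (kvar (on 0))) (on (gn (subst (lsb 1) A)))
      (on (gn (subst (V(0 := Succ (V 0))) A)))"
    using InstF_on[of 0 "Succ (V 0)" "subst (lsb 1) A"] by (simp only: Succ_subst tgn.simps on_pair)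
  ultimately show ?thesis unfolding IndAx_def induction_axiom_def gn.simps on_pair
    using Form_on by blast
qed

lemma HAx_on: "A \<in> HA \<Longrightarrow> HAx (on (gn A))"
proof -
  assume A: "A \<in> HA"
  have "B \<in> HA_generalizations \<Longrightarrow> gen rHA (on (gn B))" for B
  proof (induction rule: HA_generalizations.induct)
    case (1 A)
    then have "rHA (\<lambda>_. False) (on (gn A))" unfolding rHA_def by blast
    then show ?case using mono_rules(6) by (rule gen_I0)
  next
    case (2 A)
    have "rHA (\<lambda>_. False) (on (gn (induction_axiom A)))" unfolding rHA_def using IndAx_on by blast
    then show ?case using mono_rules(6) by (rule gen_I0)
  next
    case (3 A)
    have "rHA (\<lambda>t. t = on (gn A)) (on (gn (All A)))" unfolding rHA_def by simp
    with 3(2) show ?case using mono_rules(6) by (rule gen_I1)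
  qed
  then show ?thesis using A Fm_on[of A 0] unfolding HAx_def HA_def by blast
qed

lemma Pr_log: "LogAx x \<Longrightarrow> Pr X x"
  unfolding Pr_def by (rule gen_I0) (simp_all add: rPr_def mono_rules)

lemma Pr_ax: "X x \<Longrightarrow> Pr X x"
  unfolding Pr_def by (rule gen_I0) (simp_all add: rPr_def mono_rules)

lemma Pr_mp: "Pr X (kimp y x) \<Longrightarrow> Pr X y \<Longrightarrow> Pr X x"
  unfolding Pr_def by (rule gen_I2[of _ "kimp y x" y]) (auto simp: rPr_def mono_rules)

lemma Pr_gen: "Pr X x \<Longrightarrow> Pr X (kall x)"
  unfolding Pr_def by (rule gen_I1) (auto simp: rPr_def mono_rules)

lemma Pr_mono: "Pr X x \<Longrightarrow> (\<And>x. X x \<Longrightarrow> Y x) \<Longrightarrow> Pr Y x"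
proof -
  assume "Pr X x" and XY: "\<And>x. X x \<Longrightarrow> Y x"
  moreover have "rPr X E x \<Longrightarrow> rPr Y E x" for E x unfolding rPr_def using XY by blast
  ultimately show ?thesis unfolding Pr_def gen_def by blast
qed

text \<open>Unlike in \<open>Pr_mono\<close>, axioms are replaced by proofs, so the coded sequence
  changes. The argument is an induction on the proof inside the model, hence the definability
  premise.\<close>

lemma Pr_subset:
  assumes "Pr X x" "\<And>x. X x \<Longrightarrow> Pr Y x" "dfn M (\<lambda>e. Pr Y (e 0))"
  shows "Pr Y x"
  using assms(1)[unfolded Pr_def] mono_rules(7)
proof (rule gen_induct)
  show "Pr Y x" if "rPr X (Pr Y) x" for x
    using that assms(2) Pr_log Pr_mp Pr_gen unfolding rPr_def by blast
qed (fact assms)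

lemma Axs_upd [simp]: "Axs \<alpha> (e(0 := x)) = Axs \<alpha> e"
  by (auto simp: Axs_def)

lemma dfn_formula: "(\<And>i. dft M (\<lambda>e. g e i)) \<Longrightarrow> dfn M (\<lambda>e. sat M (g e) A)"
  by (rule dfn_sat)

lemma dfn_Pr: "dft M t \<Longrightarrow> dfn M (\<lambda>e'. Pr (Axs \<alpha> e) (t e'))"
proof -
  assume t: "dft M t"
  have "dfn M (\<lambda>e'. sat M (e(0 := t e')) (box \<alpha>))"
  proof (rule dfn_formula)
    show "dft M (\<lambda>e'. (e(0 := t e')) i)" for i using t by (cases "i = 0") (auto intro: dft_const)
  qed
  then show ?thesis by simp
qed

lemma Pr_Axs_subset: "Pr X x \<Longrightarrow> (\<And>x. X x \<Longrightarrow> Pr (Axs \<alpha> e) x) \<Longrightarrow> Pr (Axs \<alpha> e) x"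
  using Pr_subset[of X x "Axs \<alpha> e"] dfn_Pr[OF dft_var] by blast

lemma Pr_on: "HA \<turnstile> A \<Longrightarrow> (\<And>x. HAx x \<Longrightarrow> X x) \<Longrightarrow> Pr X (on (gn A))"
proof (induction rule: provable.induct)
  case (provable_mp A B)
  then show ?case using Pr_mp[of X "on (gn A)"] by simp
next
  case (provable_gen A)
  then show ?case using Pr_gen by simp
qed (auto intro: Pr_log Pr_ax LogAx_on HAx_on)

text \<open>The provable equivalence is what is used, not mere agreement on natural numbers:
  \<open>M\<close> may contain nonstandard axioms.\<close>

lemma Axs_HA:
  assumes "standard_axiomatization_HA \<eta>"
  shows "Axs \<eta> e = HAx"
proof -
  have "HA \<turnstile> allv 0 (\<eta> \<^bold>\<leftrightarrow> is_HA_axiom)"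
    using assms by (simp only: standard_axiomatization_HA_def)
  then have "sat M e (allv 0 (\<eta> \<^bold>\<leftrightarrow> is_HA_axiom))" using pa by (rule HA_sound)
  then have "sat M (e(0 := x)) \<eta> \<longleftrightarrow> HAx x" for x by auto
  then show ?thesis unfolding Axs_def fun_eq_iff HAx_def by blast
qed

subsection \<open>Numerals\<close>

lemma IsNum_zero: "IsNum zr c \<longleftrightarrow> c = kzero"
proof
  assume "IsNum zr c"
  then have "rNum (gen rNum) (mp zr c)" unfolding IsNum_def by (rule gen_unfold) (rule mono_rules)
  then show "c = kzero" by (auto simp: rNum_def)
next
  show "c = kzero \<Longrightarrow> IsNum zr c"
    unfolding IsNum_def by (rule gen_I0) (auto simp: rNum_def mono_rules on_0)
qed

lemma IsNum_suc: "IsNum (sc n) c \<longleftrightarrow> (\<exists>c'. c = ksuc c' \<and> IsNum n c')"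
proof
  assume "IsNum (sc n) c"
  then have "rNum (gen rNum) (mp (sc n) c)" unfolding IsNum_def by (rule gen_unfold) (rule mono_rules)
  then show "\<exists>c'. c = ksuc c' \<and> IsNum n c'" by (auto simp: rNum_def on_0 IsNum_def)
next
  assume "\<exists>c'. c = ksuc c' \<and> IsNum n c'"
  then show "IsNum (sc n) c"
    unfolding IsNum_def by (elim exE conjE) (rule gen_I1, auto simp: rNum_def mono_rules)
qed

lemma dft_if: "dft M s \<Longrightarrow> dft M t \<Longrightarrow> dft M (\<lambda>e. if b then s e else t e)"
  by (cases b) auto

lemma dfn_IsNum:
  assumes "dft M s" "dft M t"
  shows "dfn M (\<lambda>e. IsNum (s e) (t e))"
proof -
  have "dfn M (\<lambda>e. sat M (\<lambda>i. if i = 0 then s e else t e) (is_numeral (V 0) (V 1)))"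
    by (rule dfn_formula) (intro dft_if assms)
  then show ?thesis by simp
qed

lemma dfn_Tm:
  assumes "dft M s" "dft M t"
  shows "dfn M (\<lambda>e. Tm (s e) (t e))"
proof -
  have "dfn M (\<lambda>e. sat M (\<lambda>i. if i = 0 then s e else t e) (is_term_below (V 0) (V 1)))"
    by (rule dfn_formula) (intro dft_if assms)
  then show ?thesis by simp
qed

lemma dfn_LiftT:
  assumes "dft M d" "dft M s" "dft M t"
  shows "dfn M (\<lambda>e. LiftT (d e) (s e) (t e))"
proof -
  have "dfn M (\<lambda>e. sat M (\<lambda>i. if i = 0 then d e else if i = 1 then s e else t e)
      (is_lift_term (V 0) (V 1) (V 2)))"
    by (rule dfn_formula) (intro dft_if assms)
  then show ?thesis by simp
qed

lemma dfn_InstT: "dft M t \<Longrightarrow> dfn M (\<lambda>e. gen (rTO IV) (t e))"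
  using dfn_formula[of "\<lambda>e i. t e" "term_operation inst_var"] by (simp add: sat_inst_var)

lemma IsNum_ex1: "\<exists>!c. IsNum n c"
proof -
  have "\<exists>c. IsNum n c \<and> (\<forall>c'. IsNum n c' \<longrightarrow> c' = c)"
  proof (induction n rule: pa_induct)
    case definable
    show ?case by (intro dfn_intros dfn_IsNum)
  qed (auto simp: IsNum_zero IsNum_suc)
  then show ?thesis by blast
qed

definition numc :: "'m \<Rightarrow> 'm" where
  "numc n = (THE c. IsNum n c)"

lemma IsNum_iff: "IsNum n c \<longleftrightarrow> c = numc n"
  using theI'[OF IsNum_ex1[of n]] IsNum_ex1[of n] unfolding numc_def by blast

lemma numc_zero: "numc zr = kzero"
  using IsNum_zero IsNum_iff by blast

lemma numc_suc: "numc (sc n) = ksuc (numc n)"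
proof -
  have "IsNum (sc n) (ksuc (numc n))" by (simp add: IsNum_suc) (simp add: IsNum_iff)
  then show ?thesis by (simp add: IsNum_iff)
qed

lemma numc_on: "numc (on n) = on (tgn (num n))"
  by (induction n) (simp_all add: on_0 numc_zero on_Suc numc_suc num.simps)

text \<open>Numerals of nonstandard elements are not codes of actual terms, so facts about them need
  induction in the model; \<open>numc\<close> is first replaced by the definable relation
  \<open>IsNum\<close>.\<close>

lemma Tm_numc: "Tm d (numc a)"
proof -
  have "\<exists>c. IsNum a c \<and> Tm d c"
  proof (induction a rule: pa_induct)
    case definable
    show ?case by (intro dfn_intros dfn_IsNum dfn_Tm)
  qed (auto simp: IsNum_zero IsNum_suc intro: Tm_intros)
  then show ?thesis by (simp add: IsNum_iff)
qed

lemma LiftT_numc: "LiftT d (numc a) (numc a)"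
proof -
  have "\<exists>c. IsNum a c \<and> LiftT d c c"
  proof (induction a rule: pa_induct)
    case definable
    show ?case by (intro dfn_intros dfn_IsNum dfn_LiftT)
  qed (auto simp: IsNum_zero IsNum_suc LiftT_def intro: TO_intros)
  then show ?thesis by (simp add: IsNum_iff)
qed

lemma InstT_numc: "gen (rTO IV) (quad d p (numc a) (numc a))"
proof -
  have "\<exists>c. IsNum a c \<and> gen (rTO IV) (quad d p c c)"
  proof (induction a rule: pa_induct)
    case definable
    show ?case by (intro dfn_intros dfn_IsNum dfn_InstT dft_mp)
  qed (auto simp: IsNum_zero IsNum_suc intro: TO_intros)
  then show ?thesis by (simp add: IsNum_iff)
qed

subsection \<open>Codes with dots\<close>

text \<open>The codes \<open>f\<close> put for the free variables are arbitrary, not just numerals,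
  so that substituting terms beforehand amounts to changing \<open>f\<close>; see
  \<open>cfm_subst\<close>.\<close>

primrec ctm :: "nat \<Rightarrow> (nat \<Rightarrow> 'm) \<Rightarrow> tm \<Rightarrow> 'm" where
  "ctm d f (V i) = (if i < d then kvar (on i) else f (i - d))"
| "ctm d f Zero = kzero"
| "ctm d f (Succ t) = ksuc (ctm d f t)"
| "ctm d f (Plus s t) = kplus (ctm d f s) (ctm d f t)"
| "ctm d f (Times s t) = ktimes (ctm d f s) (ctm d f t)"

primrec cfm :: "nat \<Rightarrow> (nat \<Rightarrow> 'm) \<Rightarrow> fm \<Rightarrow> 'm" where
  "cfm d f (s \<approx> t) = keq (ctm d f s) (ctm d f t)"
| "cfm d f (s \<prec> t) = kless (ctm d f s) (ctm d f t)"
| "cfm d f Fls = kfls"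
| "cfm d f (A \<^bold>\<and> B) = kand (cfm d f A) (cfm d f B)"
| "cfm d f (A \<^bold>\<or> B) = kor (cfm d f A) (cfm d f B)"
| "cfm d f (A \<^bold>\<rightarrow> B) = kimp (cfm d f A) (cfm d f B)"
| "cfm d f (All A) = kall (cfm (Suc d) f A)"
| "cfm d f (Ex A) = kex (cfm (Suc d) f A)"

lemma eval_dotted_tm: "eval M e (dotted_tm N d t) = ctm d (\<lambda>i. e (N + i)) t"
  by (induction t) auto

lemma eval_dotted_fm: "eval M e (dotted_fm N d A) = cfm d (\<lambda>i. e (N + i)) A"
  by (induction A arbitrary: d) (auto simp: eval_dotted_tm)

lemma ctm_cong: "(\<And>i. i + d \<in> tfv t \<Longrightarrow> f i = g i) \<Longrightarrow> ctm d f t = ctm d g t"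
  by (induction t) auto

lemma cfm_cong: "(\<And>i. i + d \<in> fv A \<Longrightarrow> f i = g i) \<Longrightarrow> cfm d f A = cfm d g A"
proof (induction A arbitrary: d)
  case (All A)
  have "cfm (Suc d) f A = cfm (Suc d) g A" by (rule All.IH) (simp add: All.prems)
  then show ?case by simp
next
  case (Ex A)
  have "cfm (Suc d) f A = cfm (Suc d) g A" by (rule Ex.IH) (simp add: Ex.prems)
  then show ?case by simp
next
  case (Eq s t)
  have "ctm d f s = ctm d g s" "ctm d f t = ctm d g t" by (rule ctm_cong, simp add: Eq.prems)+
  then show ?case by simp
next
  case (Less s t)
  have "ctm d f s = ctm d g s" "ctm d f t = ctm d g t" by (rule ctm_cong, simp add: Less.prems)+
  then show ?case by simp
next
  case (And A B)
  have "cfm d f A = cfm d g A" "cfm d f B = cfm d g B"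
    by (rule And.IH, simp add: And.prems)+
  then show ?case by simp
next
  case (Or A B)
  have "cfm d f A = cfm d g A" "cfm d f B = cfm d g B"
    by (rule Or.IH, simp add: Or.prems)+
  then show ?case by simp
next
  case (Imp A B)
  have "cfm d f A = cfm d g A" "cfm d f B = cfm d g B"
    by (rule Imp.IH, simp add: Imp.prems)+
  then show ?case by simp
qed simp

lemma ctm_closed: "tfv t \<subseteq> {..<d} \<Longrightarrow> ctm d f t = on (tgn t)"
  by (induction t) auto

lemma cfm_closed: "fv A \<subseteq> {..<d} \<Longrightarrow> cfm d f A = on (gn A)"
  by (induction A arbitrary: d) (auto simp: ctm_closed dest!: fv_quantifier)

lemma ctm_shift: "ctm d f (tsubst (\<lambda>j. V (j + d)) s) = ctm 0 f s"
  by (induction s) auto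

lemma ctm_sh: "ctm d f (tsubst (sh d g) t) = ctm d (\<lambda>i. ctm 0 f (g i)) t"
  by (induction t) (auto simp: sh_def ctm_shift)

lemma cfm_sh: "cfm d f (subst (sh d g) A) = cfm d (\<lambda>i. ctm 0 f (g i)) A"
  by (induction A arbitrary: d) (auto simp: ctm_sh up_sh)

lemma cfm_subst: "cfm 0 f (subst g A) = cfm 0 (\<lambda>i. ctm 0 f (g i)) A"
  using cfm_sh[of 0 f g A] by (simp add: sh_0)

lemma Tm_ctm: "Tm (on d) (ctm d (\<lambda>i. numc (e i)) t)"
  by (induction t) (auto intro: Tm_intros Tm_numc)

lemma Fm_cfm: "Fm (on d) (cfm d (\<lambda>i. numc (e i)) A)"
  by (induction A arbitrary: d) (auto intro!: Fm_intros Tm_ctm simp flip: on_Suc)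

lemma InstT_ctm: "gen (rTO IV) (quad (on d) (numc a) (ctm (Suc d) (\<lambda>i. numc (e i)) t)
    (ctm d (\<lambda>i. numc (case_nat a e i)) t))"
proof (induction t)
  case (V i)
  consider "i < d" | "i = d" | j where "i = Suc (d + j)"
    by (metis less_imp_Suc_add linorder_neqE_nat)
  then show ?case
  proof cases
    case 1
    then show ?thesis using IV_on[of d "numc a" i] by (simp add: TO_intros)
  next
    case 2
    then show ?thesis using IV_on[of d "numc a" i] by (simp add: TO_intros)
  next
    case 3
    then show ?thesis by (simp add: InstT_numc)
  qed
qed (auto intro: TO_intros)

text \<open>Numerals contain no variables, so lifting leaves the parameter unchanged at every
  binder, and instantiating a code by a numeral gives exactly the code dotted at one more
  value.\<close>

lemma InstF_cfm: "InstF (on d) (numc a) (cfm (Suc d) (\<lambda>i. numc (e i)) A) (cfm d (\<lambda>i. numc (case_nat a e i)) A)"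
  unfolding InstF_def
  by (induction A arbitrary: d) (auto intro!: FO_intros InstT_ctm LiftT_numc simp flip: on_Suc)

abbreviation dot :: "(nat \<Rightarrow> 'm) \<Rightarrow> fm \<Rightarrow> 'm" where
  "dot e A \<equiv> cfm 0 (\<lambda>i. numc (e i)) A"

lemma Sent_dot: "Sent (dot e A)"
  by (rule Fm_cfm)

lemma dot_closed: "fv A = {} \<Longrightarrow> dot e A = on (gn A)"
  by (simp add: cfm_closed)

lemma Pr_dot_All: "Pr X (dot e (All A)) \<Longrightarrow> Pr X (dot (case_nat a e) A)"
proof -
  let ?b = "cfm 1 (\<lambda>i. numc (e i)) A"
  have "LogAx (kimp (kall ?b) (dot (case_nat a e) A))"
    using InstF_cfm[of 0 a e A] Fm_cfm[of 1 e A] Tm_numc[of zr a]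
    by (intro LogAx_quantifier[of ?b ?b "numc a" "numc a"]) auto
  moreover assume "Pr X (dot e (All A))"
  ultimately show ?thesis using Pr_log[of _ X] Pr_mp[of X "kall ?b"] by simp
qed

text \<open>The closure of \<open>A\<close> has a standard code, whose proof is copied into the
  model. Its quantifiers are then instantiated inside the model by numerals of arbitrary
  elements.\<close>

theorem Pr_dot:
  assumes "HA \<turnstile> A" "\<And>x. HAx x \<Longrightarrow> X x"
  shows "Pr X (dot e A)"
proof -
  obtain n where n: "fv ((All ^^ n) A) = {}" using closing_exists by blast
  have "\<forall>e. Pr X (dot e ((All ^^ n) A))"
    using Pr_on[OF provable_funpow[OF assms(1), of n] assms(2)] dot_closed[OF n] by simp
  then have "\<forall>e. Pr X (dot e A)"
  proof (induction n)
    case (Suc n)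
    have "Pr X (dot e ((All ^^ n) A))" for e
    proof -
      have "case_nat (e 0) (\<lambda>i. e (Suc i)) = e" by (auto simp: fun_eq_iff split: nat.split)
      moreover have "Pr X (dot (\<lambda>i. e (Suc i)) (All ((All ^^ n) A)))"
        using Suc.prems by (simp del: cfm.simps)
      ultimately show ?thesis using Pr_dot_All[of X "\<lambda>i. e (Suc i)" "(All ^^ n) A" "e 0"] by simp
    qed
    then show ?case using Suc.IH by blast
  qed simp
  then show ?thesis by blast
qed

lemma Pr_dot_mp:
  assumes "HA \<turnstile> A \<^bold>\<rightarrow> B" "\<And>x. HAx x \<Longrightarrow> X x" "Pr X (dot e A)"
  shows "Pr X (dot e B)"
proof (rule Pr_mp)
  have "Pr X (dot e (A \<^bold>\<rightarrow> B))" using assms(1,2) by (rule Pr_dot)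
  then show "Pr X (kimp (dot e A) (dot e B))" by simp
qed (fact assms)

text \<open>Variable 0 is reserved for the code, and the auxiliary variables start at
  \<open>N\<close>, beyond all free variables of \<open>D\<close>; the quantified numerals are then
  forced to be \<open>numc\<close> of the values.\<close>

lemma sat_u_is_code_of:
  assumes "0 \<notin> fv D"
  shows "sat M e (u_is_code_of D) \<longleftrightarrow> e 0 = dot e D"
proof -
  define N where "N = Suc (Max (insert 0 (fv D)))"
  have N: "i < N" if "i \<in> fv D" for i
    using that finite_fv[of D] unfolding N_def by (simp add: less_Suc_eq_le)
  have fold: "sat M e (foldr (\<lambda>j A. exv (N + j) (is_numeral (V j) (V (N + j)) \<^bold>\<and> A)) js B) \<longleftrightarrow>
      sat M (\<lambda>i. if i \<in> (+) N ` set js then numc (e (i - N)) else e i) B"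
    if "\<forall>j\<in>set js. j < N" for js B e
    using that
  proof (induction js arbitrary: e)
    case (Cons j js)
    let ?e = "e(N + j := numc (e j))"
    have "(\<lambda>i. if i \<in> (+) N ` set js then numc (?e (i - N)) else ?e i) =
        (\<lambda>i. if i \<in> (+) N ` set (j # js) then numc (e (i - N)) else e i)"
      using Cons.prems by (auto simp: fun_eq_iff image_iff)
    moreover have "sat M e (foldr (\<lambda>j A. exv (N + j) (is_numeral (V j) (V (N + j)) \<^bold>\<and> A)) (j # js) B) \<longleftrightarrow>
        sat M ?e (foldr (\<lambda>j A. exv (N + j) (is_numeral (V j) (V (N + j)) \<^bold>\<and> A)) js B)"
      using Cons.prems by (simp add: IsNum_iff)
    ultimately show ?case using Cons by simp
  qed simp
  let ?e = "\<lambda>i. if i \<in> (+) N ` fv D then numc (e (i - N)) else e i"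
  have "sat M e (u_is_code_of D) \<longleftrightarrow> sat M ?e (V 0 \<approx> dotted_fm N 0 D)"
    unfolding u_is_code_of_def Let_def N_def[symmetric] using fold[of "sorted_list_of_set (fv D)"] N by simp
  also have "\<dots> \<longleftrightarrow> e 0 = cfm 0 (\<lambda>i. ?e (N + i)) D"
    unfolding sat.simps eval_dotted_fm by (auto simp: N_def)
  also have "cfm 0 (\<lambda>i. ?e (N + i)) D = dot e D"
    by (rule cfm_cong) simp
  finally show ?thesis .
qed

end

section \<open>Provable \<open>\<Sigma>\<^sub>1\<close>-completeness\<close>

lemma HA_sem:
  assumes "sigma1 A" "sigma1 B" "\<And>(M :: nat struct) e. pa_model M \<Longrightarrow> sat M e A \<Longrightarrow> sat M e B"
  shows "HA \<turnstile> A \<^bold>\<rightarrow> B"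
  using assms by (intro conservative) (auto simp: pa_model_def)

lemma HA_valid:
  assumes "sigma1 B" "\<And>(M :: nat struct) e. pa_model M \<Longrightarrow> sat M e B"
  shows "HA \<turnstile> B"
  using HA_sem[of Tru B] assms derives_empty[OF derives_refl] provable_mp sigma1_atoms by blast

text \<open>Recursion equations in relational form: the value sits in a variable of its own, so that
  the inductions in the model can put its numeral there and advance it.\<close>

lemma HA_add_0: "HA \<turnstile> Plus (V 0) Zero \<approx> V 0"
  and HA_add_Suc: "HA \<turnstile> Plus (V 0) (V 1) \<approx> V 2 \<^bold>\<rightarrow> Plus (V 0) (Succ (V 1)) \<approx> Succ (V 2)"
  and HA_mul_0: "HA \<turnstile> Times (V 0) Zero \<approx> Zero"
  and HA_mul_Suc: "HA \<turnstile> (Times (V 0) (V 1) \<approx> V 2 \<^bold>\<and> Plus (V 2) (V 0) \<approx> V 3) \<^bold>\<rightarrow> Times (V 0) (Succ (V 1)) \<approx> V 3"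
  and HA_less: "HA \<turnstile> Plus (V 0) (Succ (V 1)) \<approx> V 2 \<^bold>\<rightarrow> V 0 \<prec> V 2"
  and HA_less_ne: "HA \<turnstile> V 0 \<prec> V 1 \<^bold>\<rightarrow> (\<^bold>\<not> V 0 \<approx> V 1) \<^bold>\<and> (\<^bold>\<not> V 1 \<approx> V 0)"
  and HA_not_less: "HA \<turnstile> Plus (V 0) (V 1) \<approx> V 2 \<^bold>\<rightarrow> \<^bold>\<not> V 2 \<prec> V 0"
proof -
  have *: "sat M e (Plus (V 0) Zero \<approx> V 0)"
    "sat M e (Plus (V 0) (V 1) \<approx> V 2) \<Longrightarrow> sat M e (Plus (V 0) (Succ (V 1)) \<approx> Succ (V 2))"
    "sat M e (Times (V 0) Zero \<approx> Zero)"
    "sat M e (Times (V 0) (V 1) \<approx> V 2 \<^bold>\<and> Plus (V 2) (V 0) \<approx> V 3) \<Longrightarrow> sat M e (Times (V 0) (Succ (V 1)) \<approx> V 3)"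
    "sat M e (Plus (V 0) (Succ (V 1)) \<approx> V 2) \<Longrightarrow> sat M e (V 0 \<prec> V 2)"
    "sat M e (V 0 \<prec> V 1) \<Longrightarrow> sat M e ((\<^bold>\<not> V 0 \<approx> V 1) \<^bold>\<and> (\<^bold>\<not> V 1 \<approx> V 0))"
    "sat M e (Plus (V 0) (V 1) \<approx> V 2) \<Longrightarrow> sat M e (\<^bold>\<not> V 2 \<prec> V 0)"
    if "pa_model M" for M :: "nat struct" and e
  proof -
    interpret pa_model M by fact
    show "sat M e (Plus (V 0) Zero \<approx> V 0)"
      "sat M e (Plus (V 0) (V 1) \<approx> V 2) \<Longrightarrow> sat M e (Plus (V 0) (Succ (V 1)) \<approx> Succ (V 2))"
      "sat M e (Times (V 0) Zero \<approx> Zero)"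
      "sat M e (Times (V 0) (V 1) \<approx> V 2 \<^bold>\<and> Plus (V 2) (V 0) \<approx> V 3) \<Longrightarrow> sat M e (Times (V 0) (Succ (V 1)) \<approx> V 3)"
      "sat M e (Plus (V 0) (Succ (V 1)) \<approx> V 2) \<Longrightarrow> sat M e (V 0 \<prec> V 2)"
      by (auto simp: less_iff)
    show "sat M e (V 0 \<prec> V 1) \<Longrightarrow> sat M e ((\<^bold>\<not> V 0 \<approx> V 1) \<^bold>\<and> (\<^bold>\<not> V 1 \<approx> V 0))"
      by (auto simp: less_le)
    show "sat M e (Plus (V 0) (V 1) \<approx> V 2) \<Longrightarrow> sat M e (\<^bold>\<not> V 2 \<prec> V 0)"
      by (auto simp: ord_not_less)
  qed
  show "HA \<turnstile> Plus (V 0) Zero \<approx> V 0" "HA \<turnstile> Times (V 0) Zero \<approx> Zero"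
    by (rule HA_valid[OF sigma1_atoms(1) *(1)] HA_valid[OF sigma1_atoms(1) *(3)]; assumption)+
  show "HA \<turnstile> Plus (V 0) (V 1) \<approx> V 2 \<^bold>\<rightarrow> Plus (V 0) (Succ (V 1)) \<approx> Succ (V 2)"
    by (rule HA_sem[OF _ _ *(2)]) (intro sigma1.intros(1) delta0.intros | assumption)+
  show "HA \<turnstile> (Times (V 0) (V 1) \<approx> V 2 \<^bold>\<and> Plus (V 2) (V 0) \<approx> V 3) \<^bold>\<rightarrow> Times (V 0) (Succ (V 1)) \<approx> V 3"
    by (rule HA_sem[OF _ _ *(4)]) (intro sigma1.intros(1) delta0.intros | assumption)+
  show "HA \<turnstile> Plus (V 0) (Succ (V 1)) \<approx> V 2 \<^bold>\<rightarrow> V 0 \<prec> V 2"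
    by (rule HA_sem[OF _ _ *(5)]) (intro sigma1.intros(1) delta0.intros | assumption)+
  show "HA \<turnstile> V 0 \<prec> V 1 \<^bold>\<rightarrow> (\<^bold>\<not> V 0 \<approx> V 1) \<^bold>\<and> (\<^bold>\<not> V 1 \<approx> V 0)"
    by (rule HA_sem[OF _ _ *(6)]) (intro sigma1.intros(1) delta0.intros | assumption)+
  show "HA \<turnstile> Plus (V 0) (V 1) \<approx> V 2 \<^bold>\<rightarrow> \<^bold>\<not> V 2 \<prec> V 0"
    by (rule HA_sem[OF _ _ *(7)]) (intro sigma1.intros(1) delta0.intros | assumption)+
qed

text \<open>The bound is the variable 0 of the new formula, and the other variables of
  \<open>A\<close> keep their numbers. An induction in the model can thus run over the
  bound.\<close>

definition ball :: "fm \<Rightarrow> fm" where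
  "ball A = All (V 0 \<prec> V 1 \<^bold>\<rightarrow> subst (up (\<lambda>i. V (Suc i))) A)"

lemma sigma1_ball: "sigma1 A \<Longrightarrow> sigma1 (ball A)"
  using sigma1.intros(4)[of _ "V 0"] by (simp add: ball_def sigma1_subst)

lemma sat_ball: "sat M e (ball A) \<longleftrightarrow> (\<forall>x. m_less M x (e 0) \<longrightarrow> sat M (case_nat x (\<lambda>i. e (Suc i))) A)"
proof -
  have "(\<lambda>i. eval M (case_nat x e) (up (\<lambda>i. V (Suc i)) i)) = case_nat x (\<lambda>i. e (Suc i))" for x
    by (auto simp: fun_eq_iff split: nat.split)
  then show ?thesis by (simp add: ball_def sat_subst)
qed

lemma HA_ball:
  assumes "sigma1 A"
  shows "HA \<turnstile> subst (case_nat Zero V) (ball A)"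
    and "HA \<turnstile> (ball A \<^bold>\<and> A) \<^bold>\<rightarrow> subst (case_nat (Succ (V 0)) (\<lambda>i. V (Suc i))) (ball A)"
    and "HA \<turnstile> (tlift t \<approx> V 0 \<^bold>\<and> ball A) \<^bold>\<rightarrow> lift (All (V 0 \<prec> tlift t \<^bold>\<rightarrow> A))"
proof -
  have *: "sat M e (subst (case_nat Zero V) (ball A))"
    "sat M e (ball A \<^bold>\<and> A) \<Longrightarrow> sat M e (subst (case_nat (Succ (V 0)) (\<lambda>i. V (Suc i))) (ball A))"
    "sat M e (tlift t \<approx> V 0 \<^bold>\<and> ball A) \<Longrightarrow> sat M e (lift (All (V 0 \<prec> tlift t \<^bold>\<rightarrow> A)))"
    if "pa_model M" for M :: "nat struct" and e
  proof -
    interpret pa_model M by fact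
    have "case_nat (e 0) (\<lambda>i. e (Suc i)) = e" by (auto simp: fun_eq_iff split: nat.split)
    then show "sat M e (ball A \<^bold>\<and> A) \<Longrightarrow> sat M e (subst (case_nat (Succ (V 0)) (\<lambda>i. V (Suc i))) (ball A))"
      by (auto simp: sat_ball sat_subst less_suc)
    show "sat M e (subst (case_nat Zero V) (ball A))" by (simp add: sat_ball sat_subst)
    have "sat M e (lift (All (V 0 \<prec> tlift t \<^bold>\<rightarrow> A))) \<longleftrightarrow>
        sat M (\<lambda>i. e (Suc i)) (All (V 0 \<prec> tlift t \<^bold>\<rightarrow> A))"
      by (simp only: lift_def sat_subst eval.simps)
    moreover have "eval M e (tlift t) = eval M (\<lambda>i. e (Suc i)) t" by (simp add: tlift_def eval_tsubst)
    ultimately show "sat M e (tlift t \<approx> V 0 \<^bold>\<and> ball A) \<Longrightarrow> sat M e (lift (All (V 0 \<prec> tlift t \<^bold>\<rightarrow> A)))"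
      by (simp add: sat_ball)
  qed
  show "HA \<turnstile> subst (case_nat Zero V) (ball A)"
    by (rule HA_valid) (use * assms in \<open>auto intro: sigma1_subst sigma1_ball\<close>)
  show "HA \<turnstile> (ball A \<^bold>\<and> A) \<^bold>\<rightarrow> subst (case_nat (Succ (V 0)) (\<lambda>i. V (Suc i))) (ball A)"
    by (rule HA_sem) (use * assms in \<open>auto intro: sigma1_subst sigma1_ball sigma1.intros(2)\<close>)
  show "HA \<turnstile> (tlift t \<approx> V 0 \<^bold>\<and> ball A) \<^bold>\<rightarrow> lift (All (V 0 \<prec> tlift t \<^bold>\<rightarrow> A))"
    by (rule HA_sem)
      (use * assms in \<open>auto simp: lift_def simp del: subst.simps
        intro!: sigma1_subst sigma1_ball sigma1.intros(2,4) sigma1_atoms\<close>)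
qed

lemma sat_exI: "sat M e A \<Longrightarrow> sat M e (lift (Ex A))"
proof -
  have "case_nat (e 0) (\<lambda>i. e (Suc i)) = e" by (auto simp: fun_eq_iff split: nat.split)
  moreover have "sat M e (lift (Ex A)) \<longleftrightarrow> (\<exists>x. sat M (case_nat x (\<lambda>i. e (Suc i))) A)"
    by (simp only: lift_def sat_subst eval.simps sat.simps)
  ultimately show "sat M e A \<Longrightarrow> sat M e (lift (Ex A))" by metis
qed

context pa_model
begin

abbreviation prov :: "(nat \<Rightarrow> 'm) \<Rightarrow> fm \<Rightarrow> bool" where
  "prov e A \<equiv> Pr HAx (dot e A)"

lemma prov_thm: "HA \<turnstile> A \<Longrightarrow> prov e A"
  by (simp add: Pr_dot)

lemma prov_mp: "HA \<turnstile> A \<^bold>\<rightarrow> B \<Longrightarrow> prov e A \<Longrightarrow> prov e B"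
  by (rule Pr_dot_mp)

lemma Pr_and: "Pr X (dot e A) \<Longrightarrow> Pr X (dot e B) \<Longrightarrow> (\<And>x. HAx x \<Longrightarrow> X x) \<Longrightarrow> Pr X (dot e (A \<^bold>\<and> B))"
proof -
  assume *: "Pr X (dot e A)" "Pr X (dot e B)" "\<And>x. HAx x \<Longrightarrow> X x"
  have "Pr X (dot e (A \<^bold>\<rightarrow> B \<^bold>\<rightarrow> A \<^bold>\<and> B))"
    by (rule Pr_dot) (use * in \<open>auto intro: provable_logic ax_andI\<close>)
  then have "Pr X (kimp (dot e A) (kimp (dot e B) (dot e (A \<^bold>\<and> B))))" by simp
  then show ?thesis using * Pr_mp by blast
qed

lemma prov_and: "prov e A \<Longrightarrow> prov e B \<Longrightarrow> prov e (A \<^bold>\<and> B)"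
  by (rule Pr_and)

text \<open>Allows semantic reasoning under the internal provability predicate: a Sigma_1
  implication valid in all models is a theorem of HA, and the model proves all its numeral
  instances.\<close>

lemma prov_sem:
  assumes "prov e A" "sigma1 A" "sigma1 B" "\<And>(M :: nat struct) e. pa_model M \<Longrightarrow> sat M e A \<Longrightarrow> sat M e B"
  shows "prov e B"
  using prov_mp[OF HA_sem] assms by blast

lemma dot_subst: "(\<And>i. ctm 0 (\<lambda>j. numc (e j)) (g i) = numc (e' i)) \<Longrightarrow> dot e (subst g A) = dot e' A"
  by (simp add: cfm_subst)

lemma dot_rename: "dot e (subst (\<lambda>i. V (r i)) A) = dot (\<lambda>i. e (r i)) A"
  by (rule dot_subst) simp

lemma dot_lift: "dot e (lift A) = dot (\<lambda>i. e (Suc i)) A"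
  unfolding lift_def by (rule dot_rename)

lemma HAx_Axs: "HAx = Axs is_HA_axiom e"
  by (auto simp: Axs_def HAx_def fun_eq_iff)

lemma dfn_prov:
  assumes "\<And>i. dft M (\<lambda>e. g e i)"
  shows "dfn M (\<lambda>e. prov (g e) A)"
proof -
  \<comment> \<open>\<open>u_is_code_of\<close> needs variable 0 for the code, so the variables of
    \<open>A\<close> make room for it.\<close>
  have shift: "0 \<notin> fv (lift A)" by (auto simp: lift_def fv_subst)
  have "prov (g e) A \<longleftrightarrow> (\<exists>u. sat M (case_nat u (g e)) (u_is_code_of (lift A)) \<and> sat M (\<lambda>_. u) (box is_HA_axiom))" for e
    unfolding sat_u_is_code_of[OF shift] sat_box HAx_Axs[symmetric] dot_lift by simp
  moreover have "dft M (\<lambda>e. case_nat (e 0) (g (\<lambda>i. e (Suc i))) i)" for i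
    using dft_shift[OF assms] by (cases i) (auto intro: dft_var)
  ultimately show ?thesis by (simp only:) (intro dfn_intros dfn_formula)
qed

lemma dft_case_nat: "dft M s \<Longrightarrow> (\<And>i. dft M (\<lambda>e. g e i)) \<Longrightarrow> dft M (\<lambda>e. case_nat (s e) (g e) i)"
  by (cases i) auto

abbreviation env3 :: "'m \<Rightarrow> 'm \<Rightarrow> 'm \<Rightarrow> (nat \<Rightarrow> 'm) \<Rightarrow> nat \<Rightarrow> 'm" where
  "env3 a b c e \<equiv> case_nat a (case_nat b (case_nat c e))"

lemma prov_Plus: "prov (env3 a b (a \<oplus> b) e) (Plus (V 0) (V 1) \<approx> V 2)"
proof (induction b rule: pa_induct)
  case definable
  show ?case by (intro dfn_prov dft_case_nat dfn_intros)
next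
  case zero
  show ?case using prov_thm[OF HA_add_0, of "\<lambda>_. a"] by (simp add: numc_zero numeral_2_eq_2)
next
  case (suc b)
  then show ?case using prov_mp[OF HA_add_Suc suc] by (simp add: numc_suc numeral_2_eq_2)
qed

lemma prov_Times: "prov (env3 a b (a \<otimes> b) e) (Times (V 0) (V 1) \<approx> V 2)"
proof (induction b rule: pa_induct)
  case definable
  show ?case by (intro dfn_prov dft_case_nat dfn_intros)
next
  case zero
  show ?case using prov_thm[OF HA_mul_0, of "\<lambda>_. a"] by (simp add: numc_zero numeral_2_eq_2)
next
  case (suc b)
  let ?e = "env3 a b (a \<otimes> b) (case_nat (a \<otimes> b \<oplus> a) e)"
  have "prov ?e (Times (V 0) (V 1) \<approx> V 2)"
    using suc by (simp add: numeral_2_eq_2)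
  moreover have "prov ?e (Plus (V 2) (V 0) \<approx> V 3)"
    using prov_Plus[of "a \<otimes> b" a e] by (simp add: numeral_2_eq_2 numeral_3_eq_3)
  ultimately have "prov ?e (Times (V 0) (Succ (V 1)) \<approx> V 3)"
    by (rule prov_mp[OF HA_mul_Suc prov_and])
  then show ?case by (simp add: numc_suc numeral_2_eq_2 numeral_3_eq_3)
qed

abbreviation evaluates :: "(nat \<Rightarrow> 'm) \<Rightarrow> tm \<Rightarrow> bool" where
  "evaluates e t \<equiv> Pr HAx (keq (ctm 0 (\<lambda>i. numc (e i)) t) (numc (eval M e t)))"

lemma ctm_shift_env: "ctm 0 (\<lambda>i. numc (env3 a b c e i)) (tsubst (\<lambda>i. V (Suc (Suc (Suc i)))) t) = ctm 0 (\<lambda>i. numc (e i)) t"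
  by (induction t) auto

text \<open>The shift by three frees the variables 0 and 1 for the values of \<open>s\<close> and
  \<open>t\<close> and 2 for a result. Replacing terms by the numerals of their values thus becomes
  a valid implication about equations.\<close>

lemma prov_binary:
  assumes "evaluates e s" "evaluates e t" "sigma1 A"
    "prov (env3 (eval M e s) (eval M e t) c e) A"
    "sigma1 B" "\<And>(M :: nat struct) e. pa_model M \<Longrightarrow>
      sat M e (tsubst (\<lambda>i. V (Suc (Suc (Suc i)))) s \<approx> V 0 \<^bold>\<and> tsubst (\<lambda>i. V (Suc (Suc (Suc i)))) t \<approx> V 1 \<^bold>\<and> A) \<Longrightarrow> sat M e B"
  shows "prov (env3 (eval M e s) (eval M e t) c e) B"
proof (rule prov_sem)
  let ?P = "tsubst (\<lambda>i. V (Suc (Suc (Suc i)))) s \<approx> V 0 \<^bold>\<and> tsubst (\<lambda>i. V (Suc (Suc (Suc i)))) t \<approx> V 1 \<^bold>\<and> A"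
  show "prov (env3 (eval M e s) (eval M e t) c e) ?P"
    by (intro prov_and) (use assms in \<open>simp_all add: ctm_shift_env\<close>)
  show "sigma1 ?P" by (intro sigma1.intros(2) sigma1_atoms assms)
  show "sat M e B" if "pa_model M" "sat M e ?P" for M :: "nat struct" and e
    using assms(6) that by blast
qed (fact assms)

lemma prov_eval: "evaluates e t"
proof (induction t)
  case (V i)
  show ?case using prov_thm[OF provable_logic[OF ax_eq_refl[of "V i"]], of e] by simp
next
  case Zero
  show ?case using prov_thm[OF provable_logic[OF ax_eq_refl[of Zero]], of e] by (simp add: numc_zero)
next
  case (Succ t)
  have "ctm 0 (\<lambda>i. numc (case_nat v e i)) (tlift t) = ctm 0 (\<lambda>i. numc (e i)) t" for v
    by (induction t) auto
  then have "prov (case_nat (eval M e t) e) (tlift t \<approx> V 0)" using Succ by simp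
  then have "prov (case_nat (eval M e t) e) (Succ (tlift t) \<approx> Succ (V 0))"
    by (rule prov_sem) (auto intro: sigma1_atoms)
  then show ?case using \<open>\<And>v. ctm 0 (\<lambda>i. numc (case_nat v e i)) (tlift t) = _\<close> by (simp add: numc_suc)
next
  case (Plus s t)
  have "prov (env3 (eval M e s) (eval M e t) (eval M e s \<oplus> eval M e t) e)
      (Plus (tsubst (\<lambda>i. V (Suc (Suc (Suc i)))) s) (tsubst (\<lambda>i. V (Suc (Suc (Suc i)))) t) \<approx> V 2)"
    by (rule prov_binary[OF Plus.IH _ prov_Plus]) (auto intro: sigma1_atoms)
  then show ?case by (simp add: ctm_shift_env numeral_2_eq_2)
next
  case (Times s t)
  have "prov (env3 (eval M e s) (eval M e t) (eval M e s \<otimes> eval M e t) e)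
      (Times (tsubst (\<lambda>i. V (Suc (Suc (Suc i)))) s) (tsubst (\<lambda>i. V (Suc (Suc (Suc i)))) t) \<approx> V 2)"
    by (rule prov_binary[OF Times.IH _ prov_Times]) (auto intro: sigma1_atoms)
  then show ?case by (simp add: ctm_shift_env numeral_2_eq_2)
qed

lemma prov_less: "a \<sqsubset> b \<Longrightarrow> prov (case_nat a (case_nat b e)) (V 0 \<prec> V 1)"
proof -
  assume "a \<sqsubset> b"
  then obtain z where z: "a \<oplus> sc z = b" unfolding less_iff by blast
  have "prov (env3 a z b e) (Plus (V 0) (Succ (V 1)) \<approx> V 2)"
    using prov_Plus[of a "sc z" e] unfolding z by (simp add: numc_suc numeral_2_eq_2)
  then have "prov (env3 a z b e) (V 0 \<prec> V 2)" by (rule prov_mp[OF HA_less])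
  then show ?thesis by (simp add: numeral_2_eq_2)
qed

lemma prov_not_less: "b \<sqsubseteq> a \<Longrightarrow> prov (case_nat a (case_nat b e)) (\<^bold>\<not> V 0 \<prec> V 1)"
proof -
  assume "b \<sqsubseteq> a"
  then obtain z where z: "b \<oplus> z = a" by blast
  have "prov (env3 b z a e) (\<^bold>\<not> V 2 \<prec> V 0)"
    using prov_mp[OF HA_not_less prov_Plus[of b z e]] z by simp
  then show ?thesis by (simp add: numeral_2_eq_2)
qed

lemma prov_ne: "a \<noteq> b \<Longrightarrow> prov (case_nat a (case_nat b e)) (\<^bold>\<not> V 0 \<approx> V 1)"
proof (erule ord_neqE)
  have conj: "HA \<turnstile> A \<^bold>\<and> B \<^bold>\<rightarrow> A" "HA \<turnstile> A \<^bold>\<and> B \<^bold>\<rightarrow> B" for A B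
    by (auto intro: provable_logic ax_andE1 ax_andE2)
  show "a \<sqsubset> b \<Longrightarrow> ?thesis"
    using prov_mp[OF conj(1) prov_mp[OF HA_less_ne prov_less]] .
  assume "b \<sqsubset> a"
  then show ?thesis
    using prov_mp[OF conj(2) prov_mp[OF HA_less_ne prov_less[of b a e]]] by simp
qed

lemma prov_atom:
  assumes "prov (case_nat (eval M e s) (case_nat (eval M e t) (\<lambda>_. zr))) A"
    "(A, B) \<in> {(V 0 \<approx> V 1, s \<approx> t), (V 0 \<prec> V 1, s \<prec> t), (\<^bold>\<not> V 0 \<approx> V 1, \<^bold>\<not> s \<approx> t), (\<^bold>\<not> V 0 \<prec> V 1, \<^bold>\<not> s \<prec> t)}"
  shows "prov e B"
proof -
  let ?e = "env3 (eval M e s) (eval M e t) zr e"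
  let ?f = "\<lambda>i. V (Suc (Suc (Suc i)))"
  have "sigma1 A" "sigma1 (subst ?f B)"
    using assms(2) by (auto intro!: sigma1.intros(1) delta0.intros)
  moreover have "prov ?e A" using assms by auto
  ultimately have "prov ?e (subst ?f B)"
    by (rule_tac prov_binary[OF prov_eval prov_eval, where A = A]) (use assms(2) in auto)
  moreover have "dot ?e (subst ?f B) = dot e B" by (rule dot_subst) simp
  ultimately show ?thesis by simp
qed

text \<open>The bound may be nonstandard, so the instances cannot be combined outside. Induction in
  the model extends the provable initial segment one element at a time through
  \<open>ball\<close>.\<close>

lemma prov_ball:
  assumes A: "\<And>x. x \<sqsubset> eval M e t \<Longrightarrow> prov (case_nat x e) A" and \<sigma>: "sigma1 A"
  shows "prov e (All (V 0 \<prec> tlift t \<^bold>\<rightarrow> A))"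
proof -
  have "b \<sqsubseteq> eval M e t \<longrightarrow> prov (case_nat b e) (ball A)" for b
  proof (induction b rule: pa_induct)
    case definable
    show ?case by (intro dfn_intros dfn_prov dft_case_nat)
  next
    case zero
    have "dot e (subst (case_nat Zero V) (ball A)) = dot (case_nat zr e) (ball A)"
      by (rule dot_subst) (auto simp: numc_zero split: nat.split)
    then show ?case using prov_thm[OF HA_ball(1)[OF \<sigma>], of e] by simp
  next
    case (suc b)
    show ?case
    proof
      assume "sc b \<sqsubseteq> eval M e t"
      then have b: "b \<sqsubset> eval M e t" unfolding less_iff by simp
      then have "prov (case_nat b e) (ball A \<^bold>\<and> A)"
        using suc A[OF b] less_le by (intro prov_and) auto
      moreover have "dot (case_nat b e) (subst (case_nat (Succ (V 0)) (\<lambda>i. V (Suc i))) (ball A)) =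
          dot (case_nat (sc b) e) (ball A)"
        by (rule dot_subst) (auto simp: numc_suc split: nat.split)
      ultimately show "prov (case_nat (sc b) e) (ball A)"
        using prov_mp[OF HA_ball(2)[OF \<sigma>]] by metis
    qed
  qed
  then have "prov (case_nat (eval M e t) e) (ball A)" using ord_order_refl by blast
  moreover have "prov (case_nat (eval M e t) e) (tlift t \<approx> V 0)"
  proof -
    have "ctm 0 (\<lambda>i. numc (case_nat v e i)) (tlift t) = ctm 0 (\<lambda>i. numc (e i)) t" for v
      by (induction t) auto
    then show ?thesis using prov_eval by simp
  qed
  ultimately have "prov (case_nat (eval M e t) e) (lift (All (V 0 \<prec> tlift t \<^bold>\<rightarrow> A)))"
    by (intro prov_mp[OF HA_ball(3)[OF \<sigma>]] prov_and)
  then show ?thesis by (simp only: dot_lift nat.case)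
qed

lemma prov_ex:
  assumes "prov (case_nat x e) A" "sigma1 A"
  shows "prov e (Ex A)"
proof -
  have "prov (case_nat x e) (lift (Ex A))"
    using assms
  proof (rule prov_sem)
    show "sigma1 (lift (Ex A))" unfolding lift_def by (intro sigma1_subst sigma1.intros(5) assms)
  qed (rule sat_exI)
  then show ?thesis by (simp only: dot_lift nat.case)
qed

text \<open>Refutability of false formulas is proved along with provability of true ones, since a
  true implication may owe its truth to a false antecedent.\<close>

lemma delta0_complete:
  "delta0 A \<Longrightarrow> (sat M e A \<longrightarrow> prov e A) \<and> (\<not> sat M e A \<longrightarrow> prov e (\<^bold>\<not> A))"
proof (induction arbitrary: e rule: delta0.induct)
  case (1 s t)
  have "prov e (s \<approx> t)" if "eval M e s = eval M e t"
    by (rule prov_atom[of e s t "V 0 \<approx> V 1"])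
      (use prov_thm[OF provable_logic[OF ax_eq_refl[of "V 0"]], of "\<lambda>_. eval M e t"] that in simp_all)
  moreover have "prov e (\<^bold>\<not> s \<approx> t)" if "eval M e s \<noteq> eval M e t"
    by (rule prov_atom[OF prov_ne[OF that]]) simp
  ultimately show ?case by auto
next
  case (2 s t)
  have "prov e (s \<prec> t)" if "eval M e s \<sqsubset> eval M e t"
    by (rule prov_atom[OF prov_less[OF that]]) simp
  moreover have "prov e (\<^bold>\<not> s \<prec> t)" if "\<not> eval M e s \<sqsubset> eval M e t"
    by (rule prov_atom[OF prov_not_less]) (use that ord_not_less in auto)
  ultimately show ?case by auto
next
  case 3
  have "prov e (\<^bold>\<not> Fls)" by (rule prov_thm[OF derives_empty[OF derives_refl]])
  then show ?case by simp
next
  case (4 A B)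
  have \<sigma>: "sigma1 (\<^bold>\<not> A)" "sigma1 (\<^bold>\<not> B)" "sigma1 (\<^bold>\<not> (A \<^bold>\<and> B))"
    by (intro sigma1.intros(1) delta0.intros 4(1,2))+
  have "prov e (\<^bold>\<not> (A \<^bold>\<and> B))" if "prov e (\<^bold>\<not> A)"
    by (rule prov_sem[OF that \<sigma>(1,3)]) simp
  moreover have "prov e (\<^bold>\<not> (A \<^bold>\<and> B))" if "prov e (\<^bold>\<not> B)"
    by (rule prov_sem[OF that \<sigma>(2,3)]) simp
  ultimately show ?case using 4(3,4)[of e] prov_and by auto
next
  case (5 A B)
  have \<sigma>: "sigma1 A" "sigma1 B" "sigma1 (A \<^bold>\<or> B)" "sigma1 ((\<^bold>\<not> A) \<^bold>\<and> \<^bold>\<not> B)" "sigma1 (\<^bold>\<not> (A \<^bold>\<or> B))"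
    by (intro sigma1.intros(1) delta0.intros 5(1,2))+
  have "prov e (A \<^bold>\<or> B)" if "prov e A" by (rule prov_sem[OF that \<sigma>(1,3)]) simp
  moreover have "prov e (A \<^bold>\<or> B)" if "prov e B" by (rule prov_sem[OF that \<sigma>(2,3)]) simp
  moreover have "prov e (\<^bold>\<not> (A \<^bold>\<or> B))" if "prov e (\<^bold>\<not> A)" "prov e (\<^bold>\<not> B)"
    by (rule prov_sem[OF prov_and[OF that] \<sigma>(4,5)]) simp
  ultimately show ?case using 5(3,4)[of e] by auto
next
  case (6 A B)
  have \<sigma>: "sigma1 (\<^bold>\<not> A)" "sigma1 B" "sigma1 (A \<^bold>\<rightarrow> B)" "sigma1 (A \<^bold>\<and> \<^bold>\<not> B)" "sigma1 (\<^bold>\<not> (A \<^bold>\<rightarrow> B))"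
    by (intro sigma1.intros(1) delta0.intros 6(1,2))+
  have "prov e (A \<^bold>\<rightarrow> B)" if "prov e (\<^bold>\<not> A)" by (rule prov_sem[OF that \<sigma>(1,3)]) simp
  moreover have "prov e (A \<^bold>\<rightarrow> B)" if "prov e B" by (rule prov_sem[OF that \<sigma>(2,3)]) simp
  moreover have "prov e (\<^bold>\<not> (A \<^bold>\<rightarrow> B))" if "prov e A" "prov e (\<^bold>\<not> B)"
    by (rule prov_sem[OF prov_and[OF that] \<sigma>(4,5)]) simp
  ultimately show ?case using 6(3,4)[of e] by auto
next
  case (7 A t)
  let ?B = "All (V 0 \<prec> tlift t \<^bold>\<rightarrow> A)"
  have "prov e (\<^bold>\<not> ?B)" if x: "x \<sqsubset> eval M e t" "\<not> sat M (case_nat x e) A" for x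
  proof -
    have "prov (case_nat x e) (V 0 \<prec> tlift t)"
      by (rule prov_atom[OF prov_less]) (use x in auto)
    moreover have "prov (case_nat x e) (\<^bold>\<not> A)" using 7 x by blast
    ultimately have "prov (case_nat x e) (V 0 \<prec> tlift t \<^bold>\<and> \<^bold>\<not> A)" by (rule prov_and)
    then have "prov (case_nat x e) (lift (\<^bold>\<not> ?B))"
    proof (rule prov_sem)
      show "sigma1 (V 0 \<prec> tlift t \<^bold>\<and> \<^bold>\<not> A)" "sigma1 (lift (\<^bold>\<not> ?B))"
        unfolding lift_def by (intro sigma1_subst sigma1.intros(1) delta0.intros 7(1))+
      fix M :: "nat struct" and e assume "sat M e (V 0 \<prec> tlift t \<^bold>\<and> \<^bold>\<not> A)"
      moreover have "case_nat (e 0) (\<lambda>i. e (Suc i)) = e" by (auto simp: fun_eq_iff split: nat.split)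
      moreover have "eval M e (tlift t) = eval M (\<lambda>i. e (Suc i)) t" by (simp add: tlift_def eval_tsubst)
      ultimately have "\<not> sat M (\<lambda>i. e (Suc i)) ?B" by auto
      then show "sat M e (lift (\<^bold>\<not> ?B))" by (simp add: lift_def sat_subst del: subst.simps(7) sat.simps(7))
    qed
    then show ?thesis by (simp only: dot_lift nat.case)
  qed
  moreover have "prov e ?B" if "sat M e ?B"
    by (rule prov_ball) (use 7 that in \<open>auto intro: sigma1.intros(1)\<close>)
  ultimately show ?case by auto
next
  case (8 A t)
  let ?B = "Ex (V 0 \<prec> tlift t \<^bold>\<and> A)"
  have "prov e ?B" if x: "x \<sqsubset> eval M e t" "sat M (case_nat x e) A" for x
  proof (rule prov_ex)
    have "prov (case_nat x e) (V 0 \<prec> tlift t)"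
      by (rule prov_atom[OF prov_less]) (use x in auto)
    then show "prov (case_nat x e) (V 0 \<prec> tlift t \<^bold>\<and> A)" using 8(2) x(2) prov_and by blast
    show "sigma1 (V 0 \<prec> tlift t \<^bold>\<and> A)" by (intro sigma1.intros(1) delta0.intros 8(1))
  qed
  moreover have "prov e (\<^bold>\<not> ?B)" if "\<not> sat M e ?B"
  proof -
    have "sigma1 (\<^bold>\<not> A)" by (intro sigma1.intros(1) delta0.intros 8(1))
    then have "prov e (All (V 0 \<prec> tlift t \<^bold>\<rightarrow> \<^bold>\<not> A))"
      by (intro prov_ball) (use 8 that in auto)
    then show ?thesis
    proof (rule prov_sem)
      show "sigma1 (All (V 0 \<prec> tlift t \<^bold>\<rightarrow> \<^bold>\<not> A))" "sigma1 (\<^bold>\<not> ?B)"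
        by (intro sigma1.intros(1) delta0.intros 8(1))+
    qed auto
  qed
  ultimately show ?case by auto
qed

theorem sigma1_complete: "sigma1 A \<Longrightarrow> sat M e A \<Longrightarrow> prov e A"
proof (induction arbitrary: e rule: sigma1.induct)
  case (1 A)
  then show ?case using delta0_complete by blast
next
  case (2 A B)
  then show ?case using prov_and by auto
next
  case (3 A B)
  note \<sigma> = 3(1,2) sigma1.intros(3)[OF 3(1,2)]
  have "prov e (A \<^bold>\<or> B)" if "prov e A" by (rule prov_sem[OF that \<sigma>(1,3)]) simp
  moreover have "prov e (A \<^bold>\<or> B)" if "prov e B" by (rule prov_sem[OF that \<sigma>(2,3)]) simp
  ultimately show ?case using 3 by auto
next
  case (4 A t)
  show ?case by (rule prov_ball) (use 4 in auto)
next
  case (5 A)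
  then show ?case using prov_ex by auto
qed

end

section \<open>Free variables and complexity of the arithmetized notions\<close>

lemma fv_exv [simp]: "fv (exv n A) = fv A - {n}"
  by (auto simp: exv_def fv_subst split: if_splits)

lemma fv_allv [simp]: "fv (allv n A) = fv A - {n}"
  by (auto simp: allv_def fv_subst split: if_splits)

lemma fv_app: "fv (app A ts) = (\<Union>i\<in>fv A. if i < length ts then tfv (ts ! i) else {i})"
  by (auto simp: app_def fv_subst split: if_splits)

lemma tfv_num [simp]: "tfv (num n) = {}"
  by (induction n) (auto simp: num.simps)

lemma tfv_tpair [simp]: "tfv \<langle>s, t\<rangle> = tfv s \<union> tfv t"
  by (auto simp: tpair_def)

lemma fv_beta: "fv beta = {0, 1, 2, 3}"
  by (auto simp: beta_def Let_def)

lemma fv_occurs: "fv occurs = {0, 1, 2, 3}"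
  by (auto simp: occurs_def fv_app fv_beta)

lemma fv_earlier [simp]: "fv (app occurs [V (Suc 0), V 2, V 3, t]) = {1, 2, 3} \<union> tfv t"
  by (auto simp: fv_app fv_occurs)

lemma fv_generated [simp]: "fv (generated A) = insert 0 (fv A - {0, 1, 2, 3, 4, 5})"
proof -
  have 1: "fv (app occurs [V (Suc 0), V 2, V 3, V 0]) = {0, 1, 2, 3}"
    "fv (app beta [V (Suc 0), V 2, V 4, V 5]) = {1, 2, 4, 5}"
    by (auto simp: fv_app fv_occurs fv_beta)
  define F where "F = fv (app A [V 5, V (Suc 0), V 2, V 4])"
  have "fv (generated A) = insert 0 (F - {1, 2, 3, 4, 5})"
    by (auto simp: generated_def 1 F_def[symmetric])
  also have "F - {1, 2, 3, 4, 5} = fv A - {0, 1, 2, 3, 4, 5}"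
    unfolding F_def by (auto simp: fv_app less_Suc_eq numeral_eq_Suc split: if_splits)
  finally show ?thesis .
qed

lemma fv_below [simp]: "fv (is_term_below d t) = tfv d \<union> tfv t" "fv (is_formula_below d t) = tfv d \<union> tfv t"
proof -
  have t: "fv (generated term_rules) = {0}" by (auto simp: term_rules_def)
  show *: "fv (is_term_below d t) = tfv d \<union> tfv t" for d t
    unfolding is_term_below_def fv_app t by simp
  have f: "fv (generated formula_rules) = {0}" by (auto simp: formula_rules_def *)
  show "fv (is_formula_below d t) = tfv d \<union> tfv t"
    unfolding is_formula_below_def fv_app f by simp
qed

lemma fv_is [simp]: "fv (is_term t) = tfv t" "fv (is_formula t) = tfv t" "fv (is_sentence t) = tfv t"
  by (simp_all add: is_term_def is_formula_def is_sentence_def fv_app insert_Diff_if)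

lemma fv_operations:
  "fv W \<subseteq> {..<4} \<Longrightarrow> fv (term_operation W) = {0}"
  "fv T \<subseteq> {0} \<Longrightarrow> fv U \<subseteq> {..<2} \<Longrightarrow> fv (formula_operation T U) = {0}"
proof -
  have W: "fv (app W [V 4, V 5, V 8, V 7]) \<subseteq> {4, 5, 7, 8}" if "fv W \<subseteq> {..<4}" for W
    using that by (auto simp: fv_app less_Suc_eq numeral_eq_Suc split: if_splits)
  show "fv (term_operation W) = {0}" if "fv W \<subseteq> {..<4}"
    using W[OF that] by (auto simp: term_operation_def)
  have T: "fv (app T [t]) \<subseteq> tfv t" if "fv T \<subseteq> {0}" for T t
    using that by (auto simp: fv_app split: if_splits)
  have U: "fv (app U [V 5, V 10]) \<subseteq> {5, 10}" if "fv U \<subseteq> {..<2}" for U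
    using that by (auto simp: fv_app less_Suc_eq numeral_eq_Suc split: if_splits)
  show "fv (formula_operation T U) = {0}" if "fv T \<subseteq> {0}" "fv U \<subseteq> {..<2}"
    using T[OF that(1), of "\<langle>V 4, \<langle>V 5, \<langle>V 8, V 9\<rangle>\<rangle>\<rangle>"] T[OF that(1), of "\<langle>V 4, \<langle>V 5, \<langle>V 10, V 11\<rangle>\<rangle>\<rangle>"] U[OF that(2)]
    by (auto simp: formula_operation_def)
qed

lemma fv_syntax [simp]:
  "fv (is_lift_term d s t) = tfv d \<union> tfv s \<union> tfv t" "fv (is_lift d s t) = tfv d \<union> tfv s \<union> tfv t"
  "fv (is_inst p s t) = tfv p \<union> tfv s \<union> tfv t" "fv (is_numeral s t) = tfv s \<union> tfv t"
proof -
  have l: "fv (term_operation lift_var) = {0}" by (rule fv_operations) (auto simp: lift_var_def)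
  have i: "fv (term_operation inst_var) = {0}" by (rule fv_operations) (auto simp: inst_var_def)
  show lt: "fv (is_lift_term d s t) = tfv d \<union> tfv s \<union> tfv t" for d s t
    by (auto simp: is_lift_term_def fv_app l)
  have "fv (formula_operation (term_operation lift_var) (V 1 \<approx> V 0)) = {0}"
    by (rule fv_operations) (auto simp: l)
  then show "fv (is_lift d s t) = tfv d \<union> tfv s \<union> tfv t" by (auto simp: is_lift_def fv_app)
  have "fv (formula_operation (term_operation inst_var) (is_lift_term (num 0) (V 0) (V 1))) = {0}"
    by (rule fv_operations) (auto simp: i lt)
  then show "fv (is_inst p s t) = tfv p \<union> tfv s \<union> tfv t" by (auto simp: is_inst_def fv_app)
  have n: "fv (generated (exs [4, 5] (V 0 \<approx> \<langle>num 0, cZero\<rangle> \<^bold>\<or> (V 0 \<approx> \<langle>Succ (V 4), cSucc (V 5)\<rangle> \<^bold>\<and> earlier \<langle>V 4, V 5\<rangle>)))) = {0}"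
    by auto
  show "fv (is_numeral s t) = tfv s \<union> tfv t"
    unfolding is_numeral_def fv_app n by simp
qed

lemma fv_logical_axiom: "fv is_logical_axiom \<subseteq> {0}"
  by (simp add: is_logical_axiom_def Let_def) blast

lemma fv_box: "fv (box \<alpha>) \<subseteq> insert 0 (fv \<alpha>)"
proof -
  let ?A = "subst (\<lambda>i. if i = 0 then V 0 else V (i + 10)) \<alpha>"
  have A: "fv ?A \<subseteq> {0} \<union> (\<lambda>i. i + 10) ` fv \<alpha>" by (auto simp: fv_subst split: if_splits)
  let ?B = "is_logical_axiom \<^bold>\<or> (is_sentence (V 0) \<^bold>\<and> ?A) \<^bold>\<or>
      exv 4 (earlier (cImp (V 4) (V 0)) \<^bold>\<and> earlier (V 4)) \<^bold>\<or> exv 4 (V 0 \<approx> cAll (V 4) \<^bold>\<and> earlier (V 4))"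
  have "fv ?B \<subseteq> {0, 1, 2, 3} \<union> (\<lambda>i. i + 10) ` fv \<alpha>"
    using A fv_logical_axiom by auto
  then have G: "fv (generated ?B) \<subseteq> {0} \<union> (\<lambda>i. i + 10) ` fv \<alpha>" unfolding fv_generated by blast
  define G where "G = generated ?B"
  have "box \<alpha> = subst (\<lambda>i. V (i - 10)) G" unfolding box_def G_def ..
  then have "fv (box \<alpha>) = (\<lambda>i. i - 10) ` fv G" by (auto simp: fv_subst)
  then show ?thesis using G unfolding G_def[symmetric] by auto
qed

lemma fv_dia: "fv (dia \<alpha> \<chi>) \<subseteq> fv \<alpha> - {0}"
proof -
  have "fv (subst (V(0 := num n)) (box \<alpha>)) = fv (box \<alpha>) - {0}" for n
    by (auto simp: fv_subst split: if_splits)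
  then show ?thesis using fv_box[of \<alpha>] by (auto simp: dia_def)
qed

lemma tfv_dotted_tm: "tfv (dotted_tm N d t) \<subseteq> {N + i |i. i + d \<in> tfv t}"
proof (induction t)
  case (V i)
  show ?case by (auto intro!: exI[of _ "i - d"])
qed auto

lemma tfv_dotted_fm: "tfv (dotted_fm N d A) \<subseteq> {N + i |i. i + d \<in> fv A}"
proof (induction A arbitrary: d)
  case (Eq s t)
  then show ?case using tfv_dotted_tm[of N d s] tfv_dotted_tm[of N d t] by auto
next
  case (Less s t)
  then show ?case using tfv_dotted_tm[of N d s] tfv_dotted_tm[of N d t] by auto
next
  case (All A)
  show ?case using All[of "Suc d"] by auto
next
  case (Ex A)
  show ?case using Ex[of "Suc d"] by auto
qed (simp_all, blast+)

lemma fv_u_is_code_of: "fv (u_is_code_of D) \<subseteq> insert 0 (fv D)"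
proof -
  define N where "N = Suc (Max (insert 0 (fv D)))"
  have "fv (foldr (\<lambda>j A. exv (N + j) (is_numeral (V j) (V (N + j)) \<^bold>\<and> A)) js B) \<subseteq>
      set js \<union> (fv B - (+) N ` set js)" for js B
    by (induction js) auto
  from this[of "sorted_list_of_set (fv D)" "V 0 \<approx> dotted_fm N 0 D"] show ?thesis
    unfolding u_is_code_of_def Let_def N_def[symmetric] using tfv_dotted_fm[of N 0 D] by fastforce
qed

lemma sigma1_generated: "sigma1 A \<Longrightarrow> sigma1 (generated A)"
proof -
  have beta: "sigma1 beta" unfolding beta_def Let_def by (intro sigma1_intros)
  then have "sigma1 occurs" unfolding occurs_def by (intro sigma1_intros)
  with beta show "sigma1 A \<Longrightarrow> sigma1 (generated A)"
    unfolding generated_def by (simp, intro sigma1_intros sigma1_allb) auto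
qed

lemma sigma1_earlier: "sigma1 (earlier t)"
  unfolding occurs_def beta_def Let_def by (intro sigma1_intros)

lemma sigma1_syntax: "sigma1 (is_term_below d t)" "sigma1 (is_formula_below d t)"
  "sigma1 (is_lift_term d s t)" "sigma1 (is_lift d s t)" "sigma1 (is_inst p s t)" "sigma1 (is_numeral s t)"
proof -
  note * = sigma1_intros sigma1_generated sigma1_earlier
  show 1: "sigma1 (is_term_below d t)" for d t
    unfolding is_term_below_def term_rules_def by (simp only: foldr.simps comp_apply id_apply) (intro *)
  show "sigma1 (is_formula_below d t)"
    unfolding is_formula_below_def formula_rules_def by (simp only: foldr.simps comp_apply id_apply) (intro * 1)
  have T: "sigma1 W \<Longrightarrow> sigma1 (term_operation W)" for W
    unfolding term_operation_def by (simp only: foldr.simps comp_apply id_apply) (intro *)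
  have F: "sigma1 T \<Longrightarrow> sigma1 U \<Longrightarrow> sigma1 (formula_operation T U)" for T U
    unfolding formula_operation_def by (simp only: foldr.simps comp_apply id_apply) (intro *)
  have l: "sigma1 lift_var" "sigma1 inst_var" unfolding lift_var_def inst_var_def by (intro *)+
  show 2: "sigma1 (is_lift_term d s t)" for d s t unfolding is_lift_term_def by (intro * T l)
  show "sigma1 (is_lift d s t)" unfolding is_lift_def by (intro * T F l)
  show "sigma1 (is_inst p s t)" unfolding is_inst_def by (intro * T F l 2)
  show "sigma1 (is_numeral s t)"
    unfolding is_numeral_def by (simp only: foldr.simps comp_apply id_apply) (intro *)
qed

lemma sigma1_is: "sigma1 (is_term t)" "sigma1 (is_formula t)" "sigma1 (is_sentence t)"
  unfolding is_term_def is_formula_def is_sentence_def by (intro sigma1_intros sigma1_syntax)+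

lemma sigma1_box: "sigma1 \<alpha> \<Longrightarrow> sigma1 (box \<alpha>)"
  unfolding box_def is_logical_axiom_def Let_def
  by (simp only: foldr.simps comp_apply id_apply)
    (intro sigma1_subst sigma1_intros sigma1_generated sigma1_earlier sigma1_syntax sigma1_is)

lemma sigma1_u_is_code_of: "sigma1 (u_is_code_of D)"
proof -
  have "sigma1 B \<Longrightarrow> sigma1 (foldr (\<lambda>j A. exv (N + j) (is_numeral (V j) (V (N + j)) \<^bold>\<and> A)) js B)" for N js B
    by (induction js) (auto intro: sigma1_intros sigma1_syntax)
  from this[OF sigma1_atoms(1)] show ?thesis unfolding u_is_code_of_def Let_def .
qed

section \<open>Arithmetical soundness\<close>

text \<open>\<open>dia\<close> at \<open>Tru\<close> denies provability of the negation of
  \<open>Tru\<close>, not of \<open>Fls\<close>; this is therefore the code that stands for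
  absurdity throughout.\<close>

abbreviation "falsum \<equiv> gn (\<^bold>\<not> Tru)"

abbreviation "inconsistency \<alpha> \<equiv> subst (V(0 := num falsum)) (box \<alpha>)"

lemma HA_contrapositive: "HA \<turnstile> B \<^bold>\<rightarrow> A \<Longrightarrow> HA \<turnstile> (\<^bold>\<not> A) \<^bold>\<rightarrow> (\<^bold>\<not> B)"
  by (meson HA_imp_iff derives_hyp derives_impI derives_mp derives_thm insertCI)

context pa_model
begin

lemma sat_inconsistency: "sat M e (inconsistency \<alpha>) \<longleftrightarrow> Pr (Axs \<alpha> e) (on falsum)"
proof -
  have "(\<lambda>i. eval M e ((V(0 := num falsum)) i)) = e(0 := on falsum)" by auto
  then have "sat M e (inconsistency \<alpha>) \<longleftrightarrow> sat M (e(0 := on falsum)) (box \<alpha>)" by (simp only: sat_subst)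
  then show ?thesis by simp
qed

text \<open>Consistency is not Sigma_1 but inconsistency is, so the implication is proved in HA
  contrapositively and then transported into the model. The premise ranges over all models for that
  reason; \<open>r\<close> and \<open>s\<close> let the two sides read one environment
  differently.\<close>

lemma Pr_con_mono:
  fixes r s :: "nat \<Rightarrow> nat"
  assumes "sigma1 \<alpha>" "sigma1 \<beta>" "\<And>x. HAx x \<Longrightarrow> X x"
    and "\<And>(M :: nat struct) e. pa_model M \<Longrightarrow> pa_model.Pr M (pa_model.Axs M \<beta> (\<lambda>i. e (s i))) (pa_model.on M falsum) \<Longrightarrow>
      pa_model.Pr M (pa_model.Axs M \<alpha> (\<lambda>i. e (r i))) (pa_model.on M falsum)"
  shows "Pr X (kimp (dot (\<lambda>i. e (r i)) (dia \<alpha> Tru)) (dot (\<lambda>i. e (s i)) (dia \<beta> Tru)))"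
proof -
  have "HA \<turnstile> subst (\<lambda>i. V (s i)) (inconsistency \<beta>) \<^bold>\<rightarrow> subst (\<lambda>i. V (r i)) (inconsistency \<alpha>)"
  proof (rule HA_sem)
    fix N :: "nat struct" and e
    assume N: "pa_model N" and "sat N e (subst (\<lambda>i. V (s i)) (inconsistency \<beta>))"
    then show "sat N e (subst (\<lambda>i. V (r i)) (inconsistency \<alpha>))"
      unfolding sat_subst[of N e "\<lambda>i. V (s i)"] sat_subst[of N e "\<lambda>i. V (r i)"] eval.simps
        pa_model.sat_inconsistency[OF N] using assms(4) by blast
  qed (intro sigma1_subst sigma1_box assms)+
  then have "HA \<turnstile> subst (\<lambda>i. V (r i)) (dia \<alpha> Tru) \<^bold>\<rightarrow> subst (\<lambda>i. V (s i)) (dia \<beta> Tru)"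
    unfolding dia_def subst.simps by (rule HA_contrapositive)
  then have "Pr X (dot e (subst (\<lambda>i. V (r i)) (dia \<alpha> Tru) \<^bold>\<rightarrow> subst (\<lambda>i. V (s i)) (dia \<beta> Tru)))"
    using assms(3) by (rule Pr_dot)
  then show ?thesis by (simp only: cfm.simps dot_rename)
qed

end

lemma provable_allv: "T \<turnstile> A \<Longrightarrow> T \<turnstile> allv n A"
  unfolding allv_def by (intro provable_gen provable_subst)

lemma HA_curry: "HA \<turnstile> (A \<^bold>\<and> B) \<^bold>\<rightarrow> C \<Longrightarrow> HA \<turnstile> A \<^bold>\<rightarrow> B \<^bold>\<rightarrow> C"
  by (rule derives_empty) (meson derives_andI derives_hyp derives_impI derives_mp derives_thm insertCI)

lemma theory_inclusionI:
  assumes "sigma1 \<alpha>" "sigma1 \<beta>"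
    and "\<And>(M :: nat struct) e x. pa_model M \<Longrightarrow> pa_model.Axs M \<beta> e x \<Longrightarrow> pa_model.Pr M (pa_model.Axs M \<alpha> e) x"
  shows "HA \<turnstile> theory_inclusion \<beta> \<alpha>"
proof -
  have "HA \<turnstile> (is_sentence (V 0) \<^bold>\<and> box \<beta>) \<^bold>\<rightarrow> box \<alpha>"
  proof (rule HA_sem)
    fix N :: "nat struct" and e
    assume N: "pa_model N" and "sat N e (is_sentence (V 0) \<^bold>\<and> box \<beta>)"
    then have "pa_model.Pr N (pa_model.Axs N \<beta> e) (e 0)" by (simp add: pa_model.sat_box)
    then have "pa_model.Pr N (pa_model.Axs N \<alpha> e) (e 0)"
      using assms(3)[OF N] by (rule pa_model.Pr_Axs_subset[OF N])
    then show "sat N e (box \<alpha>)" using N by (simp add: pa_model.sat_box)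
  qed (intro sigma1.intros(2) sigma1_is sigma1_box assms)+
  then have "HA \<turnstile> is_sentence (V 0) \<^bold>\<rightarrow> box \<beta> \<^bold>\<rightarrow> box \<alpha>" by (rule HA_curry)
  moreover have "HA \<turnstile> A \<Longrightarrow> HA \<turnstile> alls ns A" for ns A
    by (induction ns) (auto intro: provable_allv)
  ultimately show ?thesis unfolding theory_inclusion_def Let_def by (intro provable_allv)
qed

section \<open>Modal formulas as theories over an environment\<close>

locale realization =
  fixes \<Sigma> :: "'r signature" and R :: "'r \<Rightarrow> mtm list \<Rightarrow> fm" and \<eta> :: fm
  assumes standard: "standard_axiomatization_HA \<eta>"
    and infinitary: "infinitary_realization \<Sigma> R"
begin

abbreviation "rl \<phi> \<equiv> realize R \<eta> \<phi>"

lemma atom: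
  assumes "S \<in> rel_syms \<Sigma>" "length ts = rel_arity \<Sigma> S"
  obtains \<sigma> where "sigma1 \<sigma>" "fv \<sigma> \<subseteq> {0..length ts}" "R S ts = app \<sigma> (V 0 # map realize_mtm ts)"
    "\<And>f. R S (map f ts) = app \<sigma> (V 0 # map realize_mtm (map f ts))"
proof -
  obtain \<sigma> where \<sigma>: "sigma1 \<sigma>" "fv \<sigma> \<subseteq> {0..rel_arity \<Sigma> S}"
    "\<And>ts. length ts = rel_arity \<Sigma> S \<Longrightarrow> R S ts = app \<sigma> (V 0 # map realize_mtm ts)"
    using infinitary assms(1) unfolding infinitary_realization_def by blast
  show thesis by (rule that[of \<sigma>]) (simp_all add: \<sigma> assms(2) del: map_map)
qed

lemma sigma1_rl: "wf_qfm \<Sigma> \<phi> \<Longrightarrow> sigma1 (rl \<phi>)"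
proof (induction \<phi>)
  case QTop
  then show ?case using standard by (simp add: standard_axiomatization_HA_def)
next
  case (QAtom S ts)
  then obtain \<sigma> where "sigma1 \<sigma>" "R S ts = app \<sigma> (V 0 # map realize_mtm ts)" using atom by (metis wf_qfm.simps(2))
  then show ?case using standard by (auto simp: standard_axiomatization_HA_def intro: sigma1_intros)
next
  case (QDia \<phi>)
  then show ?case using standard by (auto simp: standard_axiomatization_HA_def intro: sigma1_intros sigma1_u_is_code_of)
qed (auto intro: sigma1_intros)

abbreviation "fvars \<phi> \<equiv> {0} \<union> {yvar k |k. k \<in> qfv \<phi>} \<union> {zvar k |k. k \<in> qcons \<phi>}"

lemma fv_rl: "wf_qfm \<Sigma> \<phi> \<Longrightarrow> fv (rl \<phi>) \<subseteq> fvars \<phi>"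
proof (induction \<phi>)
  case QTop
  then show ?case using standard by (auto simp: standard_axiomatization_HA_def)
next
  case (QAtom S ts)
  then obtain \<sigma> where \<sigma>: "fv \<sigma> \<subseteq> {0..length ts}" "R S ts = app \<sigma> (V 0 # map realize_mtm ts)"
    using atom by (metis wf_qfm.simps(2))
  have "tfv ((V 0 # map realize_mtm ts) ! i) \<subseteq> fvars (QAtom S ts)" if "i \<le> length ts" for i
  proof (cases i)
    case (Suc j)
    then have j: "j < length ts" using that by simp
    then have "ts ! j \<in> set ts" by simp
    with Suc j show ?thesis by (cases "ts ! j") auto
  qed simp
  then have "(if i < length (V 0 # map realize_mtm ts) then tfv ((V 0 # map realize_mtm ts) ! i) else {i})
      \<subseteq> fvars (QAtom S ts)" if "i \<in> fv \<sigma>" for i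
    using that \<sigma>(1) by (simp add: less_Suc_eq_le) (metis atLeastAtMost_iff subset_iff)
  then have "fv (R S ts) \<subseteq> fvars (QAtom S ts)" unfolding \<sigma>(2) fv_app by (rule UN_least)
  moreover have "fv \<eta> \<subseteq> {0}" using standard by (simp add: standard_axiomatization_HA_def)
  ultimately show ?case unfolding realize.simps fv.simps by blast
next
  case (QDia \<phi>)
  have "fv (u_is_code_of (dia (rl \<phi>) Tru)) \<subseteq> insert 0 (fv (rl \<phi>))"
    using fv_u_is_code_of[of "dia (rl \<phi>) Tru"] fv_dia[of "rl \<phi>" Tru] by blast
  moreover have "fv \<eta> \<subseteq> {0}" using standard by (simp add: standard_axiomatization_HA_def)
  ultimately show ?case using QDia unfolding realize.simps fv.simps qfv.simps qcons.simps wf_qfm.simps by blast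
next
  case (QAll x \<phi>)
  then show ?case by auto
qed auto

end

locale realization_model = realization \<Sigma> R \<eta> + pa_model M
  for \<Sigma> :: "'r signature" and R \<eta> and M :: "'m struct"
begin

abbreviation "th \<phi> e \<equiv> Axs (rl \<phi>) e"

lemma th_cong:
  assumes "wf_qfm \<Sigma> \<phi>" "\<And>k. k \<in> qfv \<phi> \<Longrightarrow> e (yvar k) = e' (yvar k)" "\<And>k. k \<in> qcons \<phi> \<Longrightarrow> e (zvar k) = e' (zvar k)"
  shows "th \<phi> e = th \<phi> e'"
proof -
  have "sat M (e(0 := x)) (rl \<phi>) = sat M (e'(0 := x)) (rl \<phi>)" for x
    by (rule sat_cong) (use fv_rl[OF assms(1)] assms(2,3) in fastforce)
  then show ?thesis by (simp add: Axs_def fun_eq_iff)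
qed

lemma th_Top: "th QTop e = HAx"
  using Axs_HA[OF standard] by simp

lemma sat_\<eta>: "Sent x \<Longrightarrow> sat M (e(0 := x)) \<eta> \<longleftrightarrow> HAx x"
  using th_Top[of e] by (auto simp: Axs_def fun_eq_iff)

lemma th_Atom: "th (QAtom S ts) e x \<longleftrightarrow> HAx x \<or> (Sent x \<and> sat M (e(0 := x)) (R S ts))"
  using sat_\<eta> by (auto simp: Axs_def HAx_def)

lemma th_And: "th (QAnd \<phi> \<psi>) e x \<longleftrightarrow> th \<phi> e x \<or> th \<psi> e x"
  by (auto simp: Axs_def)

lemma th_All: "th (QAll i \<phi>) e x \<longleftrightarrow> (\<exists>a. th \<phi> (e(yvar i := a)) x)"
  by (auto simp: Axs_def fun_upd_twist)

lemma th_Dia: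
  assumes "wf_qfm \<Sigma> \<phi>"
  shows "th (QDia \<phi>) e x \<longleftrightarrow> HAx x \<or> x = dot e (dia (rl \<phi>) Tru)"
proof -
  have 0: "0 \<notin> fv (dia (rl \<phi>) Tru)" using fv_dia by blast
  have "dot (e(0 := x)) (dia (rl \<phi>) Tru) = dot e (dia (rl \<phi>) Tru)"
    by (rule cfm_cong) (use 0 in \<open>auto split: if_splits\<close>)
  then show ?thesis
    using sat_\<eta> Sent_dot[of e "dia (rl \<phi>) Tru"] unfolding Axs_def realize.simps sat.simps
    by (auto simp: sat_u_is_code_of[OF 0] HAx_def)
qed

lemma HAx_th: "wf_qfm \<Sigma> \<phi> \<Longrightarrow> HAx x \<Longrightarrow> th \<phi> e x"
  by (induction \<phi> arbitrary: e) (auto simp: th_Top th_Atom th_And th_All th_Dia simp del: realize.simps)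

end

lemma even_ne_odd [simp]: "2 * k \<noteq> Suc (2 * l)" "Suc (2 * l) \<noteq> 2 * k" for k l :: nat
  by presburger+

lemma qsubst_idle: "x \<notin> qfv \<phi> \<Longrightarrow> qsubst x t \<phi> = \<phi>"
  by (induction \<phi>) (auto intro: map_idI)

lemma wf_qsubst: "wf_mtm \<Sigma> t \<Longrightarrow> wf_qfm \<Sigma> \<phi> \<Longrightarrow> wf_qfm \<Sigma> (qsubst x t \<phi>)"
  by (induction \<phi>) auto

lemma free_for_MCon: "free_for (MCon c) x \<phi>"
  by (induction \<phi>) auto

fun mvar :: "mtm \<Rightarrow> nat" where
  "mvar (MVar k) = yvar k"
| "mvar (MCon k) = zvar k"

lemma realize_mtm_mvar: "realize_mtm t = V (mvar t)"
  by (cases t) auto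

lemma mvar_inject [simp]: "mvar s = mvar t \<longleftrightarrow> s = t"
  by (cases s; cases t) auto

lemma mvar_ne_0 [simp]: "mvar t \<noteq> 0"
  by (cases t) auto

context realization
begin

lemma realization_modelI: "pa_model M \<Longrightarrow> realization_model \<Sigma> R \<eta> M"
  by (intro realization_model.intro realization_axioms)

text \<open>The two theories prove each other's axioms but need not coincide: under a diamond,
  substitution changes the realized formula and hence the consistency sentence that serves as
  axiom.\<close>

lemma th_subst:
  fixes M :: "nat struct"
  assumes "wf_qfm \<Sigma> \<phi>" "wf_mtm \<Sigma> t" "free_for t x \<phi>" "pa_model M"
  shows "(\<forall>u. pa_model.Axs M (rl (qsubst x t \<phi>)) e u \<longrightarrow>
            pa_model.Pr M (pa_model.Axs M (rl \<phi>) (e(yvar x := e (mvar t)))) u) \<and>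
         (\<forall>u. pa_model.Axs M (rl \<phi>) (e(yvar x := e (mvar t))) u \<longrightarrow>
            pa_model.Pr M (pa_model.Axs M (rl (qsubst x t \<phi>)) e) u)"
  using assms
proof (induction \<phi> arbitrary: M e)
  case QTop
  then interpret realization_model \<Sigma> R \<eta> M by (intro realization_modelI)
  show ?case using Pr_ax by (simp add: th_Top[simplified])
next
  case (QAtom S ts)
  then interpret realization_model \<Sigma> R \<eta> M by (intro realization_modelI)
  let ?f = "\<lambda>s. if s = MVar x then t else s"
  let ?e = "e(yvar x := e (mvar t))"
  obtain \<sigma> where \<sigma>: "fv \<sigma> \<subseteq> {0..length ts}" "R S ts = app \<sigma> (V 0 # map realize_mtm ts)"
    "\<And>f. R S (map f ts) = app \<sigma> (V 0 # map realize_mtm (map f ts))" "sigma1 \<sigma>"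
    using atom[of S ts] QAtom.prems(1) unfolding wf_qfm.simps by metis
  have "sat M (e(0 := u)) (R S (map ?f ts)) = sat M (?e(0 := u)) (R S ts)" for u
    unfolding \<sigma>(3)[of ?f] \<sigma>(2) sat_app
  proof (rule sat_cong)
    fix i assume "i \<in> fv \<sigma>"
    then have i: "i \<le> length ts" using \<sigma>(1) by auto
    show "(if i < length (V 0 # map realize_mtm (map ?f ts)) then eval M (e(0 := u)) ((V 0 # map realize_mtm (map ?f ts)) ! i)
        else (e(0 := u)) i) = (if i < length (V 0 # map realize_mtm ts) then eval M (?e(0 := u)) ((V 0 # map realize_mtm ts) ! i)
        else (?e(0 := u)) i)"
    proof (cases i)
      case (Suc j)
      then have "j < length ts" using i by simp
      moreover have "mvar s = yvar x \<longleftrightarrow> s = MVar x" for s using mvar_inject[of s "MVar x"] by simp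
      ultimately show ?thesis using Suc by (simp add: realize_mtm_mvar)
    qed simp
  qed
  then have eq: "th (QAtom S (map ?f ts)) e = th (QAtom S ts) ?e"
    unfolding th_Atom fun_eq_iff by blast
  show ?case unfolding qsubst.simps eq using Pr_ax by blast
next
  case (QAnd \<phi> \<psi>)
  then interpret realization_model \<Sigma> R \<eta> M by (intro realization_modelI)
  have *: "Pr (th \<phi> e) u \<Longrightarrow> Pr (th (QAnd \<phi> \<psi>) e) u" "Pr (th \<psi> e) u \<Longrightarrow> Pr (th (QAnd \<phi> \<psi>) e) u" for \<phi> \<psi> e u
    by (erule Pr_mono, simp add: th_And del: realize.simps)+
  have wf: "wf_qfm \<Sigma> \<phi>" "wf_qfm \<Sigma> \<psi>" "free_for t x \<phi>" "free_for t x \<psi>" using QAnd.prems by auto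
  show ?case unfolding qsubst.simps
    using QAnd.IH(1)[OF wf(1) QAnd.prems(2) wf(3) QAnd.prems(4), of e]
      QAnd.IH(2)[OF wf(2) QAnd.prems(2) wf(4) QAnd.prems(4), of e] * unfolding th_And by blast
next
  case (QAll y \<phi>)
  then interpret realization_model \<Sigma> R \<eta> M by (intro realization_modelI)
  let ?e = "e(yvar x := e (mvar t))"
  show ?case
  proof (cases "x \<in> qfv (QAll y \<phi>)")
    case False
    then have "qsubst x t (QAll y \<phi>) = QAll y \<phi>" by (rule qsubst_idle)
    moreover have "th (QAll y \<phi>) ?e = th (QAll y \<phi>) e"
      by (rule th_cong[OF QAll.prems(1)]) (use False in auto)
    ultimately show ?thesis using Pr_ax by metis
  next
    case True
    then have xy: "x \<noteq> y" and t: "t \<noteq> MVar y" and ff: "free_for t x \<phi>" and wf: "wf_qfm \<Sigma> \<phi>"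
      using QAll.prems by auto
    have "mvar t \<noteq> yvar y" using t mvar_inject[of t "MVar y"] by simp
    then have upd: "e(yvar y := a, yvar x := (e(yvar y := a)) (mvar t)) = ?e(yvar y := a)" for a
      using xy by (auto simp: fun_upd_twist)
    have IH: "th (qsubst x t \<phi>) (e(yvar y := a)) u \<Longrightarrow> Pr (th \<phi> (?e(yvar y := a))) u"
      "th \<phi> (?e(yvar y := a)) u \<Longrightarrow> Pr (th (qsubst x t \<phi>) (e(yvar y := a))) u" for a u
      using QAll.IH[OF wf QAll.prems(2) ff QAll.prems(4), of "e(yvar y := a)"] unfolding upd by blast+
    have up: "Pr (th \<phi> (e(yvar y := a))) u \<Longrightarrow> Pr (th (QAll y \<phi>) e) u" for \<phi> e a u
      by (erule Pr_mono) (auto simp: th_All simp del: realize.simps)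
    have q: "qsubst x t (QAll y \<phi>) = QAll y (qsubst x t \<phi>)" using xy by simp
    show ?thesis unfolding q
    proof (intro conjI allI impI)
      fix u assume "th (QAll y (qsubst x t \<phi>)) e u"
      then obtain a where "th (qsubst x t \<phi>) (e(yvar y := a)) u" unfolding th_All by blast
      then show "Pr (th (QAll y \<phi>) ?e) u" using IH(1) up by blast
    next
      fix u assume "th (QAll y \<phi>) ?e u"
      then obtain a where "th \<phi> (?e(yvar y := a)) u" unfolding th_All by blast
      then show "Pr (th (QAll y (qsubst x t \<phi>)) e) u" using IH(2) up by blast
    qed
  qed
next
  case (QDia \<phi>)
  then interpret realization_model \<Sigma> R \<eta> M by (intro realization_modelI)
  let ?e = "e(yvar x := e (mvar t))"
  let ?\<phi> = "qsubst x t \<phi>"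
  have wf: "wf_qfm \<Sigma> \<phi>" "wf_qfm \<Sigma> ?\<phi>" "free_for t x \<phi>" using QDia.prems wf_qsubst by auto
  \<comment> \<open>Updating the environment at \<open>yvar x\<close> amounts to reading its
    variables through \<open>?r\<close>. Both consistency sentences thus become dotted formulas over
    one environment, as \<open>Pr_con_mono\<close> requires.\<close>
  let ?r = "\<lambda>i. if i = yvar x then mvar t else i"
  have r: "(\<lambda>i. e (?r i)) = e(yvar x := e (mvar t))" for e :: "nat \<Rightarrow> nat" by (simp add: fun_eq_iff)
  have IH: "pa_model.Pr N (pa_model.Axs N (rl ?\<phi>) e) u \<longleftrightarrow> pa_model.Pr N (pa_model.Axs N (rl \<phi>) (e(yvar x := e (mvar t)))) u"
    if N: "pa_model N" for N :: "nat struct" and e u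
  proof
    note * = QDia.IH[OF wf(1) QDia.prems(2) wf(3) N, of e]
    show "pa_model.Pr N (pa_model.Axs N (rl ?\<phi>) e) u \<Longrightarrow>
        pa_model.Pr N (pa_model.Axs N (rl \<phi>) (e(yvar x := e (mvar t)))) u"
      by (erule pa_model.Pr_Axs_subset[OF N]) (use * in blast)
    show "pa_model.Pr N (pa_model.Axs N (rl \<phi>) (e(yvar x := e (mvar t)))) u \<Longrightarrow>
        pa_model.Pr N (pa_model.Axs N (rl ?\<phi>) e) u"
      by (erule pa_model.Pr_Axs_subset[OF N]) (use * in blast)
  qed
  have r': "e (?r i) = ?e i" for i by simp
  note \<sigma> = sigma1_rl[OF wf(1)] sigma1_rl[OF wf(2)]
  have "Pr (th (QDia \<phi>) ?e) (dot e (dia (rl ?\<phi>) Tru))"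
  proof (rule Pr_mp)
    have "Pr (th (QDia \<phi>) ?e) (kimp (dot (\<lambda>i. e (?r i)) (dia (rl \<phi>) Tru)) (dot (\<lambda>i. e i) (dia (rl ?\<phi>) Tru)))"
    proof (rule Pr_con_mono[OF \<sigma>, where r = ?r and s = "\<lambda>i. i"])
      show "HAx u \<Longrightarrow> th (QDia \<phi>) ?e u" for u using th_Dia[OF wf(1)] by blast
    qed (simp only: IH r)
    then show "Pr (th (QDia \<phi>) ?e) (kimp (dot ?e (dia (rl \<phi>) Tru)) (dot e (dia (rl ?\<phi>) Tru)))"
      by (simp only: r')
    show "Pr (th (QDia \<phi>) ?e) (dot ?e (dia (rl \<phi>) Tru))" using Pr_ax th_Dia[OF wf(1)] by blast
  qed
  moreover have "Pr (th (QDia ?\<phi>) e) (dot ?e (dia (rl \<phi>) Tru))"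
  proof (rule Pr_mp)
    have "Pr (th (QDia ?\<phi>) e) (kimp (dot (\<lambda>i. e i) (dia (rl ?\<phi>) Tru)) (dot (\<lambda>i. e (?r i)) (dia (rl \<phi>) Tru)))"
    proof (rule Pr_con_mono[OF \<sigma>(2,1), where r = "\<lambda>i. i" and s = ?r])
      show "HAx u \<Longrightarrow> th (QDia ?\<phi>) e u" for u using th_Dia[OF wf(2)] by blast
    qed (simp only: IH r)
    then show "Pr (th (QDia ?\<phi>) e) (kimp (dot e (dia (rl ?\<phi>) Tru)) (dot ?e (dia (rl \<phi>) Tru)))"
      by (simp only: r')
    show "Pr (th (QDia ?\<phi>) e) (dot e (dia (rl ?\<phi>) Tru))" using Pr_ax th_Dia[OF wf(2)] by blast
  qed
  ultimately show ?case unfolding qsubst.simps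
    using th_Dia[OF wf(1)] th_Dia[OF wf(2)] Pr_ax by metis
qed

text \<open>All models are taken together: for the diamond rule the inclusion has to hold in every
  model in order to become a theorem of HA, which can then be used inside a given one.\<close>

definition entails :: "'r qfm \<Rightarrow> 'r qfm \<Rightarrow> bool" where
  "entails \<phi> \<psi> \<longleftrightarrow> (\<forall>(M :: nat struct) e u. pa_model M \<longrightarrow>
    pa_model.Pr M (pa_model.Axs M (rl \<psi>) e) u \<longrightarrow> pa_model.Pr M (pa_model.Axs M (rl \<phi>) e) u)"

lemma entailsI:
  assumes "\<And>(M :: nat struct) e u. pa_model M \<Longrightarrow> pa_model.Axs M (rl \<psi>) e u \<Longrightarrow> pa_model.Pr M (pa_model.Axs M (rl \<phi>) e) u"
  shows "entails \<phi> \<psi>"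
  unfolding entails_def
proof (intro allI impI)
  fix M :: "nat struct" and e u
  assume M: "pa_model M" and u: "pa_model.Pr M (pa_model.Axs M (rl \<psi>) e) u"
  from u show "pa_model.Pr M (pa_model.Axs M (rl \<phi>) e) u"
    by (rule pa_model.Pr_Axs_subset[OF M]) (rule assms[OF M])
qed

lemma Pr_subst:
  assumes "wf_qfm \<Sigma> \<phi>" "wf_mtm \<Sigma> t" "free_for t x \<phi>" "pa_model (M :: nat struct)"
  shows "pa_model.Pr M (pa_model.Axs M (rl (qsubst x t \<phi>)) e) u \<longleftrightarrow>
    pa_model.Pr M (pa_model.Axs M (rl \<phi>) (e(yvar x := e (mvar t)))) u"
proof
  show "pa_model.Pr M (pa_model.Axs M (rl (qsubst x t \<phi>)) e) u \<Longrightarrow>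
      pa_model.Pr M (pa_model.Axs M (rl \<phi>) (e(yvar x := e (mvar t)))) u"
    by (erule pa_model.Pr_Axs_subset[OF assms(4)]) (use th_subst[OF assms, of e] in blast)
  show "pa_model.Pr M (pa_model.Axs M (rl \<phi>) (e(yvar x := e (mvar t)))) u \<Longrightarrow>
      pa_model.Pr M (pa_model.Axs M (rl (qsubst x t \<phi>)) e) u"
    by (erule pa_model.Pr_Axs_subset[OF assms(4)]) (use th_subst[OF assms, of e] in blast)
qed

lemma entailsD:
  "entails \<phi> \<psi> \<Longrightarrow> pa_model (M :: nat struct) \<Longrightarrow> pa_model.Axs M (rl \<psi>) e u \<Longrightarrow> pa_model.Pr M (pa_model.Axs M (rl \<phi>) e) u"
  unfolding entails_def using pa_model.Pr_ax[of M "pa_model.Axs M (rl \<psi>) e" u] by simp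

lemma qrc1_entails: "qrc1 \<Sigma> \<phi> \<psi> \<Longrightarrow> wf_qfm \<Sigma> \<phi> \<and> wf_qfm \<Sigma> \<psi> \<and> entails \<phi> \<psi>"
proof (induction rule: qrc1.induct)
  case (qrc1_top \<phi>)
  have "entails \<phi> QTop"
  proof (rule entailsI)
    fix M :: "nat struct" and e u assume "pa_model M" and u: "pa_model.Axs M (rl QTop) e u"
    then interpret realization_model \<Sigma> R \<eta> M by (intro realization_modelI)
    show "Pr (th \<phi> e) u" using u HAx_th[OF qrc1_top] Pr_ax unfolding th_Top by blast
  qed
  then show ?case using qrc1_top by simp
next
  case (qrc1_conjE1 \<phi> \<psi>)
  have "entails (QAnd \<phi> \<psi>) \<phi>"
  proof (rule entailsI)
    fix M :: "nat struct" and e u assume "pa_model M" and u: "pa_model.Axs M (rl \<phi>) e u"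
    then interpret realization_model \<Sigma> R \<eta> M by (intro realization_modelI)
    have "th (QAnd \<phi> \<psi>) e u" unfolding th_And using u by (rule disjI1)
    then show "Pr (th (QAnd \<phi> \<psi>) e) u" by (rule Pr_ax)
  qed
  then show ?case using qrc1_conjE1 by simp
next
  case (qrc1_conjE2 \<phi> \<psi>)
  have "entails (QAnd \<phi> \<psi>) \<psi>"
  proof (rule entailsI)
    fix M :: "nat struct" and e u assume "pa_model M" and u: "pa_model.Axs M (rl \<psi>) e u"
    then interpret realization_model \<Sigma> R \<eta> M by (intro realization_modelI)
    have "th (QAnd \<phi> \<psi>) e u" unfolding th_And using u by (rule disjI2)
    then show "Pr (th (QAnd \<phi> \<psi>) e) u" by (rule Pr_ax)
  qed
  then show ?case using qrc1_conjE2 by simp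
next
  case (qrc1_conjI \<phi> \<psi> \<chi>)
  have "entails \<phi> (QAnd \<psi> \<chi>)"
  proof (rule entailsI)
    fix M :: "nat struct" and e u assume M: "pa_model M" and u: "pa_model.Axs M (rl (QAnd \<psi> \<chi>)) e u"
    then interpret realization_model \<Sigma> R \<eta> M by (intro realization_modelI)
    have "entails \<phi> \<psi>" "entails \<phi> \<chi>" using qrc1_conjI.IH by simp_all
    then show "Pr (th \<phi> e) u" using u entailsD[OF _ M] unfolding th_And by metis
  qed
  then show ?case using qrc1_conjI by simp
next
  case (qrc1_nec \<phi> \<psi>)
  have "entails (QDia \<phi>) (QDia \<psi>)"
  proof (rule entailsI)
    fix M :: "nat struct" and e u assume "pa_model M" and u: "pa_model.Axs M (rl (QDia \<psi>)) e u"
    then interpret realization_model \<Sigma> R \<eta> M by (intro realization_modelI)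
    have wf: "wf_qfm \<Sigma> \<phi>" "wf_qfm \<Sigma> \<psi>" using qrc1_nec by auto
    have "Pr (th (QDia \<phi>) e) (kimp (dot (\<lambda>i. e i) (dia (rl \<phi>) Tru)) (dot (\<lambda>i. e i) (dia (rl \<psi>) Tru)))"
    proof (rule Pr_con_mono[OF sigma1_rl[OF wf(1)] sigma1_rl[OF wf(2)], where r = "\<lambda>i. i" and s = "\<lambda>i. i"])
      show "HAx u \<Longrightarrow> th (QDia \<phi>) e u" for u using th_Dia[OF wf(1)] by blast
    next
      have "entails \<phi> \<psi>" using qrc1_nec.IH by simp
      then show "pa_model.Pr N (pa_model.Axs N (rl \<psi>) (\<lambda>i. e i)) (pa_model.on N falsum) \<Longrightarrow>
        pa_model.Pr N (pa_model.Axs N (rl \<phi>) (\<lambda>i. e i)) (pa_model.on N falsum)" if "pa_model N"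
        for N :: "nat struct" and e using that unfolding entails_def by blast
    qed
    moreover have "Pr (th (QDia \<phi>) e) (dot e (dia (rl \<phi>) Tru))" using Pr_ax th_Dia[OF wf(1)] by blast
    ultimately have "Pr (th (QDia \<phi>) e) (dot e (dia (rl \<psi>) Tru))" by (rule Pr_mp)
    moreover have "Pr (th (QDia \<phi>) e) u" if "HAx u" using that th_Dia[OF wf(1)] by (intro Pr_ax) simp
    ultimately show "Pr (th (QDia \<phi>) e) u" using u unfolding th_Dia[OF wf(2)] by (elim disjE) simp_all
  qed
  then show ?case using qrc1_nec by simp
next
  case (qrc1_trans \<phi>)
  have wf: "wf_qfm \<Sigma> \<phi>" "wf_qfm \<Sigma> (QDia \<phi>)" using qrc1_trans by auto
  \<comment> \<open>An inconsistency of the theory of \<open>\<phi>\<close> is a true Sigma_1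
    statement, so HA proves it; the axiom of the diamond denies it, and the theory of the diamond is
    inconsistent too.\<close>
  have inc: "pa_model.Pr N (pa_model.Axs N (rl (QDia \<phi>)) e) (pa_model.on N falsum)"
    if "pa_model N" and inc: "pa_model.Pr N (pa_model.Axs N (rl \<phi>) e) (pa_model.on N falsum)" for N :: "nat struct" and e
  proof -
    from that interpret realization_model \<Sigma> R \<eta> N by (intro realization_modelI)
    have "prov e (inconsistency (rl \<phi>))"
    proof (rule sigma1_complete)
      show "sigma1 (inconsistency (rl \<phi>))" by (intro sigma1_subst sigma1_box sigma1_rl wf)
      show "sat N e (inconsistency (rl \<phi>))" unfolding sat_inconsistency by (rule inc)
    qed
    then have 1: "Pr (th (QDia \<phi>) e) (dot e (inconsistency (rl \<phi>)))"
      by (rule Pr_mono) (rule HAx_th[OF wf(2)])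
    have "Pr (th (QDia \<phi>) e) (dot e (dia (rl \<phi>) Tru))" using Pr_ax th_Dia[OF wf(1)] by blast
    then have "Pr (th (QDia \<phi>) e) (kimp (dot e (inconsistency (rl \<phi>))) (dot e Fls))"
      unfolding dia_def by (simp only: cfm.simps)
    then have fls: "Pr (th (QDia \<phi>) e) (dot e Fls)" using 1 by (rule Pr_mp)
    have "Pr (th (QDia \<phi>) e) (dot e (\<^bold>\<not> Tru))"
    proof (rule Pr_dot_mp[OF provable_logic[OF ax_flsE] _ fls])
      show "HAx x \<Longrightarrow> th (QDia \<phi>) e x" for x by (rule HAx_th[OF wf(2)])
    qed
    then show ?thesis by (simp only: dot_closed fv.simps Un_empty)
  qed
  have "entails (QDia (QDia \<phi>)) (QDia \<phi>)"
  proof (rule entailsI)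
    fix M :: "nat struct" and e u assume "pa_model M" and u: "pa_model.Axs M (rl (QDia \<phi>)) e u"
    then interpret realization_model \<Sigma> R \<eta> M by (intro realization_modelI)
    let ?X = "th (QDia (QDia \<phi>)) e"
    have "Pr ?X (kimp (dot (\<lambda>i. e i) (dia (rl (QDia \<phi>)) Tru)) (dot (\<lambda>i. e i) (dia (rl \<phi>) Tru)))"
    proof (rule Pr_con_mono[OF sigma1_rl[OF wf(2)] sigma1_rl[OF wf(1)], where r = "\<lambda>i. i" and s = "\<lambda>i. i"])
      show "HAx u \<Longrightarrow> ?X u" for u using th_Dia[OF wf(2)] by blast
    qed (rule inc)
    moreover have "Pr ?X (dot e (dia (rl (QDia \<phi>)) Tru))" using Pr_ax th_Dia[OF wf(2)] by blast
    ultimately have "Pr ?X (dot e (dia (rl \<phi>) Tru))" by (rule Pr_mp)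
    moreover have "Pr ?X u" if "HAx u" using that th_Dia[OF wf(2)] by (intro Pr_ax) simp
    ultimately show "Pr ?X u" using u unfolding th_Dia[OF wf(1)] by (elim disjE) simp_all
  qed
  then show ?case using wf by simp
next
  case (qrc1_allR \<phi> \<psi> x)
  have "entails \<phi> (QAll x \<psi>)"
  proof (rule entailsI)
    fix M :: "nat struct" and e u assume M: "pa_model M" and u: "pa_model.Axs M (rl (QAll x \<psi>)) e u"
    then interpret realization_model \<Sigma> R \<eta> M by (intro realization_modelI)
    obtain a where "th \<psi> (e(yvar x := a)) u" using u unfolding th_All by blast
    moreover have "entails \<phi> \<psi>" using qrc1_allR.IH by simp
    ultimately have "Pr (th \<phi> (e(yvar x := a))) u" using entailsD[OF _ M] by blast
    moreover have "th \<phi> (e(yvar x := a)) = th \<phi> e"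
      by (rule th_cong) (use qrc1_allR in auto)
    ultimately show "Pr (th \<phi> e) u" by simp
  qed
  then show ?case using qrc1_allR by simp
next
  case (qrc1_allL \<phi> t x \<psi>)
  have "entails (QAll x \<phi>) \<psi>"
  proof (rule entailsI)
    fix M :: "nat struct" and e u assume M: "pa_model M" and u: "pa_model.Axs M (rl \<psi>) e u"
    then interpret realization_model \<Sigma> R \<eta> M by (intro realization_modelI)
    have "entails (qsubst x t \<phi>) \<psi>" using qrc1_allL.IH by simp
    then have "Pr (th (qsubst x t \<phi>) e) u" using u entailsD[OF _ M] by blast
    then have "Pr (th \<phi> (e(yvar x := e (mvar t)))) u" using Pr_subst[OF qrc1_allL(1,2,3) M] by blast
    then show "Pr (th (QAll x \<phi>) e) u"
      by (rule Pr_mono) (auto simp: th_All simp del: realize.simps)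
  qed
  then show ?case using qrc1_allL by simp
next
  case (qrc1_inst \<phi> \<psi> t x)
  then have wf: "wf_qfm \<Sigma> \<phi>" "wf_qfm \<Sigma> \<psi>" by auto
  have "entails \<phi> \<psi>" using qrc1_inst.IH by simp
  then have "entails (qsubst x t \<phi>) (qsubst x t \<psi>)"
    unfolding entails_def using Pr_subst[OF wf(1) qrc1_inst(2,3)] Pr_subst[OF wf(2) qrc1_inst(2,4)]
    by simp
  then show ?case using qrc1_inst wf_qsubst by blast
next
  case (qrc1_gen_con \<phi> \<psi> c x)
  have "entails \<phi> \<psi>"
  proof (rule entailsI)
    fix M :: "nat struct" and e u assume M: "pa_model M" and u: "pa_model.Axs M (rl \<psi>) e u"
    then interpret realization_model \<Sigma> R \<eta> M by (intro realization_modelI)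
    \<comment> \<open>The constant gets the value that \<open>x\<close> has already, so substituting
      it for \<open>x\<close> changes nothing, and neither theory depends on it.\<close>
    let ?e = "e(zvar c := e (yvar x))"
    have c: "wf_mtm \<Sigma> (MCon c)" using qrc1_gen_con by simp
    have e: "?e(yvar x := ?e (mvar (MCon c))) = ?e" by (auto simp: fun_eq_iff)
    have idle: "th \<chi> ?e = th \<chi> e" if "wf_qfm \<Sigma> \<chi>" "c \<notin> qcons \<chi>" for \<chi>
      by (rule th_cong[OF that(1)]) (use that(2) in auto)
    have wf: "wf_qfm \<Sigma> \<phi>" "wf_qfm \<Sigma> \<psi>" "c \<notin> qcons \<phi>" "c \<notin> qcons \<psi>" using qrc1_gen_con by simp_all
    have "Pr (th \<psi> ?e) u" using Pr_ax[of "th \<psi> e" u] u unfolding idle[OF wf(2,4)] by simp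
    then have "Pr (th (qsubst x (MCon c) \<psi>) ?e) u"
      using Pr_subst[OF wf(2) c free_for_MCon M, of x ?e u] unfolding e by simp
    moreover have "entails (qsubst x (MCon c) \<phi>) (qsubst x (MCon c) \<psi>)" using qrc1_gen_con.IH by simp
    ultimately have "Pr (th (qsubst x (MCon c) \<phi>) ?e) u" using M unfolding entails_def by blast
    then have "Pr (th \<phi> ?e) u"
      using Pr_subst[OF wf(1) c free_for_MCon M, of x ?e u] unfolding e by simp
    then show "Pr (th \<phi> e) u" unfolding idle[OF wf(1,3)] .
  qed
  then show ?case using qrc1_gen_con by simp
qed (auto simp: entails_def)

theorem arithmetical_soundness:
  assumes "qrc1 \<Sigma> \<phi> \<psi>"
  shows "HA \<turnstile> theory_inclusion (rl \<psi>) (rl \<phi>)"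
proof (rule theory_inclusionI)
  show "sigma1 (rl \<phi>)" "sigma1 (rl \<psi>)" using qrc1_entails[OF assms] sigma1_rl by auto
  show "pa_model.Pr M (pa_model.Axs M (rl \<phi>) e) x"
    if "pa_model M" "pa_model.Axs M (rl \<psi>) e x" for M :: "nat struct" and e x
    using qrc1_entails[OF assms] that entailsD by blast
qed

end

section \<open>Reflection in the standard model\<close>

text \<open>Abstracts what reflection uses of the standard model: every element is standard, and
  induction along coded derivations is available for arbitrary predicates.\<close>

locale full_model = pa_model +
  assumes full_induct [case_names zero suc]: "P zr \<Longrightarrow> (\<And>x. P x \<Longrightarrow> P (sc x)) \<Longrightarrow> P x"
begin

lemma on_surj: obtains n where "x = on n"
proof -
  have "\<exists>n. x = on n"
    by (induction rule: full_induct) (auto simp flip: on_0 on_Suc)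
  then show ?thesis using that by blast
qed

lemma gen_full_induct:
  assumes "gen R x" "mono_rule R" "\<And>x. R P x \<Longrightarrow> P x"
  shows "P x"
  using assms
proof (rule gen_induct_aux)
  fix a b n i
  let ?Q = "\<lambda>i. i \<sqsubset> n \<longrightarrow> (\<forall>v. Beta a b i v \<longrightarrow> P v)"
  assume step: "\<And>i. (\<And>j. j \<sqsubset> i \<Longrightarrow> ?Q j) \<Longrightarrow> ?Q i"
  have "\<forall>j. j \<sqsubset> i \<longrightarrow> ?Q j" for i
  proof (induction i rule: full_induct)
    case zero
    then show ?case by simp
  next
    case (suc i)
    show ?case unfolding less_suc using suc step[of i] by blast
  qed
  then show "?Q i" using step by blast
qed

lemma Tm_decode: "Tm d x \<Longrightarrow> \<exists>t. x = on (tgn t)"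
proof -
  assume "Tm d x"
  then have "gen rTm (mp d x)" unfolding Tm_def .
  then have "\<forall>d' y. mp d x = mp d' y \<longrightarrow> (\<exists>t. y = on (tgn t))"
  proof (rule gen_full_induct[OF _ mono_rules(1)])
    fix x assume "rTm (\<lambda>x. \<forall>d' y. x = mp d' y \<longrightarrow> (\<exists>t. y = on (tgn t))) x"
    then obtain d t i j where x: "x = mp d t" and t: "t = kvar i \<or> t = kzero \<or>
        (t = ksuc i \<and> (\<exists>s. i = on (tgn s))) \<or>
        ((t = kplus i j \<or> t = ktimes i j) \<and> (\<exists>s. i = on (tgn s)) \<and> (\<exists>s. j = on (tgn s)))"
      unfolding rTm_def by (simp only: mp_inject simp_thms) metis
    have "kvar i = on (tgn (V n))" if "i = on n" for n using that by simp
    moreover have "kzero = on (tgn Zero)" "ksuc (on (tgn s)) = on (tgn (Succ s))"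
      "kplus (on (tgn s)) (on (tgn s')) = on (tgn (Plus s s'))"
      "ktimes (on (tgn s)) (on (tgn s')) = on (tgn (Times s s'))" for s s' by simp_all
    ultimately have "\<exists>s. t = on (tgn s)" using t on_surj[of i] by metis
    then show "\<forall>d' y. x = mp d' y \<longrightarrow> (\<exists>t. y = on (tgn t))" using x by simp
  qed
  then show ?thesis by blast
qed

lemma Fm_decode: "Fm d x \<Longrightarrow> \<exists>A. x = on (gn A)"
proof -
  assume "Fm d x"
  then have "gen rFm (mp d x)" unfolding Fm_def .
  then have "\<forall>d' y. mp d x = mp d' y \<longrightarrow> (\<exists>A. y = on (gn A))"
  proof (rule gen_full_induct[OF _ mono_rules(2)])
    fix x assume "rFm (\<lambda>x. \<forall>d' y. x = mp d' y \<longrightarrow> (\<exists>t. y = on (gn t))) x"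
    then obtain d a i j where x: "x = mp d a" and a: "((a = keq i j \<or> a = kless i j) \<and> Tm d i \<and> Tm d j) \<or> a = kfls \<or>
        ((a = kand i j \<or> a = kor i j \<or> a = kimp i j) \<and> (\<exists>A. i = on (gn A)) \<and> (\<exists>A. j = on (gn A))) \<or>
        ((a = kall i \<or> a = kex i) \<and> (\<exists>A. i = on (gn A)))"
      unfolding rFm_def by (simp only: mp_inject simp_thms) metis
    have "keq (on (tgn s)) (on (tgn t)) = on (gn (s \<approx> t))" "kless (on (tgn s)) (on (tgn t)) = on (gn (s \<prec> t))"
      "kfls = on (gn Fls)" "kand (on (gn A)) (on (gn B)) = on (gn (A \<^bold>\<and> B))"
      "kor (on (gn A)) (on (gn B)) = on (gn (A \<^bold>\<or> B))" "kimp (on (gn A)) (on (gn B)) = on (gn (A \<^bold>\<rightarrow> B))"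
      "kall (on (gn A)) = on (gn (All A))" "kex (on (gn A)) = on (gn (Ex A))" for s t A B by simp_all
    then have "\<exists>A. a = on (gn A)" using a Tm_decode[of d i] Tm_decode[of d j] by metis
    then show "\<forall>d' y. x = mp d' y \<longrightarrow> (\<exists>t. y = on (gn t))" using x by simp
  qed
  then show ?thesis by blast
qed

end

section \<open>Uniqueness of the coded operations on codes of actual syntax\<close>

context pa_model
begin

text \<open>The source is an actual term, so recursion on it together with inversion of the rules
  suffices; the model may be nonstandard.\<close>

lemma TO_decode:
  assumes "gen (rTO W) (quad d p (on (tgn s)) b)" "\<And>i b. W d p (on i) b \<Longrightarrow> b = on (tgn (f i))"
  shows "b = on (tgn (tsubst f s))"
  using assms(1) by (induction s arbitrary: b) (drule gen_unfold[OF _ mono_rules(3)]; force simp: rTO_def assms(2))+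

lemma LV_decode: "LV (on d) p (on i) b \<Longrightarrow> b = on (tgn (lsb d i))"
  by (auto simp: LV_def lsb_def simp flip: on_Suc)

lemma IV_decode: "IV (on d) (on (tgn u)) (on i) b \<Longrightarrow> b = on (tgn (isb d u i))"
proof -
  have "j = on (i - 1)" if "on i = sc j" for j
    using that by (cases i) (auto simp: on_Suc on_0)
  then show "IV (on d) (on (tgn u)) (on i) b \<Longrightarrow> b = on (tgn (isb d u i))"
    by (auto simp: IV_def isb_def)
qed

lemma LiftT_decode: "LiftT (on 0) (on (tgn u)) b \<Longrightarrow> b = on (tgn (tlift u))"
  unfolding LiftT_def tlift_lsb using TO_decode[of LV "on 0" "on 0" u b "lsb 0"] LV_decode by blast

lemma FO_elims:
  "gen (rFO T U) (quad d p (keq s t) b) \<Longrightarrow> \<exists>s' t'. b = keq s' t' \<and> T (quad d p s s') \<and> T (quad d p t t')"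
  "gen (rFO T U) (quad d p (kless s t) b) \<Longrightarrow> \<exists>s' t'. b = kless s' t' \<and> T (quad d p s s') \<and> T (quad d p t t')"
  "gen (rFO T U) (quad d p kfls b) \<Longrightarrow> b = kfls"
  "gen (rFO T U) (quad d p (kand s t) b) \<Longrightarrow>
    \<exists>s' t'. b = kand s' t' \<and> gen (rFO T U) (quad d p s s') \<and> gen (rFO T U) (quad d p t t')"
  "gen (rFO T U) (quad d p (kor s t) b) \<Longrightarrow>
    \<exists>s' t'. b = kor s' t' \<and> gen (rFO T U) (quad d p s s') \<and> gen (rFO T U) (quad d p t t')"
  "gen (rFO T U) (quad d p (kimp s t) b) \<Longrightarrow>
    \<exists>s' t'. b = kimp s' t' \<and> gen (rFO T U) (quad d p s s') \<and> gen (rFO T U) (quad d p t t')"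
  "gen (rFO T U) (quad d p (kall s) b) \<Longrightarrow> \<exists>s' q. b = kall s' \<and> U p q \<and> gen (rFO T U) (quad (sc d) q s s')"
  "gen (rFO T U) (quad d p (kex s) b) \<Longrightarrow> \<exists>s' q. b = kex s' \<and> U p q \<and> gen (rFO T U) (quad (sc d) q s s')"
  by (drule gen_unfold[OF _ mono_rules(4)]; simp add: rFO_def; fail)+

text \<open>\<open>G\<close> records which parameter belongs to which depth, and \<open>f\<close>
  gives the substitution it performs there; each binder moves both one level down through
  \<open>U\<close>.\<close>

lemma FO_decode:
  assumes "\<And>d p s b. G d p \<Longrightarrow> T (quad (on d) p (on (tgn s)) b) \<Longrightarrow> b = on (tgn (tsubst (f d) s))"
    "\<And>d p q. G d p \<Longrightarrow> U p q \<Longrightarrow> G (Suc d) q \<and> f (Suc d) = up (f d)"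
  shows "gen (rFO T U) (quad (on d) p (on (gn A)) b) \<Longrightarrow> G d p \<Longrightarrow> b = on (gn (subst (f d) A))"
proof (induction A arbitrary: d p b)
  case (All A)
  from FO_elims(7)[OF All.prems(1)[unfolded gn.simps on_pair]] show ?case
    using All.IH[of "Suc d"] assms(2) All.prems(2) by (auto simp: on_Suc)
next
  case (Ex A)
  from FO_elims(8)[OF Ex.prems(1)[unfolded gn.simps on_pair]] show ?case
    using Ex.IH[of "Suc d"] assms(2) Ex.prems(2) by (auto simp: on_Suc)
qed (fastforce dest!: FO_elims intro: assms(1))+

lemma LiftF_decode: "LiftF (on d) (on (gn A)) b \<Longrightarrow> b = on (gn (subst (lsb d) A))"
  unfolding LiftF_def
  by (rule FO_decode[of "\<lambda>d p. True" _ lsb])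
    (auto simp: up_lsb intro: TO_decode[where W = LV] LV_decode)

lemma InstF_decode:
  assumes "InstF (on 0) (on (tgn u)) (on (gn A)) b"
  shows "b = on (gn (inst u A))"
proof -
  \<comment> \<open>Below \<open>d\<close> binders the instantiating term has been lifted
    \<open>d\<close> times.\<close>
  let ?u = "\<lambda>d. (tlift ^^ d) u"
  have "b = on (gn (subst (isb 0 (?u 0)) A))"
    by (rule FO_decode[of "\<lambda>d p. p = on (tgn (?u d))" _ "\<lambda>d. isb d (?u d)", OF _ _ assms[unfolded InstF_def]])
      (auto simp: up_isb intro: TO_decode[where W = IV] IV_decode dest: LiftT_decode)
  then show ?thesis by (simp add: inst_def isb_0)
qed

text \<open>A statement about natural numbers, but read off in the model: \<open>on\<close> carries
  \<open>pair\<close> to \<open>mp\<close>, whose injectivity is already known.\<close>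

lemma tgn_inject [simp]: "tgn s = tgn t \<longleftrightarrow> s = t"
proof
  show "tgn s = tgn t \<Longrightarrow> s = t"
  proof (induction s arbitrary: t)
    case (V i) then show ?case by (cases t) (auto dest: arg_cong[where f = on])
  next
    case Zero then show ?case by (cases t) (auto dest: arg_cong[where f = on])
  next
    case (Succ s) then show ?case by (cases t) (auto dest!: arg_cong[where f = on])
  next
    case (Plus s s') then show ?case by (cases t) (auto dest!: arg_cong[where f = on])
  next
    case (Times s s') then show ?case by (cases t) (auto dest!: arg_cong[where f = on])
  qed
qed simp

lemma gn_inject [simp]: "gn A = gn B \<longleftrightarrow> A = B"
proof
  show "gn A = gn B \<Longrightarrow> A = B"
    by (induction A arbitrary: B; case_tac B) (auto dest!: arg_cong[where f = on])
qed simp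

end

context full_model
begin

lemma LogAx_decode:
  assumes "LogAx x"
  shows "\<exists>A. x = on (gn A) \<and> logical_axiom A"
  using assms unfolding LogAx_def
proof (elim disjE)
  assume "\<exists>a b c. Form a \<and> Form b \<and> Form c \<and>
     (x = kimp a (kimp b a) \<or>
      x = kimp (kimp a (kimp b c)) (kimp (kimp a b) (kimp a c)) \<or>
      x = kimp (kand a b) a \<or>
      x = kimp (kand a b) b \<or>
      x = kimp a (kimp b (kand a b)) \<or>
      x = kimp a (kor a b) \<or>
      x = kimp b (kor a b) \<or>
      x = kimp (kimp a c) (kimp (kimp b c) (kimp (kor a b) c)) \<or>
      x = kimp kfls a)"
  then obtain A B C where "x \<in> on ` gn ` {A \<^bold>\<rightarrow> B \<^bold>\<rightarrow> A, (A \<^bold>\<rightarrow> B \<^bold>\<rightarrow> C) \<^bold>\<rightarrow> (A \<^bold>\<rightarrow> B) \<^bold>\<rightarrow> A \<^bold>\<rightarrow> C,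
      A \<^bold>\<and> B \<^bold>\<rightarrow> A, A \<^bold>\<and> B \<^bold>\<rightarrow> B, A \<^bold>\<rightarrow> B \<^bold>\<rightarrow> A \<^bold>\<and> B, A \<^bold>\<rightarrow> A \<^bold>\<or> B, B \<^bold>\<rightarrow> A \<^bold>\<or> B,
      (A \<^bold>\<rightarrow> C) \<^bold>\<rightarrow> (B \<^bold>\<rightarrow> C) \<^bold>\<rightarrow> A \<^bold>\<or> B \<^bold>\<rightarrow> C, Fls \<^bold>\<rightarrow> A}"
    using Fm_decode by (simp only: image_insert image_empty insert_iff empty_iff gn.simps on_pair) metis
  then show ?thesis using logical_axiom.intros by blast
next
  assume "\<exists>a b s t b'. Form a \<and> Form b \<and> Term s \<and> Term t \<and>
     ((\<exists>c. InstF (on 0) t a c \<and> (x = kimp (kall a) c \<or> x = kimp c (kex a))) \<or>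
      (LiftF (on 0) b b' \<and>
        (x = kimp (kall (kimp b' a)) (kimp b (kall a)) \<or> x = kimp (kall (kimp a b')) (kimp (kex a) b))) \<or>
      x = keq t t \<or>
      (\<exists>c d. InstF (on 0) s a c \<and> InstF (on 0) t a d \<and> x = kimp (keq s t) (kimp c d)))"
  then obtain a b s t b' where f: "Form a" "Form b" "Term s" "Term t" and
     x: "(\<exists>c. InstF (on 0) t a c \<and> (x = kimp (kall a) c \<or> x = kimp c (kex a))) \<or>
      (LiftF (on 0) b b' \<and>
        (x = kimp (kall (kimp b' a)) (kimp b (kall a)) \<or> x = kimp (kall (kimp a b')) (kimp (kex a) b))) \<or>
      x = keq t t \<or>
      (\<exists>c d. InstF (on 0) s a c \<and> InstF (on 0) t a d \<and> x = kimp (keq s t) (kimp c d))"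
    by blast
  obtain A B S T where A: "a = on (gn A)" "b = on (gn B)" "s = on (tgn S)" "t = on (tgn T)"
    using f Fm_decode Tm_decode by metis
  have L: "LiftF (on 0) (on (gn B)) y \<Longrightarrow> y = on (gn (lift B))" for y B
    using LiftF_decode[of 0] by (simp add: lift_def lsb_0)
  define L where "L = {All A \<^bold>\<rightarrow> inst T A, inst T A \<^bold>\<rightarrow> Ex A, All (lift B \<^bold>\<rightarrow> A) \<^bold>\<rightarrow> B \<^bold>\<rightarrow> All A,
      All (A \<^bold>\<rightarrow> lift B) \<^bold>\<rightarrow> Ex A \<^bold>\<rightarrow> B, T \<approx> T, S \<approx> T \<^bold>\<rightarrow> inst S A \<^bold>\<rightarrow> inst T A}"
  have "L \<subseteq> Collect logical_axiom"
    unfolding L_def using logical_axiom.intros by simp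
  moreover have "x \<in> on ` gn ` L"
    using x unfolding A L_def by (auto dest!: InstF_decode L)
  ultimately show ?thesis by blast
qed

lemma IndAx_decode: "IndAx x \<Longrightarrow> \<exists>A. x = on (gn (induction_axiom A))"
proof -
  assume "IndAx x"
  then obtain a b c d where f: "Form a" and x: "InstF (on 0) kzero a b" "LiftF (on (Suc 0)) a c"
     "InstF (on 0) (ksuc (kvar (on 0))) c d" "x = kimp b (kimp (kall (kimp a d)) (kall a))"
    unfolding IndAx_def by blast
  obtain A where A: "a = on (gn A)" using f Fm_decode by blast
  have t: "kzero = on (tgn Zero)" "ksuc (kvar (on 0)) = on (tgn (Succ (V 0)))" by simp_all
  have b: "b = on (gn (inst Zero A))" using x(1) unfolding A t by (rule InstF_decode)
  have c: "c = on (gn (subst (lsb 1) A))" using LiftF_decode[of 1 A c] x(2) unfolding A by simp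
  have d: "d = on (gn (subst (V(0 := Succ (V 0))) A))"
    using InstF_decode[of "Succ (V 0)" "subst (lsb 1) A" d] x(3) unfolding c t
    by (simp only: inst_def Succ_subst flip: isb_0)
  show ?thesis unfolding x(4) A b d induction_axiom_def by (intro exI[of _ A]) simp
qed

lemma HAx_decode: "HAx x \<Longrightarrow> \<exists>A. x = on (gn A) \<and> (\<forall>e. sat M e A)"
proof -
  assume "HAx x"
  then have "gen rHA x" unfolding HAx_def by blast
  then have "\<exists>A. x = on (gn A) \<and> A \<in> HA_generalizations"
  proof (rule gen_full_induct[OF _ mono_rules(6)])
    fix x assume "rHA (\<lambda>x. \<exists>A. x = on (gn A) \<and> A \<in> HA_generalizations) x"
    then consider A where "A \<in> set basic_axioms" "x = on (gn A)" | "IndAx x"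
      | A where "x = kall (on (gn A))" "A \<in> HA_generalizations"
      unfolding rHA_def by blast
    then show "\<exists>A. x = on (gn A) \<and> A \<in> HA_generalizations"
    proof cases
      case (3 A)
      then have "x = on (gn (All A))" by simp
      then show ?thesis using HA_generalizations.intros(3) 3(2) by blast
    qed (use HA_generalizations.intros IndAx_decode in blast)+
  qed
  then show ?thesis using sat_HA_generalizations[OF pa] by blast
qed

text \<open>Soundness along a coded proof, every line of which turns out to be the code of an actual
  formula. Truth in all environments is carried, as the generalization rule requires.\<close>

lemma reflection:
  assumes "Pr X x" "\<And>x. X x \<Longrightarrow> \<exists>A. x = on (gn A) \<and> (\<forall>e. sat M e A)"
  shows "\<exists>A. x = on (gn A) \<and> (\<forall>e. sat M e A)"
  using assms(1) unfolding Pr_def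
proof (rule gen_full_induct[OF _ mono_rules(7)])
  fix x assume "rPr X (\<lambda>x. \<exists>A. x = on (gn A) \<and> (\<forall>e. sat M e A)) x"
  then consider "LogAx x" | "X x"
    | B C where "kimp (on (gn B)) x = on (gn C)" "\<forall>e. sat M e B" "\<forall>e. sat M e C"
    | B where "x = kall (on (gn B))" "\<forall>e. sat M e B"
    unfolding rPr_def by blast
  then show "\<exists>A. x = on (gn A) \<and> (\<forall>e. sat M e A)"
  proof cases
    case 1
    then show ?thesis using LogAx_decode sat_logical_axiom by blast
  next
    case 2
    then show ?thesis by (rule assms(2))
  next
    case (3 B C)
    obtain A where "C = (B \<^bold>\<rightarrow> A)" "x = on (gn A)"
      using 3(1) by (cases C) auto
    then show ?thesis using 3 by auto
  next
    case (4 B)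
    then have "x = on (gn (All B))" "\<forall>e. sat M e (All B)" by simp_all
    then show ?thesis by blast
  qed
qed

end

definition standard_model :: "nat struct" where
  "standard_model = \<lparr>m_zero = 0, m_suc = Suc, m_add = (+), m_mul = (*), m_less = (<)\<rparr>"

lemma full_model_standard: "full_model standard_model"
proof unfold_locales
  show "pa standard_model"
  proof (rule paI)
    fix A and e :: "nat \<Rightarrow> nat"
    show "A \<in> set basic_axioms \<Longrightarrow> sat standard_model e A"
      by (auto simp: basic_axioms_def standard_model_def less_iff_Suc_add) metis
    have "(\<lambda>i. eval standard_model (case_nat n e) ((V(0 := Succ (V 0))) i)) = case_nat (Suc n) e" for n
      by (auto simp: fun_eq_iff standard_model_def split: nat.split)
    then have 1: "sat standard_model (case_nat n e) (subst (V(0 := Succ (V 0))) A) \<longleftrightarrow>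
        sat standard_model (case_nat (Suc n) e) A" for n
      unfolding sat_subst by (rule arg_cong)
    have 0: "eval standard_model e Zero = 0" by (simp add: standard_model_def)
    have "sat standard_model (case_nat n e) A"
      if "sat standard_model (case_nat 0 e) A"
        "\<forall>n. sat standard_model (case_nat n e) A \<longrightarrow> sat standard_model (case_nat (Suc n) e) A" for n
      using that by (induction n) blast+
    then show "sat standard_model e (induction_axiom A)"
      unfolding induction_axiom_def sat.simps sat_inst 0 1 by blast
  qed
  show "P x" if "P (m_zero standard_model)" "\<And>x. P x \<Longrightarrow> P (m_suc standard_model x)" for P and x :: nat
    using that by (induction x) (simp_all add: standard_model_def)
qed

section \<open>Delta-0 matrices of \<open>\<Sigma>\<^sub>1\<close> formulas\<close>

text \<open>Trades a witness for a bound on it. A bound may be enlarged, which lets the witnesses of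
  several formulas be merged into one.\<close>

definition bounded_ex :: "fm \<Rightarrow> fm" where
  "bounded_ex Q = Ex (V 0 \<prec> tlift (V 0) \<^bold>\<and> subst (case_nat (V 0) (\<lambda>i. V (Suc (Suc i)))) Q)"

definition swap :: "fm \<Rightarrow> fm" where
  "swap = subst (case_nat (V 1) (case_nat (V 0) (\<lambda>i. V (Suc (Suc i)))))"

lemma sat_bounded_ex:
  "sat M (case_nat n e) (bounded_ex Q) \<longleftrightarrow> (\<exists>m. m_less M m n \<and> sat M (case_nat m e) Q)"
proof -
  have "(\<lambda>i. eval M (case_nat m (case_nat n e)) (case_nat (V 0) (\<lambda>i. V (Suc (Suc i))) i)) = case_nat m e" for m
    by (auto simp: fun_eq_iff split: nat.split)
  then show ?thesis by (simp add: bounded_ex_def sat_subst)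
qed

lemma sat_swap: "sat M (case_nat x (case_nat n e)) (swap A) = sat M (case_nat n (case_nat x e)) A"
proof -
  have "(\<lambda>i. eval M (case_nat x (case_nat n e)) (case_nat (V 1) (case_nat (V 0) (\<lambda>i. V (Suc (Suc i)))) i)) =
      case_nat n (case_nat x e)"
    by (auto simp: fun_eq_iff split: nat.split)
  then show ?thesis unfolding swap_def sat_subst by (rule arg_cong)
qed

lemma delta0_bounded_ex: "delta0 Q \<Longrightarrow> delta0 (bounded_ex Q)" and delta0_swap: "delta0 Q \<Longrightarrow> delta0 (swap Q)"
  unfolding bounded_ex_def swap_def by (intro delta0.intros delta0_subst; assumption)+

lemma (in pa_model) common_bound: obtains n where "x \<sqsubset> n" "y \<sqsubset> n" "z \<sqsubseteq> n"
proof
  show "x \<sqsubset> sc (x \<oplus> y \<oplus> z)" unfolding less_suc_le by (metis add_assoc)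
  show "y \<sqsubset> sc (x \<oplus> y \<oplus> z)" unfolding less_suc_le by (metis add_assoc add_comm)
  show "z \<sqsubseteq> sc (x \<oplus> y \<oplus> z)" by (metis add_comm add_suc)
qed

text \<open>By induction on the initial segments up to \<open>t\<close>: each new element
  contributes one witness, and \<open>common_bound\<close> absorbs it.\<close>

lemma (in pa_model) collection:
  assumes "\<And>x. x \<sqsubset> t \<Longrightarrow> \<exists>a. sat M (case_nat a (case_nat x e)) Q"
  shows "\<exists>n. \<forall>x. x \<sqsubset> t \<longrightarrow> (\<exists>a. a \<sqsubset> n \<and> sat M (case_nat a (case_nat x e)) Q)"
proof -
  have dft: "dft M (\<lambda>e'. case_nat (e' 0) (case_nat (e' 1) e) i)" for i
    by (cases i; cases "i - 1") (auto intro: dfn_intros)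
  have "y \<sqsubseteq> t \<longrightarrow> (\<exists>n. \<forall>x. x \<sqsubset> y \<longrightarrow> (\<exists>a. a \<sqsubset> n \<and> sat M (case_nat a (case_nat x e)) Q))" for y
  proof (induction y rule: pa_induct)
    case definable
    show ?case by (intro dfn_intros dfn_formula[where g = "\<lambda>e'. case_nat (e' 0) (case_nat (e' 1) e)", simplified] dft)
  next
    case zero
    then show ?case using less_iff by auto
  next
    case (suc y)
    show ?case
    proof
      assume le: "sc y \<sqsubseteq> t"
      then have "y \<sqsubset> t" unfolding less_iff by auto
      moreover from this have "y \<sqsubseteq> t" using less_le by blast
      ultimately obtain n a where n: "\<And>x. x \<sqsubset> y \<Longrightarrow> \<exists>a. a \<sqsubset> n \<and> sat M (case_nat a (case_nat x e)) Q"
        and a: "sat M (case_nat a (case_nat y e)) Q" using suc assms by blast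
      obtain k where k: "a \<sqsubset> k" "n \<sqsubseteq> k" using common_bound by blast
      have "\<exists>a. a \<sqsubset> k \<and> sat M (case_nat a (case_nat x e)) Q" if "x \<sqsubset> sc y" for x
        using that n[of x] a k ord_less_le_trans unfolding less_suc by blast
      then show "\<exists>n. \<forall>x. x \<sqsubset> sc y \<longrightarrow> (\<exists>a. a \<sqsubset> n \<and> sat M (case_nat a (case_nat x e)) Q)" by blast
    qed
  qed
  then show ?thesis using ord_order_refl by blast
qed

text \<open>Comparing triggers means denying earlier witnesses. Only a bounded matrix allows this
  negation without leaving Sigma_1.\<close>

lemma delta0_matrix:
  assumes "sigma1 A"
  obtains Q where "delta0 Q"
    "\<And>(M :: nat struct) e. pa_model M \<Longrightarrow> sat M e A \<longleftrightarrow> (\<exists>n. sat M (case_nat n e) Q)"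
proof -
  have "\<exists>Q. delta0 Q \<and> (\<forall>(M :: nat struct) e. pa_model M \<longrightarrow> sat M e A = (\<exists>n. sat M (case_nat n e) Q))"
    using assms
  proof induction
    case (1 A)
    then show ?case by (intro exI[of _ "lift A"]) (auto intro: delta0_subst[of A "\<lambda>i. V (Suc i)", folded lift_def])
  next
    case (2 A B)
    then obtain P Q where Q: "delta0 P" "delta0 Q"
      "\<And>(M :: nat struct) e. pa_model M \<Longrightarrow> sat M e A = (\<exists>n. sat M (case_nat n e) P)"
      "\<And>(M :: nat struct) e. pa_model M \<Longrightarrow> sat M e B = (\<exists>n. sat M (case_nat n e) Q)" by blast
    have "sat M e (A \<^bold>\<and> B) = (\<exists>n. sat M (case_nat n e) (bounded_ex P \<^bold>\<and> bounded_ex Q))"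
      if "pa_model M" for M :: "nat struct" and e
      unfolding sat.simps sat_bounded_ex Q(3)[OF that] Q(4)[OF that]
      using pa_model.common_bound[OF that] by metis
    then show ?case using Q(1,2) by (meson delta0.intros(4) delta0_bounded_ex)
  next
    case (3 A B)
    then obtain P Q where Q: "delta0 P" "delta0 Q"
      "\<And>(M :: nat struct) e. pa_model M \<Longrightarrow> sat M e A = (\<exists>n. sat M (case_nat n e) P)"
      "\<And>(M :: nat struct) e. pa_model M \<Longrightarrow> sat M e B = (\<exists>n. sat M (case_nat n e) Q)" by blast
    then show ?case by (intro exI[of _ "P \<^bold>\<or> Q"]) (auto intro: delta0.intros)
  next
    case (4 A t)
    then obtain Q where Q: "delta0 Q"
      "\<And>(M :: nat struct) e. pa_model M \<Longrightarrow> sat M e A = (\<exists>n. sat M (case_nat n e) Q)" by blast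
    have "sat M e (All (V 0 \<prec> tlift t \<^bold>\<rightarrow> A)) =
        (\<exists>n. sat M (case_nat n e) (All (V 0 \<prec> tlift (tlift t) \<^bold>\<rightarrow> swap (bounded_ex Q))))"
      if "pa_model M" for M :: "nat struct" and e
      unfolding sat.simps eval_tlift sat_swap sat_bounded_ex Q(2)[OF that]
      using pa_model.collection[OF that, of "eval M e t" e Q] by auto
    moreover have "delta0 (All (V 0 \<prec> tlift (tlift t) \<^bold>\<rightarrow> swap (bounded_ex Q)))"
      using Q(1) by (intro delta0.intros delta0_swap delta0_bounded_ex)
    ultimately show ?case by blast
  next
    case (5 A)
    then obtain Q where Q: "delta0 Q"
      "\<And>(M :: nat struct) e. pa_model M \<Longrightarrow> sat M e A = (\<exists>n. sat M (case_nat n e) Q)" by blast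
    have "sat M e (Ex A) = (\<exists>n. sat M (case_nat n e) (Ex (V 0 \<prec> tlift (V 0) \<^bold>\<and> swap (bounded_ex Q))))"
      if "pa_model M" for M :: "nat struct" and e
      unfolding sat.simps eval_tlift sat_swap sat_bounded_ex Q(2)[OF that] eval.simps nat.case
      using pa_model.common_bound[OF that] by metis
    moreover have "delta0 (Ex (V 0 \<prec> tlift (V 0) \<^bold>\<and> swap (bounded_ex Q)))"
      using Q(1) by (intro delta0.intros delta0_swap delta0_bounded_ex)
    ultimately show ?case by blast
  qed
  then show thesis using that by blast
qed

definition conj :: "fm list \<Rightarrow> fm" where "conj As = foldr And As Tru"
definition disj :: "fm list \<Rightarrow> fm" where "disj As = foldr Or As Fls"

lemma sat_conj [simp]: "sat M e (conj As) \<longleftrightarrow> (\<forall>A\<in>set As. sat M e A)"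
  and sat_disj [simp]: "sat M e (disj As) \<longleftrightarrow> (\<exists>A\<in>set As. sat M e A)"
  and fv_conj [simp]: "fv (conj As) = (\<Union>A\<in>set As. fv A)"
  and fv_disj [simp]: "fv (disj As) = (\<Union>A\<in>set As. fv A)"
  by (induction As) (auto simp: conj_def disj_def)

lemma delta0_conj: "(\<And>A. A \<in> set As \<Longrightarrow> delta0 A) \<Longrightarrow> delta0 (conj As)"
  and sigma1_disj: "(\<And>A. A \<in> set As \<Longrightarrow> sigma1 A) \<Longrightarrow> sigma1 (disj As)"
  by (induction As) (auto simp: conj_def disj_def intro: sigma1_intros delta0.intros)

lemma derives_conj: "(\<And>A. A \<in> set As \<Longrightarrow> derives \<Gamma> A) \<Longrightarrow> derives \<Gamma> (conj As)"
  by (induction As) (auto simp: conj_def intro: derives_andI derives_refl)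

lemma derives_conjD: "derives \<Gamma> (conj As) \<Longrightarrow> A \<in> set As \<Longrightarrow> derives \<Gamma> A"
  by (induction As) (auto simp: conj_def intro: derives_conjunct1 dest: derives_conjunct2)

lemma derives_disjE:
  assumes "derives \<Gamma> (disj As)" "\<And>A. A \<in> set As \<Longrightarrow> derives (insert A \<Gamma>) B"
  shows "derives \<Gamma> B"
  using assms
proof (induction As arbitrary: \<Gamma>)
  case Nil
  then show ?case by (simp add: disj_def derives_FlsE)
next
  case (Cons A As)
  have "derives (insert (disj As) \<Gamma>) B"
  proof (rule Cons.IH)
    show "derives (insert (disj As) \<Gamma>) (disj As)" by (simp add: derives_hyp)
    show "derives (insert C (insert (disj As) \<Gamma>)) B" if "C \<in> set As" for C
      by (rule derives_mono[OF Cons.prems(2)[of C]]) (use that in auto)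
  qed
  then show ?case using Cons.prems by (auto simp: disj_def intro: derives_orE)
qed

section \<open>Solovay sentences\<close>

text \<open>The inner variable 1 holds the code of a sentence added to HA, and after the
  substitution this is the only variable left, now with index 0. The formula says that the extended
  theory is inconsistent.\<close>

abbreviation trigger_box :: fm where
  "trigger_box \<equiv> subst (case_nat (num falsum) (\<lambda>i. V 0)) (box (is_HA_axiom \<^bold>\<or> V 0 \<approx> V 1))"

lemma sigma1_is_HA_axiom: "sigma1 is_HA_axiom"
  unfolding is_HA_axiom_def is_induction_axiom_def basic_axioms_def
  by (simp only: foldr.simps comp_apply id_apply)
    (intro sigma1_intros sigma1_generated sigma1_earlier sigma1_syntax sigma1_is)

text \<open>One matrix is fixed for all models and all worlds, so that witnesses of different
  triggers can be compared with each other.\<close>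

definition trigger_matrix :: fm where
  "trigger_matrix = (SOME Q. delta0 Q \<and>
    (\<forall>(M :: nat struct) e. pa_model M \<longrightarrow> sat M e trigger_box = (\<exists>n. sat M (case_nat n e) Q)))"

lemma trigger_matrix: "delta0 trigger_matrix"
  "pa_model M \<Longrightarrow> sat (M :: nat struct) e trigger_box \<longleftrightarrow> (\<exists>n. sat M (case_nat n e) trigger_matrix)"
proof -
  let ?P = "\<lambda>Q. delta0 Q \<and>
    (\<forall>(M :: nat struct) e. pa_model M \<longrightarrow> sat M e trigger_box = (\<exists>n. sat M (case_nat n e) Q))"
  have "sigma1 trigger_box" by (intro sigma1_subst sigma1_box sigma1_intros sigma1_is_HA_axiom)
  then have "\<exists>Q. ?P Q" using delta0_matrix by metis
  then have "?P trigger_matrix" unfolding trigger_matrix_def by (rule someI_ex)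
  then show "delta0 trigger_matrix"
    "pa_model M \<Longrightarrow> sat (M :: nat struct) e trigger_box \<longleftrightarrow> (\<exists>n. sat M (case_nat n e) trigger_matrix)" by blast+
qed

definition witnesses :: "tm \<Rightarrow> tm \<Rightarrow> fm" where
  "witnesses n c = subst (case_nat n (\<lambda>_. c)) trigger_matrix"

lemma fv_witnesses: "fv (witnesses n c) \<subseteq> tfv n \<union> tfv c"
  by (auto simp: witnesses_def fv_subst split: nat.splits)

text \<open>The numbering follows accessibility: it lets \<open>reached\<close> recurse to smaller
  worlds, and inductions from the top terminate by \<open>K\<close>.\<close>

locale frame =
  fixes K :: nat and R :: "nat \<Rightarrow> nat \<Rightarrow> bool"
  assumes R_trans: "R i j \<Longrightarrow> R j k \<Longrightarrow> R i k"
    and R_less: "R i j \<Longrightarrow> i < j \<and> j < K"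
    and R_root: "0 < w \<Longrightarrow> w < K \<Longrightarrow> R 0 w"
    and K_pos: "0 < K"
begin

definition succs :: "nat \<Rightarrow> nat list" where "succs w = filter (R w) [0..<K]"

lemma set_succs [simp]: "set (succs w) = {v. R w v}"
  using R_less by (auto simp: succs_def)

text \<open>\<open>V 1\<close> stands for the Goedel number of \<open>diagonal\<close> and \<open>V 2\<close> for that of its numeral;
  \<open>solovay_code w\<close> and \<open>limit_code w\<close> are then the Goedel numbers of \<open>solovay w\<close> and
  \<open>limit w\<close> below.\<close>

definition solovay_code :: "nat \<Rightarrow> tm" where
  "solovay_code w = cEx (cAnd (cEq (cVar (num 0)) (V 2))
     (cEx (cAnd (cEq (cVar (num 0)) (num (tgn (num w)))) (V 1))))"

definition limit_code :: "nat \<Rightarrow> tm" where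
  "limit_code w = foldr (\<lambda>v t. cAnd (cImp (solovay_code v) cFls) t) (succs w) (solovay_code w)"

text \<open>Among the triggers of the successors of \<open>w\<close>, the one of \<open>v\<close> has the least witness;
  ties go to the smaller world.\<close>

definition first :: "nat \<Rightarrow> nat \<Rightarrow> fm" where
  "first w v = exv 3 (witnesses (V 3) (limit_code v) \<^bold>\<and>
     conj (map (\<lambda>u. allb 4 (if u < v then Succ (V 3) else V 3) (\<^bold>\<not> witnesses (V 4) (limit_code u)))
       (filter (\<lambda>u. u \<noteq> v) (succs w))))"

text \<open>The path is never coded as a sequence. On a finite frame it suffices to recurse on the
  last move, which yields a finite formula.\<close>

function reached :: "nat \<Rightarrow> fm" where
  "reached v = (if v = 0 then Tru
     else disj (map (\<lambda>w. reached w \<^bold>\<and> first w v) (filter (\<lambda>w. R w v) [0..<v])))"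
  by auto
termination by (relation "measure id") auto

declare reached.simps [simp del]

text \<open>One fixed point serves all worlds: variable 0 selects the world, and variable 1 is to
  receive the Goedel number of this very formula.\<close>

definition diagonal :: fm where
  "diagonal = exv 2 (is_numeral (V 1) (V 2) \<^bold>\<and> disj (map (\<lambda>w. V 0 \<approx> num w \<^bold>\<and> reached w) [0..<K]))"

text \<open>The two values are supplied by quantified equations instead of by substitution. The code
  of the result is then an explicit term in the code of \<open>diagonal\<close> and of its numeral,
  which is exactly \<open>solovay_code\<close>.\<close>

definition solovay :: "nat \<Rightarrow> fm" where
  "solovay w = Ex (V 0 \<approx> num (gn diagonal) \<^bold>\<and> Ex (V 0 \<approx> num w \<^bold>\<and> diagonal))"

definition limit :: "nat \<Rightarrow> fm" where
  "limit w = foldr (\<lambda>v A. \<^bold>\<not> solovay v \<^bold>\<and> A) (succs w) (solovay w)"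

lemma tfv_code: "tfv (solovay_code w) \<subseteq> {1, 2}" "tfv (limit_code w) \<subseteq> {1, 2}"
proof -
  show *: "tfv (solovay_code w) \<subseteq> {1, 2}" for w by (auto simp: solovay_code_def)
  have "tfv (foldr (\<lambda>v t. cAnd (cImp (solovay_code v) cFls) t) vs (solovay_code w)) \<subseteq> {1, 2}" for vs
    using * by (induction vs) auto
  then show "tfv (limit_code w) \<subseteq> {1, 2}" by (simp add: limit_code_def)
qed

lemma fv_first: "fv (first w v) \<subseteq> {1, 2}"
proof -
  have "i = 1 \<or> i = 2 \<or> i \<in> tfv n" if "i \<in> fv (witnesses n (limit_code u))" for i n u
    using that fv_witnesses[of n "limit_code u"] tfv_code(2)[of u] by blast
  then show ?thesis unfolding first_def by (fastforce split: if_splits)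
qed

lemma fv_reached: "fv (reached w) \<subseteq> {1, 2}"
proof (induction w rule: less_induct)
  case (less w)
  have "fv (reached u \<^bold>\<and> first u w) \<subseteq> {1, 2}" if "u < w" for u
    using less[OF that] fv_first[of u w] by simp
  then show ?case unfolding reached.simps[of w] by (simp add: subset_iff) blast
qed

lemma fv_solovay [simp]: "fv (solovay w) = {}"
proof -
  have "fv diagonal \<subseteq> {0, 1}" unfolding diagonal_def using subsetD[OF fv_reached] by auto
  then show ?thesis by (auto simp: solovay_def)
qed

lemma fv_limit [simp]: "fv (limit w) = {}"
proof -
  have "fv (foldr (\<lambda>v A. \<^bold>\<not> solovay v \<^bold>\<and> A) vs (solovay w)) = {}" for vs by (induction vs) auto
  then show ?thesis by (simp add: limit_def)
qed

lemma sigma1_first: "sigma1 (first w v)"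
proof -
  have "delta0 (witnesses n c)" for n c unfolding witnesses_def by (intro delta0_subst trigger_matrix)
  then show ?thesis unfolding first_def
    by (intro sigma1_exv sigma1.intros(1) delta0.intros delta0_conj) (auto intro!: delta0_allb delta0.intros split: if_splits)
qed

lemma sigma1_reached: "sigma1 (reached w)"
proof (induction w rule: less_induct)
  case (less w)
  then show ?case by (subst reached.simps) (auto intro!: sigma1_disj sigma1_intros sigma1_first)
qed

lemma sigma1_solovay: "sigma1 (solovay w)"
proof -
  have "sigma1 (disj (map (\<lambda>w. V 0 \<approx> num w \<^bold>\<and> reached w) [0..<K]))"
    by (rule sigma1_disj) (auto intro!: sigma1_intros sigma1_reached)
  then have "sigma1 diagonal"
    unfolding diagonal_def by (intro sigma1_intros sigma1_syntax)
  then show ?thesis unfolding solovay_def by (auto intro!: sigma1_intros sigma1.intros(5))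
qed

end

section \<open>The Solovay path inside a model\<close>

locale solovay_model = frame K R + pa_model M for K R and M :: "nat struct"
begin

definition trig :: "nat \<Rightarrow> bool" where
  "trig w \<longleftrightarrow> Pr (\<lambda>x. HAx x \<or> x = on (gn (limit w))) (on falsum)"

definition wit :: "nat \<Rightarrow> nat \<Rightarrow> bool" where
  "wit w n \<longleftrightarrow> sat M (case_nat n (\<lambda>_. on (gn (limit w)))) trigger_matrix"

lemma trig_wit: "trig w \<longleftrightarrow> (\<exists>n. wit w n)"
proof -
  let ?e = "\<lambda>_ :: nat. on (gn (limit w))"
  have e: "(\<lambda>i. eval M ?e (case_nat (num falsum) (\<lambda>i. V 0) i)) = ?e(0 := on falsum)"
    by (auto simp: fun_eq_iff split: nat.split)
  have "Sent (on (gn (limit w)))" using Fm_on[of "limit w" 0] by simp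
  then have X: "Axs (is_HA_axiom \<^bold>\<or> V 0 \<approx> V 1) ?e = (\<lambda>x. HAx x \<or> x = on (gn (limit w)))"
    by (auto simp: Axs_def HAx_def fun_eq_iff)
  have "sat M ?e trigger_box \<longleftrightarrow> trig w"
    unfolding sat_subst e sat_box Axs_upd X trig_def by simp
  then show ?thesis using trigger_matrix(2)[OF pa_model_axioms, of ?e] by (simp add: wit_def)
qed

definition ahead :: "nat \<Rightarrow> nat \<Rightarrow> bool" where
  "ahead w v \<longleftrightarrow> (\<exists>n. wit v n \<and> (\<forall>u. R w u \<and> u \<noteq> v \<longrightarrow> (\<forall>m. m \<sqsubset> (if u < v then sc n else n) \<longrightarrow> \<not> wit u m)))"

definition step :: "nat \<Rightarrow> nat \<Rightarrow> bool" where
  "step w v \<longleftrightarrow> R w v \<and> ahead w v"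

context
  fixes e :: "nat \<Rightarrow> nat"
  assumes e: "e 1 = on (gn diagonal)" "e 2 = on (tgn (num (gn diagonal)))"
begin

lemma eval_code: "eval M e (solovay_code w) = on (gn (solovay w))" "eval M e (limit_code w) = on (gn (limit w))"
proof -
  show *: "eval M e (solovay_code w) = on (gn (solovay w))" for w
    unfolding solovay_code_def solovay_def using e by simp
  have "eval M e (foldr (\<lambda>v t. cAnd (cImp (solovay_code v) cFls) t) vs (solovay_code w)) =
      on (gn (foldr (\<lambda>v A. \<^bold>\<not> solovay v \<^bold>\<and> A) vs (solovay w)))" for vs
    by (induction vs) (simp_all add: *)
  then show "eval M e (limit_code w) = on (gn (limit w))" by (simp add: limit_code_def limit_def)
qed

lemma sat_witnesses: "sat M e (witnesses n (limit_code w)) \<longleftrightarrow> wit w (eval M e n)"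
proof -
  have "(\<lambda>i. eval M e (case_nat n (\<lambda>_. limit_code w) i)) = case_nat (eval M e n) (\<lambda>_. on (gn (limit w)))"
    by (auto simp: fun_eq_iff eval_code split: nat.split)
  then show ?thesis by (simp add: witnesses_def sat_subst wit_def)
qed

end

lemma sat_first:
  assumes e: "e 1 = on (gn diagonal)" "e 2 = on (tgn (num (gn diagonal)))"
  shows "sat M e (first w v) \<longleftrightarrow> ahead w v"
proof -
  have 3: "sat M (e(3 := n)) (witnesses (V 3) (limit_code u)) = wit u n" for n u
    using sat_witnesses[of "e(3 := n)" "V 3"] e by simp
  have 4: "sat M (e(3 := n, 4 := m)) (witnesses (V 4) (limit_code u)) = wit u m" for m n u
    using sat_witnesses[of "e(3 := n, 4 := m)" "V 4"] e by simp
  have if_Succ: "eval M e' (if b then Succ (V 3) else V 3) = (if b then sc (e' 3) else e' 3)" for e' b by simp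
  show ?thesis unfolding first_def ahead_def by (auto simp: 3 4 if_Succ)
qed

definition reach :: "nat \<Rightarrow> bool" where "reach w \<longleftrightarrow> step\<^sup>*\<^sup>* 0 w"

lemma reach_iff: "reach v \<longleftrightarrow> v = 0 \<or> (\<exists>w. reach w \<and> step w v)"
  unfolding reach_def using rtranclp.rtrancl_into_rtrancl[of step 0] by (metis rtranclp.cases rtranclp.rtrancl_refl)

lemma sat_reached:
  assumes e: "e 1 = on (gn diagonal)" "e 2 = on (tgn (num (gn diagonal)))"
  shows "sat M e (reached w) \<longleftrightarrow> reach w"
proof (induction w rule: less_induct)
  case (less v)
  have "(\<exists>w<v. R w v \<and> sat M e (reached w) \<and> ahead w v) \<longleftrightarrow> (\<exists>w. reach w \<and> step w v)"
    using less R_less unfolding step_def by meson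
  then show ?case
    unfolding reached.simps[of v] reach_iff[of v] by (auto simp: sat_first[OF e])
qed

lemma sat_solovay [simp]: "w < K \<Longrightarrow> sat M e (solovay w) \<longleftrightarrow> reach w"
proof -
  assume w: "w < K"
  let ?e = "case_nat (on w) (case_nat (on (gn diagonal)) e)"
  let ?e' = "?e(2 := on (tgn (num (gn diagonal))))"
  have e': "?e' 1 = on (gn diagonal)" "?e' 2 = on (tgn (num (gn diagonal)))" by simp_all
  have "sat M e (solovay w) \<longleftrightarrow> sat M ?e diagonal" by (auto simp: solovay_def)
  also have "\<dots> \<longleftrightarrow> (\<exists>v<K. on w = on v \<and> sat M ?e' (reached v))"
    by (simp add: diagonal_def IsNum_iff numc_on)
  also have "\<dots> \<longleftrightarrow> reach w" unfolding sat_reached[OF e'] on_inject using w by blast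
  finally show ?thesis .
qed

lemma sat_limit: "w < K \<Longrightarrow> sat M e (limit w) \<longleftrightarrow> reach w \<and> (\<forall>v. R w v \<longrightarrow> \<not> reach v)"
proof -
  assume w: "w < K"
  have "set vs \<subseteq> {v. R w v} \<Longrightarrow> sat M e (foldr (\<lambda>v A. \<^bold>\<not> solovay v \<^bold>\<and> A) vs (solovay w)) \<longleftrightarrow>
      (\<forall>v\<in>set vs. \<not> reach v) \<and> reach w" for vs
    by (induction vs) (use w R_less in auto)
  from this[of "succs w"] show ?thesis by (auto simp: limit_def)
qed

text \<open>For two successors the smaller one requires its witness to be at most that of the
  larger, while the larger requires its own to be strictly earlier; the tie rule makes these exclude
  each other.\<close>

lemma step_deterministic: "step w v \<Longrightarrow> step w v' \<Longrightarrow> v = v'"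
proof (induction v v' rule: linorder_wlog)
  case (le v v')
  show ?case
  proof (rule ccontr)
    assume "v \<noteq> v'"
    with le have lt: "v < v'" by simp
    obtain n where n: "wit v n" "\<And>m. m \<sqsubset> n \<Longrightarrow> \<not> wit v' m"
      using le lt unfolding step_def ahead_def by (metis less_imp_not_less less_irrefl)
    obtain n' where n': "wit v' n'" "\<And>m. m \<sqsubset> sc n' \<Longrightarrow> \<not> wit v m"
      using le lt unfolding step_def ahead_def by (metis less_irrefl)
    have "\<not> n' \<sqsubset> n" "\<not> n \<sqsubset> sc n'" using n n' by blast+
    then show False unfolding less_suc using ord_neqE by blast
  qed
qed auto

text \<open>Moves are deterministic, so two visited worlds lie on one path, and by transitivity the
  later one is accessible from the earlier.\<close>

lemma reach_connected: "reach v \<Longrightarrow> reach v' \<Longrightarrow> v = v' \<or> R v v' \<or> R v' v"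
proof -
  assume v: "reach v" "reach v'"
  have R: "step\<^sup>*\<^sup>* v v' \<Longrightarrow> v = v' \<or> R v v'" for v v'
    by (induction rule: rtranclp_induct) (use R_trans step_def in blast)+
  have "step\<^sup>*\<^sup>* v v' \<or> step\<^sup>*\<^sup>* v' v"
    using v(1)[unfolded reach_def]
  proof (induction rule: rtranclp_induct)
    case base
    then show ?case using v(2) by (simp add: reach_def)
  next
    case (step y z)
    from step.IH show ?case
    proof
      assume "step\<^sup>*\<^sup>* y v'"
      then show ?thesis
      proof (cases rule: converse_rtranclpE)
        case base
        then show ?thesis using step.hyps(2) by (simp add: r_into_rtranclp)
      next
        case (step z')
        then have "z' = z" using step_deterministic \<open>step y z\<close> by blast
        then show ?thesis using step by blast
      qed
    next
      assume "step\<^sup>*\<^sup>* v' y"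
      then show ?thesis using step.hyps(2) rtranclp.rtrancl_into_rtrancl[of "solovay_model.step K R M"] by blast
    qed
  qed
  then show ?thesis using R by blast
qed

text \<open>Having a witness for some successor is definable, so there is a least such stage. Among
  the worlds witnessed at that stage the least number is taken, in accordance with the tie
  rule.\<close>

lemma trig_step: "trig v \<Longrightarrow> R w v \<Longrightarrow> \<exists>u. step w u"
proof -
  assume v: "trig v" "R w v"
  let ?P = "\<lambda>n. \<exists>u. R w u \<and> wit u n"
  have "dfn M (\<lambda>e. \<exists>u\<in>set us. wit u (e 0))" for us
  proof (induction us)
    case (Cons u us)
    have "dft M (\<lambda>e. case_nat (e 0) (\<lambda>_. on (gn (limit u))) i)" for i
      by (cases i) (auto intro: dfn_intros)
    then have "dfn M (\<lambda>e. wit u (e 0))" unfolding wit_def by (rule dfn_formula)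
    then show ?case using Cons by (simp add: dfn_disj)
  qed (simp add: dfn_const)
  from this[of "succs w"] have "dfn M (\<lambda>e. ?P (e 0))" by (simp add: Bex_def)
  moreover obtain n where "?P n" using v trig_wit by blast
  ultimately obtain n where n: "?P n" "\<And>m. m \<sqsubset> n \<Longrightarrow> \<not> ?P m" by (rule pa_least) blast
  define u where "u = (LEAST u. R w u \<and> wit u n)"
  have u: "R w u" "wit u n" using LeastI_ex[OF n(1)] by (simp_all add: u_def)
  have "\<not> wit u' m" if "R w u'" "u' \<noteq> u" "m \<sqsubset> (if u' < u then sc n else n)" for u' m
  proof (cases "u' < u")
    case True
    then have "\<not> wit u' n" using not_less_Least[of u' "\<lambda>u. R w u \<and> wit u n"] that(1) by (simp add: u_def)
    then show ?thesis using that(1,3) True n(2)[of m] by (auto simp: less_suc)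
  next
    case False
    then show ?thesis using that n(2)[of m] by auto
  qed
  then show ?thesis using u unfolding step_def ahead_def by blast
qed

lemma trig_reach: "reach w \<Longrightarrow> trig v \<Longrightarrow> R w v \<Longrightarrow> \<exists>u. R w u \<and> reach u"
  using trig_step[of v w] reach_iff unfolding step_def by meson

lemma reach_trig: "reach w \<Longrightarrow> w \<noteq> 0 \<Longrightarrow> trig w"
  unfolding reach_iff[of w] step_def ahead_def trig_wit by metis

lemma reach_less: "reach w \<Longrightarrow> w < K"
  unfolding reach_iff[of w] step_def using K_pos R_less by metis

lemma reach_Pr: "reach w \<Longrightarrow> w < K \<Longrightarrow> Pr HAx (on (gn (solovay w)))"
proof -
  assume "reach w" "w < K"
  then have "sat M (\<lambda>_. zr) (solovay w)" by simp
  with sigma1_solovay have "prov (\<lambda>_. zr) (solovay w)" by (rule sigma1_complete)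
  then show ?thesis unfolding dot_closed[OF fv_solovay] .
qed

end

text \<open>If a world other than the root were visited, there would be a last one,
  \<open>m\<close>. Its limit sentence would be true, yet having been entered means that HA together
  with it is inconsistent, against \<open>reflection\<close>. So the path stays at the root,
  although any trigger would have moved it.\<close>

lemma (in frame) standard_model_at_root:
  assumes "0 < w" "w < K"
  shows "\<not> solovay_model.trig K R standard_model w"
proof -
  interpret full_model standard_model by (rule full_model_standard)
  interpret solovay_model K R standard_model by unfold_locales
  have none: "\<not> reach v" if "v \<noteq> 0" for v
  proof
    assume "reach v"
    have fin: "finite {v. reach v \<and> v \<noteq> 0}"
    proof (rule finite_subset)
      show "{v. reach v \<and> v \<noteq> 0} \<subseteq> {..<K}" using reach_less by blast
    qed simp
    define m where "m = Max {v. reach v \<and> v \<noteq> 0}"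
    have m: "reach m" "m \<noteq> 0" using Max_in[OF fin] \<open>reach v\<close> that unfolding m_def by auto
    then have "m < K" using reach_less by blast
    have "\<not> reach u" if "R m u" for u
    proof
      assume "reach u"
      then have "u \<le> m" using R_less[OF that] m unfolding m_def by (intro Max_ge[OF fin]) simp
      then show False using R_less[OF that] by simp
    qed
    then have lim: "\<forall>e. sat standard_model e (limit m)" using m \<open>m < K\<close> by (simp add: sat_limit)
    have "\<exists>A. on falsum = on (gn A) \<and> (\<forall>e. sat standard_model e A)"
    proof (rule reflection[OF reach_trig[OF m, unfolded trig_def]])
      fix x assume "HAx x \<or> x = on (gn (limit m))"
      then show "\<exists>A. x = on (gn A) \<and> (\<forall>e. sat standard_model e A)"
        using lim HAx_decode[of x] by blast
    qed
    then show False unfolding on_inject gn_inject by (metis sat.simps(3,6))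
  qed
  show ?thesis
  proof
    assume "trig w"
    moreover have "reach 0" using reach_iff by blast
    ultimately obtain u where u: "R 0 u" "reach u" using trig_reach[OF _ _ R_root[OF assms]] by metis
    then have "u \<noteq> 0" using R_less[of 0 u] by simp
    then show False using none u(2) by simp
  qed
qed

section \<open>Realizations from Kripke models\<close>

context pa_model
begin

text \<open>Every element of the model is mapped to one of the \<open>m\<close> elements of a Kripke domain, the
  large and nonstandard ones to the last.\<close>

definition cut :: "nat \<Rightarrow> 'm \<Rightarrow> nat" where
  "cut m x = (if \<exists>d. Suc d < m \<and> x = on d then THE d. x = on d else m - 1)"

lemma cut_less: "0 < m \<Longrightarrow> cut m x < m"
  by (auto simp: cut_def)

lemma cut_on: "d < m \<Longrightarrow> cut m (on d) = d"
  by (auto simp: cut_def)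

lemma Pr_derives:
  assumes "derives \<Gamma> B" "\<And>A. A \<in> \<Gamma> \<Longrightarrow> Pr X (dot e A)" "\<And>x. HAx x \<Longrightarrow> X x"
  shows "Pr X (dot e B)"
  using assms(1)
proof induction
  case (derives_thm A)
  then show ?case using assms(3) by (rule Pr_dot)
next
  case (derives_mp A C)
  then show ?case using Pr_mp by simp
qed (rule assms(2))

end

text \<open>The last domain element stands for everything from \<open>m - 1\<close> on, which is
  expressed by a lower bound; this makes the condition bounded and total even on nonstandard
  elements.\<close>

definition cut_is :: "nat \<Rightarrow> nat \<Rightarrow> tm \<Rightarrow> fm" where
  "cut_is m d t = (if Suc d < m then t \<approx> num d else num d \<prec> Succ t)"

lemma fv_cut_is [simp]: "fv (cut_is m d t) = tfv t"
  by (simp add: cut_is_def)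

lemma delta0_cut_is: "delta0 (cut_is m d t)"
  by (simp add: cut_is_def delta0.intros)

lemma (in pa_model) sat_cut_is: "d < m \<Longrightarrow> sat M e (cut_is m d t) \<longleftrightarrow> cut m (eval M e t) = d"
proof (cases "Suc d < m")
  case True
  then show ?thesis by (auto simp: cut_is_def cut_def)
next
  case False
  assume "d < m"
  with False have m: "m = Suc d" by simp
  have "\<not> on d \<sqsubset> sc x \<longleftrightarrow> (\<exists>k<d. x = on k)" for x
    using less_on ord_less_irrefl ord_less_trans ord_neqE less_suc on_less by metis
  then have "on d \<sqsubset> sc x \<longleftrightarrow> cut m x = d" for x
    unfolding cut_def m by auto
  then show ?thesis using False by (simp add: cut_is_def)
qed

locale kripke = frame K R for K R +
  fixes \<Sigma> :: "'r signature" and \<eta> :: fm and m :: nat and F :: "nat \<Rightarrow> 'r \<Rightarrow> nat list \<Rightarrow> bool"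
  assumes standard: "standard_axiomatization_HA \<eta>" and m: "0 < m"
begin

primrec forces :: "nat \<Rightarrow> (mtm \<Rightarrow> nat) \<Rightarrow> 'r qfm \<Rightarrow> bool" where
  "forces w \<rho> QTop \<longleftrightarrow> True"
| "forces w \<rho> (QAtom S ts) \<longleftrightarrow> F w S (map \<rho> ts)"
| "forces w \<rho> (QAnd \<phi> \<psi>) \<longleftrightarrow> forces w \<rho> \<phi> \<and> forces w \<rho> \<psi>"
| "forces w \<rho> (QAll x \<phi>) \<longleftrightarrow> (\<forall>d<m. forces w (\<rho>(MVar x := d)) \<phi>)"
| "forces w \<rho> (QDia \<phi>) \<longleftrightarrow> (\<exists>v. R w v \<and> forces v \<rho> \<phi>)"

lemma forces_cong:
  "(\<And>k. k \<in> qfv \<phi> \<Longrightarrow> \<rho> (MVar k) = \<rho>' (MVar k)) \<Longrightarrow> (\<And>k. k \<in> qcons \<phi> \<Longrightarrow> \<rho> (MCon k) = \<rho>' (MCon k)) \<Longrightarrow>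
    forces w \<rho> \<phi> = forces w \<rho>' \<phi>"
proof (induction \<phi> arbitrary: \<rho> \<rho>' w)
  case (QAtom S ts)
  have "\<rho> t = \<rho>' t" if "t \<in> set ts" for t using QAtom that by (cases t) auto
  then have "map \<rho> ts = map \<rho>' ts" by simp
  then show ?case by (simp only: forces.simps)
next
  case (QAnd \<phi> \<psi>)
  have "forces w \<rho> \<phi> = forces w \<rho>' \<phi>" "forces w \<rho> \<psi> = forces w \<rho>' \<psi>"
    using QAnd.prems by (auto intro!: QAnd.IH)
  then show ?case by simp
next
  case (QAll x \<phi>)
  have "forces w (\<rho>(MVar x := d)) \<phi> = forces w (\<rho>'(MVar x := d)) \<phi>" for d
    by (rule QAll.IH) (use QAll.prems in auto)
  then show ?case by simp
next
  case (QDia \<phi>)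
  have "forces v \<rho> \<phi> = forces v \<rho>' \<phi>" for v by (rule QDia.IH) (use QDia.prems in auto)
  then show ?case by simp
qed simp

definition atom_axiom :: "'r \<Rightarrow> nat list \<Rightarrow> fm" where
  "atom_axiom S ds = conj (map (\<lambda>w. \<^bold>\<not> limit w) (filter (\<lambda>w. w \<noteq> 0 \<and> \<not> F w S ds) [0..<K]))"

lemma fv_atom_axiom [simp]: "fv (atom_axiom S ds) = {}"
  by (simp add: atom_axiom_def)

lemma atom_axiomD:
  "derives \<Gamma> (atom_axiom S ds) \<Longrightarrow> 0 < w \<Longrightarrow> w < K \<Longrightarrow> \<not> F w S ds \<Longrightarrow> derives \<Gamma> (\<^bold>\<not> limit w)"
  unfolding atom_axiom_def by (erule derives_conjD) auto

definition atom_formula :: "'r \<Rightarrow> fm" where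
  "atom_formula S = disj (map (\<lambda>ds. conj (map (\<lambda>i. cut_is m (ds ! i) (V (Suc i))) [0..<length ds]) \<^bold>\<and>
     V 0 \<approx> num (gn (atom_axiom S ds))) (List.n_lists (rel_arity \<Sigma> S) [0..<m]))"

definition atoms :: "'r \<Rightarrow> mtm list \<Rightarrow> fm" where
  "atoms S ts = app (atom_formula S) (V 0 # map realize_mtm ts)"

lemma infinitary_realization_atoms: "infinitary_realization \<Sigma> atoms"
  unfolding infinitary_realization_def
proof
  fix S
  have "sigma1 (atom_formula S)" unfolding atom_formula_def
    by (auto intro!: sigma1_disj sigma1_intros sigma1.intros(1)[OF delta0_conj] delta0_cut_is)
  moreover have "fv (atom_formula S) \<subseteq> {0..rel_arity \<Sigma> S}"
    unfolding atom_formula_def by (auto simp: set_n_lists)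
  ultimately show "\<exists>\<sigma>. sigma1 \<sigma> \<and> fv \<sigma> \<subseteq> {0..rel_arity \<Sigma> S} \<and>
      (\<forall>ts. length ts = rel_arity \<Sigma> S \<longrightarrow> atoms S ts = app \<sigma> (V 0 # map realize_mtm ts))"
    unfolding atoms_def by blast
qed

end

sublocale kripke \<subseteq> realization \<Sigma> atoms \<eta>
  by unfold_locales (rule standard infinitary_realization_atoms)+

lemma finite_qfv: "finite (qfv \<phi>)" "finite (qcons \<phi>)"
proof -
  have "finite {k. MVar k \<in> set ts}" "finite {k. MCon k \<in> set ts}" for ts :: "mtm list"
    by (rule finite_vimageI[of "set ts" MVar, unfolded vimage_def] finite_vimageI[of "set ts" MCon, unfolded vimage_def];
      simp add: inj_def)+
  then show "finite (qfv \<phi>)" "finite (qcons \<phi>)" by (induction \<phi>) auto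
qed

context frame
begin

lemma derives_limit:
  assumes "derives \<Gamma> (solovay w)" "\<And>v. R w v \<Longrightarrow> derives \<Gamma> (\<^bold>\<not> solovay v)"
  shows "derives \<Gamma> (limit w)"
proof -
  have "set vs \<subseteq> {v. R w v} \<Longrightarrow> derives \<Gamma> (foldr (\<lambda>v A. \<^bold>\<not> solovay v \<^bold>\<and> A) vs (solovay w))" for vs
    by (induction vs) (use assms in \<open>auto intro: derives_andI\<close>)
  from this[of "succs w"] show ?thesis by (simp add: limit_def)
qed

lemma derives_limitD:
  assumes "derives \<Gamma> (limit w)"
  shows "derives \<Gamma> (solovay w)" "R w v \<Longrightarrow> derives \<Gamma> (\<^bold>\<not> solovay v)"
proof -
  have *: "derives \<Gamma> (foldr (\<lambda>v A. \<^bold>\<not> solovay v \<^bold>\<and> A) vs (solovay w)) \<Longrightarrow>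
      derives \<Gamma> (solovay w) \<and> (\<forall>v\<in>set vs. derives \<Gamma> (\<^bold>\<not> solovay v))" for vs
    by (induction vs) (auto dest: derives_conjunct1 derives_conjunct2)
  from *[of "succs w"] assms show "derives \<Gamma> (solovay w)" "R w v \<Longrightarrow> derives \<Gamma> (\<^bold>\<not> solovay v)"
    by (simp_all add: limit_def)
qed

text \<open>For comparable worlds one limit sentence denies a visit that the other asserts. For
  incomparable ones both visits contradict \<open>reach_connected\<close>; this implication between
  Sigma_1 formulas transfers from models to HA.\<close>

lemma limits_exclusive:
  assumes "w < K" "v < K" "w \<noteq> v"
  shows "derives {limit w} (\<^bold>\<not> limit v)"
proof (rule derives_impI)
  let ?\<Gamma> = "{limit v, limit w}"
  have s: "derives ?\<Gamma> (limit v)" "derives ?\<Gamma> (limit w)" by (simp_all add: derives_hyp)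
  consider "R w v" | "R v w" | "\<not> R w v" "\<not> R v w" by blast
  then show "derives ?\<Gamma> Fls"
  proof cases
    case 1
    show ?thesis using derives_limitD(2)[OF s(2) 1] derives_limitD(1)[OF s(1)] by (rule derives_mp)
  next
    case 2
    show ?thesis using derives_limitD(2)[OF s(1) 2] derives_limitD(1)[OF s(2)] by (rule derives_mp)
  next
    case 3
    have "HA \<turnstile> (solovay w \<^bold>\<and> solovay v) \<^bold>\<rightarrow> Fls"
    proof (rule HA_sem)
      fix M :: "nat struct" and e assume M: "pa_model M" "sat M e (solovay w \<^bold>\<and> solovay v)"
      then interpret pa_model M by simp
      interpret solovay_model K R M by unfold_locales
      show "sat M e Fls" using M(2) reach_connected[of w v] 3 assms by simp
    qed (intro sigma1_intros sigma1_solovay)+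
    then have "derives ?\<Gamma> ((solovay w \<^bold>\<and> solovay v) \<^bold>\<rightarrow> Fls)" by (rule derives_thm)
    then show ?thesis using derives_andI[OF derives_limitD(1)[OF s(2)] derives_limitD(1)[OF s(1)]]
      by (rule derives_mp)
  qed
qed

end

text \<open>The theory refutes visits above \<open>w\<close> from the top down: a visit to
  \<open>v\<close> without later visits would be the limit sentence of \<open>v\<close>. All
  conclusions are negations, so no excluded middle is used. Since the visit to \<open>w\<close> is
  provable, so is its limit sentence, and the trigger that let the path enter \<open>w\<close>
  supplies the contradiction.\<close>

lemma (in solovay_model) inconsistent_if_reached:
  assumes w: "reach w" "0 < w" and v: "\<And>v. R w v \<Longrightarrow> Pr (Axs \<alpha> e) (dot e (\<^bold>\<not> limit v))"
    and HAx: "\<And>x. HAx x \<Longrightarrow> Axs \<alpha> e x"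
  shows "Pr (Axs \<alpha> e) (on falsum)"
proof -
  have not: "R w v \<Longrightarrow> Pr (Axs \<alpha> e) (dot e (\<^bold>\<not> solovay v))" for v
  proof (induction "K - v" arbitrary: v rule: less_induct)
    case less
    let ?\<Gamma> = "insert (\<^bold>\<not> limit v) ((\<lambda>u. \<^bold>\<not> solovay u) ` {u. R v u})"
    have "derives ?\<Gamma> (\<^bold>\<not> solovay v)"
    proof (rule derives_impI)
      have "derives (insert (solovay v) ?\<Gamma>) (limit v)"
        by (rule derives_limit) (auto intro: derives_hyp)
      then show "derives (insert (solovay v) ?\<Gamma>) Fls"
        by (rule derives_mp[rotated]) (simp add: derives_hyp)
    qed
    moreover have "Pr (Axs \<alpha> e) (dot e A)" if A: "A \<in> ?\<Gamma>" for A
    proof (cases "A = (\<^bold>\<not> limit v)")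
      case True
      then show ?thesis using v[OF less.prems] by simp
    next
      case False
      then obtain u where u: "A = (\<^bold>\<not> solovay u)" "R v u" using A by blast
      have "K - u < K - v" using R_less[OF u(2)] by arith
      then show ?thesis using less.hyps R_trans[OF less.prems u(2)] u(1) by blast
    qed
    ultimately show ?case using HAx by (rule Pr_derives)
  qed
  have "derives (insert (solovay w) ((\<lambda>u. \<^bold>\<not> solovay u) ` {u. R w u})) (limit w)"
    by (rule derives_limit) (auto intro: derives_hyp)
  moreover have "Pr (Axs \<alpha> e) (on (gn (solovay w)))"
    using reach_Pr[OF w(1) reach_less[OF w(1)]] HAx by (rule Pr_mono)
  then have "Pr (Axs \<alpha> e) (dot e A)" if "A \<in> insert (solovay w) ((\<lambda>u. \<^bold>\<not> solovay u) ` {u. R w u})" for A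
    using that not dot_closed[OF fv_solovay] by (auto simp del: cfm.simps)
  ultimately have "Pr (Axs \<alpha> e) (dot e (limit w))" using HAx by (rule Pr_derives)
  then have lim: "Pr (Axs \<alpha> e) (on (gn (limit w)))" unfolding dot_closed[OF fv_limit] .
  have "trig w" using reach_trig w by simp
  then show ?thesis unfolding trig_def
  proof (rule Pr_Axs_subset)
    fix x assume "HAx x \<or> x = on (gn (limit w))"
    then show "Pr (Axs \<alpha> e) x" using lim HAx Pr_ax[of "Axs \<alpha> e" x] by blast
  qed
qed

locale kripke_model = kripke K R \<Sigma> \<eta> m F + solovay_model K R M
  for K R and \<Sigma> :: "'r signature" and \<eta> m F and M :: "nat struct"

sublocale kripke_model \<subseteq> realization_model \<Sigma> atoms \<eta> M
  by unfold_locales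

context kripke_model
begin

abbreviation "asg e t \<equiv> cut m (e (mvar t))"

lemma sat_atoms:
  assumes "length ts = rel_arity \<Sigma> S"
  shows "sat M (e(0 := x)) (atoms S ts) \<longleftrightarrow> x = on (gn (atom_axiom S (map (asg e) ts)))"
proof -
  define e' where "e' = (\<lambda>i. if i < length (V 0 # map realize_mtm ts)
    then eval M (e(0 := x)) ((V 0 # map realize_mtm ts) ! i) else (e(0 := x)) i)"
  have e': "e' 0 = x" "i < length ts \<Longrightarrow> e' (Suc i) = e (mvar (ts ! i))" for i
    by (simp_all add: e'_def realize_mtm_mvar)
  have cuts: "sat M e' (conj (map (\<lambda>i. cut_is m (ds ! i) (V (Suc i))) [0..<length ds])) \<longleftrightarrow>
      (\<forall>i<length ts. asg e (ts ! i) = ds ! i)"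
    if "ds \<in> set (List.n_lists (length ts) [0..<m])" for ds
  proof -
    have ds: "length ds = length ts" "set ds \<subseteq> {0..<m}" using that by (simp_all add: set_n_lists)
    then have "ds ! i < m" if "i < length ts" for i
      using that by (metis atLeastLessThan_iff nth_mem subset_iff)
    then have "sat M e' (cut_is m (ds ! i) (V (Suc i))) \<longleftrightarrow> asg e (ts ! i) = ds ! i" if "i < length ts" for i
      using that e'(2)[OF that] by (simp add: sat_cut_is)
    then show ?thesis using ds(1) by auto
  qed
  have "sat M e' (atom_formula S) \<longleftrightarrow> (\<exists>ds\<in>set (List.n_lists (length ts) [0..<m]).
      (\<forall>i<length ts. asg e (ts ! i) = ds ! i) \<and> x = on (gn (atom_axiom S ds)))"
    unfolding atom_formula_def assms[symmetric] using cuts by (auto simp: e'(1))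
  also have "\<dots> \<longleftrightarrow> x = on (gn (atom_axiom S (map (asg e) ts)))"
  proof -
    have "(\<forall>i<length ts. asg e (ts ! i) = ds ! i) \<longleftrightarrow> ds = map (asg e) ts" if "length ds = length ts" for ds
      using that by (auto simp: list_eq_iff_nth_eq)
    moreover have "map (asg e) ts \<in> set (List.n_lists (length ts) [0..<m])"
      using cut_less[OF m] by (auto simp: set_n_lists)
    ultimately show ?thesis by (auto simp: set_n_lists)
  qed
  finally show ?thesis unfolding atoms_def sat_app e'_def .
qed

lemma th_QAtom:
  "length ts = rel_arity \<Sigma> S \<Longrightarrow> th (QAtom S ts) e x \<longleftrightarrow> HAx x \<or> x = on (gn (atom_axiom S (map (asg e) ts)))"
  using Fm_on[of "atom_axiom S (map (asg e) ts)" 0] unfolding th_Atom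
  by (auto simp: sat_atoms)

lemma asg_upd: "(asg e)(MVar i := cut m a) = asg (e(yvar i := a))"
  using mvar_inject[of _ "MVar i"] by (auto simp: fun_eq_iff simp del: mvar_inject)

end

section \<open>Forcing compared with the realized theories\<close>

context kripke
begin

text \<open>Forcing depends on the values of the parameters only through their cuts. Recording these
  as a bounded formula allows one implication in HA to cover all values alike, and its true
  instances are provable.\<close>

definition cond :: "(mtm \<Rightarrow> nat) \<Rightarrow> 'r qfm \<Rightarrow> fm" where
  "cond \<rho> \<phi> = conj (map (\<lambda>t. cut_is m (\<rho> t) (V (mvar t)))
     (map MVar (sorted_list_of_set (qfv \<phi>)) @ map MCon (sorted_list_of_set (qcons \<phi>))))"

lemma sigma1_cond: "sigma1 (cond \<rho> \<phi>)"
  unfolding cond_def by (auto intro!: sigma1.intros(1)[OF delta0_conj] delta0_cut_is)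

lemma kripke_modelI: "pa_model M \<Longrightarrow> kripke_model K R \<eta> m M"
  by (intro kripke_model.intro solovay_model.intro kripke_axioms frame_axioms)

lemma sat_cond_iff:
  assumes "pa_model (M :: nat struct)" "\<And>t. \<rho> t < m"
  shows "sat M e (cond \<rho> \<phi>) \<longleftrightarrow> (\<forall>k\<in>qfv \<phi>. pa_model.cut M m (e (mvar (MVar k))) = \<rho> (MVar k)) \<and>
    (\<forall>k\<in>qcons \<phi>. pa_model.cut M m (e (mvar (MCon k))) = \<rho> (MCon k))"
  by (auto simp: cond_def pa_model.sat_cut_is[OF assms(1)] assms(2) finite_qfv ball_Un)

lemma forces_cond:
  assumes "pa_model (M :: nat struct)" "\<And>t. \<rho> t < m" "sat M e (cond \<rho> \<phi>)"
  shows "forces w (\<lambda>t. pa_model.cut M m (e (mvar t))) \<phi> = forces w \<rho> \<phi>"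
  using assms(3) unfolding sat_cond_iff[OF assms(1,2)] by (intro forces_cong) auto

abbreviation limit_theory :: "nat struct \<Rightarrow> nat \<Rightarrow> nat \<Rightarrow> bool" where
  "limit_theory M w x \<equiv> pa_model.HAx M x \<or> x = pa_model.on M (gn (limit w))"

abbreviation assignment :: "nat struct \<Rightarrow> (nat \<Rightarrow> nat) \<Rightarrow> mtm \<Rightarrow> nat" where
  "assignment M e t \<equiv> pa_model.cut M m (e (mvar t))"

text \<open>HA plus a limit sentence is presented as the theory of an axiomatizing formula with the
  code of the sentence as parameter. This makes its provability definable, as replacing axioms by
  proofs requires.\<close>

lemma Pr_limit_subset:
  assumes "pa_model M" "pa_model.Pr M X x" "\<And>y. X y \<Longrightarrow> pa_model.Pr M (limit_theory M w) y"
  shows "pa_model.Pr M (limit_theory M w) x"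
proof -
  interpret kripke_model K R \<Sigma> \<eta> m F M using assms(1) by (rule kripke_modelI)
  have "Sent (on (gn (limit w)))" using Fm_on[of "limit w" 0] by simp
  then have "Axs (is_HA_axiom \<^bold>\<or> V 0 \<approx> V 1) (\<lambda>_. on (gn (limit w))) = limit_theory M w"
    by (auto simp: Axs_def HAx_def fun_eq_iff)
  then show ?thesis using Pr_Axs_subset[OF assms(2), of "is_HA_axiom \<^bold>\<or> V 0 \<approx> V 1"] assms(3) by metis
qed

text \<open>The model is generalized in the induction: the diamond case needs the hypothesis in
  every model, to turn it into an implication provable in HA.\<close>

lemma unforced_refutes:
  assumes "pa_model M" "wf_qfm \<Sigma> \<phi>" "0 < w" "w < K" "\<not> forces w (assignment M e) \<phi>"
  shows "pa_model.Pr M (pa_model.Axs M (rl \<phi>) e) (pa_model.on M (gn (\<^bold>\<not> limit w)))"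
  using assms
proof (induction \<phi> arbitrary: M e w)
  case QTop
  then show ?case by simp
next
  case (QAtom S ts)
  interpret kripke_model K R \<Sigma> \<eta> m F M using QAtom(1) by (rule kripke_modelI)
  have len: "length ts = rel_arity \<Sigma> S" using QAtom.prems(2) by simp
  let ?A = "atom_axiom S (map (asg e) ts)"
  have "derives {?A} (\<^bold>\<not> limit w)"
    by (rule atom_axiomD[OF derives_hyp]) (use QAtom.prems in auto)
  moreover have "Pr (th (QAtom S ts) e) (dot e ?A)"
    unfolding dot_closed[OF fv_atom_axiom] by (rule Pr_ax) (simp add: th_QAtom[OF len] del: realize.simps)
  ultimately have "Pr (th (QAtom S ts) e) (dot e (\<^bold>\<not> limit w))"
    using Pr_derives[of "{?A}"] HAx_th[OF QAtom.prems(2)] by blast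
  then show ?case by (subst (asm) dot_closed) simp_all
next
  case (QAnd \<phi> \<psi>)
  interpret kripke_model K R \<Sigma> \<eta> m F M using QAnd.prems(1) by (rule kripke_modelI)
  have "Pr (th \<phi> e) (on (gn (\<^bold>\<not> limit w))) \<or> Pr (th \<psi> e) (on (gn (\<^bold>\<not> limit w)))"
    using QAnd.IH(1)[of M w e] QAnd.IH(2)[of M w e] QAnd.prems by auto
  then show ?case
    using Pr_mono[of "th \<phi> e" _ "th (QAnd \<phi> \<psi>) e"] Pr_mono[of "th \<psi> e" _ "th (QAnd \<phi> \<psi>) e"] th_And by blast
next
  case (QAll i \<phi>)
  interpret kripke_model K R \<Sigma> \<eta> m F M using QAll.prems(1) by (rule kripke_modelI)
  \<comment> \<open>The failing domain element is represented in the model by \<open>on d\<close>,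
    and one member of the union suffices for the refutation.\<close>
  obtain d where d: "d < m" "\<not> forces w ((asg e)(MVar i := d)) \<phi>" using QAll.prems by auto
  then have "\<not> forces w (asg (e(yvar i := on d))) \<phi>"
    unfolding asg_upd[symmetric] cut_on[OF d(1)] by blast
  moreover have "wf_qfm \<Sigma> \<phi>" using QAll.prems(2) by simp
  ultimately have "Pr (th \<phi> (e(yvar i := on d))) (on (gn (\<^bold>\<not> limit w)))"
    using QAll.IH[OF QAll.prems(1) _ QAll.prems(3,4)] by blast
  then show ?case by (rule Pr_mono) (use th_All in blast)
next
  case (QDia \<phi>)
  interpret kripke_model K R \<Sigma> \<eta> m F M using QDia.prems(1) by (rule kripke_modelI)
  let ?C = "cond (asg e) \<phi>"
  have less: "\<And>t. asg e t < m" using cut_less[OF m] by simp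
  have wf: "wf_qfm \<Sigma> \<phi>" using QDia.prems by simp
  \<comment> \<open>At a visit to \<open>w\<close>, the induction hypothesis makes the theory of
    \<open>\<phi>\<close> refute the limits of all successors, so it is inconsistent. This
    contradicts the axiom contributed by the diamond.\<close>
  have imp: "HA \<turnstile> (?C \<^bold>\<and> solovay w) \<^bold>\<rightarrow> inconsistency (rl \<phi>)"
  proof (rule HA_sem)
    fix N :: "nat struct" and e'
    assume N: "pa_model N" "sat N e' (?C \<^bold>\<and> solovay w)"
    then interpret N: kripke_model K R \<Sigma> \<eta> m F N by (intro kripke_modelI)
    have "N.Pr (N.th \<phi> e') (N.dot e' (\<^bold>\<not> limit v))" if "R w v" for v
    proof -
      have "\<not> forces v (assignment N e') \<phi>"
        using forces_cond[OF N(1) less, where e = e' and \<phi> = \<phi> and w = v] N(2) QDia.prems(5) that by auto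
      then have "N.Pr (N.th \<phi> e') (N.on (gn (\<^bold>\<not> limit v)))"
        using QDia.IH[OF N(1) wf, of v e'] R_less[OF that] by simp
      then show ?thesis by (subst N.dot_closed) simp_all
    qed
    moreover have "N.reach w" using N(2) N.sat_solovay[OF QDia.prems(4)] by simp
    ultimately have "N.Pr (N.th \<phi> e') (N.on falsum)"
      using N.inconsistent_if_reached[OF _ QDia.prems(3), of "rl \<phi>" e'] N.HAx_th[OF wf] by blast
    then show "sat N e' (inconsistency (rl \<phi>))" unfolding N.sat_inconsistency .
  qed (intro sigma1_intros sigma1_cond sigma1_solovay sigma1_subst sigma1_box sigma1_rl wf)+
  let ?\<Gamma> = "{?C, dia (rl \<phi>) Tru}"
  have "derives ?\<Gamma> (\<^bold>\<not> limit w)"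
  proof (rule derives_impI)
    let ?\<Delta> = "insert (limit w) ?\<Gamma>"
    have "derives ?\<Delta> (limit w)" by (rule derives_hyp) (rule insertI1)
    note s = derives_limitD(1)[OF this]
    have c: "derives ?\<Delta> ?C" by (rule derives_hyp) blast
    have d: "derives ?\<Delta> (\<^bold>\<not> inconsistency (rl \<phi>))" by (rule derives_hyp) (simp add: dia_def)
    show "derives ?\<Delta> Fls"
      using d derives_mp[OF derives_thm[OF imp] derives_andI[OF c s]] by (rule derives_mp)
  qed
  moreover have "Pr (th (QDia \<phi>) e) (dot e A)" if "A \<in> ?\<Gamma>" for A
  proof -
    have "sat M e ?C" unfolding sat_cond_iff[OF QDia.prems(1) less] by simp
    then have "Pr (th (QDia \<phi>) e) (dot e ?C)"
      by (rule Pr_mono[OF sigma1_complete[OF sigma1_cond]]) (use HAx_th QDia.prems in blast)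
    moreover have "Pr (th (QDia \<phi>) e) (dot e (dia (rl \<phi>) Tru))"
      by (rule Pr_ax) (use th_Dia[OF wf] in blast)
    ultimately show ?thesis using that by blast
  qed
  ultimately have "Pr (th (QDia \<phi>) e) (dot e (\<^bold>\<not> limit w))"
    using HAx_th[OF QDia.prems(2)] by (rule Pr_derives)
  then show ?case by (subst (asm) dot_closed) simp_all
qed

lemma forced_limit_theory:
  assumes "pa_model M" "wf_qfm \<Sigma> \<phi>" "0 < w" "w < K" "forces w (assignment M e) \<phi>"
    "pa_model.Axs M (rl \<phi>) e x"
  shows "pa_model.Pr M (limit_theory M w) x"
  using assms
proof (induction \<phi> arbitrary: M e w x)
  case QTop
  interpret kripke_model K R \<Sigma> \<eta> m F M using QTop(1) by (rule kripke_modelI)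
  have "HAx x" using QTop(6) unfolding th_Top .
  then show ?case using Pr_ax[of "limit_theory M w"] by blast
next
  case (QAtom S ts)
  interpret kripke_model K R \<Sigma> \<eta> m F M using QAtom(1) by (rule kripke_modelI)
  have len: "length ts = rel_arity \<Sigma> S" using QAtom.prems(2) by simp
  let ?A = "atom_axiom S (map (asg e) ts)"
  have "F w S (map (asg e) ts)" using QAtom by simp
  then have "derives {limit w} ?A" unfolding atom_axiom_def
    by (intro derives_conj) (auto intro!: limits_exclusive QAtom.prems(4))
  moreover have "Pr (limit_theory M w) (dot e (limit w))"
    unfolding dot_closed[OF fv_limit] by (rule Pr_ax) simp
  ultimately have "Pr (limit_theory M w) (dot e ?A)" using Pr_derives[of "{limit w}"] by blast
  then show ?case using QAtom(6) Pr_ax[of "limit_theory M w"]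
    unfolding th_QAtom[OF len] dot_closed[OF fv_atom_axiom] by blast
next
  case (QAnd \<phi> \<psi>)
  interpret kripke_model K R \<Sigma> \<eta> m F M using QAnd.prems(1) by (rule kripke_modelI)
  show ?case using QAnd.IH(1)[of M w e x] QAnd.IH(2)[of M w e x] QAnd.prems unfolding th_And by auto
next
  case (QAll i \<phi>)
  interpret kripke_model K R \<Sigma> \<eta> m F M using QAll.prems(1) by (rule kripke_modelI)
  \<comment> \<open>The witness may be nonstandard; it plays the part of its cut, which lies in the
    Kripke domain.\<close>
  obtain a where a: "th \<phi> (e(yvar i := a)) x" using QAll.prems(6) unfolding th_All by blast
  have "forces w ((asg e)(MVar i := cut m a)) \<phi>" using QAll.prems(5) cut_less[OF m] by simp
  then show ?case unfolding asg_upd using QAll.IH[OF QAll.prems(1) _ QAll.prems(3,4) _ a] QAll.prems(2) by simp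
next
  case (QDia \<phi>)
  interpret kripke_model K R \<Sigma> \<eta> m F M using QDia.prems(1) by (rule kripke_modelI)
  let ?C = "cond (asg e) \<phi>"
  have less: "\<And>t. asg e t < m" using cut_less[OF m] by simp
  have wf: "wf_qfm \<Sigma> \<phi>" using QDia.prems by simp
  obtain v where v: "R w v" "forces v (asg e) \<phi>" using QDia.prems(5) by auto
  \<comment> \<open>If the theory of \<open>\<phi>\<close> were inconsistent, so would be HA with
    the limit sentence of \<open>v\<close>, which contains it. The trigger of \<open>v\<close> then
    moves the path from \<open>w\<close> to some successor, not necessarily to
    \<open>v\<close>.\<close>
  have imp: "HA \<turnstile> ((?C \<^bold>\<and> solovay w) \<^bold>\<and> inconsistency (rl \<phi>)) \<^bold>\<rightarrow> disj (map solovay (succs w))"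
  proof (rule HA_sem)
    fix N :: "nat struct" and e'
    assume N: "pa_model N" "sat N e' ((?C \<^bold>\<and> solovay w) \<^bold>\<and> inconsistency (rl \<phi>))"
    then interpret N: kripke_model K R \<Sigma> \<eta> m F N by (intro kripke_modelI)
    have f: "forces v (assignment N e') \<phi>"
      using forces_cond[OF N(1) less, where e = e' and \<phi> = \<phi> and w = v] N(2) v by auto
    have "N.Pr (N.th \<phi> e') (N.on falsum)" using N(2) N.sat_inconsistency by (simp only: sat.simps)
    then have "N.trig v" unfolding N.trig_def
    proof (rule Pr_limit_subset[OF N(1)])
      fix y assume "N.th \<phi> e' y"
      then show "N.Pr (limit_theory N v) y"
        using QDia.IH[OF N(1) wf _ _ f] R_less[OF v(1)] by simp
    qed
    moreover have "N.reach w" using N(2) N.sat_solovay[OF QDia.prems(4)] by simp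
    ultimately obtain u where u: "R w u" "N.reach u" using N.trig_reach v(1) by meson
    then have "sat N e' (solovay u)" using N.sat_solovay[of u e'] R_less[of w u] by simp
    then show "sat N e' (disj (map solovay (succs w)))" using u(1) by auto
  qed (auto intro!: sigma1_intros sigma1_cond sigma1_solovay sigma1_subst sigma1_box sigma1_rl wf sigma1_disj)
  let ?\<Gamma> = "{?C, limit w}"
  have "derives ?\<Gamma> (dia (rl \<phi>) Tru)" unfolding dia_def
  proof (rule derives_impI)
    let ?\<Delta> = "insert (inconsistency (rl \<phi>)) ?\<Gamma>"
    have lim: "derives ?\<Delta> (limit w)" by (rule derives_hyp) blast
    have c: "derives ?\<Delta> ?C" by (rule derives_hyp) blast
    have i: "derives ?\<Delta> (inconsistency (rl \<phi>))" by (rule derives_hyp) (rule insertI1)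
    have "derives ?\<Delta> (disj (map solovay (succs w)))"
      by (rule derives_mp[OF derives_thm[OF imp] derives_andI[OF derives_andI[OF c derives_limitD(1)[OF lim]] i]])
    then show "derives ?\<Delta> Fls"
    proof (rule derives_disjE)
      fix A assume "A \<in> set (map solovay (succs w))"
      then obtain u where u: "A = solovay u" "R w u" by auto
      have "derives (insert A ?\<Delta>) (\<^bold>\<not> solovay u)"
        using derives_limitD(2)[OF lim u(2)] by (rule derives_mono) blast
      then show "derives (insert A ?\<Delta>) Fls" by (rule derives_mp) (simp add: u derives_hyp)
    qed
  qed
  moreover have "Pr (limit_theory M w) (dot e A)" if "A \<in> ?\<Gamma>" for A
  proof -
    have "sat M e ?C" unfolding sat_cond_iff[OF QDia.prems(1) less] by simp
    then have "Pr (limit_theory M w) (dot e ?C)"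
      by (rule Pr_mono[OF sigma1_complete[OF sigma1_cond]]) simp
    moreover have "Pr (limit_theory M w) (dot e (limit w))"
      unfolding dot_closed[OF fv_limit] by (rule Pr_ax) simp
    ultimately show ?thesis using that by blast
  qed
  moreover have "limit_theory M w x" if "HAx x" for x using that by blast
  ultimately have "Pr (limit_theory M w) (dot e (dia (rl \<phi>) Tru))" by (rule Pr_derives)
  then show ?case using QDia.prems(6) Pr_ax[of "limit_theory M w" x] unfolding th_Dia[OF wf] by blast
qed

theorem arithmetical_countermodel:
  assumes "wf_qfm \<Sigma> \<phi>" "wf_qfm \<Sigma> \<psi>" "0 < w" "w < K" "\<And>t. \<rho> t < m"
    "forces w \<rho> \<phi>" "\<not> forces w \<rho> \<psi>"
  shows "\<not> (HA \<turnstile> theory_inclusion (rl \<psi>) (rl \<phi>))"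
proof
  assume incl: "HA \<turnstile> theory_inclusion (rl \<psi>) (rl \<phi>)"
  interpret full_model standard_model by (rule full_model_standard)
  interpret kripke_model K R \<Sigma> \<eta> m F standard_model using pa_model_axioms by (rule kripke_modelI)
  \<comment> \<open>Each term gets a standard element below \<open>m\<close>, which
    \<open>cut\<close> leaves alone, so the assignment is recovered exactly.\<close>
  define e where "e = (\<lambda>i. on (\<rho> (inv mvar i)))"
  have "inj mvar" by (simp add: inj_def)
  then have "asg e = \<rho>" using cut_on assms(5) by (auto simp: e_def fun_eq_iff)
  with assms(6,7) have f: "forces w (asg e) \<phi>" "\<not> forces w (asg e) \<psi>" by simp_all
  let ?x = "on (gn (\<^bold>\<not> limit w))" and ?N = standard_model
  have sent: "Sent ?x" by (rule Fm_on[of _ 0, simplified]) simp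
  have alls: "sat ?N e (alls ns A) \<Longrightarrow> (\<And>i. i \<in> set ns \<Longrightarrow> i \<noteq> 0) \<Longrightarrow> sat ?N e A" for ns A e
    by (induction ns arbitrary: e) (simp, metis fun_upd_triv list.set_intros sat_allv foldr.simps(2) comp_apply)
  have "sat ?N (e(0 := ?x)) (is_sentence (V 0) \<^bold>\<rightarrow> box (rl \<psi>) \<^bold>\<rightarrow> box (rl \<phi>))"
  proof (rule alls)
    let ?\<chi> = "is_sentence (V 0) \<^bold>\<rightarrow> box (rl \<psi>) \<^bold>\<rightarrow> box (rl \<phi>)"
    have "sat ?N e (theory_inclusion (rl \<psi>) (rl \<phi>))" using incl pa by (rule HA_sound)
    then show "sat ?N (e(0 := ?x)) (alls (sorted_list_of_set (fv ?\<chi> - {0})) ?\<chi>)"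
      unfolding theory_inclusion_def Let_def by simp
  qed (simp add: finite_fv)
  then have "Pr (th \<psi> e) ?x \<longrightarrow> Pr (th \<phi> e) ?x" using sent by (simp only: sat.simps sat_is_sentence sat_box eval.simps) simp
  moreover have "Pr (th \<psi> e) ?x"
    using unforced_refutes[OF pa_model_axioms assms(2,3,4) f(2)] .
  ultimately have "Pr (th \<phi> e) ?x" by blast
  then have "Pr (limit_theory ?N w) ?x"
    by (rule Pr_limit_subset[OF pa_model_axioms])
      (rule forced_limit_theory[OF pa_model_axioms assms(1,3,4) f(1)])
  moreover have "Pr (limit_theory ?N w) (on (gn (limit w)))" by (rule Pr_ax) simp
  moreover have "derives {\<^bold>\<not> limit w, limit w} (\<^bold>\<not> Tru)"
    by (rule derives_impI, rule derives_mp[of _ "limit w"]) (simp_all add: derives_hyp)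
  then have "Pr (limit_theory ?N w) (dot e (\<^bold>\<not> Tru))"
    by (rule Pr_derives) (use calculation in \<open>auto simp: dot_closed\<close>)
  ultimately have "trig w" unfolding trig_def by (subst (asm) dot_closed) simp_all
  then show False using standard_model_at_root assms(3,4) by blast
qed

end

section \<open>Kripke completeness\<close>

primrec tsub :: "(nat \<Rightarrow> mtm) \<Rightarrow> mtm \<Rightarrow> mtm" where
  "tsub \<sigma> (MVar k) = \<sigma> k"
| "tsub \<sigma> (MCon c) = MCon c"

text \<open>Capture is not excluded here; the terms substituted below consist of variables that are not bound
  in the formula.\<close>

primrec isub :: "(nat \<Rightarrow> mtm) \<Rightarrow> 'r qfm \<Rightarrow> 'r qfm" where
  "isub \<sigma> QTop = QTop"
| "isub \<sigma> (QAtom S ts) = QAtom S (map (tsub \<sigma>) ts)"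
| "isub \<sigma> (QAnd \<phi> \<psi>) = QAnd (isub \<sigma> \<phi>) (isub \<sigma> \<psi>)"
| "isub \<sigma> (QAll x \<phi>) = QAll x (isub (\<sigma>(x := MVar x)) \<phi>)"
| "isub \<sigma> (QDia \<phi>) = QDia (isub \<sigma> \<phi>)"

primrec qvars :: "'r qfm \<Rightarrow> nat set" where
  "qvars QTop = {}"
| "qvars (QAtom S ts) = {k. MVar k \<in> set ts}"
| "qvars (QAnd \<phi> \<psi>) = qvars \<phi> \<union> qvars \<psi>"
| "qvars (QAll x \<phi>) = insert x (qvars \<phi>)"
| "qvars (QDia \<phi>) = qvars \<phi>"

lemma qfv_qvars: "qfv \<phi> \<subseteq> qvars \<phi>"
  by (induction \<phi>) auto

lemma finite_qvars: "finite (qvars \<phi>)"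
proof (induction \<phi>)
  case (QAtom S ts)
  then show ?case using finite_qfv(1)[of "QAtom S ts"] by simp
qed auto

lemma isub_cong: "(\<And>y. y \<in> qfv \<phi> \<Longrightarrow> \<sigma> y = \<sigma>' y) \<Longrightarrow> isub \<sigma> \<phi> = isub \<sigma>' \<phi>"
proof (induction \<phi> arbitrary: \<sigma> \<sigma>')
  case (QAtom S ts)
  have "tsub \<sigma> t = tsub \<sigma>' t" if "t \<in> set ts" for t by (cases t) (use QAtom that in auto)
  then show ?case by simp
next
  case (QAnd \<phi> \<psi>)
  have "isub \<sigma> \<phi> = isub \<sigma>' \<phi>" "isub \<sigma> \<psi> = isub \<sigma>' \<psi>"
    using QAnd.prems by (auto intro!: QAnd.IH)
  then show ?case by simp
next
  case (QAll x \<phi>)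
  have "isub (\<sigma>(x := MVar x)) \<phi> = isub (\<sigma>'(x := MVar x)) \<phi>"
    by (rule QAll.IH) (use QAll.prems in auto)
  then show ?case by simp
next
  case (QDia \<phi>)
  have "isub \<sigma> \<phi> = isub \<sigma>' \<phi>" by (rule QDia.IH) (use QDia.prems in simp)
  then show ?case by simp
qed simp

lemma isub_MVar: "isub MVar \<phi> = \<phi>"
proof (induction \<phi>)
  case (QAtom S ts)
  have "tsub MVar t = t" for t by (cases t) auto
  then show ?case by (simp add: map_idI)
qed (simp_all add: fun_upd_idem)

lemma wf_isub: "wf_qfm \<Sigma> \<phi> \<Longrightarrow> (\<And>y. wf_mtm \<Sigma> (\<sigma> y)) \<Longrightarrow> wf_qfm \<Sigma> (isub \<sigma> \<phi>)"
proof (induction \<phi> arbitrary: \<sigma>)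
  case (QAtom S ts)
  have "wf_mtm \<Sigma> (tsub \<sigma> t)" if "t \<in> set ts" for t by (cases t) (use QAtom that in auto)
  then show ?case using QAtom by simp
qed auto

lemma qfv_isub: "k \<in> qfv (isub \<sigma> \<phi>) \<Longrightarrow> \<exists>y\<in>qfv \<phi>. \<sigma> y = MVar k"
proof (induction \<phi> arbitrary: \<sigma>)
  case (QAtom S ts)
  then obtain t where t: "t \<in> set ts" "tsub \<sigma> t = MVar k" by auto
  show ?case by (cases t) (use t in auto)
next
  case (QAll x \<phi>)
  then have k: "k \<in> qfv (isub (\<sigma>(x := MVar x)) \<phi>)" "k \<noteq> x" by simp_all
  obtain y where y: "y \<in> qfv \<phi>" "(\<sigma>(x := MVar x)) y = MVar k" using QAll.IH[OF k(1)] by blast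
  then have "y \<noteq> x" using k(2) by (cases "y = x") simp_all
  then show ?case using y by (intro bexI[of _ y]) simp_all
qed auto

text \<open>Either \<open>x\<close> comes only from itself, so that a binder \<open>x\<close> hides
  the same occurrences on both sides, or \<open>x\<close> is not bound in \<open>\<phi>\<close> at
  all.\<close>

lemma qsubst_isub:
  "(\<forall>y. \<sigma> y = MVar x \<longrightarrow> y = x) \<or> x \<notin> qvars \<phi> \<Longrightarrow>
    qsubst x t (isub \<sigma> \<phi>) = isub (\<lambda>y. if \<sigma> y = MVar x then t else \<sigma> y) \<phi>"
proof (induction \<phi> arbitrary: \<sigma>)
  case (QAtom S ts)
  have "(if tsub \<sigma> s = MVar x then t else tsub \<sigma> s) = tsub (\<lambda>y. if \<sigma> y = MVar x then t else \<sigma> y) s" for s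
    by (cases s) auto
  then show ?case by simp
next
  case (QAll z \<phi>)
  let ?\<sigma> = "\<lambda>y. if \<sigma> y = MVar x then t else \<sigma> y"
  show ?case
  proof (cases "z = x")
    case True
    then have "\<sigma>(x := MVar x) = ?\<sigma>(x := MVar x)" using QAll.prems by (auto simp: fun_eq_iff)
    then show ?thesis using True by simp
  next
    case False
    have "qsubst x t (isub (\<sigma>(z := MVar z)) \<phi>) =
        isub (\<lambda>y. if (\<sigma>(z := MVar z)) y = MVar x then t else (\<sigma>(z := MVar z)) y) \<phi>"
      by (rule QAll.IH) (use QAll.prems in auto)
    also have "(\<lambda>y. if (\<sigma>(z := MVar z)) y = MVar x then t else (\<sigma>(z := MVar z)) y) = ?\<sigma>(z := MVar z)"
      using False by (auto simp: fun_eq_iff)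
    finally show ?thesis using False by (simp only: isub.simps qsubst.simps if_False)
  qed
qed auto

lemma free_for_isub: "(\<And>y. y \<in> qvars \<phi> \<Longrightarrow> t \<noteq> MVar y) \<Longrightarrow> free_for t x (isub \<sigma> \<phi>)"
  by (induction \<phi> arbitrary: \<sigma>) auto

text \<open>The variable \<open>v\<close> enters only through \<open>x\<close>. Below a binder
  \<open>x\<close> it is therefore no longer free, and no other binder can capture the new
  \<open>x\<close>.\<close>

lemma free_for_isub_rename:
  "v \<notin> qvars \<phi> \<Longrightarrow> v \<noteq> x \<Longrightarrow> (\<forall>y. \<sigma> y = MVar v \<longrightarrow> y = x) \<Longrightarrow> free_for (MVar x) v (isub \<sigma> \<phi>)"
proof (induction \<phi> arbitrary: \<sigma>)
  case (QAll z \<phi>)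
  show ?case
  proof (cases "z = x")
    case True
    then have "v \<notin> qfv (isub \<sigma> (QAll z \<phi>))"
      using QAll.prems qfv_isub[of v "\<sigma>(z := MVar z)" \<phi>] by (auto split: if_splits)
    then show ?thesis by simp
  next
    case False
    have "free_for (MVar x) v (isub (\<sigma>(z := MVar z)) \<phi>)"
      by (rule QAll.IH) (use QAll.prems in auto)
    then show ?thesis using False by simp
  qed
qed auto

text \<open>The calculus substitutes one variable at a time, so the renaming is undone step by step:
  after \<open>n\<close> steps the first \<open>n\<close> variables are restored. The renamed ones
  start at \<open>k\<close> and are never bound.\<close>

lemma qrc1_rename_back:
  assumes k: "qvars \<phi> \<subseteq> {..<k}" "qvars \<psi> \<subseteq> {..<k}"
    and "qrc1 \<Sigma> (isub (\<lambda>y. MVar (k + y)) \<phi>) (isub (\<lambda>y. MVar (k + y)) \<psi>)"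
  shows "qrc1 \<Sigma> \<phi> \<psi>"
proof -
  let ?\<sigma> = "\<lambda>n y. if y < n then MVar y else MVar (k + y)"
  have "n \<le> k \<Longrightarrow> qrc1 \<Sigma> (isub (?\<sigma> n) \<phi>) (isub (?\<sigma> n) \<psi>)" for n
  proof (induction n)
    case 0
    then show ?case using assms(3) by simp
  next
    case (Suc n)
    have sub: "qsubst (k + n) (MVar n) (isub (?\<sigma> n) \<theta>) = isub (?\<sigma> (Suc n)) \<theta>"
      and free: "free_for (MVar n) (k + n) (isub (?\<sigma> n) \<theta>)" if "qvars \<theta> \<subseteq> {..<k}" for \<theta> :: "'a qfm"
    proof -
      have "k + n \<notin> qvars \<theta>" using that by auto
      moreover have "isub (\<lambda>y. if ?\<sigma> n y = MVar (k + n) then MVar n else ?\<sigma> n y) \<theta> = isub (?\<sigma> (Suc n)) \<theta>"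
        by (rule isub_cong) (use that qfv_qvars in \<open>auto simp: less_Suc_eq\<close>)
      ultimately show "qsubst (k + n) (MVar n) (isub (?\<sigma> n) \<theta>) = isub (?\<sigma> (Suc n)) \<theta>"
        using qsubst_isub[of "?\<sigma> n" "k + n" \<theta>] by simp
      show "free_for (MVar n) (k + n) (isub (?\<sigma> n) \<theta>)"
        by (rule free_for_isub_rename) (use \<open>k + n \<notin> qvars \<theta>\<close> Suc.prems in auto)
    qed
    have "qrc1 \<Sigma> (isub (?\<sigma> n) \<phi>) (isub (?\<sigma> n) \<psi>)" using Suc by simp
    from qrc1_inst[OF this _ free[OF k(1)] free[OF k(2)]] show ?case
      unfolding sub[OF k(1)] sub[OF k(2)] by simp
  qed
  then have "qrc1 \<Sigma> (isub (?\<sigma> k) \<phi>) (isub (?\<sigma> k) \<psi>)" by blast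
  moreover have "isub (?\<sigma> k) \<theta> = isub MVar \<theta>" if "qvars \<theta> \<subseteq> {..<k}" for \<theta> :: "'a qfm"
    by (rule isub_cong) (use that qfv_qvars in auto)
  ultimately show ?thesis using k by (simp add: isub_MVar)
qed

text \<open>An instance is kept as a pair instead of a substituted formula: eliminating a quantifier
  then merely updates the assignment, and recursion on the formula remains structural.\<close>

type_synonym 'r world = "(nat \<Rightarrow> mtm) \<times> 'r qfm"

abbreviation form :: "'r world \<Rightarrow> 'r qfm" where "form w \<equiv> isub (fst w) (snd w)"

text \<open>Formulas use variables below \<open>k\<close> and the domain only variables from
  \<open>k\<close> on, so nothing is captured. Two assignments on \<open>k\<close> variables occupy
  at most \<open>2 * k\<close> domain variables, which leaves a fresh one for the quantifier
  case.\<close>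

locale canonical =
  fixes \<Sigma> :: "'r signature" and D :: "mtm list" and k :: nat
  assumes D_wf: "d \<in> set D \<Longrightarrow> wf_mtm \<Sigma> d"
    and D_fresh: "MVar v \<in> set D \<Longrightarrow> k \<le> v"
    and D_many: "2 * k < card {v. MVar v \<in> set D}"
begin

text \<open>These are the atoms obtained by eliminating conjunctions and, with domain terms,
  quantifiers, without entering a diamond. They and the diamonds found in the same way determine the
  world.\<close>

primrec atom_parts :: "(nat \<Rightarrow> mtm) \<Rightarrow> 'r qfm \<Rightarrow> ('r \<times> mtm list) set" where
  "atom_parts \<sigma> QTop = {}"
| "atom_parts \<sigma> (QAtom S ts) = {(S, map (tsub \<sigma>) ts)}"
| "atom_parts \<sigma> (QAnd \<phi> \<psi>) = atom_parts \<sigma> \<phi> \<union> atom_parts \<sigma> \<psi>"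
| "atom_parts \<sigma> (QAll x \<phi>) = (\<Union>d\<in>set D. atom_parts (\<sigma>(x := d)) \<phi>)"
| "atom_parts \<sigma> (QDia \<phi>) = {}"

primrec dia_parts :: "(nat \<Rightarrow> mtm) \<Rightarrow> 'r qfm \<Rightarrow> 'r world set" where
  "dia_parts \<sigma> QTop = {}"
| "dia_parts \<sigma> (QAtom S ts) = {}"
| "dia_parts \<sigma> (QAnd \<phi> \<psi>) = dia_parts \<sigma> \<phi> \<union> dia_parts \<sigma> \<psi>"
| "dia_parts \<sigma> (QAll x \<phi>) = (\<Union>d\<in>set D. dia_parts (\<sigma>(x := d)) \<phi>)"
| "dia_parts \<sigma> (QDia \<phi>) = {(\<sigma>, \<phi>)}"

definition sees :: "'r world \<Rightarrow> 'r world \<Rightarrow> bool" where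
  "sees w v \<longleftrightarrow> v \<in> dia_parts (fst w) (snd w)"

primrec holds :: "'r world \<Rightarrow> (nat \<Rightarrow> mtm) \<Rightarrow> 'r qfm \<Rightarrow> bool" where
  "holds w \<sigma> QTop \<longleftrightarrow> True"
| "holds w \<sigma> (QAtom S ts) \<longleftrightarrow> (S, map (tsub \<sigma>) ts) \<in> atom_parts (fst w) (snd w)"
| "holds w \<sigma> (QAnd \<phi> \<psi>) \<longleftrightarrow> holds w \<sigma> \<phi> \<and> holds w \<sigma> \<psi>"
| "holds w \<sigma> (QAll x \<phi>) \<longleftrightarrow> (\<forall>d\<in>set D. holds w (\<sigma>(x := d)) \<phi>)"
| "holds w \<sigma> (QDia \<phi>) \<longleftrightarrow> (\<exists>v. sees\<^sup>+\<^sup>+ w v \<and> holds v \<sigma> \<phi>)"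

definition good :: "'r world \<Rightarrow> bool" where
  "good w \<longleftrightarrow> (\<forall>y. fst w y \<in> set D) \<and> wf_qfm \<Sigma> (snd w) \<and> qvars (snd w) \<subseteq> {..<k}"

text \<open>Stated for every formula whose parts are present at \<open>w\<close>, since the
  recursion descends through components of the formula of the world; the diamond case starts anew at
  the world given by its own pair.\<close>

lemma holds_parts:
  "atom_parts \<sigma> \<phi> \<subseteq> atom_parts (fst w) (snd w) \<Longrightarrow> dia_parts \<sigma> \<phi> \<subseteq> {v. sees\<^sup>+\<^sup>+ w v} \<Longrightarrow> holds w \<sigma> \<phi>"
proof (induction \<phi> arbitrary: w \<sigma>)
  case (QAll x \<phi>)
  have "holds w (\<sigma>(x := d)) \<phi>" if d: "d \<in> set D" for d
  proof (rule QAll.IH)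
    show "atom_parts (\<sigma>(x := d)) \<phi> \<subseteq> atom_parts (fst w) (snd w)"
      using QAll.prems(1) d unfolding atom_parts.simps by blast
    show "dia_parts (\<sigma>(x := d)) \<phi> \<subseteq> {v. sees\<^sup>+\<^sup>+ w v}"
      using QAll.prems(2) d unfolding dia_parts.simps by blast
  qed
  then show ?case unfolding holds.simps by blast
next
  case (QDia \<phi>)
  have "holds (\<sigma>, \<phi>) \<sigma> \<phi>" by (rule QDia.IH) (auto simp: sees_def intro!: tranclp.r_into_trancl)
  then show ?case using QDia.prems by auto
qed simp_all

lemma holds_self: "holds w (fst w) (snd w)"
  by (rule holds_parts) (auto simp: sees_def intro!: tranclp.r_into_trancl)

lemma wf_form: "good w \<Longrightarrow> wf_qfm \<Sigma> (form w)"
  unfolding good_def using D_wf by (intro wf_isub) auto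

lemma good_parts: "good (\<sigma>, \<phi>) \<Longrightarrow> v \<in> dia_parts \<sigma> \<phi> \<Longrightarrow> good v \<and> size (snd v) < size \<phi>"
proof (induction \<phi> arbitrary: \<sigma>)
  case (QAll x \<phi>)
  then obtain d where d: "d \<in> set D" "v \<in> dia_parts (\<sigma>(x := d)) \<phi>" by auto
  moreover have "good (\<sigma>(x := d), \<phi>)" using QAll.prems d by (auto simp: good_def)
  ultimately show ?case using QAll.IH by fastforce
qed (auto simp: good_def less_Suc_eq trans_less_add1 trans_less_add2)

lemma sees_good: "sees w v \<Longrightarrow> good w \<Longrightarrow> good v \<and> size (snd v) < size (snd w)"
  using good_parts[of "fst w" "snd w" v] by (simp add: sees_def)

lemma sees_trancl_good: "sees\<^sup>+\<^sup>+ w v \<Longrightarrow> good w \<Longrightarrow> good v \<and> size (snd v) < size (snd w)"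
  by (induction rule: tranclp_induct) (use sees_good order_less_trans in blast)+

lemma parts_derivable:
  "good (\<sigma>, \<phi>) \<Longrightarrow> ((S, ts) \<in> atom_parts \<sigma> \<phi> \<longrightarrow> qrc1 \<Sigma> (isub \<sigma> \<phi>) (QAtom S ts)) \<and>
    (v \<in> dia_parts \<sigma> \<phi> \<longrightarrow> qrc1 \<Sigma> (isub \<sigma> \<phi>) (QDia (form v)))"
proof (induction \<phi> arbitrary: \<sigma>)
  case (QAnd \<phi> \<psi>)
  then have g: "good (\<sigma>, \<phi>)" "good (\<sigma>, \<psi>)" by (auto simp: good_def)
  have c: "qrc1 \<Sigma> (isub \<sigma> (QAnd \<phi> \<psi>)) (isub \<sigma> \<phi>)" "qrc1 \<Sigma> (isub \<sigma> (QAnd \<phi> \<psi>)) (isub \<sigma> \<psi>)"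
    using g[THEN wf_form] by (auto intro: qrc1_conjE1 qrc1_conjE2)
  show ?case unfolding atom_parts.simps dia_parts.simps Un_iff
    using QAnd.IH(1)[OF g(1)] QAnd.IH(2)[OF g(2)] qrc1_cut[OF c(1)] qrc1_cut[OF c(2)] by blast
next
  case (QAll x \<phi>)
  have c: "qrc1 \<Sigma> (isub \<sigma> (QAll x \<phi>)) (isub (\<sigma>(x := d)) \<phi>)" and g: "good (\<sigma>(x := d), \<phi>)" if d: "d \<in> set D" for d
  proof -
    show g: "good (\<sigma>(x := d), \<phi>)" using QAll.prems d by (auto simp: good_def)
    let ?\<sigma> = "\<sigma>(x := MVar x)"
    have x: "x < k" "\<sigma> y \<in> set D" for y using QAll.prems by (auto simp: good_def)
    then have ne: "\<sigma> y \<noteq> MVar x" for y using D_fresh[of x] by (metis not_le)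
    have "(\<lambda>y. if ?\<sigma> y = MVar x then d else ?\<sigma> y) = \<sigma>(x := d)" using ne by auto
    then have sub: "qsubst x d (isub ?\<sigma> \<phi>) = isub (\<sigma>(x := d)) \<phi>"
      using qsubst_isub[of ?\<sigma> x \<phi> d] ne by simp
    have "wf_mtm \<Sigma> (?\<sigma> y)" for y using QAll.prems D_wf by (simp add: good_def)
    then have "wf_qfm \<Sigma> (isub ?\<sigma> \<phi>)" using QAll.prems by (intro wf_isub) (auto simp: good_def)
    moreover have "free_for d x (isub ?\<sigma> \<phi>)"
      by (rule free_for_isub) (use QAll.prems d D_fresh in \<open>fastforce simp: good_def\<close>)
    moreover have "qrc1 \<Sigma> (qsubst x d (isub ?\<sigma> \<phi>)) (isub (\<sigma>(x := d)) \<phi>)"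
      unfolding sub using wf_form[OF g] by (simp add: qrc1_refl)
    ultimately show "qrc1 \<Sigma> (isub \<sigma> (QAll x \<phi>)) (isub (\<sigma>(x := d)) \<phi>)"
      using qrc1_allL D_wf[OF d] by simp
  qed
  show ?case unfolding atom_parts.simps dia_parts.simps UN_iff
    using QAll.IH[OF g] qrc1_cut[OF c] by blast
next
  case (QDia \<phi>)
  then show ?case using wf_form[of "(\<sigma>, QDia \<phi>)"] by (auto intro: qrc1_refl)
next
  case (QAtom S' ts')
  then show ?case using wf_form[of "(\<sigma>, QAtom S' ts')"] by (auto intro: qrc1_refl simp del: wf_qfm.simps)
qed simp

lemma sees_derivable: "sees\<^sup>+\<^sup>+ w v \<Longrightarrow> good w \<Longrightarrow> qrc1 \<Sigma> (form w) (QDia (form v))"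
proof (induction rule: tranclp_induct)
  case (base v)
  then show ?case using parts_derivable[of "fst w" "snd w"] by (simp add: sees_def)
next
  case (step v u)
  have v: "good v" "good u" using sees_trancl_good[OF step.hyps(1) step.prems] sees_good[OF step.hyps(2)] by auto
  then have "qrc1 \<Sigma> (form v) (QDia (form u))"
    using parts_derivable[of "fst v" "snd v"] step.hyps(2) by (simp add: sees_def)
  then have "qrc1 \<Sigma> (QDia (form v)) (QDia (form u))"
    using qrc1_cut[OF qrc1_nec qrc1_trans[OF wf_form[OF v(2)]]] by blast
  then show ?case using step qrc1_cut by blast
qed

lemma fresh_exists:
  assumes "good w" "qvars \<phi> \<subseteq> {..<k}"
  obtains v where "MVar v \<in> set D" "v \<notin> qfv (form w)" "\<And>y. y \<in> qvars \<phi> \<Longrightarrow> \<sigma> y \<noteq> MVar v"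
proof -
  have few: "finite {v. \<exists>y<k. \<tau> y = MVar v} \<and> card {v. \<exists>y<k. \<tau> y = MVar v} \<le> k" for \<tau>
  proof -
    let ?g = "\<lambda>y. THE v. \<tau> y = MVar v"
    have sub: "{v. \<exists>y<k. \<tau> y = MVar v} \<subseteq> ?g ` {..<k}" by force
    have "card (?g ` {..<k}) \<le> k" using card_image_le[of "{..<k}" ?g] by simp
    then show ?thesis
      using finite_subset[OF sub] card_mono[OF _ sub] by (meson finite_imageI finite_lessThan le_trans)
  qed
  let ?U = "{v. \<exists>y<k. fst w y = MVar v} \<union> {v. \<exists>y<k. \<sigma> y = MVar v}"
  have "finite ?U" "card ?U \<le> 2 * k"
    using few[of "fst w"] few[of \<sigma>] card_Un_le[of "{v. \<exists>y<k. fst w y = MVar v}" "{v. \<exists>y<k. \<sigma> y = MVar v}"]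
    by (blast intro: finite_UnI, linarith)
  then have "\<not> {v. MVar v \<in> set D} \<subseteq> ?U" using D_many card_mono[of ?U "{v. MVar v \<in> set D}"] by linarith
  then obtain v where v: "MVar v \<in> set D" "v \<notin> ?U" by blast
  have "v \<notin> qfv (form w)"
  proof
    assume "v \<in> qfv (form w)"
    then obtain y where y: "y \<in> qfv (snd w)" "fst w y = MVar v" using qfv_isub by blast
    then have "y < k" using qfv_qvars[of "snd w"] assms(1) unfolding good_def by blast
    then show False using y(2) v(2) by blast
  qed
  then show thesis using that v assms(2) by blast
qed

text \<open>This half of a truth lemma suffices: what holds at a world is derivable from its
  formula, so an underivable consequent fails at the world of the antecedent.\<close>

lemma holds_derivable:
  "holds w \<sigma> \<phi> \<Longrightarrow> good w \<Longrightarrow> good (\<sigma>, \<phi>) \<Longrightarrow> qrc1 \<Sigma> (form w) (isub \<sigma> \<phi>)"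
proof (induction \<phi> arbitrary: w \<sigma>)
  case QTop
  then show ?case using wf_form by (simp add: qrc1_top)
next
  case (QAtom S ts)
  then show ?case using parts_derivable[of "fst w" "snd w"] by simp
next
  case (QAnd \<phi> \<psi>)
  have "qrc1 \<Sigma> (form w) (isub \<sigma> \<phi>)" "qrc1 \<Sigma> (form w) (isub \<sigma> \<psi>)"
    using QAnd by (auto simp: good_def)
  then show ?case by (simp add: qrc1_conjI)
next
  case (QAll x \<phi>)
  have x: "x < k" "qvars \<phi> \<subseteq> {..<k}" "\<And>y. \<sigma> y \<in> set D" "wf_qfm \<Sigma> \<phi>" using QAll.prems(3) by (auto simp: good_def)
  obtain v where v: "MVar v \<in> set D" "v \<notin> qfv (form w)" "\<And>y. y \<in> qvars \<phi> \<Longrightarrow> \<sigma> y \<noteq> MVar v"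
    using fresh_exists[OF QAll.prems(2) x(2)] by blast
  have "v \<notin> qvars \<phi>" "v \<noteq> x" using D_fresh[OF v(1)] x by auto
  \<comment> \<open>Values of \<open>\<sigma>\<close> outside the variables of \<open>\<phi>\<close>
    are irrelevant but might equal \<open>MVar v\<close>. They are reset to \<open>MVar x\<close>,
    so that \<open>v\<close> enters through \<open>x\<close> alone.\<close>
  define \<tau> where "\<tau> = (\<lambda>y. if y \<in> qvars \<phi> then \<sigma> y else MVar x)"
  have \<tau>: "isub (\<tau>(x := d)) \<phi> = isub (\<sigma>(x := d)) \<phi>" for d
    by (rule isub_cong) (use qfv_qvars in \<open>auto simp: \<tau>_def\<close>)
  let ?\<tau> = "\<tau>(x := MVar v)"
  have \<tau>v: "\<forall>y. ?\<tau> y = MVar v \<longrightarrow> y = x" using v(3) \<open>v \<noteq> x\<close> by (auto simp: \<tau>_def)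
  have "qrc1 \<Sigma> (form w) (isub (\<sigma>(x := MVar v)) \<phi>)"
  proof (rule QAll.IH)
    show "holds w (\<sigma>(x := MVar v)) \<phi>" using QAll.prems(1) v(1) unfolding holds.simps by blast
    show "good (\<sigma>(x := MVar v), \<phi>)" using x v(1) by (simp add: good_def)
  qed (rule QAll.prems)
  \<comment> \<open>The generic instance is generalized over the fresh \<open>v\<close>; the bound
    variable is then changed to \<open>x\<close> by eliminating at \<open>x\<close> and generalizing
    again.\<close>
  then have 1: "qrc1 \<Sigma> (form w) (QAll v (isub ?\<tau> \<phi>))" unfolding \<tau> using v(2) by (rule qrc1_allR)
  have wf: "wf_qfm \<Sigma> (isub (\<sigma>(x := MVar u)) \<phi>)" for u
    using x(4) by (rule wf_isub) (use x(3) D_wf in simp)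
  have "qrc1 \<Sigma> (QAll v (isub ?\<tau> \<phi>)) (isub (\<sigma>(x := MVar x)) \<phi>)"
  proof (rule qrc1_allL)
    show "wf_qfm \<Sigma> (isub ?\<tau> \<phi>)" unfolding \<tau> by (rule wf)
    show "free_for (MVar x) v (isub ?\<tau> \<phi>)"
      using \<open>v \<notin> qvars \<phi>\<close> \<open>v \<noteq> x\<close> \<tau>v by (rule free_for_isub_rename)
    have "qsubst v (MVar x) (isub ?\<tau> \<phi>) = isub (\<lambda>y. if ?\<tau> y = MVar v then MVar x else ?\<tau> y) \<phi>"
      using \<open>v \<notin> qvars \<phi>\<close> by (intro qsubst_isub) blast
    also have "(\<lambda>y. if ?\<tau> y = MVar v then MVar x else ?\<tau> y) = \<tau>(x := MVar x)"
    proof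
      fix y show "(if ?\<tau> y = MVar v then MVar x else ?\<tau> y) = (\<tau>(x := MVar x)) y"
        using spec[OF \<tau>v, of y] by (cases "y = x") simp_all
    qed
    also have "isub (\<tau>(x := MVar x)) \<phi> = isub (\<sigma>(x := MVar x)) \<phi>" by (rule \<tau>)
    finally have eq: "qsubst v (MVar x) (isub ?\<tau> \<phi>) = isub (\<sigma>(x := MVar x)) \<phi>" .
    show "qrc1 \<Sigma> (qsubst v (MVar x) (isub ?\<tau> \<phi>)) (isub (\<sigma>(x := MVar x)) \<phi>)"
      unfolding eq using wf by (rule qrc1_refl)
  qed simp
  moreover have "x \<notin> qfv (QAll v (isub ?\<tau> \<phi>))"
  proof
    assume "x \<in> qfv (QAll v (isub ?\<tau> \<phi>))"
    then have "x \<in> qfv (isub (\<sigma>(x := MVar v)) \<phi>)" unfolding \<tau> qfv.simps by blast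
    then obtain y where "(\<sigma>(x := MVar v)) y = MVar x" using qfv_isub by blast
    then have "MVar x = \<sigma> y" using \<open>v \<noteq> x\<close> by (cases "y = x") simp_all
    then show False using x(1) x(3)[of y] D_fresh[of x] by simp
  qed
  ultimately have "qrc1 \<Sigma> (QAll v (isub ?\<tau> \<phi>)) (QAll x (isub (\<sigma>(x := MVar x)) \<phi>))"
    by (rule qrc1_allR)
  with 1 show ?case using qrc1_cut by simp
next
  case (QDia \<phi>)
  then obtain v where v: "sees\<^sup>+\<^sup>+ w v" "holds v \<sigma> \<phi>" by auto
  have "qrc1 \<Sigma> (form v) (isub \<sigma> \<phi>)"
    using QDia.IH[OF v(2)] sees_trancl_good[OF v(1) QDia.prems(2)] QDia.prems(3) by (simp add: good_def)
  then show ?case using qrc1_cut[OF sees_derivable[OF v(1) QDia.prems(2)] qrc1_nec] by simp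
qed

lemma finite_reachable: "good w \<Longrightarrow> finite {v. sees\<^sup>*\<^sup>* w v}"
proof (induction "size (snd w)" arbitrary: w rule: less_induct)
  case less
  have fin: "finite (dia_parts \<sigma> \<phi>)" for \<sigma> \<phi>
    by (induction \<phi> arbitrary: \<sigma>) auto
  have "{v. sees\<^sup>*\<^sup>* w v} \<subseteq> insert w (\<Union>u\<in>dia_parts (fst w) (snd w). {v. sees\<^sup>*\<^sup>* u v})"
    by (auto elim: converse_rtranclpE simp: sees_def)
  moreover have "finite {v. sees\<^sup>*\<^sup>* u v}" if "u \<in> dia_parts (fst w) (snd w)" for u
    using less sees_good[of w u] that by (simp add: sees_def)
  then have "finite (\<Union>u\<in>dia_parts (fst w) (snd w). {v. sees\<^sup>*\<^sup>* u v})"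
    by (rule finite_UN_I[OF fin])
  ultimately show ?case by (rule finite_subset[OF _ finite.insertI])
qed

end

section \<open>From canonical worlds to a numbered frame\<close>

context canonical
begin

lemma countermodel:
  assumes standard: "standard_axiomatization_HA \<eta>"
    and good: "good (\<sigma>, \<phi>)" "good (\<sigma>, \<psi>)" and cons: "MCon ` (qcons \<phi> \<union> qcons \<psi>) \<subseteq> set D"
    and underivable: "\<not> qrc1 \<Sigma> (isub \<sigma> \<phi>) (isub \<sigma> \<psi>)"
  obtains K R F w \<rho> where "frame K R" "0 < w" "w < K" "\<And>t. \<rho> t < length D"
    "kripke.forces R (length D) F w \<rho> \<phi>" "\<not> kripke.forces R (length D) F w \<rho> \<psi>"
proof -
  let ?W = "{v. sees\<^sup>*\<^sup>* (\<sigma>, \<phi>) v}"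
  \<comment> \<open>Accessible worlds have smaller formulas, so this key grows along accessibility;
    sizes never exceed that of \<open>\<phi>\<close>, and the subtraction loses nothing.\<close>
  let ?key = "\<lambda>v :: 'r world. size \<phi> - size (snd v)"
  obtain ys where ys: "set ys = ?W" using finite_list[OF finite_reachable[OF good(1)]] by blast
  define xs where "xs = sort_key ?key ys"
  have xs: "set xs = ?W" by (simp add: xs_def ys)
  have W: "good v \<and> size (snd v) \<le> size \<phi>" if "v \<in> ?W" for v
  proof (cases "v = (\<sigma>, \<phi>)")
    case True
    then show ?thesis using good(1) by simp
  next
    case False
    then have "sees\<^sup>+\<^sup>+ (\<sigma>, \<phi>) v" using that rtranclpD[of sees "(\<sigma>, \<phi>)" v] by blast
    then show ?thesis using sees_trancl_good[of "(\<sigma>, \<phi>)" v] good(1) by simp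
  qed
  define K where "K = Suc (length xs)"
  \<comment> \<open>Number 0 is kept for the added root, hence the offset by one.\<close>
  define world where "world i = xs ! (i - 1)" for i
  define R where "R i j \<longleftrightarrow> 0 < j \<and> j < K \<and> (i = 0 \<or> i < K \<and> sees\<^sup>+\<^sup>+ (world i) (world j))" for i j
  define F where "F i S ns \<longleftrightarrow> (S, map (nth D) ns) \<in> atom_parts (fst (world i)) (snd (world i))"
    for i and S :: 'r and ns
  have world: "world i \<in> ?W" if "0 < i" "i < K" for i
  proof -
    have "i - 1 < length xs" using that by (simp add: K_def)
    then have "world i \<in> set xs" unfolding world_def by (rule nth_mem)
    then show ?thesis unfolding xs .
  qed
  have reached: "\<exists>i. 0 < i \<and> i < K \<and> world i = v" if "v \<in> ?W" for v
  proof -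
    have "v \<in> set xs" using that unfolding xs .
    then obtain n where "n < length xs" "xs ! n = v" unfolding in_set_conv_nth by blast
    then show ?thesis by (intro exI[of _ "Suc n"]) (simp add: K_def world_def)
  qed
  have less: "i < j" if ij: "0 < i" "i < K" "0 < j" "j < K" "sees\<^sup>+\<^sup>+ (world i) (world j)" for i j
  proof (rule ccontr)
    assume "\<not> i < j"
    then have "?key (world j) \<le> ?key (world i)"
      unfolding world_def using ij sorted_nth_mono[of "map ?key xs" "j - 1" "i - 1"]
      by (simp add: xs_def K_def)
    moreover have "size (snd (world j)) < size (snd (world i))" "size (snd (world i)) \<le> size \<phi>"
      using sees_trancl_good[OF ij(5)] W[OF world[OF ij(1,2)]] by auto
    ultimately show False by linarith
  qed
  have frame: "frame K R"
  proof
    show "R i j \<Longrightarrow> R j l \<Longrightarrow> R i l" for i j l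
      unfolding R_def using tranclp_trans[of sees] by auto
    show "R i j \<Longrightarrow> i < j \<and> j < K" for i j
      using less unfolding R_def by (cases "i = 0") auto
  qed (auto simp: R_def K_def)
  have D: "0 < length D" using good(1) unfolding good_def by (metis empty_iff length_greater_0_conv list.set(1))
  interpret Kr: kripke K R \<Sigma> \<eta> "length D" F
    using frame standard D by (intro kripke.intro kripke_axioms.intro)
  have forces: "0 < i \<Longrightarrow> i < K \<Longrightarrow> (\<And>y. D ! \<rho> (MVar y) = \<tau> y) \<Longrightarrow>
      (\<And>c. c \<in> qcons \<chi> \<Longrightarrow> D ! \<rho> (MCon c) = MCon c) \<Longrightarrow> Kr.forces i \<rho> \<chi> \<longleftrightarrow> holds (world i) \<tau> \<chi>"
    for i \<rho> \<tau> \<chi>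
  proof (induction \<chi> arbitrary: i \<rho> \<tau>)
    case (QAtom S ts)
    have "D ! \<rho> t = tsub \<tau> t" if "t \<in> set ts" for t by (cases t) (use QAtom that in auto)
    then have "map (nth D) (map \<rho> ts) = map (tsub \<tau>) ts" by simp
    then have "F i S (map \<rho> ts) \<longleftrightarrow> holds (world i) \<tau> (QAtom S ts)"
      unfolding F_def holds.simps by (simp only:)
    then show ?case by (simp only: Kr.forces.simps)
  next
    case (QAnd \<chi> \<chi>')
    have "Kr.forces i \<rho> \<chi> \<longleftrightarrow> holds (world i) \<tau> \<chi>" by (rule QAnd.IH) (use QAnd.prems in auto)
    moreover have "Kr.forces i \<rho> \<chi>' \<longleftrightarrow> holds (world i) \<tau> \<chi>'" by (rule QAnd.IH) (use QAnd.prems in auto)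
    ultimately show ?case by simp
  next
    case (QAll x \<chi>)
    have "Kr.forces i (\<rho>(MVar x := d)) \<chi> \<longleftrightarrow> holds (world i) (\<tau>(x := D ! d)) \<chi>" for d
      by (rule QAll.IH) (use QAll.prems in auto)
    then show ?case unfolding Kr.forces.simps holds.simps all_set_conv_all_nth by blast
  next
    case (QDia \<chi>)
    have IH: "Kr.forces j \<rho> \<chi> \<longleftrightarrow> holds (world j) \<tau> \<chi>" if "0 < j" "j < K" for j
      using that by (rule QDia.IH) (use QDia.prems in auto)
    have "\<exists>j. 0 < j \<and> j < K \<and> world j = v" if "sees\<^sup>+\<^sup>+ (world i) v" for v
    proof -
      have "sees\<^sup>*\<^sup>* (\<sigma>, \<phi>) (world i)" using world[OF QDia.prems(1,2)] by simp
      with tranclp_into_rtranclp[OF that] have "sees\<^sup>*\<^sup>* (\<sigma>, \<phi>) v" by (rule rtranclp_trans[rotated])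
      then show ?thesis using reached[of v] by simp
    qed
    then have "(\<exists>j. R i j \<and> holds (world j) \<tau> \<chi>) \<longleftrightarrow> (\<exists>v. sees\<^sup>+\<^sup>+ (world i) v \<and> holds v \<tau> \<chi>)"
      unfolding R_def using QDia.prems(1,2) by (metis less_irrefl)
    moreover have "(\<exists>j. R i j \<and> Kr.forces j \<rho> \<chi>) \<longleftrightarrow> (\<exists>j. R i j \<and> holds (world j) \<tau> \<chi>)"
      using IH unfolding R_def by blast
    ultimately show ?case by simp
  qed simp
  \<comment> \<open>Constants outside \<open>\<phi>\<close> and \<open>\<psi>\<close> need not
    belong to the domain. They get the arbitrary value 0, which affects neither formula.\<close>
  define idx where "idx d = (if d \<in> set D then SOME n. n < length D \<and> D ! n = d else 0)" for d
  have idx: "idx d < length D" "d \<in> set D \<Longrightarrow> D ! idx d = d" for d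
    using someI_ex[of "\<lambda>n. n < length D \<and> D ! n = d"] D by (auto simp: idx_def in_set_conv_nth)
  let ?\<rho> = "\<lambda>t. idx (tsub \<sigma> t)"
  obtain w where w: "0 < w" "w < K" "world w = (\<sigma>, \<phi>)" using reached[of "(\<sigma>, \<phi>)"] by auto
  have v: "D ! ?\<rho> (MVar y) = \<sigma> y" for y using idx(2) good(1) by (simp add: good_def)
  have "Kr.forces w ?\<rho> \<chi> \<longleftrightarrow> holds (world w) \<sigma> \<chi>" if "\<chi> = \<phi> \<or> \<chi> = \<psi>" for \<chi>
    using w(1,2) v by (rule forces) (use that cons idx(2) in auto)
  moreover have "holds (world w) \<sigma> \<phi>" using holds_self[of "(\<sigma>, \<phi>)"] w(3) by simp
  moreover have "\<not> holds (world w) \<sigma> \<psi>"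
    using holds_derivable[of "(\<sigma>, \<phi>)" \<sigma> \<psi>] good underivable w(3) by auto
  ultimately show thesis using that[OF frame w(1,2), of ?\<rho> F] idx(1) by blast
qed

end

lemma qcons_wf: "wf_qfm \<Sigma> \<phi> \<Longrightarrow> qcons \<phi> \<subseteq> con_syms \<Sigma>"
  by (induction \<phi>) auto

theorem theorem7p8:
  fixes \<Sigma> :: "'r signature" and \<phi> \<psi> :: "'r qfm" and \<eta> :: fm
  assumes "standard_axiomatization_HA \<eta>"
    and "wf_qfm \<Sigma> \<phi>" and "wf_qfm \<Sigma> \<psi>"
  shows "qrc1 \<Sigma> \<phi> \<psi> \<longleftrightarrow>
    (\<forall>R. infinitary_realization \<Sigma> R \<longrightarrow>
      (HA \<turnstile> theory_inclusion (realize R \<eta> \<psi>) (realize R \<eta> \<phi>)))"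
proof
  assume "qrc1 \<Sigma> \<phi> \<psi>"
  then show "\<forall>R. infinitary_realization \<Sigma> R \<longrightarrow>
      (HA \<turnstile> theory_inclusion (realize R \<eta> \<psi>) (realize R \<eta> \<phi>))"
    using realization.arithmetical_soundness[OF realization.intro[OF assms(1)]] by blast
next
  assume valid: "\<forall>R. infinitary_realization \<Sigma> R \<longrightarrow>
      (HA \<turnstile> theory_inclusion (realize R \<eta> \<psi>) (realize R \<eta> \<phi>))"
  show "qrc1 \<Sigma> \<phi> \<psi>"
  proof (rule ccontr)
    assume underivable: "\<not> qrc1 \<Sigma> \<phi> \<psi>"
    obtain k where k: "qvars \<phi> \<subseteq> {..<k}" "qvars \<psi> \<subseteq> {..<k}" "0 < k"
    proof -
      obtain k where "qvars \<phi> \<union> qvars \<psi> \<union> {0} \<subseteq> {..<k}"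
        using finite_nat_bounded finite_qvars by (metis finite.emptyI finite.insertI finite_UnI)
      then show thesis using that[of k] by auto
    qed
    \<comment> \<open>The variables from \<open>k\<close> to \<open>3 * k\<close> number one more
      than \<open>2 * k\<close>, which is what the search for fresh variables demands. Constants of
      the two formulas are included so that they can denote themselves.\<close>
    define D where "D = map MVar [k..<3 * k + 1] @ map MCon (sorted_list_of_set (qcons \<phi> \<union> qcons \<psi>))"
    have set_D: "set D = MVar ` {k..<3 * k + 1} \<union> MCon ` (qcons \<phi> \<union> qcons \<psi>)"
      by (simp add: D_def finite_qfv del: upt_Suc upt_rec_numeral)
    \<comment> \<open>Every value must lie in the domain, also at variables that do not occur; those
      from \<open>k\<close> on are sent to the default \<open>k\<close>.\<close>
    let ?\<sigma> = "\<lambda>y. MVar (if y < k then k + y else k)"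
    interpret canonical \<Sigma> D k
    proof
      show "wf_mtm \<Sigma> d" if "d \<in> set D" for d
        using that qcons_wf[OF assms(2)] qcons_wf[OF assms(3)] by (auto simp: set_D)
      have "{v. MVar v \<in> set D} = {k..<3 * k + 1}" by (auto simp: set_D)
      then show "2 * k < card {v. MVar v \<in> set D}" by simp
    qed (auto simp: set_D)
    have good: "good (?\<sigma>, \<phi>)" "good (?\<sigma>, \<psi>)" using k assms(2,3) by (auto simp: good_def set_D)
    have "isub ?\<sigma> \<theta> = isub (\<lambda>y. MVar (k + y)) \<theta>" if "qvars \<theta> \<subseteq> {..<k}" for \<theta> :: "'r qfm"
      by (rule isub_cong) (use that qfv_qvars in auto)
    then have underivable': "\<not> qrc1 \<Sigma> (isub ?\<sigma> \<phi>) (isub ?\<sigma> \<psi>)"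
      using qrc1_rename_back[OF k(1,2)] underivable k(1,2) by auto
    have "MCon ` (qcons \<phi> \<union> qcons \<psi>) \<subseteq> set D" by (simp add: set_D)
    from countermodel[OF assms(1) good this underivable'] obtain K R F w \<rho> where frame: "frame K R" and w: "0 < w" "w < K" and \<rho>: "\<And>t. \<rho> t < length D"
      and forces: "kripke.forces R (length D) F w \<rho> \<phi>" "\<not> kripke.forces R (length D) F w \<rho> \<psi>"
      by metis
    interpret kripke K R \<Sigma> \<eta> "length D" F
      using frame assms(1) \<rho>[of "MVar 0"] by (intro kripke.intro kripke_axioms.intro) auto
    have "HA \<turnstile> theory_inclusion (realize atoms \<eta> \<psi>) (realize atoms \<eta> \<phi>)"
      using valid infinitary_realization_atoms by blast
    then show False using arithmetical_countermodel[OF assms(2,3) w \<rho> forces] by contradiction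
  qed
qed

end
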